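(* Let $n\ge2$, $m\ge1$ and $\mathfrak q=\mathfrak{sl}_n\ltimes m(\mathbb C^n)^*$. Then $\mathbb C[\mathfrak q^*]^Q$ is a polynomial ring if and only if $m\le n+1$ and $m$ divides one of $n-1$, $n$, $n+1$. Under these assumptions on $m$, the fundamental semi-invariant satisfies $\mathbf p_{\mathfrak q}=1$ if and only if $m$ divides $n-1$ or $n+1$.
   Context: $\mathfrak q=\mathfrak{sl}_n\ltimes V$ with $V=m(\mathbb C^n)^*$ ($m$ copies of the dual of the defining representation) an abelian ideal, $Q=\mathrm{SL}_n\ltimes\exp(V)$, $\mathfrak q^*=\mathfrak{sl}_n\oplus m\mathbb C^n$ (identifying $\mathfrak{sl}_n\cong\mathfrak{sl}_n^*$ via the trace form), and $\mathbb C[\mathfrak q^*]^Q=\mathcal S(\mathfrak q)^{\mathfrak q}$ is the algebra of symmetric invariants. Fundamental semi-invariant $\mathbf p_{\mathfrak q}$: the gcd of the Pfaffians of the principal minors of size $\dim\mathfrak q-\operatorname{ind}\mathfrak q$ of the structure matrix $([\xi_i,\xi_j])$ for a basis $\{\xi_i\}$ of $\mathfrak q$, where $\operatorname{ind}\mathfrak q=\min_{\gamma\in\mathfrak q^*}\dim\mathfrak q_\gamma$; $\mathbf p_{\mathfrak q}=1$ iff the set of $\gamma$ with $\dim\mathfrak q_\gamma>\operatorname{ind}\mathfrak q$ has codimension $\ge2$. *)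

theory Defs
  imports Complex_Main "HOL-Library.Function_Algebras" "HOL-Combinatorics.Permutations"
begin

text \<open>Coordinates of q = sl_n \<ltimes> m(C^n)^* and of its dual q^* = sl_n \<oplus> m C^n.
  Mat i j : (i,j) matrix entry (i,j < n);  Vec k i : i-th entry of the k-th copy (k < m, i < n).\<close>
datatype idx = Mat nat nat | Vec nat nat

definition in_range :: "nat \<Rightarrow> nat \<Rightarrow> idx \<Rightarrow> bool" where
  "in_range n m c = (case c of Mat i j \<Rightarrow> i < n \<and> j < n | Vec k i \<Rightarrow> k < m \<and> i < n)"

text \<open>The underlying space: elements supported on the index range with traceless matrix part.
  The same carrier is used for q (X, xi) with xi k a row vector of (C^n)^*, and for q^* (A, v)
  with v k a column vector in C^n; sl_n^* is identified with sl_n by the trace form.\<close>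
definition qspace :: "nat \<Rightarrow> nat \<Rightarrow> (idx \<Rightarrow> complex) set" where
  "qspace n m = {x. (\<forall>c. \<not> in_range n m c \<longrightarrow> x c = 0) \<and> (\<Sum>i<n. x (Mat i i)) = 0}"

abbreviation qdual :: "nat \<Rightarrow> nat \<Rightarrow> (idx \<Rightarrow> complex) set" where
  "qdual n m \<equiv> qspace n m"

text \<open>Lie bracket: [(X,xi),(Y,eta)] = ([X,Y], X.eta - Y.xi) with X.eta = - eta X (dual action).\<close>
definition qbracket :: "nat \<Rightarrow> nat \<Rightarrow> (idx \<Rightarrow> complex) \<Rightarrow> (idx \<Rightarrow> complex) \<Rightarrow> (idx \<Rightarrow> complex)" where
  "qbracket n m x y = (\<lambda>c. if \<not> in_range n m c then 0 else
     (case c of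
        Mat i j \<Rightarrow> (\<Sum>l<n. x (Mat i l) * y (Mat l j) - y (Mat i l) * x (Mat l j))
      | Vec k j \<Rightarrow> (\<Sum>i<n. x (Vec k i) * y (Mat i j) - y (Vec k i) * x (Mat i j))))"

definition qpair :: "nat \<Rightarrow> nat \<Rightarrow> (idx \<Rightarrow> complex) \<Rightarrow> (idx \<Rightarrow> complex) \<Rightarrow> complex" where
  "qpair n m \<gamma> x = (\<Sum>i<n. \<Sum>j<n. \<gamma> (Mat i j) * x (Mat j i))
                    + (\<Sum>k<m. \<Sum>i<n. x (Vec k i) * \<gamma> (Vec k i))"

definition cscale :: "complex \<Rightarrow> (idx \<Rightarrow> complex) \<Rightarrow> (idx \<Rightarrow> complex)" where
  "cscale a x = (\<lambda>c. a * x c)"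

definition qdim :: "nat \<Rightarrow> nat \<Rightarrow> nat" where
  "qdim n m = vector_space.dim cscale (qspace n m)"

definition qstab :: "nat \<Rightarrow> nat \<Rightarrow> (idx \<Rightarrow> complex) \<Rightarrow> (idx \<Rightarrow> complex) set" where
  "qstab n m \<gamma> = {x \<in> qspace n m. \<forall>y \<in> qspace n m. qpair n m \<gamma> (qbracket n m x y) = 0}"

definition qind :: "nat \<Rightarrow> nat \<Rightarrow> nat" where
  "qind n m = (LEAST d. \<exists>\<gamma> \<in> qdual n m. vector_space.dim cscale (qstab n m \<gamma>) = d)"

text \<open>Polynomial functions in the coordinates indexed by I (over the infinite field C these are
  exactly the polynomials).\<close>
inductive_set poly_fun :: "'i set \<Rightarrow> (('i \<Rightarrow> complex) \<Rightarrow> complex) set" for I :: "'i set" where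
  pf_const: "(\<lambda>x. c) \<in> poly_fun I"
| pf_var: "i \<in> I \<Longrightarrow> (\<lambda>x. x i) \<in> poly_fun I"
| pf_add: "f \<in> poly_fun I \<Longrightarrow> g \<in> poly_fun I \<Longrightarrow> (\<lambda>x. f x + g x) \<in> poly_fun I"
| pf_mult: "f \<in> poly_fun I \<Longrightarrow> g \<in> poly_fun I \<Longrightarrow> (\<lambda>x. f x * g x) \<in> poly_fun I"

definition detn :: "nat \<Rightarrow> (nat \<Rightarrow> nat \<Rightarrow> complex) \<Rightarrow> complex" where
  "detn n g = (\<Sum>p | p permutes {..<n}. of_int (sign p) * (\<Prod>i<n. g i (p i)))"

text \<open>Coadjoint action of g in SL_n (h = g^{-1}): (A, v) -> (g A g^{-1}, g v_k).\<close>
definition act_SL :: "nat \<Rightarrow> nat \<Rightarrow> (nat \<Rightarrow> nat \<Rightarrow> complex) \<Rightarrow> (nat \<Rightarrow> nat \<Rightarrow> complex)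
                      \<Rightarrow> (idx \<Rightarrow> complex) \<Rightarrow> (idx \<Rightarrow> complex)" where
  "act_SL n m g h \<gamma> = (\<lambda>c. if \<not> in_range n m c then 0 else
     (case c of
        Mat i j \<Rightarrow> (\<Sum>a<n. \<Sum>b<n. g i a * \<gamma> (Mat a b) * h b j)
      | Vec k i \<Rightarrow> (\<Sum>a<n. g i a * \<gamma> (Vec k a))))"

text \<open>Coadjoint action of exp(eta), eta in V = m(C^n)^* (eta k a row vector):
  (A, v) -> (A - pr_{sl_n}(sum_k v_k eta_k), v).\<close>
definition act_V :: "nat \<Rightarrow> nat \<Rightarrow> (nat \<Rightarrow> nat \<Rightarrow> complex) \<Rightarrow> (idx \<Rightarrow> complex) \<Rightarrow> (idx \<Rightarrow> complex)" where
  "act_V n m \<eta> \<gamma> = (\<lambda>c. if \<not> in_range n m c then 0 else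
     (case c of
        Mat i j \<Rightarrow> \<gamma> (Mat i j) - (\<Sum>k<m. \<gamma> (Vec k i) * \<eta> k j)
                   + (if i = j then (\<Sum>k<m. \<Sum>l<n. \<gamma> (Vec k l) * \<eta> k l) / of_nat n else 0)
      | Vec k i \<Rightarrow> \<gamma> (Vec k i)))"

definition is_SL :: "nat \<Rightarrow> (nat \<Rightarrow> nat \<Rightarrow> complex) \<Rightarrow> (nat \<Rightarrow> nat \<Rightarrow> complex) \<Rightarrow> bool" where
  "is_SL n g h = ((\<forall>i<n. \<forall>j<n. (\<Sum>l<n. g i l * h l j) = (if i = j then 1 else 0)) \<and> detn n g = 1)"

text \<open>C[q^*]^Q: polynomial functions on q^* invariant under Q = SL_n \<ltimes> exp(V)
  (generated by the two kinds of elements).\<close>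
definition inv_alg :: "nat \<Rightarrow> nat \<Rightarrow> ((idx \<Rightarrow> complex) \<Rightarrow> complex) set" where
  "inv_alg n m = {F \<in> poly_fun UNIV.
      (\<forall>\<gamma> \<in> qdual n m. \<forall>g h. is_SL n g h \<longrightarrow> F (act_SL n m g h \<gamma>) = F \<gamma>) \<and>
      (\<forall>\<gamma> \<in> qdual n m. \<forall>\<eta>. F (act_V n m \<eta> \<gamma>) = F \<gamma>)}"

definition inv_polynomial_ring :: "nat \<Rightarrow> nat \<Rightarrow> bool" where
  "inv_polynomial_ring n m = (\<exists>r (Fs :: nat \<Rightarrow> (idx \<Rightarrow> complex) \<Rightarrow> complex).
      (\<forall>i<r. Fs i \<in> inv_alg n m) \<and>
      (\<forall>P \<in> poly_fun {..<r}. (\<forall>\<gamma> \<in> qdual n m. P (\<lambda>i. Fs i \<gamma>) = 0) \<longrightarrow> (\<forall>y. P y = 0)) \<and>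
      (\<forall>F \<in> inv_alg n m. \<exists>P \<in> poly_fun {..<r}. \<forall>\<gamma> \<in> qdual n m. F \<gamma> = P (\<lambda>i. Fs i \<gamma>)))"

definition unitv :: "idx \<Rightarrow> idx \<Rightarrow> complex" where
  "unitv c = (\<lambda>d. if d = c then 1 else 0)"

definition qbasis :: "nat \<Rightarrow> nat \<Rightarrow> (idx \<Rightarrow> complex) list" where
  "qbasis n m =
     [unitv (Mat i j). i \<leftarrow> [0..<n], j \<leftarrow> [0..<n], i \<noteq> j]
   @ [(\<lambda>d. if d = Mat i i then 1 else if d = Mat (Suc i) (Suc i) then -1 else 0). i \<leftarrow> [0..<n - 1]]
   @ [unitv (Vec k i). k \<leftarrow> [0..<m], i \<leftarrow> [0..<n]]"

definition pfaffian :: "nat \<Rightarrow> (nat \<Rightarrow> nat \<Rightarrow> complex) \<Rightarrow> complex" where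
  "pfaffian k A = (\<Sum>\<sigma> | \<sigma> permutes {..<2*k}.
      of_int (sign \<sigma>) * (\<Prod>i<k. A (\<sigma> (2*i)) (\<sigma> (2*i+1)))) / (2^k * fact k)"

definition struct_mat :: "nat \<Rightarrow> nat \<Rightarrow> (idx \<Rightarrow> complex) \<Rightarrow> nat \<Rightarrow> nat \<Rightarrow> complex" where
  "struct_mat n m \<gamma> s t = qpair n m \<gamma> (qbracket n m (qbasis n m ! s) (qbasis n m ! t))"

definition principal_pfaffian :: "nat \<Rightarrow> nat \<Rightarrow> nat set \<Rightarrow> (idx \<Rightarrow> complex) \<Rightarrow> complex" where
  "principal_pfaffian n m J \<gamma> =
     (let js = sorted_list_of_set J in
      pfaffian (card J div 2) (\<lambda>a b. struct_mat n m \<gamma> (js ! a) (js ! b)))"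

definition pdvd :: "nat \<Rightarrow> nat \<Rightarrow> ((idx \<Rightarrow> complex) \<Rightarrow> complex) \<Rightarrow> ((idx \<Rightarrow> complex) \<Rightarrow> complex) \<Rightarrow> bool" where
  "pdvd n m f g = (\<exists>h \<in> poly_fun UNIV. \<forall>\<gamma> \<in> qdual n m. g \<gamma> = f \<gamma> * h \<gamma>)"

text \<open>p_q = 1: the gcd of the Pfaffians of the principal minors of size dim q - ind q of the
  structure matrix is 1, i.e. every common divisor in C[q^*] is a unit (nonzero constant).\<close>
definition fund_semi_inv_trivial :: "nat \<Rightarrow> nat \<Rightarrow> bool" where
  "fund_semi_inv_trivial n m =
     (\<forall>f \<in> poly_fun UNIV.
        (\<forall>J. J \<subseteq> {..<length (qbasis n m)} \<and> card J = qdim n m - qind n m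
              \<longrightarrow> pdvd n m f (principal_pfaffian n m J))
        \<longrightarrow> (\<exists>c. c \<noteq> 0 \<and> (\<forall>\<gamma> \<in> qdual n m. f \<gamma> = c)))"

end

theory Submission
  imports Defs "Subresultants.Subresultant_Gcd" "HOL-Computational_Algebra.Fundamental_Theorem_Algebra" "HOL-Computational_Algebra.Field_as_Ring"
begin

text \<open>Write \<open>n = t m + r\<close> with \<open>0 < r \<le> m\<close>. The group \<open>Q\<close> moves a generic point \<open>(A, v)\<close> of the dual into a
  slice parametrised by \<open>r \<times> m\<close> matrices \<open>w\<close>: the columns of \<open>v, A v, \<dots>, A\<^sup>t\<^sup>-\<^sup>1 v\<close> become basis vectors
  and \<open>w\<close> is what remains of \<open>A\<^sup>t v\<close>. Invariants restrict to \<open>SL\<^sub>r\<close>-invariants of \<open>w\<close>, and each \<open>r \<times> r\<close> minor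
  of \<open>w\<close> is the restriction of a Krylov determinant. The minors are algebraically independent generators
  for \<open>r \<in> {1, m - 1, m}\<close>; otherwise a three-term Pluecker relation among the linear parts of
  hypothetical free generators gives a contradiction.

  A common divisor of the Pfaffians does not vanish at regular points, hence is constant along unipotent
  orbits and so \<open>Q\<close>-invariant. For \<open>r < m\<close> its restriction to the slice does not depend on any single column of
  \<open>w\<close>, so it is constant. For \<open>m = 1\<close> it is a polynomial in the Krylov determinant, whose zero set also contains
  a regular point, so that this polynomial has no root. For \<open>r = m \<ge> 2\<close> the index is at most \<open>1\<close> while stabilisers have dimension
  at least \<open>2\<close> wherever the Krylov determinant vanishes; as this determinant is square-free, it divides every Pfaffian.\<close>

subsection \<open>Polynomial functions\<close>

text \<open>The remainder \<open>r\<close> runs through 1, ..., m rather than 0, ..., m - 1, so that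
  the last block is never empty; m dividing n - 1, n or n + 1 then reads r = 1, r = m, or (r = m - 1
  or m = 1). The SL_r-invariants of r by m matrices form the coordinate ring of the cone over the
  Grassmannian of r-planes in m-space, and for 0 < r <= m this cone is an affine space exactly when
  r is 1, m - 1 or m: this is where the three cases come from. Polynomials on the dual are treated
  as functions, so divisibility is not read off from factorisations. Statements in several variables
  are restricted to lines or polynomial curves, where finiteness of roots and the fundamental
  theorem of algebra decide. Density plays the part of irreducibility, and square-freeness of the
  Krylov determinant is witnessed by a single line with as many distinct zeros as its degree. The
  link between Pfaffians and stabilisers is pointwise: the Pfaffians of size dim q - ind q vanish
  together exactly where the stabiliser is larger than the index.\<close>

lemma poly_fun_cmult: "f \<in> poly_fun I \<Longrightarrow> (\<lambda>x. c * f x) \<in> poly_fun I"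
  using pf_mult[OF pf_const] by blast

lemma poly_fun_uminus: "f \<in> poly_fun I \<Longrightarrow> (\<lambda>x. - f x) \<in> poly_fun I"
  using poly_fun_cmult[of f I "-1"] by simp

lemma poly_fun_diff: "f \<in> poly_fun I \<Longrightarrow> g \<in> poly_fun I \<Longrightarrow> (\<lambda>x. f x - g x) \<in> poly_fun I"
  using pf_add[OF _ poly_fun_uminus] by fastforce

lemma poly_fun_sum: "(\<And>a. a \<in> A \<Longrightarrow> f a \<in> poly_fun I) \<Longrightarrow> (\<lambda>x. \<Sum>a\<in>A. f a x) \<in> poly_fun I"
  by (induction A rule: infinite_finite_induct) (auto intro: pf_const pf_add)

lemma poly_fun_prod: "(\<And>a. a \<in> A \<Longrightarrow> f a \<in> poly_fun I) \<Longrightarrow> (\<lambda>x. \<Prod>a\<in>A. f a x) \<in> poly_fun I"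
  by (induction A rule: infinite_finite_induct) (auto intro: pf_const pf_mult)

lemma poly_fun_power: "f \<in> poly_fun I \<Longrightarrow> (\<lambda>x. f x ^ k) \<in> poly_fun I"
  by (induction k) (auto intro: pf_const pf_mult)

lemma poly_fun_div: "f \<in> poly_fun I \<Longrightarrow> (\<lambda>x. f x / c) \<in> poly_fun I"
  using poly_fun_cmult[of f I "inverse c"] by (simp add: field_simps)

lemma poly_fun_if: "f \<in> poly_fun I \<Longrightarrow> g \<in> poly_fun I \<Longrightarrow> (\<lambda>x. if b then f x else g x) \<in> poly_fun I"
  by (cases b) auto

lemmas poly_fun_intros = pf_const pf_var pf_add pf_mult poly_fun_cmult poly_fun_uminus
  poly_fun_diff poly_fun_sum poly_fun_prod poly_fun_power poly_fun_div poly_fun_if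

lemma poly_fun_compose:
  assumes "f \<in> poly_fun I" "\<And>i. i \<in> I \<Longrightarrow> (\<lambda>x. g x i) \<in> poly_fun J"
  shows "(\<lambda>x. f (g x)) \<in> poly_fun J"
  using assms(1) by induction (auto intro: poly_fun_intros assms(2))

lemma poly_fun_compose_poly:
  assumes "f \<in> poly_fun I"
  shows "(\<lambda>x. poly p (f x)) \<in> poly_fun I"
  by (simp add: poly_altdef poly_fun_intros assms)

lemma poly_fun_cong:
  assumes "f \<in> poly_fun I" "\<And>i. i \<in> I \<Longrightarrow> x i = y i"
  shows "f x = f y"
  using assms(1) by induction (auto simp: assms(2))

text \<open>The bridge from several variables to one: along a polynomial curve every polynomial
  function is a univariate polynomial, whose roots can be counted.\<close>

lemma poly_fun_curve:
  assumes "f \<in> poly_fun I"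
  shows "\<exists>p. \<forall>s. f (\<lambda>i. poly (g i) s) = poly p s"
  using assms
proof induction
  case (pf_const c)
  show ?case by (intro exI[of _ "[:c:]"]) simp
next
  case (pf_add f h)
  then show ?case by (metis poly_add)
next
  case (pf_mult f h)
  then show ?case by (metis poly_mult)
qed auto

lemma poly_fun_line:
  assumes "f \<in> poly_fun I"
  shows "\<exists>p. \<forall>s. f (\<lambda>i. x i + s * y i) = poly p s"
  using poly_fun_curve[OF assms, of "\<lambda>i. [:x i, y i:]"] by simp

text \<open>Stands for an affine subspace. Containing the complex line through any two of its points
  is what makes the polynomial functions on it an integral domain.\<close>

definition line_closed :: "('i \<Rightarrow> complex) set \<Rightarrow> bool" where
  "line_closed S \<longleftrightarrow> (\<forall>x\<in>S. \<forall>y\<in>S. \<forall>s. (\<lambda>i. x i + s * (y i - x i)) \<in> S)"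

lemma line_closed_UNIV: "line_closed UNIV"
  by (simp add: line_closed_def)

text \<open>On the line through \<open>x\<close> and \<open>y\<close> both functions restrict to
  nonzero polynomials, and their product has finitely many roots among infinitely many
  parameters.\<close>

lemma poly_fun_mult_nonzero:
  assumes S: "line_closed S" and f: "f \<in> poly_fun I" and g: "g \<in> poly_fun J"
    and x: "x \<in> S" "f x \<noteq> 0" and y: "y \<in> S" "g y \<noteq> 0"
  shows "\<exists>z\<in>S. f z \<noteq> 0 \<and> g z \<noteq> 0"
proof -
  let ?l = "\<lambda>s i. x i + s * (y i - x i)"
  obtain p where p: "\<And>s. f (?l s) = poly p s" using poly_fun_line[OF f, of x "\<lambda>i. y i - x i"] by blast
  obtain q where q: "\<And>s. g (?l s) = poly q s" using poly_fun_line[OF g, of x "\<lambda>i. y i - x i"] by blast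
  have "poly p 0 \<noteq> 0" "poly q 1 \<noteq> 0" using p[of 0] q[of 1] x y by simp_all
  then have "p * q \<noteq> 0" by auto
  then have "finite {s. poly (p * q) s = 0}" by (rule poly_roots_finite)
  then obtain s where "poly (p * q) s \<noteq> 0"
    using ex_new_if_finite[OF infinite_UNIV_char_0] by blast
  moreover have "?l s \<in> S" using S x y by (simp add: line_closed_def)
  ultimately show ?thesis using p q by (intro bexI[of _ "?l s"]) auto
qed

text \<open>Zariski density of the set where \<open>f\<close> does not vanish: a point with
  \<open>g y\<close> nonzero would produce a point of \<open>S\<close> at which both
  \<open>f\<close> and \<open>g\<close> are nonzero.\<close>

lemma poly_fun_dense:
  assumes S: "line_closed S" and f: "f \<in> poly_fun I" and g: "g \<in> poly_fun J"
    and x: "x \<in> S" "f x \<noteq> 0" and vanish: "\<And>z. z \<in> S \<Longrightarrow> f z \<noteq> 0 \<Longrightarrow> g z = 0" and y: "y \<in> S"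
  shows "g y = 0"
  using poly_fun_mult_nonzero[OF S f g x y] vanish by blast

lemma poly_fun_dense_eq:
  assumes S: "line_closed S" and f: "f \<in> poly_fun I" and g: "g \<in> poly_fun J" and h: "h \<in> poly_fun J"
    and x: "x \<in> S" "f x \<noteq> 0" and eq: "\<And>z. z \<in> S \<Longrightarrow> f z \<noteq> 0 \<Longrightarrow> g z = h z" and y: "y \<in> S"
  shows "g y = h y"
  using poly_fun_dense[OF S f poly_fun_diff[OF g h] x _ y] eq by simp

lemma nonvanishing_poly_constant:
  fixes p :: "complex poly"
  assumes "\<And>s. poly p s \<noteq> 0"
  shows "poly p s = poly p u"
proof -
  have "degree p = 0" using fundamental_theorem_of_algebra_alt[of p] assms
    by (metis constant_degree degree_pCons_0 fundamental_theorem_of_algebra)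
  then obtain c where "p = [:c:]" by (metis degree_eq_zeroE)
  then show ?thesis by simp
qed

text \<open>A complex polynomial without roots is constant. The curves in question are orbits of
  unipotent one-parameter groups and lines inside the slice.\<close>

lemma nonvanishing_poly_fun_curve_constant:
  assumes f: "f \<in> poly_fun I" and nz: "\<And>s. f (\<lambda>i. poly (g i) s) \<noteq> 0"
  shows "f (\<lambda>i. poly (g i) s) = f (\<lambda>i. poly (g i) u)"
proof -
  obtain p where "\<And>s. f (\<lambda>i. poly (g i) s) = poly p s" using poly_fun_curve[OF f] by blast
  then show ?thesis using nonvanishing_poly_constant[of p] nz by metis
qed

text \<open>The additive map \<open>L\<close> is the differential of \<open>f\<close> at \<open>a\<close>.\<close>

lemma poly_fun_first_order:
  assumes "f \<in> poly_fun I"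
  shows "\<exists>L :: ('i \<Rightarrow> complex) \<Rightarrow> complex. (\<forall>u v. L (\<lambda>i. u i + v i) = L u + L v) \<and>
    (\<forall>k\<ge>1. \<forall>g u. (\<forall>i\<in>I. monom 1 (Suc k) dvd g i - [:a i:] - monom (u i) k) \<longrightarrow>
      (\<exists>p. (\<forall>s. f (\<lambda>i. poly (g i) s) = poly p s) \<and>
           monom 1 (Suc k) dvd p - [:f a:] - monom (L u) k))"
  using assms
proof induction
  case (pf_const c)
  show ?case by (rule exI[of _ "\<lambda>_. 0"]) (auto intro!: exI[of _ "[:c:]"])
next
  case (pf_var i)
  then show ?case by (intro exI[of _ "\<lambda>u. u i"]) auto
next
  case (pf_add f h)
  obtain L where L: "\<And>u v. L (\<lambda>i. u i + v i) = L u + L v"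
    "\<And>k g u. k \<ge> 1 \<Longrightarrow> (\<forall>i\<in>I. monom 1 (Suc k) dvd g i - [:a i:] - monom (u i) k) \<Longrightarrow>
      \<exists>p. (\<forall>s. f (\<lambda>i. poly (g i) s) = poly p s) \<and> monom 1 (Suc k) dvd p - [:f a:] - monom (L u) k"
    using pf_add(3) by blast
  obtain K where K: "\<And>u v. K (\<lambda>i. u i + v i) = K u + K v"
    "\<And>k g u. k \<ge> 1 \<Longrightarrow> (\<forall>i\<in>I. monom 1 (Suc k) dvd g i - [:a i:] - monom (u i) k) \<Longrightarrow>
      \<exists>p. (\<forall>s. h (\<lambda>i. poly (g i) s) = poly p s) \<and> monom 1 (Suc k) dvd p - [:h a:] - monom (K u) k"
    using pf_add(4) by blast
  show ?case
  proof (intro exI[of _ "\<lambda>u. L u + K u"] conjI allI impI)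
    fix k :: nat and g u assume k: "1 \<le> k" and g: "\<forall>i\<in>I. monom 1 (Suc k) dvd g i - [:a i:] - monom (u i) k"
    obtain p q where p: "\<forall>s. f (\<lambda>i. poly (g i) s) = poly p s" "monom 1 (Suc k) dvd p - [:f a:] - monom (L u) k"
      and q: "\<forall>s. h (\<lambda>i. poly (g i) s) = poly q s" "monom 1 (Suc k) dvd q - [:h a:] - monom (K u) k"
      using L(2)[OF k g] K(2)[OF k g] by blast
    have eq: "p + q - [:f a + h a:] - monom (L u + K u) k =
      (p - [:f a:] - monom (L u) k) + (q - [:h a:] - monom (K u) k)"
      by (simp flip: add_monom)
    then show "\<exists>p. (\<forall>s. f (\<lambda>i. poly (g i) s) + h (\<lambda>i. poly (g i) s) = poly p s) \<and>
           monom 1 (Suc k) dvd p - [:f a + h a:] - monom (L u + K u) k"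
      using p(1) q(1) dvd_add[OF p(2) q(2)] unfolding eq[symmetric]
      by (intro exI[of _ "p + q"]) (simp only: poly_add simp_thms)
  qed (simp add: L(1) K(1))
next
  case (pf_mult f h)
  obtain L where L: "\<And>u v. L (\<lambda>i. u i + v i) = L u + L v"
    "\<And>k g u. k \<ge> 1 \<Longrightarrow> (\<forall>i\<in>I. monom 1 (Suc k) dvd g i - [:a i:] - monom (u i) k) \<Longrightarrow>
      \<exists>p. (\<forall>s. f (\<lambda>i. poly (g i) s) = poly p s) \<and> monom 1 (Suc k) dvd p - [:f a:] - monom (L u) k"
    using pf_mult(3) by blast
  obtain K where K: "\<And>u v. K (\<lambda>i. u i + v i) = K u + K v"
    "\<And>k g u. k \<ge> 1 \<Longrightarrow> (\<forall>i\<in>I. monom 1 (Suc k) dvd g i - [:a i:] - monom (u i) k) \<Longrightarrow>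
      \<exists>p. (\<forall>s. h (\<lambda>i. poly (g i) s) = poly p s) \<and> monom 1 (Suc k) dvd p - [:h a:] - monom (K u) k"
    using pf_mult(4) by blast
  show ?case
  proof (intro exI[of _ "\<lambda>u. f a * K u + h a * L u"] conjI allI impI)
    fix k :: nat and g u assume k: "1 \<le> k" and g: "\<forall>i\<in>I. monom 1 (Suc k) dvd g i - [:a i:] - monom (u i) k"
    obtain p q where p: "\<forall>s. f (\<lambda>i. poly (g i) s) = poly p s" "monom 1 (Suc k) dvd p - [:f a:] - monom (L u) k"
      and q: "\<forall>s. h (\<lambda>i. poly (g i) s) = poly q s" "monom 1 (Suc k) dvd q - [:h a:] - monom (K u) k"
      using L(2)[OF k g] K(2)[OF k g] by blast
    obtain p' where p': "p = [:f a:] + monom (L u) k + monom 1 (Suc k) * p'"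
      using p(2) by (auto simp: dvd_def algebra_simps)
    obtain q' where q': "q = [:h a:] + monom (K u) k + monom 1 (Suc k) * q'"
      using q(2) by (auto simp: dvd_def algebra_simps)
    \<comment> \<open>Here \<open>1 \<le> k\<close> enters: the product of the two terms of order k
      has order 2k >= k + 1 and is absorbed by the remainder.\<close>
    have m2: "monom (L u) k * monom (K u) k = monom 1 (Suc k) * monom (L u * K u) (k - 1)"
      using k by (simp add: mult_monom)
    have c: "[:f a:] * monom (K u) k = monom (f a * K u) k" "[:h a:] * monom (L u) k = monom (h a * L u) k"
      "[:f a:] * [:h a:] = [:f a * h a:]"
      by (simp_all add: smult_monom)
    have "p * q - [:f a * h a:] - monom (f a * K u + h a * L u) k =
      monom 1 (Suc k) * (monom (L u * K u) (k - 1) + p' * q + ([:f a:] + monom (L u) k) * q')"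
      unfolding add_monom[symmetric] distrib_left m2[symmetric] c[symmetric]
      unfolding p' q' by (simp only: algebra_simps)
    then show "\<exists>p. (\<forall>s. f (\<lambda>i. poly (g i) s) * h (\<lambda>i. poly (g i) s) = poly p s) \<and>
           monom 1 (Suc k) dvd p - [:f a * h a:] - monom (f a * K u + h a * L u) k"
      using p q by (intro exI[of _ "p * q"]) auto
  qed (simp add: L(1) K(1) algebra_simps)
qed

subsection \<open>Pfaffians of skew-symmetric forms\<close>

lemma pfaffian_cong:
  assumes "\<And>a b. a < 2*k \<Longrightarrow> b < 2*k \<Longrightarrow> A a b = B a b"
  shows "pfaffian k A = pfaffian k B"
proof -
  have "A (\<sigma> (2*i)) (\<sigma> (2*i+1)) = B (\<sigma> (2*i)) (\<sigma> (2*i+1))" if "\<sigma> permutes {..<2*k}" "i < k" for \<sigma> i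
    using permutes_in_image[OF that(1), of "2*i"] permutes_in_image[OF that(1), of "2*i+1"] that(2)
    by (intro assms) auto
  then show ?thesis unfolding pfaffian_def by (auto intro!: sum.cong prod.cong arg_cong2[where f="(/)"])
qed

lemma pfaffian_permute:
  assumes p: "\<pi> permutes {..<2*k}"
  shows "pfaffian k (\<lambda>a b. A (\<pi> a) (\<pi> b)) = of_int (sign \<pi>) * pfaffian k A"
proof -
  have s: "of_int (sign \<sigma>) = (of_int (sign \<pi>) * of_int (sign (\<pi> \<circ> \<sigma>)) :: complex)"
    if "\<sigma> permutes {..<2*k}" for \<sigma>
  proof -
    have "sign (\<pi> \<circ> \<sigma>) = sign \<pi> * sign \<sigma>"
      using that p by (intro sign_compose) (auto intro: permutation_permutes[THEN iffD2])
    moreover have "sign \<pi> * sign \<pi> = 1" by (rule sign_idempotent)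
    ultimately have "sign \<sigma> = sign \<pi> * sign (\<pi> \<circ> \<sigma>)" by (metis mult.assoc mult_1)
    then show ?thesis by simp
  qed
  have "(\<Sum>\<sigma> | \<sigma> permutes {..<2*k}. of_int (sign \<sigma>) * (\<Prod>i<k. A (\<pi> (\<sigma> (2*i))) (\<pi> (\<sigma> (2*i+1)))))
    = (\<Sum>\<sigma> | \<sigma> permutes {..<2*k}. of_int (sign \<pi>) *
        (of_int (sign (\<pi> \<circ> \<sigma>)) * (\<Prod>i<k. A ((\<pi> \<circ> \<sigma>) (2*i)) ((\<pi> \<circ> \<sigma>) (2*i+1)))))"
    by (intro sum.cong refl) (simp add: s)
  also have "\<dots> = of_int (sign \<pi>) * (\<Sum>\<sigma> | \<sigma> permutes {..<2*k}. of_int (sign (\<pi> \<circ> \<sigma>)) *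
      (\<Prod>i<k. A ((\<pi> \<circ> \<sigma>) (2*i)) ((\<pi> \<circ> \<sigma>) (2*i+1))))"
    by (simp only: sum_distrib_left)
  also have "\<dots> = of_int (sign \<pi>) * (\<Sum>\<sigma> | \<sigma> permutes {..<2*k}. of_int (sign \<sigma>) *
      (\<Prod>i<k. A (\<sigma> (2*i)) (\<sigma> (2*i+1))))"
    by (subst setum_permutations_compose_left[OF p, of "\<lambda>\<sigma>. of_int (sign \<sigma>) * (\<Prod>i<k. A (\<sigma> (2*i)) (\<sigma> (2*i+1)))"]) simp
  finally show ?thesis by (simp add: pfaffian_def)
qed

lemma pfaffian_repeated_index:
  assumes "a < 2*k" "b < 2*k" "a \<noteq> b" "f a = f b"
  shows "pfaffian k (\<lambda>i j. M (f i) (f j)) = 0"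
proof -
  let ?t = "transpose a b"
  have t: "?t permutes {..<2*k}" using assms by (intro permutes_swap_id) auto
  have ft: "f (?t i) = f i" for i using assms by (auto simp: transpose_def)
  have "pfaffian k (\<lambda>i j. M (f i) (f j)) = pfaffian k (\<lambda>i j. M (f (?t i)) (f (?t j)))"
    by (simp add: ft)
  also have "\<dots> = - pfaffian k (\<lambda>i j. M (f i) (f j))"
    using pfaffian_permute[OF t, of "\<lambda>i j. M (f i) (f j)"] assms by (simp add: sign_swap_id)
  finally show ?thesis by simp
qed

text \<open>Column exchange for the determinant with entries \<open>T a (f b)\<close>. It is kept as
  a sum over permutations because the column labels \<open>f b\<close> come from another range than
  the rows.\<close>

lemma alternating_sum_permute:
  fixes T :: "nat \<Rightarrow> nat \<Rightarrow> complex"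
  assumes p: "\<pi> permutes {..<N}"
  shows "(\<Sum>\<sigma> | \<sigma> permutes {..<N}. of_int (sign \<sigma>) * (\<Prod>j<N. T (\<sigma> j) (f (\<pi> j)))) =
    of_int (sign \<pi>) * (\<Sum>\<sigma> | \<sigma> permutes {..<N}. of_int (sign \<sigma>) * (\<Prod>j<N. T (\<sigma> j) (f j)))"
proof -
  have "(\<Sum>\<sigma> | \<sigma> permutes {..<N}. of_int (sign \<sigma>) * (\<Prod>j<N. T (\<sigma> j) (f (\<pi> j))))
    = (\<Sum>\<sigma> | \<sigma> permutes {..<N}. of_int (sign (\<sigma> \<circ> \<pi>)) * (\<Prod>j<N. T ((\<sigma> \<circ> \<pi>) j) (f (\<pi> j))))"
    by (rule sum_permutations_compose_right[OF p])
  also have "\<dots> = (\<Sum>\<sigma> | \<sigma> permutes {..<N}. of_int (sign \<pi>) * (of_int (sign \<sigma>) * (\<Prod>j<N. T (\<sigma> j) (f j))))"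
  proof (rule sum.cong[OF refl])
    fix \<sigma> assume "\<sigma> \<in> {\<sigma>. \<sigma> permutes {..<N}}"
    then have \<sigma>: "\<sigma> permutes {..<N}" by simp
    have "sign (\<sigma> \<circ> \<pi>) = sign \<sigma> * sign \<pi>"
      using \<sigma> p by (intro sign_compose) (auto intro: permutation_permutes[THEN iffD2])
    moreover have "(\<Prod>j<N. T ((\<sigma> \<circ> \<pi>) j) (f (\<pi> j))) = (\<Prod>j<N. T (\<sigma> j) (f j))"
      using prod.permute[OF p, of "\<lambda>j. T (\<sigma> j) (f j)"] by (simp add: comp_def)
    ultimately show "of_int (sign (\<sigma> \<circ> \<pi>)) * (\<Prod>j<N. T ((\<sigma> \<circ> \<pi>) j) (f (\<pi> j))) =
      of_int (sign \<pi>) * (of_int (sign \<sigma>) * (\<Prod>j<N. T (\<sigma> j) (f j)))" by simp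
  qed
  finally show ?thesis by (simp add: sum_distrib_left)
qed

lemma prod_lessThan_double:
  fixes g :: "nat \<Rightarrow> 'a::comm_monoid_mult"
  shows "(\<Prod>j<2*k. g j) = (\<Prod>i<k. g (2*i) * g (2*i+1))"
  by (induction k) (auto simp: mult.assoc)

text \<open>A qualitative Cauchy-Binet formula for the Pfaffian of T M T^t: multilinear expansion
  gives a sum over index maps \<open>f\<close>, and after averaging over rearrangements of
  \<open>f\<close> each summand is a multiple of the Pfaffian of M along \<open>f\<close>. Hence one
  of these is nonzero.\<close>

lemma pfaffian_expand:
  fixes T M :: "nat \<Rightarrow> nat \<Rightarrow> complex"
  assumes B: "\<And>a b. a < 2*k \<Longrightarrow> b < 2*k \<Longrightarrow> B a b = (\<Sum>s<L. \<Sum>u<L. T a s * M s u * T b u)"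
    and nz: "pfaffian k B \<noteq> 0"
  shows "\<exists>f. f ` {..<2*k} \<subseteq> {..<L} \<and> pfaffian k (\<lambda>a b. M (f a) (f b)) \<noteq> 0"
proof (rule ccontr)
  assume none: "\<not> ?thesis"
  define S where "S = PiE {..<2*k} (\<lambda>_. {..<L})"
  define G where "G = PiE {..<k} (\<lambda>_. {..<L} \<times> {..<L})"
  define D where "D f = (\<Sum>\<sigma> | \<sigma> permutes {..<2*k}. of_int (sign \<sigma>) * (\<Prod>j<2*k. T (\<sigma> j) (f j)))" for f
  define h where "h f = (\<Prod>i<k. M (f (2*i)) (f (2*i+1))) * D f" for f
  have fin: "finite S" "finite {\<sigma>. \<sigma> permutes {..<2*k}}"
    by (auto simp: S_def intro: finite_PiE finite_permutations)
  have "(\<Prod>i<k. B (\<sigma> (2*i)) (\<sigma> (2*i+1))) = (\<Sum>f\<in>S. (\<Prod>i<k. M (f (2*i)) (f (2*i+1))) * (\<Prod>j<2*k. T (\<sigma> j) (f j)))"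
    if \<sigma>: "\<sigma> permutes {..<2*k}" for \<sigma>
  proof -
    have "(\<Prod>i<k. B (\<sigma> (2*i)) (\<sigma> (2*i+1))) =
      (\<Prod>i<k. \<Sum>su\<in>{..<L}\<times>{..<L}. T (\<sigma> (2*i)) (fst su) * M (fst su) (snd su) * T (\<sigma> (2*i+1)) (snd su))"
    proof (intro prod.cong refl)
      fix i assume "i \<in> {..<k}"
      then have "\<sigma> (2*i) < 2*k" "\<sigma> (2*i+1) < 2*k"
        using permutes_in_image[OF \<sigma>, of "2*i"] permutes_in_image[OF \<sigma>, of "2*i+1"] by auto
      then show "B (\<sigma> (2*i)) (\<sigma> (2*i+1)) = (\<Sum>su\<in>{..<L}\<times>{..<L}. T (\<sigma> (2*i)) (fst su) * M (fst su) (snd su) * T (\<sigma> (2*i+1)) (snd su))"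
        by (simp add: B sum.cartesian_product case_prod_beta)
    qed
    also have "\<dots> = (\<Sum>g\<in>G. \<Prod>i<k. T (\<sigma> (2*i)) (fst (g i)) * M (fst (g i)) (snd (g i)) * T (\<sigma> (2*i+1)) (snd (g i)))"
      unfolding G_def by (subst prod_sum_PiE) auto
    \<comment> \<open>A family of k pairs of indices is the same as one map on 2k positions: pair i
      occupies positions 2i and 2i + 1.\<close>
    also have "\<dots> = (\<Sum>f\<in>S. \<Prod>i<k. T (\<sigma> (2*i)) (f (2*i)) * M (f (2*i)) (f (2*i+1)) * T (\<sigma> (2*i+1)) (f (2*i+1)))"
    proof (rule sum.reindex_bij_witness[where
          i = "\<lambda>f. restrict (\<lambda>i. (f (2*i), f (2*i+1))) {..<k}" and
          j = "\<lambda>g. restrict (\<lambda>j. if even j then fst (g (j div 2)) else snd (g (j div 2))) {..<2*k}"])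
      fix g assume g: "g \<in> G"
      show "restrict (\<lambda>i. (restrict (\<lambda>j. if even j then fst (g (j div 2)) else snd (g (j div 2))) {..<2*k} (2*i),
          restrict (\<lambda>j. if even j then fst (g (j div 2)) else snd (g (j div 2))) {..<2*k} (2*i+1))) {..<k} = g"
        using g by (auto simp: G_def PiE_def extensional_def restrict_def fun_eq_iff)
      show "restrict (\<lambda>j. if even j then fst (g (j div 2)) else snd (g (j div 2))) {..<2*k} \<in> S"
        using g by (auto simp: G_def S_def PiE_def Pi_def mem_Times_iff)
      show "(\<Prod>i<k. T (\<sigma> (2*i)) (restrict (\<lambda>j. if even j then fst (g (j div 2)) else snd (g (j div 2))) {..<2*k} (2*i)) *
         M (restrict (\<lambda>j. if even j then fst (g (j div 2)) else snd (g (j div 2))) {..<2*k} (2*i))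
           (restrict (\<lambda>j. if even j then fst (g (j div 2)) else snd (g (j div 2))) {..<2*k} (2*i+1)) *
         T (\<sigma> (2*i+1)) (restrict (\<lambda>j. if even j then fst (g (j div 2)) else snd (g (j div 2))) {..<2*k} (2*i+1))) =
        (\<Prod>i<k. T (\<sigma> (2*i)) (fst (g i)) * M (fst (g i)) (snd (g i)) * T (\<sigma> (2*i+1)) (snd (g i)))"
        by (intro prod.cong) auto
    next
      fix f assume f: "f \<in> S"
      show "restrict (\<lambda>j. if even j then fst (restrict (\<lambda>i. (f (2*i), f (2*i+1))) {..<k} (j div 2))
          else snd (restrict (\<lambda>i. (f (2*i), f (2*i+1))) {..<k} (j div 2))) {..<2*k} = f"
      proof
        fix j
        show "restrict (\<lambda>j. if even j then fst (restrict (\<lambda>i. (f (2*i), f (2*i+1))) {..<k} (j div 2))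
          else snd (restrict (\<lambda>i. (f (2*i), f (2*i+1))) {..<k} (j div 2))) {..<2*k} j = f j"
          using f by (cases "even j") (auto simp: S_def PiE_def extensional_def elim!: evenE oddE)
      qed
      show "restrict (\<lambda>i. (f (2*i), f (2*i+1))) {..<k} \<in> G"
        using f by (auto simp: G_def S_def PiE_def Pi_def)
    qed
    also have "\<dots> = (\<Sum>f\<in>S. (\<Prod>i<k. M (f (2*i)) (f (2*i+1))) * (\<Prod>j<2*k. T (\<sigma> j) (f j)))"
      unfolding prod_lessThan_double prod.distrib by (simp only: mult_ac)
    finally show ?thesis .
  qed
  then have "(\<Sum>\<sigma> | \<sigma> permutes {..<2*k}. of_int (sign \<sigma>) * (\<Prod>i<k. B (\<sigma> (2*i)) (\<sigma> (2*i+1)))) =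
    (\<Sum>\<sigma> | \<sigma> permutes {..<2*k}. \<Sum>f\<in>S. of_int (sign \<sigma>) * ((\<Prod>i<k. M (f (2*i)) (f (2*i+1))) * (\<Prod>j<2*k. T (\<sigma> j) (f j))))"
    by (intro sum.cong refl) (simp add: sum_distrib_left)
  also have "\<dots> = (\<Sum>f\<in>S. h f)"
    by (subst sum.swap) (simp add: h_def D_def sum_distrib_left mult_ac)
  finally have pfB: "pfaffian k B = (\<Sum>f\<in>S. h f) / (2^k * fact k)" by (simp add: pfaffian_def)
  have inv: "(\<Sum>f\<in>S. h f) = (\<Sum>f\<in>S. h (f \<circ> \<pi>))" if \<pi>: "\<pi> permutes {..<2*k}" for \<pi>
  proof (rule sum.reindex_bij_witness[where i = "\<lambda>f. f \<circ> \<pi>" and j = "\<lambda>f. f \<circ> Hilbert_Choice.inv \<pi>"])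
    have i: "Hilbert_Choice.inv \<pi> permutes {..<2*k}" by (rule permutes_inv[OF \<pi>])
    have mem: "f \<circ> \<rho> \<in> S" if "f \<in> S" "\<rho> permutes {..<2*k}" for f \<rho>
      using that permutes_in_image[OF that(2)] permutes_not_in[OF that(2)]
      unfolding S_def PiE_def extensional_def Pi_def by auto
    show "f \<circ> \<pi> \<in> S" "f \<circ> Hilbert_Choice.inv \<pi> \<in> S" if "f \<in> S" for f using mem that \<pi> i by auto
    show "f \<circ> Hilbert_Choice.inv \<pi> \<circ> \<pi> = f" "f \<circ> \<pi> \<circ> Hilbert_Choice.inv \<pi> = f" for f :: "nat \<Rightarrow> nat"
      using \<pi> by (simp_all add: comp_assoc permutes_inv_o)
    then show "h (f \<circ> Hilbert_Choice.inv \<pi> \<circ> \<pi>) = h f" for f by simp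
  qed
  \<comment> \<open>Averaging over all rearrangements: \<open>D\<close> only picks up the sign of
    the permutation, so the inner sum becomes the alternating sum that defines the Pfaffian of M
    along \<open>f\<close>, which is zero by assumption.\<close>
  have "of_nat (card {\<pi>. \<pi> permutes {..<2*k}}) * (\<Sum>f\<in>S. h f) = (\<Sum>\<pi> | \<pi> permutes {..<2*k}. \<Sum>f\<in>S. h (f \<circ> \<pi>))"
    using inv by (subst sum_constant[symmetric]) (rule sum.cong, auto)
  also have "\<dots> = (\<Sum>f\<in>S. \<Sum>\<pi> | \<pi> permutes {..<2*k}. h (f \<circ> \<pi>))" by (rule sum.swap)
  also have "\<dots> = (\<Sum>f\<in>S. D f * (\<Sum>\<pi> | \<pi> permutes {..<2*k}. of_int (sign \<pi>) * (\<Prod>i<k. M (f (\<pi> (2*i))) (f (\<pi> (2*i+1))))))"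
  proof (intro sum.cong refl)
    fix f
    have "D (f \<circ> \<pi>) = of_int (sign \<pi>) * D f" if "\<pi> permutes {..<2*k}" for \<pi>
      using alternating_sum_permute[OF that, of T f] by (simp add: D_def)
    then show "(\<Sum>\<pi> | \<pi> permutes {..<2*k}. h (f \<circ> \<pi>)) =
      D f * (\<Sum>\<pi> | \<pi> permutes {..<2*k}. of_int (sign \<pi>) * (\<Prod>i<k. M (f (\<pi> (2*i))) (f (\<pi> (2*i+1)))))"
      by (auto simp: h_def sum_distrib_left mult_ac intro!: sum.cong)
  qed
  also have "\<dots> = 0"
  proof (intro sum.neutral ballI)
    fix f assume "f \<in> S"
    then have "f ` {..<2*k} \<subseteq> {..<L}" by (auto simp: S_def)
    then have "pfaffian k (\<lambda>a b. M (f a) (f b)) = 0" using none by blast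
    then show "D f * (\<Sum>\<pi> | \<pi> permutes {..<2*k}. of_int (sign \<pi>) * (\<Prod>i<k. M (f (\<pi> (2*i))) (f (\<pi> (2*i+1))))) = 0"
      by (simp add: pfaffian_def)
  qed
  finally have "(\<Sum>f\<in>S. h f) = 0" using card_permutations[of "{..<2*k}" "2*k"] by simp
  then show False using nz pfB by simp
qed

text \<open>The Gram matrix of a Darboux basis, with 2i and 2i + 1 as partners.\<close>

definition std_skew :: "nat \<Rightarrow> nat \<Rightarrow> complex" where
  "std_skew a b = (if a div 2 = b div 2 \<and> a \<noteq> b then (if even a then 1 else -1) else 0)"

lemma std_skew_simps [simp]:
  "std_skew (2*i) (Suc (2*i)) = 1" "std_skew (Suc (2*i)) (2*i) = -1"
  by (auto simp: std_skew_def)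

text \<open>No cancellation can occur in the Pfaffian: a surviving permutation sends pairs to pairs;
  permuting whole pairs is even, and flipping one pair changes both the sign of the permutation and
  the sign of one entry. The induction first brings the image of the last pair back to the last
  place.\<close>

lemma std_skew_permutation_term:
  assumes "\<sigma> permutes {..<2*k}" "\<And>i. i < k \<Longrightarrow> std_skew (\<sigma> (2*i)) (\<sigma> (2*i+1)) \<noteq> 0"
  shows "of_int (sign \<sigma>) * (\<Prod>i<k. std_skew (\<sigma> (2*i)) (\<sigma> (2*i+1))) = 1"
  using assms
proof (induction k arbitrary: \<sigma>)
  case 0
  then show ?case by simp
next
  case (Suc k)
  have perm: "permutation p" if "p permutes {..<2 * Suc k}" for p :: "nat \<Rightarrow> nat"
    using that permutation_permutes by blast
  define q where "q = \<sigma> (2*k) div 2"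
  have q: "\<sigma> (2*k) div 2 = q" "\<sigma> (2*k+1) div 2 = q" "\<sigma> (2*k) \<noteq> \<sigma> (2*k+1)"
    using Suc.prems(2)[of k] by (auto simp: std_skew_def q_def split: if_splits)
  have qk: "q < Suc k" using q(1) permutes_in_image[OF Suc.prems(1), of "2*k"] by auto
  \<comment> \<open>Exchanges the pairs q and k. Being a product of two transpositions (both trivial
    if q = k) it is even, and it preserves \<open>std_skew\<close>.\<close>
  define \<rho> where "\<rho> = transpose (2*q) (2*k) \<circ> transpose (2*q+1) (2*k+1)"
  have \<rho>p: "\<rho> permutes {..<2 * Suc k}" unfolding \<rho>_def using qk
    by (intro permutes_compose permutes_swap_id) auto
  have "sign \<rho> = 1" unfolding \<rho>_def
    by (subst sign_compose) (auto simp: sign_swap_id permutation_swap_id)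
  have \<rho>val: "\<rho> x = (if x div 2 = q then 2*k + x mod 2 else if x div 2 = k then 2*q + x mod 2 else x)" for x
  proof -
    have "x = 2 * (x div 2) + x mod 2" "x mod 2 = 0 \<or> x mod 2 = 1" by auto
    then show ?thesis by (auto simp: \<rho>_def transpose_def)
  qed
  have \<rho>d: "\<rho> x div 2 = (if x div 2 = q then k else if x div 2 = k then q else x div 2)"
    "even (\<rho> x) \<longleftrightarrow> even x" for x
  proof -
    have "(2*a + x mod 2) div 2 = a" "even (2*a + x mod 2) \<longleftrightarrow> even x" for a by presburger+
    then show "\<rho> x div 2 = (if x div 2 = q then k else if x div 2 = k then q else x div 2)"
      "even (\<rho> x) \<longleftrightarrow> even x" unfolding \<rho>val by (simp_all split: if_split)
  qed
  have inj: "\<rho> x = \<rho> y \<longleftrightarrow> x = y" for x y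
    using permutes_inj[OF \<rho>p] by (auto simp: inj_def)
  have \<rho>S: "std_skew (\<rho> x) (\<rho> y) = std_skew x y" for x y
    by (auto simp: std_skew_def \<rho>d inj)
  define \<sigma>1 where "\<sigma>1 = \<rho> \<circ> \<sigma>"
  have s1p: "\<sigma>1 permutes {..<2 * Suc k}" unfolding \<sigma>1_def by (rule permutes_compose[OF Suc.prems(1) \<rho>p])
  have s1sign: "sign \<sigma>1 = sign \<sigma>" unfolding \<sigma>1_def
    using \<open>sign \<rho> = 1\<close> perm[OF \<rho>p] perm[OF Suc.prems(1)] by (simp add: sign_compose)
  have s1k: "\<sigma>1 (2*k) div 2 = k" "\<sigma>1 (2*k+1) div 2 = k" "\<sigma>1 (2*k) \<noteq> \<sigma>1 (2*k+1)"
    using q by (simp_all add: \<sigma>1_def \<rho>d inj)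
  have h: "y div 2 = k \<Longrightarrow> y = 2*k \<or> y = 2*k+1" for y by presburger
  have s1v: "(\<sigma>1 (2*k) = 2*k \<and> \<sigma>1 (2*k+1) = 2*k+1) \<or> (\<sigma>1 (2*k) = 2*k+1 \<and> \<sigma>1 (2*k+1) = 2*k)"
    using h[OF s1k(1)] h[OF s1k(2)] s1k(3) by metis
  \<comment> \<open>Undoes a possible flip inside the last pair; its sign equals the entry of
    \<open>std_skew\<close> at that pair.\<close>
  define \<tau> where "\<tau> = (if \<sigma>1 (2*k) = 2*k then id else transpose (2*k) (2*k+1))"
  define \<sigma>2 where "\<sigma>2 = \<tau> \<circ> \<sigma>1"
  have \<tau>p: "\<tau> permutes {..<2 * Suc k}" unfolding \<tau>_def
    by (auto intro: permutes_swap_id permutes_id)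
  have s2p: "\<sigma>2 permutes {..<2 * Suc k}" unfolding \<sigma>2_def by (rule permutes_compose[OF s1p \<tau>p])
  have fix2: "\<sigma>2 (2*k) = 2*k" "\<sigma>2 (2*k+1) = 2*k+1"
    using s1v by (auto simp: \<sigma>2_def \<tau>_def)
  have rest: "\<sigma>2 x = \<sigma>1 x" if "x < 2*k" for x
  proof -
    have "\<sigma>1 x \<noteq> \<sigma>1 (2*k)" "\<sigma>1 x \<noteq> \<sigma>1 (2*k+1)"
      using that by (simp_all add: inj_eq[OF permutes_inj[OF s1p]])
    then have "\<sigma>1 x \<noteq> 2*k" "\<sigma>1 x \<noteq> 2*k+1" using s1v by metis+
    then show ?thesis by (simp add: \<sigma>2_def \<tau>_def transpose_def)
  qed
  have s2p': "\<sigma>2 permutes {..<2*k}"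
  proof (rule permutes_superset[OF s2p])
    fix x assume "x \<in> {..<2 * Suc k} - {..<2*k}"
    then have "x = 2*k \<or> x = 2*k+1" by auto
    then show "\<sigma>2 x = x" using fix2 by auto
  qed
  have "of_int (sign \<sigma>2) * (\<Prod>i<k. std_skew (\<sigma>2 (2*i)) (\<sigma>2 (2*i+1))) = 1"
  proof (rule Suc.IH[OF s2p'])
    fix i assume "i < k"
    then show "std_skew (\<sigma>2 (2*i)) (\<sigma>2 (2*i+1)) \<noteq> 0"
      using rest[of "2*i"] rest[of "2*i+1"] Suc.prems(2)[of i] \<rho>S by (simp add: \<sigma>1_def)
  qed
  moreover have "(\<Prod>i<k. std_skew (\<sigma>2 (2*i)) (\<sigma>2 (2*i+1))) = (\<Prod>i<k. std_skew (\<sigma> (2*i)) (\<sigma> (2*i+1)))"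
    using rest \<rho>S by (intro prod.cong) (auto simp: \<sigma>1_def)
  moreover have "of_int (sign \<sigma>2) = of_int (sign \<sigma>) * std_skew (\<sigma> (2*k)) (\<sigma> (2*k+1))"
  proof -
    have c: "std_skew (\<sigma> (2*k)) (\<sigma> (2*k+1)) = std_skew (\<sigma>1 (2*k)) (\<sigma>1 (2*k+1))"
      using \<rho>S by (simp add: \<sigma>1_def)
    have sg: "sign \<sigma>2 = sign \<tau> * sign \<sigma>" unfolding \<sigma>2_def
      using perm[OF \<tau>p] perm[OF s1p] s1sign by (simp add: sign_compose)
    show ?thesis
    proof (cases "\<sigma>1 (2*k) = 2*k")
      case True
      then have "\<sigma>1 (2*k+1) = 2*k+1" using fix2(2) by (simp add: \<sigma>2_def \<tau>_def)
      then show ?thesis using True c sg by (simp add: \<tau>_def sign_id)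
    next
      case False
      then have "\<sigma>1 (2*k) = 2*k+1" "\<sigma>1 (2*k+1) = 2*k" using s1v by auto
      then show ?thesis using False c sg by (simp add: \<tau>_def sign_swap_id)
    qed
  qed
  ultimately show ?case by (simp add: mult_ac)
qed

lemma pfaffian_std_skew: "pfaffian k std_skew \<noteq> 0"
proof -
  let ?t = "\<lambda>\<sigma>. of_int (sign \<sigma>) * (\<Prod>i<k. std_skew (\<sigma> (2*i)) (\<sigma> (2*i+1)))"
  let ?P = "{\<sigma>. \<sigma> permutes {..<2*k}}"
  let ?G = "{\<sigma>. \<sigma> permutes {..<2*k} \<and> (\<forall>i<k. std_skew (\<sigma> (2*i)) (\<sigma> (2*i+1)) \<noteq> 0)}"
  have fin: "finite ?P" by (rule finite_permutations) simp
  then have finG: "finite ?G" by (rule rev_finite_subset) auto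
  have "sum ?t ?P = sum ?t ?G"
    by (rule sum.mono_neutral_right[OF fin]) auto
  also have "\<dots> = sum (\<lambda>_. 1) ?G"
    by (rule sum.cong) (use std_skew_permutation_term in auto)
  finally have "sum ?t ?P = of_nat (card ?G)" by simp
  moreover have "id \<in> ?G" by (auto simp: permutes_id)
  then have "?G \<noteq> {}" by blast
  then have "0 < card ?G" by (intro card_gt_0_iff[THEN iffD2] conjI finG)
  ultimately have "sum ?t ?P \<noteq> 0" by simp
  then show ?thesis by (simp add: pfaffian_def)
qed

lemma pfaffian_injective_reindex:
  assumes inj: "inj_on f {..<2*k}" and J: "J = f ` {..<2*k}"
  defines "js \<equiv> sorted_list_of_set J"
  shows "\<exists>\<pi>. \<pi> permutes {..<2*k} \<and>
    pfaffian k (\<lambda>a b. M (f a) (f b)) = of_int (sign \<pi>) * pfaffian k (\<lambda>a b. M (js ! a) (js ! b))"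
proof -
  have fin: "finite J" and card: "card J = 2*k" using inj J by (auto simp: card_image)
  have js: "set js = J" "distinct js" "length js = 2*k" using fin card by (auto simp: js_def)
  have bij: "bij_betw ((!) js) {..<2*k} J" using js bij_betw_nth[of js "{..<2*k}" J] by simp
  define g where "g a = (if a < 2*k then inv_into {..<2*k} ((!) js) (f a) else a)" for a
  have g: "js ! g a = f a" "g a < 2*k" if "a < 2*k" for a
  proof -
    have "f a \<in> (!) js ` {..<2*k}" using bij that J by (auto simp: bij_betw_def)
    then show "js ! g a = f a" "g a < 2*k" using that f_inv_into_f[of "f a" "(!) js" "{..<2*k}"]
        inv_into_into[of "f a" "(!) js" "{..<2*k}"] by (auto simp: g_def)
  qed
  have perm: "g permutes {..<2*k}"
  proof (rule bij_imp_permutes)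
    have "inj_on g {..<2*k}" using g inj by (metis inj_on_def lessThan_iff)
    moreover have "g ` {..<2*k} \<subseteq> {..<2*k}" using g by auto
    ultimately show "bij_betw g {..<2*k} {..<2*k}"
      by (metis bij_betw_def endo_inj_surj finite_lessThan)
  qed (simp add: g_def)
  have "pfaffian k (\<lambda>a b. M (f a) (f b)) = pfaffian k (\<lambda>a b. M (js ! g a) (js ! g b))"
    by (rule pfaffian_cong) (simp add: g)
  then show ?thesis using pfaffian_permute[OF perm, of "\<lambda>a b. M (js ! a) (js ! b)"] perm by auto
qed

section \<open>Skew forms: Darboux families, radical and principal Pfaffians\<close>

locale skew_form = vector_space scale for scale :: "complex \<Rightarrow> 'v::ab_group_add \<Rightarrow> 'v" (infixr "*s" 75) +
  fixes V :: "'v set" and B :: "'v \<Rightarrow> 'v \<Rightarrow> complex" and E :: "'v list"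
  assumes V_span: "V = span (set E)"
    and B_add: "B x (y + z) = B x y + B x z"
    and B_scale: "B x (c *s y) = c * B x y"
    and B_skew: "B x y = - B y x"
begin

definition radical :: "'v set" where
  "radical = {x \<in> V. \<forall>y\<in>V. B x y = 0}"

definition principal_pf :: "nat set \<Rightarrow> complex" where
  "principal_pf J = (let js = sorted_list_of_set J in
     pfaffian (card J div 2) (\<lambda>a b. B (E ! (js ! a)) (E ! (js ! b))))"

definition darboux :: "nat \<Rightarrow> (nat \<Rightarrow> 'v) \<Rightarrow> bool" where
  "darboux k x \<longleftrightarrow> (\<forall>i<2*k. x i \<in> V) \<and> (\<forall>i<2*k. \<forall>j<2*k. B (x i) (x j) = std_skew i j)"

lemma B_zero [simp]: "B x 0 = 0"
  using B_add[of x 0 0] by simp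

lemma B_zero_left [simp]: "B 0 x = 0"
  using B_skew[of 0 x] by simp

lemma B_sum: "B x (sum f A) = (\<Sum>a\<in>A. B x (f a))"
  by (induction A rule: infinite_finite_induct) (auto simp: B_add)

lemma B_self: "B x x = 0"
  using B_skew[of x x] by simp

lemma B_add_left: "B (x + y) z = B x z + B y z"
  using B_skew[of "x + y" z] B_skew[of x z] B_skew[of y z] B_add[of z x y] by simp

lemma B_scale_left: "B (c *s x) z = c * B x z"
  using B_skew[of "c *s x" z] B_skew[of x z] B_scale[of z c x] by simp

lemma B_sum_left: "B (sum f A) x = (\<Sum>a\<in>A. B (f a) x)"
  by (induction A rule: infinite_finite_induct) (auto simp: B_add_left)

lemma B_diff: "B x (y - z) = B x y - B x z"
  using B_add[of x "y - z" z] by simp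

lemma subspace_V: "subspace V"
  using V_span subspace_span by simp

lemma subspace_radical: "subspace radical"
  unfolding radical_def using subspace_V
  by (auto simp: subspace_def B_add_left B_scale_left)

text \<open>With \<open>c j = B z (x j)\<close> for a Darboux family \<open>x\<close>, the
  combination with these partner coefficients pairs with every \<open>x j\<close> as
  \<open>z\<close> does. This is the projection \<open>pr\<close> in
  \<open>maximal_darboux\<close>.\<close>

lemma std_skew_partner_sum:
  assumes "j < 2*k"
  shows "(\<Sum>i<2*k. (if even i then c (i + 1) else - c (i - 1)) * std_skew i j) = c j"
proof -
  define p where "p = (if even j then j + 1 else j - 1)"
  have p: "p < 2*k" using assms by (auto simp: p_def elim!: evenE) 
  have "std_skew i j = 0" if "i \<noteq> p" for i
  proof -
    have "\<not> (i div 2 = j div 2 \<and> i \<noteq> j)" using that by (auto simp: p_def) presburger+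
    then show ?thesis by (auto simp: std_skew_def)
  qed
  then have "(\<Sum>i<2*k. (if even i then c (i + 1) else - c (i - 1)) * std_skew i j) =
    (\<Sum>i\<in>{p}. (if even i then c (i + 1) else - c (i - 1)) * std_skew i j)"
    using p by (intro sum.mono_neutral_right) auto
  also have "\<dots> = c j" by (auto simp: p_def std_skew_def elim!: oddE)
  finally show ?thesis .
qed

lemma darboux_independent:
  assumes "darboux k x"
  shows "inj_on x {..<2*k}" "independent (x ` {..<2*k})"
proof -
  have eq: "B (x i) (x j) = std_skew i j" if "i < 2*k" "j < 2*k" for i j
    using assms that by (auto simp: darboux_def)
  have zero: "u i = 0" if "(\<Sum>i<2*k. u i *s x i) = 0" "i < 2*k" for u i
  proof -
    define p where "p = (if even i then i + 1 else i - 1)"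
    have p: "p < 2*k" using that(2) by (auto simp: p_def elim!: evenE)
    have z: "std_skew p l = 0" if "l \<noteq> i" for l
    proof -
      have "\<not> (p div 2 = l div 2 \<and> p \<noteq> l)" using that by (auto simp: p_def) presburger+
      then show ?thesis by (auto simp: std_skew_def)
    qed
    have "0 = B (x p) (\<Sum>l<2*k. u l *s x l)" using that(1) by simp
    also have "\<dots> = (\<Sum>l<2*k. u l * std_skew p l)" using p by (simp add: B_sum B_scale eq)
    also have "\<dots> = (\<Sum>l\<in>{i}. u l * std_skew p l)"
      using z that(2) by (intro sum.mono_neutral_right) auto
    finally show "u i = 0" by (auto simp: p_def std_skew_def elim!: oddE split: if_splits)
  qed
  show inj: "inj_on x {..<2*k}"
  proof (rule inj_onI, rule ccontr)
    fix i j assume ij: "i \<in> {..<2*k}" "j \<in> {..<2*k}" "x i = x j" "i \<noteq> j"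
    let ?u = "\<lambda>l. if l = i then 1 else if l = j then -1 else (0::complex)"
    have "(\<Sum>l<2*k. ?u l *s x l) = (\<Sum>l\<in>{i,j}. ?u l *s x l)"
      using ij by (intro sum.mono_neutral_right) auto
    also have "\<dots> = 0" using ij by simp
    finally show False using zero[of ?u i] ij by simp
  qed
  show "independent (x ` {..<2*k})"
  proof
    assume "dependent (x ` {..<2*k})"
    then obtain u where u: "\<exists>v\<in>x ` {..<2*k}. u v \<noteq> 0" "(\<Sum>v\<in>x ` {..<2*k}. u v *s v) = 0"
      by (auto simp: dependent_finite)
    have "(\<Sum>i<2*k. u (x i) *s x i) = 0" using u(2) by (simp add: sum.reindex[OF inj])
    then show False using zero[of "\<lambda>i. u (x i)"] u(1) by auto
  qed
qed

text \<open>Symplectic Gram-Schmidt by maximality: the orthogonal complement W of a longest Darboux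
  family carries the zero form and is therefore the radical; a basis of the radical and the family
  together form a basis of V.\<close>

lemma maximal_darboux:
  obtains k x where "darboux k x" "dim V = 2*k + dim radical"
    "\<And>z. z \<in> V \<Longrightarrow> \<exists>c. z - (\<Sum>i<2*k. c i *s x i) \<in> radical"
proof -
  have bound: "k \<le> length E" if "darboux k x" for k x
  proof -
    have "x ` {..<2*k} \<subseteq> span (set E)" using that unfolding V_span[symmetric] by (auto simp: darboux_def)
    then have "card (x ` {..<2*k}) \<le> card (set E)"
      using independent_span_bound[OF _ darboux_independent(2)[OF that]] by auto
    then show ?thesis using card_length[of E] darboux_independent(1)[OF that] by (simp add: card_image)
  qed
  have "\<exists>x. darboux 0 x" by (simp add: darboux_def)
  moreover have "\<forall>k. (\<exists>x. darboux k x) \<longrightarrow> k \<le> length E" using bound by metis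
  ultimately obtain k where k: "\<exists>x. darboux k x" "\<And>l. \<exists>x. darboux l x \<Longrightarrow> l \<le> k"
    using GreatestI_nat[of "\<lambda>k. \<exists>x. darboux k x" 0 "length E"]
      Greatest_le_nat[of "\<lambda>k. \<exists>x. darboux k x" _ "length E"] by metis
  then obtain x where x: "darboux k x" by blast
  have xV: "x i \<in> V" if "i < 2*k" for i using x that by (auto simp: darboux_def)
  have xx: "B (x i) (x j) = std_skew i j" if "i < 2*k" "j < 2*k" for i j
    using x that by (auto simp: darboux_def)
  define W where "W = {z \<in> V. \<forall>i<2*k. B z (x i) = 0}"
  define pr where "pr z = (\<Sum>i<2*k. (if even i then B z (x (i + 1)) else - B z (x (i - 1))) *s x i)" for z
  have prV: "pr z \<in> V" for z unfolding pr_def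
    using xV subspace_V by (intro subspace_sum subspace_scale) auto
  have prW: "z - pr z \<in> W" if "z \<in> V" for z
  proof -
    have "B (z - pr z) (x j) = 0" if j: "j < 2*k" for j
    proof -
      have "B (pr z) (x j) = (\<Sum>i<2*k. (if even i then B z (x (i + 1)) else - B z (x (i - 1))) * std_skew i j)"
        unfolding pr_def B_sum_left using j by (intro sum.cong) (auto simp: B_scale_left xx)
      also have "\<dots> = B z (x j)" by (rule std_skew_partner_sum[OF j])
      finally show ?thesis using B_add_left[of "z - pr z" "pr z" "x j"] by simp
    qed
    then show ?thesis using that prV subspace_V by (simp add: W_def subspace_diff)
  qed
  \<comment> \<open>Two vectors of W with nonzero pairing, one of them rescaled, would be a further
    pair and contradict maximality.\<close>
  have WW: "B z y = 0" if z: "z \<in> W" and y: "y \<in> W" for z y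
  proof (rule ccontr)
    assume nz: "B z y \<noteq> 0"
    define y' where "y' = inverse (B z y) *s y"
    have y'1: "B z y' = 1" using nz by (simp add: y'_def B_scale)
    have y': "y' \<in> V" "B z y' = 1" "B y' z = -1" "\<And>i. i < 2*k \<Longrightarrow> B y' (x i) = 0"
      using y subspace_V B_skew[of y' z] y'1
      by (simp_all add: y'_def W_def B_scale_left subspace_scale)
    define x' where "x' i = (if i < 2*k then x i else if i = 2*k then z else y')" for i
    have "B (x' i) (x' j) = std_skew i j" if "i < 2 * Suc k" "j < 2 * Suc k" for i j
    proof -
      have "i < 2*k \<or> i = 2*k \<or> i = Suc (2*k)" "j < 2*k \<or> j = 2*k \<or> j = Suc (2*k)" using that by auto
      moreover have "std_skew a b = 0" if "a < 2*k" "b = 2*k \<or> b = Suc (2*k)" for a b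
        using that by (auto simp: std_skew_def)
      moreover have "std_skew b a = 0" if "a < 2*k" "b = 2*k \<or> b = Suc (2*k)" for a b
        using that by (auto simp: std_skew_def)
      moreover have "B (x a) z = 0" "B (x a) y' = 0" "B z (x a) = 0" if "a < 2*k" for a
        using that z y' B_skew[of "x a" z] B_skew[of "x a" y'] by (auto simp: W_def)
      ultimately show ?thesis using y' B_self
        by (elim disjE) (simp_all add: x'_def xx std_skew_def[of "2*k" "2*k"] std_skew_def[of "Suc (2*k)" "Suc (2*k)"])
    qed
    moreover have "x' i \<in> V" if "i < 2 * Suc k" for i using xV y' z by (auto simp: x'_def W_def)
    ultimately have "darboux (Suc k) x'" by (auto simp: darboux_def)
    then show False using k(2)[of "Suc k"] by auto
  qed
  have Wrad: "W = radical"
  proof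
    show "radical \<subseteq> W" using xV by (auto simp: radical_def W_def)
    show "W \<subseteq> radical"
    proof
      fix z assume z: "z \<in> W"
      have "B z y = 0" if "y \<in> V" for y
      proof -
        have "B z (pr y) = 0" using z unfolding pr_def B_sum
          by (intro sum.neutral) (auto simp: B_scale W_def)
        then show ?thesis using WW[OF z prW[OF that]] by (simp add: B_diff)
      qed
      then show "z \<in> radical" using z by (auto simp: radical_def W_def)
    qed
  qed
  let ?S = "x ` {..<2*k}"
  obtain C where C: "C \<subseteq> radical" "independent C" "radical \<subseteq> span C" "card C = dim radical"
    using basis_exists by blast
  have CV: "C \<subseteq> V" using C(1) by (auto simp: radical_def)
  have finC: "finite C" using independent_span_bound[OF _ C(2), of "set E"] CV V_span by auto
  have indS: "inj_on x {..<2*k}" "independent ?S" using darboux_independent[OF x] by auto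
  have zero: "u (x i) = 0" if s: "(\<Sum>v\<in>C. u v *s v) + (\<Sum>v\<in>?S. w v *s v) = 0" and i: "i < 2*k" and uw: "u = w" for u w i
  proof -
    have "(\<Sum>v\<in>?S. w v *s v) = - (\<Sum>v\<in>C. u v *s v)" using s by (simp add: eq_neg_iff_add_eq_0 add.commute)
    also have "\<dots> \<in> radical" using C(1) subspace_radical
      by (intro subspace_neg subspace_sum subspace_scale) auto
    finally have r: "(\<Sum>i<2*k. w (x i) *s x i) \<in> radical" by (simp add: sum.reindex[OF indS(1)])
    define p where "p = (if even i then i + 1 else i - 1)"
    have p: "p < 2*k" using i by (auto simp: p_def elim!: evenE)
    have z: "std_skew l p = 0" if "l \<noteq> i" for l
    proof -
      have "\<not> (l div 2 = p div 2 \<and> l \<noteq> p)" using that by (auto simp: p_def) presburger+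
      then show ?thesis by (auto simp: std_skew_def)
    qed
    have "0 = B (\<Sum>l<2*k. w (x l) *s x l) (x p)" using r xV[OF p] by (simp add: radical_def)
    also have "\<dots> = (\<Sum>l<2*k. w (x l) * std_skew l p)" using p by (simp add: B_sum_left B_scale_left xx)
    also have "\<dots> = (\<Sum>l\<in>{i}. w (x l) * std_skew l p)"
      using z i by (intro sum.mono_neutral_right) auto
    finally show ?thesis using uw by (auto simp: p_def std_skew_def elim!: oddE split: if_splits)
  qed
  have disj: "C \<inter> ?S = {}"
  proof -
    have False if "i < 2*k" "x i \<in> radical" for i
    proof -
      define p where "p = (if even i then i + 1 else i - 1)"
      have p: "p < 2*k" using that(1) by (auto simp: p_def elim!: evenE)
      have "std_skew i p = 0" using that xx[OF that(1) p] xV[OF p] by (simp add: radical_def)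
      then show False by (auto simp: p_def std_skew_def elim!: oddE split: if_splits)
    qed
    then show ?thesis using C(1) by auto
  qed
  have ind: "independent (C \<union> ?S)"
  proof
    assume "dependent (C \<union> ?S)"
    then obtain u where u: "\<exists>v\<in>C \<union> ?S. u v \<noteq> 0" "(\<Sum>v\<in>C \<union> ?S. u v *s v) = 0"
      using finC by (auto simp: dependent_finite)
    have s: "(\<Sum>v\<in>C. u v *s v) + (\<Sum>v\<in>?S. u v *s v) = 0"
      using u(2) finC disj by (simp add: sum.union_disjoint)
    have uS: "u (x i) = 0" if "i < 2*k" for i using zero[OF s that] by simp
    then have "(\<Sum>v\<in>?S. u v *s v) = 0" by (intro sum.neutral) auto
    then have "(\<Sum>v\<in>C. u v *s v) = 0" using s by simp
    then have "\<forall>v\<in>C. u v = 0" using C(2) finC by (auto simp: dependent_finite)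
    then show False using u(1) uS by auto
  qed
  have span: "span (C \<union> ?S) = V"
  proof
    show "span (C \<union> ?S) \<subseteq> V" using CV xV subspace_V by (intro span_minimal) auto
    show "V \<subseteq> span (C \<union> ?S)"
    proof
      fix z assume "z \<in> V"
      then have "z - pr z \<in> span C" using prW Wrad C(3) by auto
      then have "z - pr z \<in> span (C \<union> ?S)" by (meson span_mono subsetD sup_ge1)
      moreover have "pr z \<in> span (C \<union> ?S)" unfolding pr_def
        by (intro span_sum span_scale span_base) auto
      ultimately show "z \<in> span (C \<union> ?S)" using span_add by fastforce
    qed
  qed
  have "dim V = card (C \<union> ?S)" using dim_span[of "C \<union> ?S"] dim_eq_card_independent[OF ind] span by simp
  also have "\<dots> = dim radical + 2*k"
    using finC disj C(4) indS(1) by (simp add: card_Un_disjoint card_image)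
  finally have dim: "dim V = 2*k + dim radical" by simp
  show ?thesis
  proof (rule that[OF x dim])
    fix z assume "z \<in> V"
    then show "\<exists>c. z - (\<Sum>i<2*k. c i *s x i) \<in> radical" using prW[of z] Wrad
      by (intro exI[of _ "\<lambda>i. if even i then B z (x (i + 1)) else - B z (x (i - 1))"]) (simp add: pr_def)
  qed
qed

lemma span_list_coordinates:
  assumes "z \<in> V"
  shows "\<exists>c. z = (\<Sum>s<length E. c s *s E ! s)"
proof -
  have "z \<in> span (set E)" using assms V_span by simp
  then show ?thesis
  proof (induction rule: span_induct_alt)
    case base
    show ?case by (rule exI[of _ "\<lambda>_. 0"]) simp
  next
    case (step c x y)
    then obtain d s0 where d: "y = (\<Sum>s<length E. d s *s E ! s)" and s0: "s0 < length E" "x = E ! s0"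
      by (auto simp: in_set_conv_nth)
    have "c *s x + y = (\<Sum>s<length E. (if s = s0 then c *s x else 0) + d s *s E ! s)"
      using s0 by (simp add: sum.distrib d)
    also have "\<dots> = (\<Sum>s<length E. ((if s = s0 then c else 0) + d s) *s E ! s)"
      using s0 by (intro sum.cong) (auto simp: scale_left_distrib)
    finally show ?case by (intro exI[of _ "\<lambda>s. (if s = s0 then c else 0) + d s"])
  qed
qed

lemma even_corank: "\<exists>k. dim V = 2*k + dim radical"
  by (rule maximal_darboux) blast

text \<open>The standard skew matrix is the Gram matrix of a Darboux family written in terms of
  \<open>E\<close>, so \<open>pfaffian_expand\<close> yields a nonzero Pfaffian along some index
  map. A repeated index would make it vanish; hence the map is injective and its image is the
  required J.\<close>

lemma exists_principal_pf_nonzero: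
  obtains J where "J \<subseteq> {..<length E}" "card J = dim V - dim radical" "principal_pf J \<noteq> 0"
proof -
  obtain k x where x: "darboux k x" "dim V = 2*k + dim radical" by (rule maximal_darboux) blast
  have "\<forall>i\<in>{..<2*k}. \<exists>c. x i = (\<Sum>s<length E. c s *s E ! s)"
    using x(1) span_list_coordinates by (auto simp: darboux_def)
  then obtain T where T: "\<And>i. i < 2*k \<Longrightarrow> x i = (\<Sum>s<length E. T i s *s E ! s)"
    using bchoice[of "{..<2*k}" "\<lambda>i c. x i = (\<Sum>s<length E. c s *s E ! s)"] by auto
  have "std_skew a b = (\<Sum>s<length E. \<Sum>u<length E. T a s * B (E ! s) (E ! u) * T b u)"
    if "a < 2*k" "b < 2*k" for a b
  proof -
    have "std_skew a b = B (x a) (x b)" using x(1) that by (auto simp: darboux_def)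
    also have "\<dots> = (\<Sum>s<length E. \<Sum>u<length E. T a s * B (E ! s) (E ! u) * T b u)"
      unfolding T[OF that(1)] T[OF that(2)] B_sum_left
      by (simp add: B_sum B_scale B_scale_left sum_distrib_left mult_ac)
    finally show ?thesis .
  qed
  then obtain f where f: "f ` {..<2*k} \<subseteq> {..<length E}"
    "pfaffian k (\<lambda>a b. B (E ! f a) (E ! f b)) \<noteq> 0"
    using pfaffian_expand[where k = k and B = std_skew and T = T and L = "length E"
        and M = "\<lambda>s u. B (E ! s) (E ! u)"] pfaffian_std_skew by blast
  have inj: "inj_on f {..<2*k}"
    using f(2) pfaffian_repeated_index[of _ k _ f "\<lambda>i j. B (E ! i) (E ! j)"] by (auto simp: inj_on_def)
  have "pfaffian k (\<lambda>a b. B (E ! (sorted_list_of_set (f ` {..<2*k}) ! a)) (E ! (sorted_list_of_set (f ` {..<2*k}) ! b))) \<noteq> 0"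
    using pfaffian_injective_reindex[OF inj refl, of "\<lambda>i j. B (E ! i) (E ! j)"] f(2) by auto
  moreover have "card (f ` {..<2*k}) = 2*k" using inj by (simp add: card_image)
  ultimately show ?thesis using that[of "f ` {..<2*k}"] f(1) x(2) by (simp add: principal_pf_def Let_def)
qed

text \<open>The same expansion in the other direction: modulo the radical the vectors
  \<open>E ! j\<close> are combinations of 2k Darboux vectors, and a surviving term injects the
  indices of J into 2k places. Parity of \<open>card J\<close> matters because
  \<open>principal_pf\<close> halves it.\<close>

lemma principal_pf_nonzero_bound:
  assumes J: "J \<subseteq> {..<length E}" "even (card J)" and nz: "principal_pf J \<noteq> 0"
  shows "card J + dim radical \<le> dim V"
proof -
  obtain k x where x: "darboux k x" "dim V = 2*k + dim radical"
    "\<And>z. z \<in> V \<Longrightarrow> \<exists>c. z - (\<Sum>i<2*k. c i *s x i) \<in> radical" by (rule maximal_darboux) blast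
  define js where "js = sorted_list_of_set J"
  have finJ: "finite J" using J(1) finite_subset by blast
  obtain l where l: "card J = 2*l" using J(2) by (elim evenE)
  have js: "js ! a \<in> J" if "a < 2*l" for a
    using that finJ l by (metis js_def length_sorted_list_of_set nth_mem set_sorted_list_of_set)
  define e where "e a = E ! (js ! a)" for a
  have eV: "e a \<in> V" if "a < 2*l" for a
    using js[OF that] J(1) V_span span_base by (auto simp: e_def)
  have "\<forall>a\<in>{..<2*l}. \<exists>c. e a - (\<Sum>i<2*k. c i *s x i) \<in> radical" using eV x(3) by auto
  then obtain T where T: "\<And>a. a < 2*l \<Longrightarrow> e a - (\<Sum>i<2*k. T a i *s x i) \<in> radical"
    using bchoice[of "{..<2*l}" "\<lambda>a c. e a - (\<Sum>i<2*k. c i *s x i) \<in> radical"] by auto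
  have xV: "x i \<in> V" if "i < 2*k" for i using x(1) that by (auto simp: darboux_def)
  have "B (e a) (e b) = (\<Sum>s<2*k. \<Sum>u<2*k. T a s * std_skew s u * T b u)" if a: "a < 2*l" and b: "b < 2*l" for a b
  proof -
    let ?y = "\<lambda>a. (\<Sum>i<2*k. T a i *s x i)"
    have yV: "?y a \<in> V" for a using xV subspace_V by (intro subspace_sum subspace_scale) auto
    have "B (e a) (e b) = B (?y a) (e b)"
      using T[OF a] eV[OF b] B_add_left[of "e a - ?y a" "?y a" "e b"] by (simp add: radical_def)
    also have "\<dots> = - B (e b) (?y a)" by (rule B_skew)
    also have "B (e b) (?y a) = B (?y b) (?y a)"
      using T[OF b] yV B_add_left[of "e b - ?y b" "?y b" "?y a"] by (simp add: radical_def)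
    also have "- B (?y b) (?y a) = B (?y a) (?y b)" using B_skew[of "?y a" "?y b"] by simp
    also have "\<dots> = (\<Sum>s<2*k. \<Sum>u<2*k. T a s * std_skew s u * T b u)"
      unfolding B_sum_left using x(1)
      by (intro sum.cong refl) (simp add: B_sum B_scale B_scale_left darboux_def sum_distrib_left mult_ac)
    finally show ?thesis .
  qed
  then obtain f where f: "f ` {..<2*l} \<subseteq> {..<2*k}" "pfaffian l (\<lambda>a b. std_skew (f a) (f b)) \<noteq> 0"
    using pfaffian_expand[where k = l and B = "\<lambda>a b. B (e a) (e b)" and T = T and L = "2*k" and M = std_skew] nz l
    by (auto simp: principal_pf_def Let_def e_def js_def)
  have "inj_on f {..<2*l}"
    using f(2) pfaffian_repeated_index[of _ l _ f std_skew] by (auto simp: inj_on_def)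
  then have "2*l \<le> 2*k" using f(1) card_inj_on_le[of f "{..<2*l}" "{..<2*k}"] by simp
  then show ?thesis using l x(2) by simp
qed

end

text \<open>Side conditions are equations between dimensions instead of carrier memberships, a form
  that the simplifier can discharge while rearranging long products.\<close>

lemma mat_mult_dims:
  fixes A B C :: "complex mat"
  shows mat_assoc: "dim_col A = dim_row B \<Longrightarrow> dim_col B = dim_row C \<Longrightarrow> A * B * C = A * (B * C)"
    and mat_add_right: "dim_col A = dim_row B \<Longrightarrow> dim_row B = dim_row C \<Longrightarrow> dim_col B = dim_col C \<Longrightarrow>
      A * (B + C) = A * B + A * C"
    and mat_minus_right: "dim_col A = dim_row B \<Longrightarrow> dim_row B = dim_row C \<Longrightarrow> dim_col B = dim_col C \<Longrightarrow>
      A * (B - C) = A * B - A * C"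
    and mat_add_left: "dim_col A = dim_row C \<Longrightarrow> dim_row A = dim_row B \<Longrightarrow> dim_col A = dim_col B \<Longrightarrow>
      (A + B) * C = A * C + B * C"
    and mat_minus_left: "dim_col A = dim_row C \<Longrightarrow> dim_row A = dim_row B \<Longrightarrow> dim_col A = dim_col B \<Longrightarrow>
      (A - B) * C = A * C - B * C"
    and mat_smult_right: "dim_col A = dim_row B \<Longrightarrow> A * (c \<cdot>\<^sub>m B) = c \<cdot>\<^sub>m (A * B)"
    and mat_smult_left: "dim_col A = dim_row B \<Longrightarrow> (c \<cdot>\<^sub>m A) * B = c \<cdot>\<^sub>m (A * B)"
    and mat_one_left: "dim_row A = k \<Longrightarrow> 1\<^sub>m k * A = A"
    and mat_one_right: "dim_col A = k \<Longrightarrow> A * 1\<^sub>m k = A"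
    and mat_zero_left: "dim_row A = k \<Longrightarrow> 0\<^sub>m l k * A = 0\<^sub>m l (dim_col A)"
    and mat_zero_right: "dim_col A = k \<Longrightarrow> A * 0\<^sub>m k l = 0\<^sub>m (dim_row A) l"
    and mat_transpose_add: "dim_row A = dim_row B \<Longrightarrow> dim_col A = dim_col B \<Longrightarrow>
      transpose_mat (A + B) = transpose_mat A + transpose_mat B"
    and mat_smult_add: "dim_row A = dim_row B \<Longrightarrow> dim_col A = dim_col B \<Longrightarrow>
      c \<cdot>\<^sub>m (A + B) = c \<cdot>\<^sub>m A + c \<cdot>\<^sub>m B"
    and transpose_smult: "transpose_mat (c \<cdot>\<^sub>m A) = c \<cdot>\<^sub>m transpose_mat A"
proof -
  have c: "M \<in> carrier_mat (dim_row M) (dim_col M)" for M :: "complex mat" by simp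
  show "dim_col A = dim_row B \<Longrightarrow> dim_col B = dim_row C \<Longrightarrow> A * B * C = A * (B * C)"
    by (rule assoc_mult_mat[of _ "dim_row A" "dim_col A" _ "dim_col B" _ "dim_col C"]) auto
  show "dim_col A = dim_row B \<Longrightarrow> dim_row B = dim_row C \<Longrightarrow> dim_col B = dim_col C \<Longrightarrow> A * (B + C) = A * B + A * C"
    by (rule mult_add_distrib_mat[of _ "dim_row A" "dim_col A" _ "dim_col B"]) auto
  show "dim_col A = dim_row B \<Longrightarrow> dim_row B = dim_row C \<Longrightarrow> dim_col B = dim_col C \<Longrightarrow> A * (B - C) = A * B - A * C"
    by (rule mult_minus_distrib_mat[of _ "dim_row A" "dim_col A" _ "dim_col B"]) auto
  show "dim_col A = dim_row C \<Longrightarrow> dim_row A = dim_row B \<Longrightarrow> dim_col A = dim_col B \<Longrightarrow> (A + B) * C = A * C + B * C"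
    by (rule add_mult_distrib_mat[of _ "dim_row A" "dim_col A" _ _ "dim_col C"]) auto
  show "dim_col A = dim_row C \<Longrightarrow> dim_row A = dim_row B \<Longrightarrow> dim_col A = dim_col B \<Longrightarrow> (A - B) * C = A * C - B * C"
    by (rule minus_mult_distrib_mat[of _ "dim_row A" "dim_col A" _ _ "dim_col C"]) auto
  show "dim_col A = dim_row B \<Longrightarrow> A * (c \<cdot>\<^sub>m B) = c \<cdot>\<^sub>m (A * B)"
    by (rule mult_smult_distrib[of _ "dim_row A" "dim_col A" _ "dim_col B"]) auto
  show "dim_col A = dim_row B \<Longrightarrow> (c \<cdot>\<^sub>m A) * B = c \<cdot>\<^sub>m (A * B)"
    by (rule mult_smult_assoc_mat[of _ "dim_row A" "dim_col A" _ "dim_col B"]) auto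
  show "dim_row A = dim_row B \<Longrightarrow> dim_col A = dim_col B \<Longrightarrow> c \<cdot>\<^sub>m (A + B) = c \<cdot>\<^sub>m A + c \<cdot>\<^sub>m B"
    by (rule eq_matI) (auto simp: algebra_simps)
qed (rule eq_matI; auto)+

lemmas mat_algebra = mat_assoc mat_add_right mat_minus_right mat_add_left mat_minus_left
  mat_smult_right mat_smult_left mat_one_left mat_one_right mat_zero_left mat_zero_right

lemma mat_inverse_cancel:
  fixes X :: "complex mat"
  assumes "g * g' = 1\<^sub>m n" "dim_col g = dim_row g'" "dim_col g' = dim_row X" "dim_row X = n"
  shows "g * (g' * X) = X"
proof -
  have "g * (g' * X) = g * g' * X" using assms by (intro mat_assoc[symmetric]) auto
  then show ?thesis using assms by (simp add: mat_one_left)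
qed

subsection \<open>Matrix coordinates on \<open>q\<close> and \<open>q\<^sup>*\<close>\<close>

definition mtr :: "complex mat \<Rightarrow> complex" where
  "mtr A = (\<Sum>i<dim_row A. A $$ (i,i))"

definition lin_part :: "nat \<Rightarrow> (idx \<Rightarrow> complex) \<Rightarrow> complex mat" where
  "lin_part n x = mat n n (\<lambda>(i,j). x (Mat i j))"

text \<open>The \<open>Vec\<close> coordinates are read as m row vectors for elements of q and, in
  \<open>col_part\<close>, as m column vectors for points of the dual.\<close>

definition row_part :: "nat \<Rightarrow> nat \<Rightarrow> (idx \<Rightarrow> complex) \<Rightarrow> complex mat" where
  "row_part n m x = mat m n (\<lambda>(k,i). x (Vec k i))"

definition col_part :: "nat \<Rightarrow> nat \<Rightarrow> (idx \<Rightarrow> complex) \<Rightarrow> complex mat" where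
  "col_part n m x = mat n m (\<lambda>(i,k). x (Vec k i))"

definition point :: "nat \<Rightarrow> nat \<Rightarrow> complex mat \<Rightarrow> complex mat \<Rightarrow> idx \<Rightarrow> complex" where
  "point n m A v c = (if in_range n m c then (case c of Mat i j \<Rightarrow> A $$ (i,j) | Vec k i \<Rightarrow> v $$ (i,k)) else 0)"

lemma part_carrier [simp]:
  "lin_part n x \<in> carrier_mat n n" "row_part n m x \<in> carrier_mat m n" "col_part n m x \<in> carrier_mat n m"
  "dim_row (lin_part n x) = n" "dim_col (lin_part n x) = n"
  "dim_row (row_part n m x) = m" "dim_col (row_part n m x) = n"
  "dim_row (col_part n m x) = n" "dim_col (col_part n m x) = m"
  by (auto simp: lin_part_def row_part_def col_part_def)

lemma point_simps [simp]:
  "i < n \<Longrightarrow> j < n \<Longrightarrow> point n m A v (Mat i j) = A $$ (i,j)"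
  "k < m \<Longrightarrow> i < n \<Longrightarrow> point n m A v (Vec k i) = v $$ (i,k)"
  by (auto simp: point_def in_range_def)

lemma parts_point [simp]:
  "dim_row A = n \<Longrightarrow> dim_col A = n \<Longrightarrow> lin_part n (point n m A v) = A"
  "dim_row v = n \<Longrightarrow> dim_col v = m \<Longrightarrow> col_part n m (point n m A v) = v"
  "dim_row v = n \<Longrightarrow> dim_col v = m \<Longrightarrow> row_part n m (point n m A v) = transpose_mat v"
  by (auto simp: lin_part_def row_part_def col_part_def)

lemma point_parts: "x \<in> qspace n m \<Longrightarrow> point n m (lin_part n x) (col_part n m x) = x"
  by (rule ext) (auto simp: qspace_def point_def lin_part_def col_part_def in_range_def split: idx.splits)

lemma point_in_qspace:
  "A \<in> carrier_mat n n \<Longrightarrow> mtr A = 0 \<Longrightarrow> point n m A v \<in> qspace n m"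
  by (auto simp: qspace_def mtr_def point_def in_range_def)

lemma mtr_lin_part: "x \<in> qspace n m \<Longrightarrow> mtr (lin_part n x) = 0"
  by (auto simp: qspace_def mtr_def lin_part_def)

lemma qdual_cases:
  assumes "\<gamma> \<in> qspace n m"
  obtains A v where "A \<in> carrier_mat n n" "v \<in> carrier_mat n m" "mtr A = 0" "\<gamma> = point n m A v"
  using point_parts[OF assms] mtr_lin_part[OF assms] that[of "lin_part n \<gamma>" "col_part n m \<gamma>"] by simp

lemma mtr_linear:
  "dim_row A = dim_row B \<Longrightarrow> dim_col A = dim_row A \<Longrightarrow> dim_col B = dim_row B \<Longrightarrow> mtr (A + B) = mtr A + mtr B"
  "dim_row A = dim_row B \<Longrightarrow> dim_col A = dim_row A \<Longrightarrow> dim_col B = dim_row B \<Longrightarrow> mtr (A - B) = mtr A - mtr B"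
  "dim_col A = dim_row A \<Longrightarrow> mtr (c \<cdot>\<^sub>m A) = c * mtr A"
  by (auto simp: mtr_def sum.distrib sum_subtractf sum_distrib_left)

lemma mtr_one: "mtr (1\<^sub>m n) = of_nat n"
  by (auto simp: mtr_def)

lemma mtr_mult: "A \<in> carrier_mat n m \<Longrightarrow> B \<in> carrier_mat m n \<Longrightarrow>
    mtr (A * B) = (\<Sum>i<n. \<Sum>j<m. A $$ (i,j) * B $$ (j,i))"
  by (auto simp: mtr_def scalar_prod_def lessThan_atLeast0)

lemma mtr_comm:
  assumes "A \<in> carrier_mat n m" "B \<in> carrier_mat m n"
  shows "mtr (A * B) = mtr (B * A)"
  unfolding mtr_mult[OF assms] mtr_mult[OF assms(2,1)]
  by (subst sum.swap) (simp add: mult.commute)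

lemma qpair_parts:
  "qpair n m \<gamma> z = mtr (lin_part n \<gamma> * lin_part n z) + mtr (row_part n m z * col_part n m \<gamma>)"
  by (simp add: qpair_def mtr_mult[of _ n n] mtr_mult[of _ m n])
    (simp add: lin_part_def row_part_def col_part_def)

lemma qbracket_parts:
  "lin_part n (qbracket n m x y) = lin_part n x * lin_part n y - lin_part n y * lin_part n x"
  "row_part n m (qbracket n m x y) = row_part n m x * lin_part n y - row_part n m y * lin_part n x"
  by (auto simp: qbracket_def lin_part_def row_part_def in_range_def scalar_prod_def sum_subtractf lessThan_atLeast0)

text \<open>The matrix component of the functional that sends y to the value of \<gamma> on [x, y]:
  the commutator [A, X] plus v \<xi>. Traceless y see it only up to scalars.\<close>

definition moment :: "nat \<Rightarrow> nat \<Rightarrow> (idx \<Rightarrow> complex) \<Rightarrow> (idx \<Rightarrow> complex) \<Rightarrow> complex mat" where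
  "moment n m \<gamma> x = lin_part n \<gamma> * lin_part n x - lin_part n x * lin_part n \<gamma> + col_part n m \<gamma> * row_part n m x"

lemma moment_carrier [simp]:
  "moment n m \<gamma> x \<in> carrier_mat n n" "dim_row (moment n m \<gamma> x) = n" "dim_col (moment n m \<gamma> x) = n"
  by (auto simp: moment_def)

lemma qpair_qbracket:
  "qpair n m \<gamma> (qbracket n m x y) =
     mtr (moment n m \<gamma> x * lin_part n y) - mtr (row_part n m y * (lin_part n x * col_part n m \<gamma>))"
proof -
  let ?A = "lin_part n \<gamma>" and ?v = "col_part n m \<gamma>" and ?X = "lin_part n x" and ?Y = "lin_part n y"
    and ?a = "row_part n m x" and ?b = "row_part n m y"
  have c: "?A \<in> carrier_mat n n" "?X \<in> carrier_mat n n" "?Y \<in> carrier_mat n n"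
    "?v \<in> carrier_mat n m" "?a \<in> carrier_mat m n" "?b \<in> carrier_mat m n" by simp_all
  have 1: "mtr (?A * (?X * ?Y - ?Y * ?X)) = mtr (?A * ?X * ?Y) - mtr (?X * ?A * ?Y)"
  proof -
    have "?A * (?X * ?Y - ?Y * ?X) = ?A * ?X * ?Y - ?A * ?Y * ?X"
      using c by (simp add: mat_algebra)
    moreover have "mtr (?A * ?Y * ?X) = mtr (?X * (?A * ?Y))" using c by (intro mtr_comm[of _ n n]) auto
    ultimately show ?thesis using c by (simp add: mtr_linear mat_algebra)
  qed
  have 2: "mtr ((?a * ?Y - ?b * ?X) * ?v) = mtr (?v * ?a * ?Y) - mtr (?b * (?X * ?v))"
  proof -
    have "(?a * ?Y - ?b * ?X) * ?v = ?a * ?Y * ?v - ?b * (?X * ?v)"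
      using c by (simp add: mat_algebra)
    moreover have "mtr (?a * ?Y * ?v) = mtr (?v * (?a * ?Y))" using c by (intro mtr_comm[of _ m n]) auto
    ultimately show ?thesis using c by (simp add: mtr_linear mat_algebra)
  qed
  have "moment n m \<gamma> x * ?Y = ?A * ?X * ?Y - ?X * ?A * ?Y + ?v * ?a * ?Y"
    using c unfolding moment_def by (simp add: mat_algebra)
  then have 3: "mtr (moment n m \<gamma> x * ?Y) = mtr (?A * ?X * ?Y) - mtr (?X * ?A * ?Y) + mtr (?v * ?a * ?Y)"
    using c by (simp add: mtr_linear mat_algebra)
  show ?thesis unfolding qpair_parts qbracket_parts 1 2 3 by simp
qed

lemma parts_add:
  "lin_part n (x + y) = lin_part n x + lin_part n y"
  "row_part n m (x + y) = row_part n m x + row_part n m y"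
  "col_part n m (x + y) = col_part n m x + col_part n m y"
  by (auto simp: lin_part_def row_part_def col_part_def)

lemma parts_cscale:
  "lin_part n (cscale c x) = c \<cdot>\<^sub>m lin_part n x"
  "row_part n m (cscale c x) = c \<cdot>\<^sub>m row_part n m x"
  "col_part n m (cscale c x) = c \<cdot>\<^sub>m col_part n m x"
  by (auto simp: lin_part_def row_part_def col_part_def cscale_def)

lemma qpair_qbracket_bilinear:
  "qpair n m \<gamma> (qbracket n m x (y + z)) = qpair n m \<gamma> (qbracket n m x y) + qpair n m \<gamma> (qbracket n m x z)"
  "qpair n m \<gamma> (qbracket n m x (cscale c y)) = c * qpair n m \<gamma> (qbracket n m x y)"
  "qpair n m \<gamma> (qbracket n m x y) = - qpair n m \<gamma> (qbracket n m y x)"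
proof -
  show "qpair n m \<gamma> (qbracket n m x (y + z)) = qpair n m \<gamma> (qbracket n m x y) + qpair n m \<gamma> (qbracket n m x z)"
    unfolding qpair_qbracket parts_add
    by (simp add: mat_algebra mtr_linear mtr_linear)
  show "qpair n m \<gamma> (qbracket n m x (cscale c y)) = c * qpair n m \<gamma> (qbracket n m x y)"
    unfolding qpair_qbracket parts_cscale
    by (simp add: mat_algebra mtr_linear mtr_linear algebra_simps)
  have "qbracket n m x y c = - qbracket n m y x c" for c
    by (auto simp: qbracket_def sum_negf[symmetric] split: idx.splits intro!: sum.cong)
  then show "qpair n m \<gamma> (qbracket n m x y) = - qpair n m \<gamma> (qbracket n m y x)"
    by (simp add: qpair_def sum_negf)
qed

lemma unitv_in_qspace:
  "i < n \<Longrightarrow> j < n \<Longrightarrow> i \<noteq> j \<Longrightarrow> unitv (Mat i j) \<in> qspace n m"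
  "k < m \<Longrightarrow> i < n \<Longrightarrow> unitv (Vec k i) \<in> qspace n m"
  by (auto simp: qspace_def unitv_def in_range_def intro!: sum.neutral)

lemma diag_difference_in_qspace:
  assumes "i < n" "j < n" "i \<noteq> j"
  shows "(\<lambda>d. if d = Mat i i then 1 else if d = Mat j j then -1 else 0) \<in> qspace n m"
proof -
  have "(\<Sum>l<n. if Mat l l = Mat i i then 1 else if Mat l l = Mat j j then -1 else 0) =
    (\<Sum>l\<in>{i,j}. if Mat l l = Mat i i then 1 else if Mat l l = Mat j j then -1 else (0::complex))"
    using assms by (intro sum.mono_neutral_right) auto
  also have "\<dots> = 0" using assms by simp
  finally show ?thesis using assms by (auto simp: qspace_def in_range_def)
qed

text \<open>Testing against the unit vectors \<open>Vec k i\<close> gives X v = 0. Testing against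
  off-diagonal units and differences of diagonal units shows that the moment is scalar; the scalar
  is free since y ranges over traceless matrices.\<close>

lemma qstab_iff:
  "x \<in> qstab n m \<gamma> \<longleftrightarrow> x \<in> qspace n m \<and> lin_part n x * col_part n m \<gamma> = 0\<^sub>m n m \<and>
     (\<exists>c. moment n m \<gamma> x = c \<cdot>\<^sub>m 1\<^sub>m n)"
proof
  assume R: "x \<in> qspace n m \<and> lin_part n x * col_part n m \<gamma> = 0\<^sub>m n m \<and> (\<exists>c. moment n m \<gamma> x = c \<cdot>\<^sub>m 1\<^sub>m n)"
  then obtain c where c: "moment n m \<gamma> x = c \<cdot>\<^sub>m 1\<^sub>m n" by blast
  have "qpair n m \<gamma> (qbracket n m x y) = 0" if "y \<in> qspace n m" for y
  proof -
    have "mtr (c \<cdot>\<^sub>m 1\<^sub>m n * lin_part n y) = 0"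
      using mtr_lin_part[OF that] by (simp add: mat_algebra mtr_linear)
    moreover have "mtr (0\<^sub>m m m) = 0" by (simp add: mtr_def)
    ultimately show ?thesis using R c by (simp add: qpair_qbracket)
  qed
  then show "x \<in> qstab n m \<gamma>" using R by (auto simp: qstab_def)
next
  assume x: "x \<in> qstab n m \<gamma>"
  then have xq: "x \<in> qspace n m" and z: "\<And>y. y \<in> qspace n m \<Longrightarrow> qpair n m \<gamma> (qbracket n m x y) = 0"
    by (auto simp: qstab_def)
  let ?C = "moment n m \<gamma> x" and ?D = "lin_part n x * col_part n m \<gamma>"
  have val: "qpair n m \<gamma> (qbracket n m x y) = (\<Sum>i<n. \<Sum>j<n. ?C $$ (i,j) * y (Mat j i)) -
      (\<Sum>k<m. \<Sum>i<n. y (Vec k i) * ?D $$ (i,k))" for y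
  proof -
    have "mtr (?C * lin_part n y) = (\<Sum>i<n. \<Sum>j<n. ?C $$ (i,j) * y (Mat j i))"
      by (subst mtr_mult[of _ n n]) (auto simp: lin_part_def)
    moreover have "mtr (row_part n m y * ?D) = (\<Sum>k<m. \<Sum>i<n. y (Vec k i) * ?D $$ (i,k))"
      by (subst mtr_mult[of _ m n]) (auto simp: row_part_def simp del: index_mult_mat(1))
    ultimately show ?thesis by (simp add: qpair_qbracket)
  qed
  have D: "?D = 0\<^sub>m n m"
  proof (rule eq_matI)
    fix i k assume "i < dim_row (0\<^sub>m n m :: complex mat)" "k < dim_col (0\<^sub>m n m :: complex mat)"
    then have ik: "i < n" "k < m" by auto
    have "0 = qpair n m \<gamma> (qbracket n m x (unitv (Vec k i)))" using z unitv_in_qspace(2) ik by metis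
    also have "\<dots> = - (\<Sum>k'<m. \<Sum>i'<n. (if k' = k \<and> i' = i then 1 else 0) * ?D $$ (i',k'))"
      unfolding val by (simp add: unitv_def)
    also have "\<dots> = - (\<Sum>k'<m. if k' = k then ?D $$ (i,k) else 0)"
    proof -
      have eq: "(\<Sum>i'<n. (if k' = k \<and> i' = i then 1 else 0) * ?D $$ (i',k')) = (if k' = k then ?D $$ (i,k) else 0)" for k'
        using ik by (cases "k' = k") (simp_all add: if_distrib[of "\<lambda>u. u * _"] cong: if_cong)
      show ?thesis by (simp only: eq)
    qed
    also have "\<dots> = - ?D $$ (i,k)" using ik by simp
    finally show "?D $$ (i,k) = (0\<^sub>m n m) $$ (i,k)" using ik by simp
  qed auto
  have S: "(\<Sum>i<n. \<Sum>j<n. ?C $$ (i,j) * y (Mat j i)) = 0" if "y \<in> qspace n m" for y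
    using z[OF that] unfolding val D by simp
  have off: "?C $$ (j,i) = 0" if "i < n" "j < n" "i \<noteq> j" for i j
  proof -
    have "(\<Sum>b<n. ?C $$ (a,b) * unitv (Mat i j) (Mat b a)) = (if a = j then ?C $$ (j,i) else 0)" for a
      using that by (cases "a = j") (simp_all add: unitv_def if_distrib cong: if_cong)
    then show ?thesis using S[OF unitv_in_qspace(1)[OF that]] that by simp
  qed
  have diag: "?C $$ (i,i) = ?C $$ (j,j)" if "i < n" "j < n" "i \<noteq> j" for i j
  proof -
    let ?y = "\<lambda>d. if d = Mat i i then 1 else if d = Mat j j then -1 else (0::complex)"
    have "(\<Sum>b<n. ?C $$ (a,b) * ?y (Mat b a)) = ?C $$ (a,a) * ?y (Mat a a)" if "a < n" for a
    proof -
      have "(\<Sum>b<n. ?C $$ (a,b) * ?y (Mat b a)) = (\<Sum>b\<in>{a}. ?C $$ (a,b) * ?y (Mat b a))"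
        using that by (intro sum.mono_neutral_right) auto
      then show ?thesis by simp
    qed
    then have "0 = (\<Sum>a<n. ?C $$ (a,a) * ?y (Mat a a))"
      using S[OF diag_difference_in_qspace[OF that]] by simp
    also have "\<dots> = (\<Sum>a\<in>{i,j}. ?C $$ (a,a) * ?y (Mat a a))"
      using that by (intro sum.mono_neutral_right) auto
    finally show ?thesis using that by simp
  qed
  have "?C = ?C $$ (0,0) \<cdot>\<^sub>m 1\<^sub>m n"
  proof (rule eq_matI)
    fix i j assume "i < dim_row (?C $$ (0,0) \<cdot>\<^sub>m 1\<^sub>m n)" "j < dim_col (?C $$ (0,0) \<cdot>\<^sub>m 1\<^sub>m n)"
    then show "?C $$ (i,j) = (?C $$ (0,0) \<cdot>\<^sub>m 1\<^sub>m n) $$ (i,j)"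
      using off[of j i] diag[of i 0] by (cases "i = j"; cases "i = 0") auto
  qed (use moment_carrier[of n m \<gamma> x] in auto)
  then show "x \<in> qspace n m \<and> ?D = 0\<^sub>m n m \<and> (\<exists>c. ?C = c \<cdot>\<^sub>m 1\<^sub>m n)" using xq D by blast
qed

section \<open>The structure matrix as a skew form on q, and regular points\<close>

interpretation cs: vector_space cscale
  by unfold_locales (auto simp: cscale_def fun_eq_iff algebra_simps)

definition stab_dim :: "nat \<Rightarrow> nat \<Rightarrow> (idx \<Rightarrow> complex) \<Rightarrow> nat" where
  "stab_dim n m \<gamma> = cs.dim (qstab n m \<gamma>)"

lemma qspace_subspace: "cs.subspace (qspace n m)"
  by (auto simp: cs.subspace_def qspace_def cscale_def sum.distrib sum_distrib_left[symmetric])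

lemma qbasis_set:
  "set (qbasis n m) = {unitv (Mat i j) | i j. i < n \<and> j < n \<and> i \<noteq> j} \<union>
     {(\<lambda>d. if d = Mat i i then 1 else if d = Mat (Suc i) (Suc i) then -1 else 0) | i. i < n - 1} \<union>
     {unitv (Vec k i) | k i. k < m \<and> i < n}"
  unfolding qbasis_def set_append Un_assoc[symmetric]
proof (intro arg_cong2[where f = "(\<union>)"])
  show "set [unitv (Mat i j). i \<leftarrow> [0..<n], j \<leftarrow> [0..<n], i \<noteq> j] = {unitv (Mat i j) | i j. i < n \<and> j < n \<and> i \<noteq> j}"
  proof (intro equalityI subsetI)
    fix x assume "x \<in> {unitv (Mat i j) | i j. i < n \<and> j < n \<and> i \<noteq> j}"
    then obtain i j where "x = unitv (Mat i j)" "i < n" "j < n" "i \<noteq> j" by blast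
    then show "x \<in> set [unitv (Mat i j). i \<leftarrow> [0..<n], j \<leftarrow> [0..<n], i \<noteq> j]"
      by (simp add: image_iff) (rule bexI[of _ i], rule bexI[of _ j], simp_all)
  qed (auto, blast)
  show "set [unitv (Vec k i). k \<leftarrow> [0..<m], i \<leftarrow> [0..<n]] = {unitv (Vec k i) | k i. k < m \<and> i < n}"
    by (auto, blast)
qed auto

lemma qspace_span_qbasis: "qspace n m = cs.span (set (qbasis n m))"
proof
  have "unitv (Mat i j) \<in> qspace n m" if "i < n" "j < n" "i \<noteq> j" for i j using that unitv_in_qspace by blast
  moreover have "(\<lambda>d. if d = Mat i i then 1 else if d = Mat (Suc i) (Suc i) then -1 else 0) \<in> qspace n m"
    if "i < n - 1" for i using that by (intro diag_difference_in_qspace) auto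
  ultimately have "set (qbasis n m) \<subseteq> qspace n m" unfolding qbasis_set using unitv_in_qspace by blast
  then show "cs.span (set (qbasis n m)) \<subseteq> qspace n m" using qspace_subspace by (rule cs.span_minimal)
next
  let ?h = "\<lambda>i d. if d = Mat i i then 1 else if d = Mat (Suc i) (Suc i) then -1 else (0::complex)"
  let ?S = "cs.span (set (qbasis n m))"
  show "qspace n m \<subseteq> ?S"
  proof
    fix x assume x: "x \<in> qspace n m"
    define y1 where "y1 = (\<Sum>i<n. \<Sum>j<n. cscale (if i = j then 0 else x (Mat i j)) (unitv (Mat i j)))"
    \<comment> \<open>Summation by parts on the diagonal: the coefficients at the simple coroots are
      the partial sums of the diagonal entries, and tracelessness makes the last partial sum
      vanish.\<close>
    define y2 where "y2 = (\<Sum>i<n-1. cscale (\<Sum>l\<le>i. x (Mat l l)) (?h i))"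
    define y3 where "y3 = (\<Sum>k<m. \<Sum>i<n. cscale (x (Vec k i)) (unitv (Vec k i)))"
    have y1: "y1 \<in> ?S" unfolding y1_def
    proof (intro cs.span_sum)
      fix i j assume "i \<in> {..<n}" "j \<in> {..<n}"
      then have "unitv (Mat i j) \<in> ?S" if "i \<noteq> j" using that by (intro cs.span_base) (auto simp: qbasis_set)
      then show "cscale (if i = j then 0 else x (Mat i j)) (unitv (Mat i j)) \<in> ?S"
        using cs.span_zero cs.span_scale by (cases "i = j") auto
    qed
    have y2: "y2 \<in> ?S" unfolding y2_def
      by (intro cs.span_sum cs.span_scale cs.span_base) (auto simp: qbasis_set)
    have y3: "y3 \<in> ?S" unfolding y3_def
      by (intro cs.span_sum cs.span_scale cs.span_base) (auto simp: qbasis_set)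
    have app: "(\<Sum>a\<in>A. f a) d = (\<Sum>a\<in>A. f a d)" for A and f :: "nat \<Rightarrow> idx \<Rightarrow> complex" and d
      by (induction A rule: infinite_finite_induct) auto
    have mat: "y1 (Mat i j) = (if i < n \<and> j < n \<and> i \<noteq> j then x (Mat i j) else 0)" for i j
    proof -
      have "(\<Sum>j'<n. cscale (if i' = j' then 0 else x (Mat i' j')) (unitv (Mat i' j')) (Mat i j)) =
        (if i' = i then (if j < n \<and> i \<noteq> j then x (Mat i j) else 0) else 0)" for i'
      proof -
        have "(\<Sum>j'<n. cscale (if i' = j' then 0 else x (Mat i' j')) (unitv (Mat i' j')) (Mat i j)) =
          (\<Sum>j'<n. if j' = j then (if i' = i \<and> i \<noteq> j then x (Mat i j) else 0) else 0)"
          by (intro sum.cong refl) (auto simp: cscale_def unitv_def)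
        then show ?thesis by auto
      qed
      then show ?thesis by (auto simp: y1_def app)
    qed
    have vec: "y3 (Vec k i) = (if k < m \<and> i < n then x (Vec k i) else 0)" for k i
    proof -
      have "(\<Sum>i'<n. cscale (x (Vec k' i')) (unitv (Vec k' i')) (Vec k i)) =
        (if k' = k then (if i < n then x (Vec k i) else 0) else 0)" for k'
      proof -
        have "(\<Sum>i'<n. cscale (x (Vec k' i')) (unitv (Vec k' i')) (Vec k i)) =
          (\<Sum>i'<n. if i' = i then (if k' = k then x (Vec k i) else 0) else 0)"
          by (intro sum.cong refl) (auto simp: cscale_def unitv_def)
        then show ?thesis by auto
      qed
      then show ?thesis by (auto simp: y3_def app)
    qed
    have y2v: "y2 (Vec k i) = 0" "y1 (Vec k i) = 0" for k i
      by (simp_all add: y2_def y1_def app cscale_def unitv_def)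
    have y3m: "y3 (Mat i j) = 0" for i j by (simp add: y3_def app cscale_def unitv_def)
    have y2o: "y2 (Mat i j) = 0" if "i \<noteq> j" for i j
      using that by (auto simp: y2_def app cscale_def intro!: sum.neutral)
    have y2d: "y2 (Mat i i) = (if i < n then x (Mat i i) else 0)" for i
    proof -
      define s where "s i = (\<Sum>l\<le>i. x (Mat l l))" for i
      have "y2 (Mat i i) = (\<Sum>l<n-1. (if l = i then s i else 0) - (if Suc l = i then s l else 0))"
        unfolding y2_def app by (intro sum.cong) (auto simp: cscale_def s_def)
      also have "\<dots> = (if i < n - 1 then s i else 0) - (\<Sum>l<n-1. if Suc l = i then s l else 0)"
        by (simp add: sum_subtractf)
      also have "(\<Sum>l<n-1. if Suc l = i then s l else 0) = (if 0 < i \<and> i \<le> n - 1 then s (i - 1) else 0)"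
      proof (cases i)
        case (Suc i')
        then show ?thesis by simp
      qed simp
      finally have e: "y2 (Mat i i) = (if i < n - 1 then s i else 0) - (if 0 < i \<and> i \<le> n - 1 then s (i - 1) else 0)" .
      have last: "s (n - 1) = 0" if "n > 0"
        using x that unfolding s_def qspace_def by (metis (mono_tags, lifting) Suc_pred' lessThan_Suc_atMost mem_Collect_eq)
      have step: "s i = s (i - 1) + x (Mat i i)" if "i > 0"
        using that by (cases i) (auto simp: s_def)
      have zero: "s 0 = x (Mat 0 0)" by (simp add: s_def)
      have out: "x (Mat i i) = 0" if "\<not> i < n" using x that by (auto simp: qspace_def in_range_def)
      consider "i < n - 1" "i = 0" | "i < n - 1" "i > 0" | "i = n - 1" "n > 0" "i > 0" | "i = n - 1" "n > 0" "i = 0" | "i \<ge> n"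
        by linarith
      then show ?thesis using e last step zero out by cases (auto simp: add_eq_0_iff)
    qed
    have "x = y1 + y2 + y3"
    proof
      fix d
      show "x d = (y1 + y2 + y3) d"
      proof (cases d)
        case (Mat i j)
        then show ?thesis using x by (cases "i = j") (auto simp: mat y2o y2d y3m qspace_def in_range_def)
      next
        case (Vec k i)
        then show ?thesis using x by (auto simp: vec y2v qspace_def in_range_def)
      qed
    qed
    then show "x \<in> ?S" using y1 y2 y3 by (simp add: cs.span_add)
  qed
qed

lemma struct_skew_form:
  "skew_form cscale (qspace n m) (\<lambda>x y. qpair n m \<gamma> (qbracket n m x y)) (qbasis n m)"
  by unfold_locales (fact qspace_span_qbasis qpair_qbracket_bilinear)+

lemma struct_radical:
  "skew_form.radical (qspace n m) (\<lambda>x y. qpair n m \<gamma> (qbracket n m x y)) = qstab n m \<gamma>"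
  by (simp add: skew_form.radical_def[OF struct_skew_form] qstab_def)

lemma struct_principal_pf:
  "skew_form.principal_pf (\<lambda>x y. qpair n m \<gamma> (qbracket n m x y)) (qbasis n m) J = principal_pfaffian n m J \<gamma>"
  by (simp add: skew_form.principal_pf_def[OF struct_skew_form] principal_pfaffian_def struct_mat_def Let_def)

lemma qdim_stab_dim_parity: "\<exists>k. qdim n m = 2*k + stab_dim n m \<gamma>"
  using skew_form.even_corank[OF struct_skew_form, of n m \<gamma>]
  by (simp add: qdim_def stab_dim_def struct_radical)

lemma principal_pfaffian_nonzero_exists:
  "\<exists>J\<subseteq>{..<length (qbasis n m)}. card J = qdim n m - stab_dim n m \<gamma> \<and> principal_pfaffian n m J \<gamma> \<noteq> 0"
  by (rule skew_form.exists_principal_pf_nonzero[OF struct_skew_form, of n m \<gamma>])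
    (auto simp: qdim_def stab_dim_def struct_radical struct_principal_pf)

lemma principal_pfaffian_nonzero_bound:
  assumes "J \<subseteq> {..<length (qbasis n m)}" "even (card J)" "principal_pfaffian n m J \<gamma> \<noteq> 0"
  shows "card J + stab_dim n m \<gamma> \<le> qdim n m"
  using skew_form.principal_pf_nonzero_bound[OF struct_skew_form, of J n m \<gamma>] assms
  by (simp add: qdim_def stab_dim_def struct_radical struct_principal_pf)

lemma principal_pfaffian_poly_fun: "principal_pfaffian n m J \<in> poly_fun UNIV"
  unfolding principal_pfaffian_def pfaffian_def struct_mat_def qpair_def Let_def
  by (intro poly_fun_intros) auto

lemma line_closed_qspace: "line_closed (qspace n m)"
  by (auto simp: line_closed_def qspace_def sum.distrib sum_subtractf sum_distrib_left[symmetric])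

lemma qind_le_stab_dim: "\<gamma> \<in> qspace n m \<Longrightarrow> qind n m \<le> stab_dim n m \<gamma>"
  unfolding qind_def stab_dim_def by (intro Least_le) auto

lemma zero_in_qspace: "(\<lambda>_. 0) \<in> qspace n m"
  by (auto simp: qspace_def)

lemma qind_attained: "\<exists>\<gamma>\<in>qspace n m. stab_dim n m \<gamma> = qind n m"
proof -
  have "\<exists>d. \<exists>\<gamma>\<in>qspace n m. stab_dim n m \<gamma> = d" using zero_in_qspace by blast
  from LeastI_ex[OF this] show ?thesis unfolding qind_def stab_dim_def .
qed

lemma even_qdim_minus_stab_dim: "even (qdim n m - stab_dim n m \<gamma>)"
  using qdim_stab_dim_parity[of n m \<gamma>] by auto

text \<open>A Pfaffian of size dim q - ind q that is nonzero at one regular point is nonzero only at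
  regular points, so these contain a dense open set.\<close>

lemma generic_regular_point:
  assumes f: "f \<in> poly_fun I" and x: "x \<in> qspace n m" "f x \<noteq> 0"
  shows "\<exists>\<gamma>\<in>qspace n m. f \<gamma> \<noteq> 0 \<and> stab_dim n m \<gamma> = qind n m"
proof -
  obtain \<gamma>0 where g0: "\<gamma>0 \<in> qspace n m" "stab_dim n m \<gamma>0 = qind n m" using qind_attained by blast
  obtain J where J: "J \<subseteq> {..<length (qbasis n m)}" "card J = qdim n m - qind n m" "principal_pfaffian n m J \<gamma>0 \<noteq> 0"
    using principal_pfaffian_nonzero_exists[of n m \<gamma>0] g0(2) by auto
  obtain \<gamma> where g: "\<gamma> \<in> qspace n m" "f \<gamma> \<noteq> 0" "principal_pfaffian n m J \<gamma> \<noteq> 0"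
    using poly_fun_mult_nonzero[OF line_closed_qspace f principal_pfaffian_poly_fun x g0(1) J(3)] by blast
  have ev: "even (card J)" using J(2) even_qdim_minus_stab_dim[of n m \<gamma>0] g0(2) by simp
  have "card J + stab_dim n m \<gamma> \<le> qdim n m" using principal_pfaffian_nonzero_bound[OF J(1) ev g(3)] .
  moreover have "qind n m \<le> qdim n m" using qdim_stab_dim_parity[of n m \<gamma>0] g0(2) by auto
  ultimately have "stab_dim n m \<gamma> \<le> qind n m" using J(2) by simp
  then show ?thesis using g qind_le_stab_dim[OF g(1)] by (intro bexI[of _ \<gamma>]) auto
qed

lemma common_divisor_nonzero_at_regular:
  assumes f: "\<forall>J. J \<subseteq> {..<length (qbasis n m)} \<and> card J = qdim n m - qind n m \<longrightarrow> pdvd n m f (principal_pfaffian n m J)"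
    and \<gamma>: "\<gamma> \<in> qspace n m" "stab_dim n m \<gamma> = qind n m"
  shows "f \<gamma> \<noteq> 0"
proof -
  obtain J where J: "J \<subseteq> {..<length (qbasis n m)}" "card J = qdim n m - qind n m" "principal_pfaffian n m J \<gamma> \<noteq> 0"
    using principal_pfaffian_nonzero_exists[of n m \<gamma>] \<gamma>(2) by auto
  then show ?thesis using f \<gamma>(1) unfolding pdvd_def by (metis mult_zero_left)
qed

text \<open>The counterpart of \<open>principal_pfaffian_nonzero_exists\<close>: the common zeros of
  the Pfaffians of this size are exactly the points with stabiliser larger than the index.\<close>

lemma principal_pfaffian_zero_at_singular:
  assumes J: "J \<subseteq> {..<length (qbasis n m)}" "card J = qdim n m - qind n m"
    and \<gamma>: "qind n m < stab_dim n m \<gamma>"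
  shows "principal_pfaffian n m J \<gamma> = 0"
proof (rule ccontr)
  assume nz: "principal_pfaffian n m J \<gamma> \<noteq> 0"
  obtain \<gamma>0 where g0: "stab_dim n m \<gamma>0 = qind n m" using qind_attained by blast
  have "even (card J)" using J(2) even_qdim_minus_stab_dim[of n m \<gamma>0] g0 by simp
  from principal_pfaffian_nonzero_bound[OF J(1) this nz] show False using J(2) \<gamma> by simp
qed

section \<open>Stabiliser dimension under the symmetries of the dual\<close>

lemma dim_le_injective_image:
  assumes S': "S' \<subseteq> cs.span E" "finite E" and lin: "Vector_Spaces.linear cscale cscale T"
    and inj: "inj_on T S" and S: "cs.subspace S" and im: "T ` S \<subseteq> S'"
  shows "cs.dim S \<le> cs.dim S'"
proof -
  interpret vp: vector_space_pair cscale cscale by unfold_locales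
  obtain C where C: "C \<subseteq> S" "cs.independent C" "S \<subseteq> cs.span C" "card C = cs.dim S"
    using cs.basis_exists by blast
  have spC: "cs.span C = S" using C S by (metis cs.span_minimal subset_antisym)
  have ind: "cs.independent (T ` C)"
    using vp.linear_independent_injective_image[OF lin C(2)] inj spC by simp
  obtain D where D: "D \<subseteq> S'" "cs.independent D" "S' \<subseteq> cs.span D" "card D = cs.dim S'"
    using cs.basis_exists by blast
  have "finite D" using cs.independent_span_bound[OF S'(2) D(2)] D(1) S'(1) by blast
  moreover have "T ` C \<subseteq> cs.span D" using C(1) im D(3) by auto
  ultimately have "card (T ` C) \<le> card D" using cs.independent_span_bound[OF _ ind] by blast
  moreover have "card (T ` C) = card C" using inj C(1) by (metis card_image inj_on_subset)
  ultimately show ?thesis using C(4) D(4) by simp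
qed

lemma qstab_subset_qspace: "qstab n m \<gamma> \<subseteq> cs.span (set (qbasis n m))"
  unfolding qspace_span_qbasis[symmetric] by (auto simp: qstab_def)

lemma qstab_subspace: "cs.subspace (qstab n m \<gamma>)"
  using skew_form.subspace_radical[OF struct_skew_form, of n m \<gamma>] by (simp add: struct_radical)

lemma stab_dim_le:
  assumes lin: "Vector_Spaces.linear cscale cscale T"
    and inj: "inj_on T (qstab n m \<gamma>)" and im: "T ` qstab n m \<gamma> \<subseteq> qstab n m \<gamma>'"
  shows "stab_dim n m \<gamma> \<le> stab_dim n m \<gamma>'"
  unfolding stab_dim_def
  by (rule dim_le_injective_image[OF qstab_subset_qspace _ lin inj qstab_subspace im]) simp

lemma point_linear:
  assumes "\<And>x y. f (x + y) = f x + f y" "\<And>c x. f (cscale c x) = c \<cdot>\<^sub>m f x"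
    "\<And>x y. g (x + y) = g x + g y" "\<And>c x. g (cscale c x) = c \<cdot>\<^sub>m g x"
    "\<And>x. f x \<in> carrier_mat n n" "\<And>x. g x \<in> carrier_mat n m"
  shows "Vector_Spaces.linear cscale cscale (\<lambda>x. point n m (f x) (g x))"
proof -
  have d: "dim_row (f x) = n" "dim_col (f x) = n" "dim_row (g x) = n" "dim_col (g x) = m" for x
    using assms(5,6)[of x] by auto
  show ?thesis
  proof unfold_locales
    fix x y c
    show "point n m (f (x + y)) (g (x + y)) = point n m (f x) (g x) + point n m (f y) (g y)"
      by (auto simp: assms(1,3) d point_def in_range_def fun_eq_iff split: idx.splits)
    show "point n m (f (cscale c x)) (g (cscale c x)) = cscale c (point n m (f x) (g x))"
      unfolding assms(2,4) by (auto simp: d point_def in_range_def cscale_def fun_eq_iff split: idx.splits)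
  qed
qed

lemma smult_mult_mat3:
  assumes "g \<in> carrier_mat a b" "X \<in> carrier_mat b c" "h \<in> carrier_mat c d"
  shows "g * (k \<cdot>\<^sub>m X) * h = k \<cdot>\<^sub>m (g * X * (h :: complex mat))"
  using assms by (simp add: mat_algebra)

text \<open>The matrix \<open>h\<close> mixes the m copies. This GL_m symmetry is not part of Q, nor
  is \<open>g\<close> required to have determinant 1, but both come from automorphisms of q; they
  will identify all generic slice points.\<close>

lemma stab_dim_conj_le:
  assumes A: "A \<in> carrier_mat n n" and v: "v \<in> carrier_mat n m"
    and g: "g \<in> carrier_mat n n" "g' \<in> carrier_mat n n" "g * g' = 1\<^sub>m n" "g' * g = 1\<^sub>m n"
    and h: "h \<in> carrier_mat m m" "h' \<in> carrier_mat m m" "h * h' = 1\<^sub>m m" "h' * h = 1\<^sub>m m"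
  shows "stab_dim n m (point n m A v) \<le> stab_dim n m (point n m (g * A * g') (g * v * h))"
proof -
  \<comment> \<open>The row part transforms contragrediently to v; it is transposed because
    \<open>point\<close> expects columns.\<close>
  define T where "T x = point n m (g * lin_part n x * g') (transpose_mat (h' * row_part n m x * g'))" for x
  have cT: "transpose_mat (h' * row_part n m x * g') \<in> carrier_mat n m" for x using g h by auto
  have TX: "lin_part n (T x) = g * lin_part n x * g'" "row_part n m (T x) = h' * row_part n m x * g'" for x
    using g h by (auto simp: T_def)
  have lin: "Vector_Spaces.linear cscale cscale T" unfolding T_def
  proof (rule point_linear)
    fix x y c
    show "g * lin_part n (x + y) * g' = g * lin_part n x * g' + g * lin_part n y * g'"
      using g by (simp add: parts_add mat_algebra)
    show "transpose_mat (h' * row_part n m (x + y) * g') =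
      transpose_mat (h' * row_part n m x * g') + transpose_mat (h' * row_part n m y * g')"
    proof -
      have "h' * row_part n m (x + y) * g' = h' * row_part n m x * g' + h' * row_part n m y * g'"
        using g h by (simp add: parts_add mat_algebra)
      then show ?thesis using g h by (simp add: mat_transpose_add)
    qed
    show "g * lin_part n (cscale c x) * g' = c \<cdot>\<^sub>m (g * lin_part n x * g')"
      unfolding parts_cscale using g by (intro smult_mult_mat3) auto
    have "h' * row_part n m (cscale c x) * g' = c \<cdot>\<^sub>m (h' * row_part n m x * g')"
      unfolding parts_cscale using g h by (intro smult_mult_mat3) auto
    then show "transpose_mat (h' * row_part n m (cscale c x) * g') = c \<cdot>\<^sub>m transpose_mat (h' * row_part n m x * g')"
      by (metis transpose_smult)
  qed (use g cT in auto)
  have canc: "g' * (g * X) = X" "X * g' * g = X" if "X \<in> carrier_mat n n" for X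
    using g that by (auto simp: mat_algebra mat_inverse_cancel)
  have canch: "h * (h' * X) = X" if "X \<in> carrier_mat m n" for X
    using h that by (intro mat_inverse_cancel[OF h(3)]) auto
  have inj: "inj_on T (qstab n m (point n m A v))"
  proof (rule inj_onI)
    fix x y assume x: "x \<in> qstab n m (point n m A v)" and y: "y \<in> qstab n m (point n m A v)" and e: "T x = T y"
    have "g' * (g * lin_part n x * g') * g = g' * (g * lin_part n y * g') * g" using e TX by metis
    then have 1: "lin_part n x = lin_part n y" using g canc by (simp add: mat_algebra)
    have "h * (h' * row_part n m x * g') * g = h * (h' * row_part n m y * g') * g" using e TX by metis
    moreover have "h * (h' * X * g') * g = X" if X: "X \<in> carrier_mat m n" for X
      using g h X by (simp add: mat_algebra mat_inverse_cancel[OF g(4)] mat_inverse_cancel[OF h(3)])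
    ultimately have 2: "row_part n m x = row_part n m y" by simp
    have "col_part n m z = transpose_mat (row_part n m z)" for z by (auto simp: col_part_def row_part_def)
    then show "x = y" using 1 2 x y point_parts unfolding qstab_def by (metis (no_types, lifting) mem_Collect_eq)
  qed
  show ?thesis
  proof (rule stab_dim_le[OF lin inj], rule image_subsetI)
    fix x assume "x \<in> qstab n m (point n m A v)"
    then obtain c where x: "x \<in> qspace n m" "lin_part n x * v = 0\<^sub>m n m"
      "A * lin_part n x - lin_part n x * A + v * row_part n m x = c \<cdot>\<^sub>m 1\<^sub>m n"
      using A v by (auto simp: qstab_iff moment_def)
    let ?X = "lin_part n x" and ?R = "row_part n m x"
    have X: "?X \<in> carrier_mat n n" and R: "?R \<in> carrier_mat m n" by auto
    have "mtr (g * ?X * g') = mtr (g' * (g * ?X))" using g by (intro mtr_comm[of _ n n]) auto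
    then have tr: "mtr (g * ?X * g') = 0" using canc[OF X] mtr_lin_part[OF x(1)] by simp
    have Tq: "T x \<in> qspace n m" unfolding T_def using tr g by (intro point_in_qspace) auto
    have xv: "?X * (v * Z) = 0\<^sub>m n (dim_col Z)" if "dim_row Z = m" for Z
    proof -
      have "?X * (v * Z) = ?X * v * Z" using v that by (intro mat_assoc[symmetric]) auto
      then show ?thesis using x(2) that by (simp add: mat_algebra)
    qed
    have e1: "g * ?X * g' * (g * v * h) = 0\<^sub>m n m"
      using g h v X by (simp add: mat_algebra mat_inverse_cancel[OF g(4)] xv)
    have e2: "g * A * g' * (g * ?X * g') = g * (A * ?X) * g'" "g * ?X * g' * (g * A * g') = g * (?X * A) * g'"
      using g A X by (simp_all add: mat_algebra mat_inverse_cancel[OF g(4)])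
    have e3: "g * v * h * (h' * ?R * g') = g * (v * ?R) * g'"
      using g h v R by (simp add: mat_algebra mat_inverse_cancel[OF g(4)] mat_inverse_cancel[OF h(3)])
    have "g * A * g' * (g * ?X * g') - g * ?X * g' * (g * A * g') + g * v * h * (h' * ?R * g') =
      g * (A * ?X - ?X * A + v * ?R) * g'"
      unfolding e2 e3 using g A v X R
      by (simp add: mat_algebra)
    also have "\<dots> = c \<cdot>\<^sub>m (g * 1\<^sub>m n * g')" unfolding x(3) using g by (intro smult_mult_mat3) auto
    also have "\<dots> = c \<cdot>\<^sub>m 1\<^sub>m n" using g by simp
    finally have e4: "g * A * g' * (g * ?X * g') - g * ?X * g' * (g * A * g') + g * v * h * (h' * ?R * g') = c \<cdot>\<^sub>m 1\<^sub>m n" .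
    have gA: "g * A * g' \<in> carrier_mat n n" "g * v * h \<in> carrier_mat n m" using g h A v by auto
    show "T x \<in> qstab n m (point n m (g * A * g') (g * v * h))"
      unfolding qstab_iff moment_def parts_point(1)[OF carrier_matD[OF gA(1)]] parts_point(2)[OF carrier_matD[OF gA(2)]] TX
      using Tq e1 e4 by blast
  qed
qed

lemma stab_dim_conj:
  assumes A: "A \<in> carrier_mat n n" and v: "v \<in> carrier_mat n m"
    and g: "g \<in> carrier_mat n n" "g' \<in> carrier_mat n n" "g * g' = 1\<^sub>m n"
    and h: "h \<in> carrier_mat m m" "h' \<in> carrier_mat m m" "h * h' = 1\<^sub>m m"
  shows "stab_dim n m (point n m (g * A * g') (g * v * h)) = stab_dim n m (point n m A v)"
proof (rule antisym)
  have g'g: "g' * g = 1\<^sub>m n" using mat_mult_left_right_inverse[OF g] .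
  have h'h: "h' * h = 1\<^sub>m m" using mat_mult_left_right_inverse[OF h] .
  show "stab_dim n m (point n m A v) \<le> stab_dim n m (point n m (g * A * g') (g * v * h))"
    by (rule stab_dim_conj_le[OF A v g g'g h h'h])
  have gA: "g * A * g' \<in> carrier_mat n n" "g * v * h \<in> carrier_mat n m" using g h A v by auto
  have 1: "g' * (g * A * g') * g = A"
    using g A g'g by (simp add: mat_algebra mat_inverse_cancel[OF g'g])
  have 2: "g' * (g * v * h) * h' = v"
    using g h v g'g by (simp add: mat_algebra mat_inverse_cancel[OF g'g])
  show "stab_dim n m (point n m (g * A * g') (g * v * h)) \<le> stab_dim n m (point n m A v)"
    using stab_dim_conj_le[OF gA g(2) g(1) g'g g(3) h(2) h(1) h'h h(3)] by (simp only: 1 2)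
qed

text \<open>The map \<open>T\<close> is conjugation by the element of exp(V) given by
  \<open>e\<close>. Since X v = 0 on the stabiliser, the terms v e X cancel and X v e vanishes; the
  scalar matrix drops out of the commutator.\<close>

lemma stab_dim_shift_le:
  assumes A: "A \<in> carrier_mat n n" and v: "v \<in> carrier_mat n m" and e: "e \<in> carrier_mat m n"
  shows "stab_dim n m (point n m A v) \<le> stab_dim n m (point n m (A - v * e + c \<cdot>\<^sub>m 1\<^sub>m n) v)"
proof -
  define T where "T x = point n m (lin_part n x) (transpose_mat (row_part n m x + e * lin_part n x))" for x
  have cT: "transpose_mat (row_part n m x + e * lin_part n x) \<in> carrier_mat n m" for x using e by auto
  have TX: "lin_part n (T x) = lin_part n x" "row_part n m (T x) = row_part n m x + e * lin_part n x" for x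
    using e by (auto simp: T_def)
  have lin: "Vector_Spaces.linear cscale cscale T" unfolding T_def
  proof (rule point_linear)
    fix x y c
    have "row_part n m (x + y) + e * lin_part n (x + y) =
      (row_part n m x + e * lin_part n x) + (row_part n m y + e * lin_part n y)"
      using e unfolding parts_add by (simp add: mat_algebra) (rule eq_matI, auto)
    then show "transpose_mat (row_part n m (x + y) + e * lin_part n (x + y)) =
      transpose_mat (row_part n m x + e * lin_part n x) + transpose_mat (row_part n m y + e * lin_part n y)"
      using e by (simp add: mat_transpose_add)
    have "row_part n m (cscale c x) + e * lin_part n (cscale c x) = c \<cdot>\<^sub>m (row_part n m x + e * lin_part n x)"
      unfolding parts_cscale using e by (simp add: mat_algebra mat_smult_add)
    then show "transpose_mat (row_part n m (cscale c x) + e * lin_part n (cscale c x)) =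
      c \<cdot>\<^sub>m transpose_mat (row_part n m x + e * lin_part n x)" by (metis transpose_smult)
  qed (use cT in \<open>auto simp: parts_add parts_cscale\<close>)
  have inj: "inj_on T (qstab n m (point n m A v))"
  proof (rule inj_onI)
    fix x y assume x: "x \<in> qstab n m (point n m A v)" and y: "y \<in> qstab n m (point n m A v)" and eq: "T x = T y"
    have 1: "lin_part n x = lin_part n y" using eq TX by metis
    have "row_part n m x + e * lin_part n x = row_part n m y + e * lin_part n x" using eq TX 1 by metis
    then have "(row_part n m x + e * lin_part n x) $$ (i,j) = (row_part n m y + e * lin_part n x) $$ (i,j)" for i j
      by simp
    then have "row_part n m x $$ (i,j) = row_part n m y $$ (i,j)" if ij: "i < m" "j < n" for i j
    proof -
      have "(row_part n m x + e * lin_part n x) $$ (i,j) = (row_part n m y + e * lin_part n x) $$ (i,j)" by fact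
      then show ?thesis using ij e by simp
    qed
    then have 2: "row_part n m x = row_part n m y" by (intro eq_matI) auto
    have "col_part n m z = transpose_mat (row_part n m z)" for z by (auto simp: col_part_def row_part_def)
    then show "x = y" using 1 2 x y point_parts unfolding qstab_def by (metis (no_types, lifting) mem_Collect_eq)
  qed
  show ?thesis
  proof (rule stab_dim_le[OF lin inj], rule image_subsetI)
    fix x assume "x \<in> qstab n m (point n m A v)"
    then obtain b where x: "x \<in> qspace n m" "lin_part n x * v = 0\<^sub>m n m"
      "A * lin_part n x - lin_part n x * A + v * row_part n m x = b \<cdot>\<^sub>m 1\<^sub>m n"
      using A v by (auto simp: qstab_iff moment_def)
    let ?X = "lin_part n x" and ?R = "row_part n m x" and ?A = "A - v * e + c \<cdot>\<^sub>m 1\<^sub>m n"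
    have X: "?X \<in> carrier_mat n n" and R: "?R \<in> carrier_mat m n" by auto
    have Tq: "T x \<in> qspace n m" unfolding T_def using mtr_lin_part[OF x(1)] by (intro point_in_qspace) auto
    have cA: "?A \<in> carrier_mat n n" using A v e by auto
    have a: "?A * ?X = A * ?X - v * (e * ?X) + c \<cdot>\<^sub>m ?X"
    proof -
      have "?A * ?X = A * ?X - v * e * ?X + c \<cdot>\<^sub>m 1\<^sub>m n * ?X"
        using A v e X by (simp add: mat_algebra)
      then show ?thesis using v e X by (simp add: mat_algebra)
    qed
    have b: "?X * ?A = ?X * A - 0\<^sub>m n n + c \<cdot>\<^sub>m ?X"
    proof -
      have "?X * ?A = ?X * A - ?X * (v * e) + ?X * (c \<cdot>\<^sub>m 1\<^sub>m n)"
        using A v e X by (simp add: mat_algebra)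
      moreover have "?X * (v * e) = ?X * v * e" using v e X by (intro mat_assoc[symmetric]) auto
      ultimately show ?thesis using v e X x(2) by (simp add: mat_algebra)
    qed
    have "?A * ?X - ?X * ?A + v * (?R + e * ?X) = A * ?X - ?X * A + v * ?R"
      unfolding a b using A v e X R by (simp add: mat_algebra) (rule eq_matI, auto)
    then have "?A * ?X - ?X * ?A + v * (?R + e * ?X) = b \<cdot>\<^sub>m 1\<^sub>m n" using x(3) by simp
    then show "T x \<in> qstab n m (point n m ?A v)"
      unfolding qstab_iff moment_def parts_point(1)[OF carrier_matD[OF cA]] parts_point(2)[OF carrier_matD[OF v]] TX
      using Tq x(2) by blast
  qed
qed

lemma stab_dim_shift:
  assumes A: "A \<in> carrier_mat n n" and v: "v \<in> carrier_mat n m" and e: "e \<in> carrier_mat m n"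
  shows "stab_dim n m (point n m (A - v * e + c \<cdot>\<^sub>m 1\<^sub>m n) v) = stab_dim n m (point n m A v)"
proof (rule antisym)
  show "stab_dim n m (point n m A v) \<le> stab_dim n m (point n m (A - v * e + c \<cdot>\<^sub>m 1\<^sub>m n) v)"
    by (rule stab_dim_shift_le[OF A v e])
  let ?A = "A - v * e + c \<cdot>\<^sub>m 1\<^sub>m n"
  have cA: "?A \<in> carrier_mat n n" and me: "- e \<in> carrier_mat m n" using A v e by auto
  have "v * (- e) = - (v * e)" using v e by simp
  then have "?A - v * (- e) + (- c) \<cdot>\<^sub>m 1\<^sub>m n = A" using A v e by (intro eq_matI) auto
  then show "stab_dim n m (point n m ?A v) \<le> stab_dim n m (point n m A v)"
    using stab_dim_shift_le[OF cA v me, of "- c"] by simp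
qed

subsection \<open>The coadjoint action in matrix form\<close>

lemma mat_mult_entry:
  assumes "A \<in> carrier_mat n k" "B \<in> carrier_mat k m" "i < n" "j < m"
  shows "(A * B) $$ (i,j) = (\<Sum>l<k. A $$ (i,l) * (B $$ (l,j) :: complex))"
  using assms by (simp add: scalar_prod_def lessThan_atLeast0)

lemma detn_eq_det: "detn n g = det (mat n n (\<lambda>(i,j). g i j))"
proof -
  have "det (mat n n (\<lambda>(i,j). g i j)) = (\<Sum>p | p permutes {0..<n}. signof p * (\<Prod>i = 0..<n. g i (p i)))"
    by (subst det_def'[of _ n]) (auto intro!: sum.cong prod.cong simp: permutes_in_image)
  then show ?thesis by (simp add: detn_def lessThan_atLeast0 of_int_hom.hom_signof)
qed

lemma is_SL_iff:
  "is_SL n g h \<longleftrightarrow> mat n n (\<lambda>(i,j). g i j) * mat n n (\<lambda>(i,j). h i j) = 1\<^sub>m n \<and> det (mat n n (\<lambda>(i,j). g i j)) = 1"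
proof -
  have "(mat n n (\<lambda>(i,j). g i j) * mat n n (\<lambda>(i,j). h i j) = 1\<^sub>m n) \<longleftrightarrow>
    (\<forall>i<n. \<forall>j<n. (\<Sum>l<n. g i l * h l j) = (if i = j then 1 else 0))" (is "?L \<longleftrightarrow> ?R")
  proof
    assume L: ?L
    show ?R
    proof (intro allI impI)
      fix i j assume ij: "i < n" "j < n"
      have "(mat n n (\<lambda>(i,j). g i j) * mat n n (\<lambda>(i,j). h i j)) $$ (i,j) = (1\<^sub>m n) $$ (i,j)" using L by simp
      then show "(\<Sum>l<n. g i l * h l j) = (if i = j then 1 else 0)"
        using ij by (simp add: scalar_prod_def lessThan_atLeast0)
    qed
  next
    assume ?R
    then show ?L by (intro eq_matI) (auto simp: scalar_prod_def lessThan_atLeast0)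
  qed
  then show ?thesis by (simp add: is_SL_def detn_eq_det)
qed

lemma act_SL_point:
  assumes "A \<in> carrier_mat n n" "v \<in> carrier_mat n m"
  shows "act_SL n m g h (point n m A v) =
    point n m (mat n n (\<lambda>(i,j). g i j) * A * mat n n (\<lambda>(i,j). h i j)) (mat n n (\<lambda>(i,j). g i j) * v)"
proof
  fix c
  show "act_SL n m g h (point n m A v) c =
    point n m (mat n n (\<lambda>(i,j). g i j) * A * mat n n (\<lambda>(i,j). h i j)) (mat n n (\<lambda>(i,j). g i j) * v) c"
  proof (cases c)
    case (Mat i j)
    have "(\<Sum>a<n. \<Sum>b<n. g i a * A $$ (a,b) * h b j) = (\<Sum>b<n. (\<Sum>a<n. g i a * A $$ (a,b)) * h b j)"
      by (subst sum.swap) (simp add: sum_distrib_right)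
    then show ?thesis using assms Mat
      by (auto simp: act_SL_def point_def in_range_def scalar_prod_def lessThan_atLeast0)
  next
    case (Vec k i)
    then show ?thesis using assms
      by (auto simp: act_SL_def point_def in_range_def scalar_prod_def lessThan_atLeast0)
  qed
qed

lemma act_V_point:
  fixes \<eta> :: "nat \<Rightarrow> nat \<Rightarrow> complex"
  assumes "A \<in> carrier_mat n n" "v \<in> carrier_mat n m"
  defines "e \<equiv> mat m n (\<lambda>(k,j). \<eta> k j)"
  shows "act_V n m \<eta> (point n m A v) = point n m (A - v * e + (mtr (v * e) / of_nat n) \<cdot>\<^sub>m 1\<^sub>m n) v"
proof -
  have ee: "e \<in> carrier_mat m n" "\<And>k j. k < m \<Longrightarrow> j < n \<Longrightarrow> e $$ (k,j) = \<eta> k j"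
    by (auto simp: e_def)
  have tr: "mtr (v * e) = (\<Sum>k<m. \<Sum>l<n. v $$ (l,k) * \<eta> k l)"
    unfolding mtr_mult[OF assms(2) ee(1)] by (subst sum.swap) (simp add: ee(2))
  show ?thesis
  proof
    fix c
    show "act_V n m \<eta> (point n m A v) c = point n m (A - v * e + (mtr (v * e) / of_nat n) \<cdot>\<^sub>m 1\<^sub>m n) v c"
    proof (cases c)
      case (Mat i j)
      have "(v * e) $$ (i,j) = (\<Sum>k<m. v $$ (i,k) * \<eta> k j)" if "i < n" "j < n"
        using mat_mult_entry[OF assms(2) ee(1) that] that by (simp add: ee(2))
      moreover have "(v * e) \<in> carrier_mat n n" using assms(2) ee(1) by auto
      ultimately show ?thesis using Mat assms(1,2)
        by (auto simp: tr act_V_def point_def in_range_def simp del: index_mult_mat(1))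
    next
      case (Vec k i)
      then show ?thesis by (auto simp: act_V_def point_def in_range_def)
    qed
  qed
qed

lemma inv_algI:
  assumes "F \<in> poly_fun UNIV"
    and SL: "\<And>A v g g'. A \<in> carrier_mat n n \<Longrightarrow> v \<in> carrier_mat n m \<Longrightarrow> mtr A = 0 \<Longrightarrow>
      g \<in> carrier_mat n n \<Longrightarrow> g' \<in> carrier_mat n n \<Longrightarrow> g * g' = 1\<^sub>m n \<Longrightarrow> det g = 1 \<Longrightarrow>
      F (point n m (g * A * g') (g * v)) = F (point n m A v)"
    and V: "\<And>A v e. A \<in> carrier_mat n n \<Longrightarrow> v \<in> carrier_mat n m \<Longrightarrow> mtr A = 0 \<Longrightarrow> e \<in> carrier_mat m n \<Longrightarrow>
      F (point n m (A - v * e + (mtr (v * e) / of_nat n) \<cdot>\<^sub>m 1\<^sub>m n) v) = F (point n m A v)"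
  shows "F \<in> inv_alg n m"
  unfolding inv_alg_def
proof (intro CollectI conjI ballI allI impI assms(1))
  fix \<gamma> g h assume \<gamma>: "\<gamma> \<in> qspace n m" and gh: "is_SL n g h"
  obtain A v where "A \<in> carrier_mat n n" "v \<in> carrier_mat n m" "mtr A = 0" "\<gamma> = point n m A v"
    using qdual_cases[OF \<gamma>] by blast
  then show "F (act_SL n m g h \<gamma>) = F \<gamma>" using gh
    by (simp add: act_SL_point is_SL_iff) (intro SL, auto)
next
  fix \<gamma> \<eta> assume \<gamma>: "\<gamma> \<in> qspace n m"
  obtain A v where "A \<in> carrier_mat n n" "v \<in> carrier_mat n m" "mtr A = 0" "\<gamma> = point n m A v"
    using qdual_cases[OF \<gamma>] by blast
  then show "F (act_V n m \<eta> \<gamma>) = F \<gamma>" by (simp add: act_V_point) (intro V, auto)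
qed

lemma inv_algD:
  assumes "F \<in> inv_alg n m"
  shows "F \<in> poly_fun UNIV"
    and "\<And>A v g g'. A \<in> carrier_mat n n \<Longrightarrow> v \<in> carrier_mat n m \<Longrightarrow> mtr A = 0 \<Longrightarrow>
      g \<in> carrier_mat n n \<Longrightarrow> g' \<in> carrier_mat n n \<Longrightarrow> g * g' = 1\<^sub>m n \<Longrightarrow> det g = 1 \<Longrightarrow>
      F (point n m (g * A * g') (g * v)) = F (point n m A v)"
    and "\<And>A v e. A \<in> carrier_mat n n \<Longrightarrow> v \<in> carrier_mat n m \<Longrightarrow> mtr A = 0 \<Longrightarrow> e \<in> carrier_mat m n \<Longrightarrow>
      F (point n m (A - v * e + (mtr (v * e) / of_nat n) \<cdot>\<^sub>m 1\<^sub>m n) v) = F (point n m A v)"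
proof -
  show "F \<in> poly_fun UNIV" using assms by (simp add: inv_alg_def)
  show "F (point n m (g * A * g') (g * v)) = F (point n m A v)"
    if A: "A \<in> carrier_mat n n" and v: "v \<in> carrier_mat n m" and tr: "mtr A = 0" and
      g: "g \<in> carrier_mat n n" "g' \<in> carrier_mat n n" "g * g' = 1\<^sub>m n" "det g = 1" for A v g g'
  proof -
    have m: "mat n n (($$) g) = g" "mat n n (($$) g') = g'" using g by (auto intro!: eq_matI)
    have "is_SL n (\<lambda>i j. g $$ (i,j)) (\<lambda>i j. g' $$ (i,j))" using g m by (simp add: is_SL_iff)
    then have "F (act_SL n m (\<lambda>i j. g $$ (i,j)) (\<lambda>i j. g' $$ (i,j)) (point n m A v)) = F (point n m A v)"
      using assms point_in_qspace[OF A tr] by (auto simp: inv_alg_def)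
    then show ?thesis by (simp add: act_SL_point[OF A v] m)
  qed
  show "F (point n m (A - v * e + (mtr (v * e) / of_nat n) \<cdot>\<^sub>m 1\<^sub>m n) v) = F (point n m A v)"
    if A: "A \<in> carrier_mat n n" and v: "v \<in> carrier_mat n m" and tr: "mtr A = 0" and
      e: "e \<in> carrier_mat m n" for A v e
  proof -
    have m: "mat m n (($$) e) = e" using e by (auto intro!: eq_matI)
    have "F (act_V n m (\<lambda>k j. e $$ (k,j)) (point n m A v)) = F (point n m A v)"
      using assms point_in_qspace[OF A tr] by (auto simp: inv_alg_def)
    then show ?thesis by (simp add: act_V_point[OF A v] m)
  qed
qed

text \<open>The orbit relation of Q on traceless points, closed under single moves. In
  \<open>qconj_V\<close> the scalar is left free and pinned down by the trace condition, so that it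
  need not be computed at each move.\<close>

inductive qconj :: "nat \<Rightarrow> nat \<Rightarrow> complex mat \<Rightarrow> complex mat \<Rightarrow> complex mat \<Rightarrow> complex mat \<Rightarrow> bool"
  for n m A v where
  qconj_refl: "A \<in> carrier_mat n n \<Longrightarrow> v \<in> carrier_mat n m \<Longrightarrow> mtr A = 0 \<Longrightarrow> qconj n m A v A v"
| qconj_SL: "qconj n m A v B u \<Longrightarrow> g \<in> carrier_mat n n \<Longrightarrow> g' \<in> carrier_mat n n \<Longrightarrow> g * g' = 1\<^sub>m n \<Longrightarrow> det g = 1 \<Longrightarrow>
    qconj n m A v (g * B * g') (g * u)"
| qconj_V: "qconj n m A v B u \<Longrightarrow> e \<in> carrier_mat m n \<Longrightarrow> mtr (B - u * e + c \<cdot>\<^sub>m 1\<^sub>m n) = 0 \<Longrightarrow>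
    qconj n m A v (B - u * e + c \<cdot>\<^sub>m 1\<^sub>m n) u"

lemma mtr_conj:
  assumes "A \<in> carrier_mat n n" "g \<in> carrier_mat n n" "g' \<in> carrier_mat n n" "g * g' = 1\<^sub>m n"
  shows "mtr (g * A * g') = mtr A"
proof -
  have i: "g' * g = 1\<^sub>m n" using mat_mult_left_right_inverse assms by blast
  have "mtr (g * A * g') = mtr (g' * (g * A))" using assms by (intro mtr_comm[of _ n n]) auto
  also have "g' * (g * A) = A" using assms by (intro mat_inverse_cancel[OF i]) auto
  finally show ?thesis .
qed

lemma qconj_carrier:
  assumes "qconj n m A v B u"
  shows "A \<in> carrier_mat n n" "v \<in> carrier_mat n m" "mtr A = 0"
    "B \<in> carrier_mat n n" "u \<in> carrier_mat n m" "mtr B = 0"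
proof -
  have "A \<in> carrier_mat n n \<and> v \<in> carrier_mat n m \<and> mtr A = 0 \<and>
    B \<in> carrier_mat n n \<and> u \<in> carrier_mat n m \<and> mtr B = 0"
    using assms
  proof induction
    case (qconj_SL B u g g')
    then show ?case using mtr_conj[of B n g g'] by auto
  qed auto
  then show "A \<in> carrier_mat n n" "v \<in> carrier_mat n m" "mtr A = 0"
    "B \<in> carrier_mat n n" "u \<in> carrier_mat n m" "mtr B = 0" by auto
qed

lemma qconj_trans: "qconj n m B u C w \<Longrightarrow> qconj n m A v B u \<Longrightarrow> qconj n m A v C w"
  by (induction rule: qconj.induct) (auto intro: qconj.intros)

lemma qconj_invariants:
  assumes "qconj n m A v B u" "n > 0"
  shows "F \<in> inv_alg n m \<Longrightarrow> F (point n m A v) = F (point n m B u)"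
    and "stab_dim n m (point n m A v) = stab_dim n m (point n m B u)"
proof -
  show "F \<in> inv_alg n m \<Longrightarrow> F (point n m A v) = F (point n m B u)"
    using assms(1)
  proof induction
    case (qconj_SL B u g g')
    then show ?case using inv_algD(2)[of F n m B u g g'] qconj_carrier[OF qconj_SL(1)] by simp
  next
    case (qconj_V B u e c)
    note c = qconj_carrier[OF qconj_V(1)]
    have "mtr (B - u * e + c \<cdot>\<^sub>m 1\<^sub>m n) = mtr B - mtr (u * e) + c * of_nat n"
      using c qconj_V(2) by (simp add: mtr_linear mtr_one)
    then have "c = mtr (u * e) / of_nat n" using qconj_V(3) c assms(2) by (simp add: field_simps)
    then show ?case using inv_algD(3)[of F n m B u e] qconj_V c by simp
  qed simp
  show "stab_dim n m (point n m A v) = stab_dim n m (point n m B u)"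
    using assms(1)
  proof induction
    case (qconj_SL B u g g')
    note c = qconj_carrier[OF qconj_SL(1)]
    have "stab_dim n m (point n m (g * B * g') (g * u * 1\<^sub>m m)) = stab_dim n m (point n m B u)"
      using qconj_SL c by (intro stab_dim_conj[where h' = "1\<^sub>m m"]) auto
    then show ?case using qconj_SL c by (simp add: mat_one_right)
  next
    case (qconj_V B u e c)
    then show ?case using stab_dim_shift[of B n u m e c] qconj_carrier[OF qconj_V(1)] by simp
  qed simp
qed

subsection \<open>Krylov determinants\<close>

text \<open>Columns become functions on the natural numbers, extended by zero, so that spans of
  Krylov columns can be formed in one fixed vector space.\<close>

definition fscale :: "complex \<Rightarrow> (nat \<Rightarrow> complex) \<Rightarrow> nat \<Rightarrow> complex" where
  "fscale c x = (\<lambda>a. c * x a)"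

interpretation fs: vector_space fscale
  by unfold_locales (auto simp: fscale_def fun_eq_iff algebra_simps)

lemma fs_span_coordinates:
  fixes N :: nat
  assumes "z \<in> fs.span (f ` {..<N})"
  shows "\<exists>c. \<forall>a. z a = (\<Sum>s<N. f s a * c s)"
  using assms
proof (induction rule: fs.span_induct_alt)
  case base
  show ?case by (rule exI[of _ "\<lambda>_. 0"]) simp
next
  case (step k x y)
  then obtain d s0 where d: "\<And>a. y a = (\<Sum>s<N. f s a * d s)" and s0: "s0 < N" "x = f s0" by blast
  have "(fscale k x + y) a = (\<Sum>s<N. f s a * ((if s = s0 then k else 0) + d s))" for a
  proof -
    have "(\<Sum>s<N. f s a * ((if s = s0 then k else 0) + d s)) = (\<Sum>s<N. (if s = s0 then f s0 a * k else 0) + f s a * d s)"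
      by (intro sum.cong) (auto simp: algebra_simps)
    also have "\<dots> = f s0 a * k + y a" unfolding sum.distrib d using s0(1) by (subst sum.delta) auto
    finally show ?thesis using s0 by (simp add: fscale_def)
  qed
  then show ?case by (intro exI[of _ "\<lambda>s. (if s = s0 then k else 0) + d s"] allI)
qed

fun kpow :: "complex mat \<Rightarrow> complex mat \<Rightarrow> nat \<Rightarrow> complex mat" where
  "kpow A v 0 = v"
| "kpow A v (Suc j) = A * kpow A v j"

lemma kpow_carrier [simp]:
  "A \<in> carrier_mat n n \<Longrightarrow> v \<in> carrier_mat n m \<Longrightarrow> kpow A v j \<in> carrier_mat n m"
  by (induction j) auto

definition kblock :: "nat \<Rightarrow> nat \<Rightarrow> nat \<Rightarrow> nat" where
  "kblock m t j = (if j < t * m then j div m else t)"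

definition kindex :: "nat \<Rightarrow> nat \<Rightarrow> (nat \<Rightarrow> nat) \<Rightarrow> nat \<Rightarrow> nat" where
  "kindex m t c j = (if j < t * m then j mod m else c (j - t * m))"

text \<open>All columns of blocks below that of j stand before j. This makes the column operation in
  \<open>kdet_invariant\<close> unitriangular.\<close>

lemma kblock_le: "kblock m t j * m \<le> j" "kblock m t j * m \<le> t * m"
proof -
  show 1: "kblock m t j * m \<le> j"
  proof (cases "j < t * m")
    case True
    then have "kblock m t j = j div m" by (simp add: kblock_def)
    then show ?thesis by (simp only: div_times_less_eq_dividend)
  next
    case False
    then have "kblock m t j = t" by (simp add: kblock_def)
    then show ?thesis using False by simp
  qed
  show "kblock m t j * m \<le> t * m"
  proof (cases "j < t * m")
    case True
    then show ?thesis using 1 by linarith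
  next
    case False
    then have "kblock m t j = t" by (simp add: kblock_def)
    then show ?thesis by simp
  qed
qed

text \<open>The columns of \<open>kry\<close> are those of \<open>v, A v, \<dots>, A\<^sup>t\<^sup>-\<^sup>1 v\<close>, followed by the columns
  of \<open>A\<^sup>t v\<close> selected by \<open>c\<close>.\<close>

definition kry :: "nat \<Rightarrow> nat \<Rightarrow> nat \<Rightarrow> (nat \<Rightarrow> nat) \<Rightarrow> complex mat \<Rightarrow> complex mat \<Rightarrow> complex mat" where
  "kry n m t c A v = mat n n (\<lambda>(i,j). kpow A v (kblock m t j) $$ (i, kindex m t c j))"

definition kdet :: "nat \<Rightarrow> nat \<Rightarrow> nat \<Rightarrow> (nat \<Rightarrow> nat) \<Rightarrow> (idx \<Rightarrow> complex) \<Rightarrow> complex" where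
  "kdet n m t c \<gamma> = det (kry n m t c (lin_part n \<gamma>) (col_part n m \<gamma>))"

lemma kry_carrier [simp]: "kry n m t c A v \<in> carrier_mat n n" "dim_row (kry n m t c A v) = n" "dim_col (kry n m t c A v) = n"
  by (auto simp: kry_def)

lemma det_poly_fun:
  assumes "\<And>i j. i < n \<Longrightarrow> j < n \<Longrightarrow> (\<lambda>x. M x i j) \<in> poly_fun I"
  shows "(\<lambda>x. det (mat n n (\<lambda>(i,j). M x i j))) \<in> poly_fun I"
  unfolding detn_eq_det[symmetric] detn_def
  by (intro poly_fun_intros assms) (auto, metis lessThan_iff permutes_in_image)

lemma kpow_poly_fun:
  assumes "i < n" "k < m"
  shows "(\<lambda>\<gamma>. kpow (lin_part n \<gamma>) (col_part n m \<gamma>) j $$ (i,k)) \<in> poly_fun UNIV"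
  using assms
proof (induction j arbitrary: i)
  case 0
  then show ?case by (auto simp: col_part_def intro: poly_fun_intros)
next
  case (Suc j)
  have c: "kpow (lin_part n \<gamma>) (col_part n m \<gamma>) j \<in> carrier_mat n m" for \<gamma> by simp
  have "(\<lambda>\<gamma>. kpow (lin_part n \<gamma>) (col_part n m \<gamma>) (Suc j) $$ (i,k)) =
    (\<lambda>\<gamma>. \<Sum>l<n. \<gamma> (Mat i l) * kpow (lin_part n \<gamma>) (col_part n m \<gamma>) j $$ (l,k))"
  proof
    fix \<gamma>
    have "kpow (lin_part n \<gamma>) (col_part n m \<gamma>) (Suc j) $$ (i,k) =
      (\<Sum>l<n. lin_part n \<gamma> $$ (i,l) * kpow (lin_part n \<gamma>) (col_part n m \<gamma>) j $$ (l,k))"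
      unfolding kpow.simps by (rule mat_mult_entry[OF part_carrier(1) c Suc.prems])
    also have "\<dots> = (\<Sum>l<n. \<gamma> (Mat i l) * kpow (lin_part n \<gamma>) (col_part n m \<gamma>) j $$ (l,k))"
      using Suc.prems by (intro sum.cong) (auto simp: lin_part_def)
    finally show "kpow (lin_part n \<gamma>) (col_part n m \<gamma>) (Suc j) $$ (i,k) =
      (\<Sum>l<n. \<gamma> (Mat i l) * kpow (lin_part n \<gamma>) (col_part n m \<gamma>) j $$ (l,k))" .
  qed
  then show ?case using Suc by (auto intro!: poly_fun_intros)
qed

lemma kindex_less:
  assumes "n \<le> t * m + r" "j < n" "\<And>l. l < r \<Longrightarrow> c l < m"
  shows "kindex m t c j < m"
  using assms by (cases "m = 0") (auto simp: kindex_def)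

lemma kdet_poly_fun:
  assumes "n = t * m + r" "\<And>l. l < r \<Longrightarrow> c l < m"
  shows "kdet n m t c \<in> poly_fun UNIV"
  unfolding kdet_def kry_def
  using assms kindex_less[of n t m r _ c] by (intro det_poly_fun kpow_poly_fun) auto

lemma kpow_conj:
  assumes "A \<in> carrier_mat n n" "v \<in> carrier_mat n m" "g \<in> carrier_mat n n" "g' \<in> carrier_mat n n" "g' * g = 1\<^sub>m n"
  shows "kpow (g * A * g') (g * v) j = g * kpow A v j"
proof (induction j)
  case (Suc j)
  have "kpow A v j \<in> carrier_mat n m" using assms by simp
  then show ?case using Suc assms by (simp add: mat_algebra mat_inverse_cancel[OF assms(5)] carrier_matD[of "kpow A v j" n m])
qed simp

text \<open>An element g of SL_n multiplies the Krylov matrix by g from the left. An element of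
  exp(V) changes the columns of each block only by combinations of columns of lower blocks, a
  unitriangular operation from the right.\<close>

lemma kdet_invariant:
  assumes m: "m > 0" and n: "n = t * m + r" and c: "\<And>l. l < r \<Longrightarrow> c l < m"
  shows "kdet n m t c \<in> inv_alg n m"
proof (rule inv_algI)
  show "kdet n m t c \<in> poly_fun UNIV" using n c by (rule kdet_poly_fun)
next
  fix A v g g' :: "complex mat"
  assume A: "A \<in> carrier_mat n n" and v: "v \<in> carrier_mat n m" and
    g: "g \<in> carrier_mat n n" "g' \<in> carrier_mat n n" "g * g' = 1\<^sub>m n" "det g = 1"
  have g'g: "g' * g = 1\<^sub>m n" using mat_mult_left_right_inverse[OF g(1-3)] .
  have "kry n m t c (g * A * g') (g * v) = g * kry n m t c A v"
  proof (rule eq_matI)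
    fix i j assume "i < dim_row (g * kry n m t c A v)" "j < dim_col (g * kry n m t c A v)"
    then have ij: "i < n" "j < n" using g by auto
    have kc: "kpow A v (kblock m t j) \<in> carrier_mat n m" using A v by simp
    have l: "kindex m t c j < m" using kindex_less[of n t m r j c] n ij c by simp
    show "kry n m t c (g * A * g') (g * v) $$ (i,j) = (g * kry n m t c A v) $$ (i,j)"
      using ij g(1) kc l by (simp add: kry_def kpow_conj[OF A v g(1,2) g'g] scalar_prod_def)
  qed (use g in auto)
  moreover have "det (g * kry n m t c A v) = det g * det (kry n m t c A v)" using g by (intro det_mult) auto
  moreover have "g * A * g' \<in> carrier_mat n n" "g * v \<in> carrier_mat n m" using A v g by auto
  ultimately show "kdet n m t c (point n m (g * A * g') (g * v)) = kdet n m t c (point n m A v)"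
    using A v g by (simp add: kdet_def)
next
  fix A v e :: "complex mat"
  assume A: "A \<in> carrier_mat n n" and v: "v \<in> carrier_mat n m" and e: "e \<in> carrier_mat m n"
  define k where "k = mtr (v * e) / of_nat n"
  define A' where "A' = A - v * e + k \<cdot>\<^sub>m 1\<^sub>m n"
  have A': "A' \<in> carrier_mat n n" using A v e by (auto simp: A'_def)
  define kc where "kc s = (\<lambda>a. if a < n then kpow A v (s div m) $$ (a, s mod m) else 0)" for s
  define app where "app M x = (\<lambda>a. if a < n then \<Sum>b<n. M $$ (a,b) * x b else 0)" for M :: "complex mat" and x :: "nat \<Rightarrow> complex"
  have app_lin: "app M (x + y) = app M x + app M y" "app M (fscale r x) = fscale r (app M x)" for M x y r
    by (auto simp: app_def fun_eq_iff fscale_def sum.distrib algebra_simps sum_distrib_left)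
  have kcA: "app A (kc s) = kc (s + m)" for s
  proof -
    have "kpow A v (s div m) \<in> carrier_mat n m" using A v by simp
    then show ?thesis using m A
      by (auto simp: app_def kc_def fun_eq_iff scalar_prod_def lessThan_atLeast0)
  qed
  have spanA: "app A x \<in> fs.span (kc ` {..<Suc j * m})" if "x \<in> fs.span (kc ` {..<j * m})" for x j
    using that
  proof (induction rule: fs.span_induct_alt)
    case base
    have "app A 0 = 0" by (auto simp: app_def fun_eq_iff)
    then show ?case using fs.span_zero by metis
  next
    case (step r x y)
    then obtain s where s: "s < j * m" "x = kc s" by blast
    have "app A x \<in> fs.span (kc ` {..<Suc j * m})" unfolding s(2) kcA using s(1) by (intro fs.span_base) auto
    then show ?case using step.IH unfolding app_lin by (intro fs.span_add fs.span_scale)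
  qed
  have mono: "fs.span (kc ` {..<j * m}) \<subseteq> fs.span (kc ` {..<Suc j * m})" for j
    by (intro fs.span_mono image_mono) auto
  have im: "(\<lambda>a. if a < n then \<Sum>l<m. v $$ (a,l) * y l else 0) \<in> fs.span (kc ` {..<Suc j * m})" for y j
  proof -
    have "(\<lambda>a. if a < n then \<Sum>l<m. v $$ (a,l) * y l else 0) = (\<Sum>l<m. fscale (y l) (kc l))"
    proof
      fix a
      have "(\<Sum>l<m. fscale (y l) (kc l)) a = (\<Sum>l<m. y l * kc l a)"
      proof -
        have "(\<Sum>l\<in>S. fscale (y l) (kc l)) a = (\<Sum>l\<in>S. y l * kc l a)" for S
          by (induction S rule: infinite_finite_induct) (auto simp: fscale_def)
        then show ?thesis .
      qed
      also have "\<dots> = (if a < n then \<Sum>l<m. v $$ (a,l) * y l else 0)"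
        by (auto simp: kc_def intro!: sum.cong)
      finally show "(if a < n then \<Sum>l<m. v $$ (a,l) * y l else 0) = (\<Sum>l<m. fscale (y l) (kc l)) a" by simp
    qed
    also have "\<dots> \<in> fs.span (kc ` {..<Suc j * m})" by (intro fs.span_sum fs.span_scale fs.span_base) auto
    finally show ?thesis .
  qed
  define kv where "kv j l = (\<lambda>a. if a < n then kpow A v j $$ (a,l) else 0)" for j l
  define kv' where "kv' j l = (\<lambda>a. if a < n then kpow A' v j $$ (a,l) else 0)" for j l
  have kvspan: "kv j l \<in> fs.span (kc ` {..<Suc j * m})" if "l < m" for j l
  proof -
    have "j * m + l < Suc j * m" using that by simp
    moreover have "(j * m + l) div m = j" "(j * m + l) mod m = l"
      using that m div_mult_self3[of m j l] mod_mult_self3[of j m l] by simp_all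
    then have "kc (j * m + l) = kv j l" by (auto simp: kc_def kv_def fun_eq_iff)
    ultimately show ?thesis by (metis fs.span_base imageI lessThan_iff)
  qed
  \<comment> \<open>Induction on the block: A' x = A x - v (e x) + k x, where A raises the block by
    one, v (e x) lies in the span of block 0, and k x stays in the blocks already reached.\<close>
  have diff: "kv' j l - kv j l \<in> fs.span (kc ` {..<j * m})" if l: "l < m" for j l
  proof (induction j)
    case 0
    have "kv' 0 l - kv 0 l = 0" by (auto simp: kv_def kv'_def fun_eq_iff)
    then show ?case using fs.span_zero by metis
  next
    case (Suc j)
    have c1: "kpow A v j \<in> carrier_mat n m" and c2: "kpow A' v j \<in> carrier_mat n m" using A A' v by auto
    have s1: "kv (Suc j) l = app A (kv j l)"
      using A c1 l by (auto simp: kv_def app_def fun_eq_iff scalar_prod_def lessThan_atLeast0)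
    have s2: "kv' (Suc j) l = app A' (kv' j l)"
      using A' c2 l by (auto simp: kv'_def app_def fun_eq_iff scalar_prod_def lessThan_atLeast0)
    have s3: "app A' x = app A x - (\<lambda>a. if a < n then \<Sum>q<m. v $$ (a,q) * (\<Sum>b<n. e $$ (q,b) * x b) else 0) + fscale k x"
      if x: "\<And>a. \<not> a < n \<Longrightarrow> x a = 0" for x
    proof
      fix a
      show "app A' x a = (app A x - (\<lambda>a. if a < n then \<Sum>q<m. v $$ (a,q) * (\<Sum>b<n. e $$ (q,b) * x b) else 0) + fscale k x) a"
      proof (cases "a < n")
        case True
        have "app A' x a = (\<Sum>b<n. (A $$ (a,b) - (\<Sum>q<m. v $$ (a,q) * e $$ (q,b)) + k * (if a = b then 1 else 0)) * x b)"
          unfolding app_def using True A v e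
          by (auto simp: A'_def scalar_prod_def lessThan_atLeast0 intro!: sum.cong)
        also have "\<dots> = (\<Sum>b<n. A $$ (a,b) * x b) - (\<Sum>b<n. \<Sum>q<m. v $$ (a,q) * (e $$ (q,b) * x b)) + (\<Sum>b<n. if a = b then k * x b else 0)"
          unfolding sum_subtractf[symmetric] sum.distrib[symmetric]
          by (intro sum.cong refl) (simp add: algebra_simps sum_distrib_left sum_distrib_right)
        also have "(\<Sum>b<n. \<Sum>q<m. v $$ (a,q) * (e $$ (q,b) * x b)) = (\<Sum>q<m. v $$ (a,q) * (\<Sum>b<n. e $$ (q,b) * x b))"
          by (subst sum.swap) (simp add: sum_distrib_left)
        finally show ?thesis using True by (simp add: app_def fscale_def)
      next
        case False
        then show ?thesis using x by (simp add: app_def fscale_def)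
      qed
    qed
    have z': "kv' j l a = 0" if "\<not> a < n" for a using that by (simp add: kv'_def)
    have step: "kv' j l \<in> fs.span (kc ` {..<Suc j * m})"
    proof -
      have "(kv' j l - kv j l) + kv j l \<in> fs.span (kc ` {..<Suc j * m})"
        by (intro fs.span_add subsetD[OF mono] Suc.IH kvspan[OF l])
      then show ?thesis by (simp only: diff_add_cancel)
    qed
    have d: "app A (kv' j l) - app A (kv j l) = app A (kv' j l - kv j l)"
      using app_lin(1)[of A "kv' j l - kv j l" "kv j l"] by (simp only: diff_add_cancel add_diff_cancel)
    define y where "y = (\<lambda>a. if a < n then \<Sum>q<m. v $$ (a,q) * (\<Sum>b<n. e $$ (q,b) * kv' j l b) else 0)"
    have s3': "app A' (kv' j l) = app A (kv' j l) - y + fscale k (kv' j l)"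
      unfolding y_def by (rule s3) (simp add: z')
    have "kv' (Suc j) l - kv (Suc j) l = app A (kv' j l - kv j l) - y + fscale k (kv' j l)"
      unfolding s1 s2 s3' d[symmetric] by (simp only: algebra_simps)
    also have "\<dots> \<in> fs.span (kc ` {..<Suc j * m})"
      unfolding y_def by (intro fs.span_add fs.span_diff fs.span_scale spanA Suc.IH im step)
    finally show ?case .
  qed
  have "\<exists>C. \<forall>a. (kv' (kblock m t j) (kindex m t c j) - kv (kblock m t j) (kindex m t c j)) a =
      (\<Sum>s<kblock m t j * m. kc s a * C s)" if "j < n" for j
    using fs_span_coordinates[OF diff[of "kindex m t c j" "kblock m t j"]] kindex_less[of n t m r j c] n c that by simp
  then obtain C where C: "\<And>j a. j < n \<Longrightarrow> (kv' (kblock m t j) (kindex m t c j) - kv (kblock m t j) (kindex m t c j)) a =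
      (\<Sum>s<kblock m t j * m. kc s a * C j s)" by metis
  \<comment> \<open>The column operation that turns the Krylov matrix of A into that of A'.\<close>
  define U where "U = mat n n (\<lambda>(s,j). if s = j then 1 else if s < kblock m t j * m then C j s else 0)"
  note bl = kblock_le
  have "kry n m t c A' v = kry n m t c A v * U"
  proof (rule eq_matI)
    fix a j assume "a < dim_row (kry n m t c A v * U)" "j < dim_col (kry n m t c A v * U)"
    then have aj: "a < n" "j < n" by (auto simp: U_def)
    let ?N = "kblock m t j * m"
    have N: "?N \<le> n" "?N \<le> j" "?N \<le> t * m" using bl(1)[of m t j] bl(2)[of m t j] aj by linarith+
    have "(kry n m t c A v * U) $$ (a,j) = (\<Sum>s<n. kry n m t c A v $$ (a,s) * U $$ (s,j))"
      using aj by (simp add: scalar_prod_def lessThan_atLeast0 U_def)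
    also have "\<dots> = (\<Sum>s<n. (if s = j then kry n m t c A v $$ (a,j) else 0) + (if s < ?N then kc s a * C j s else 0))"
    proof (intro sum.cong refl)
      fix s assume "s \<in> {..<n}"
      then have s: "s < n" by simp
      have "kry n m t c A v $$ (a,s) = kc s a" if "s < ?N"
      proof -
        have "s < t * m" using that N by linarith
        then have "kblock m t s = s div m" "kindex m t c s = s mod m" by (auto simp: kblock_def kindex_def)
        then show ?thesis using aj s by (simp add: kry_def kc_def)
      qed
      then show "kry n m t c A v $$ (a,s) * U $$ (s,j) =
        (if s = j then kry n m t c A v $$ (a,j) else 0) + (if s < ?N then kc s a * C j s else 0)"
        using s aj N by (auto simp: U_def)
    qed
    also have "\<dots> = kry n m t c A v $$ (a,j) + (\<Sum>s<n. if s < ?N then kc s a * C j s else 0)"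
      using aj by (simp add: sum.distrib)
    also have "(\<Sum>s<n. if s < ?N then kc s a * C j s else 0) = (\<Sum>s<?N. kc s a * C j s)"
      using N by (intro sum.mono_neutral_cong_right) auto
    also have "\<dots> = kv' (kblock m t j) (kindex m t c j) a - kv (kblock m t j) (kindex m t c j) a"
      using C[OF aj(2), of a] by simp
    finally show "kry n m t c A' v $$ (a,j) = (kry n m t c A v * U) $$ (a,j)"
      using aj by (simp add: kry_def kv_def kv'_def)
  qed (auto simp: U_def)
  moreover have "det U = 1"
  proof -
    have "upper_triangular U" unfolding upper_triangular_def
    proof (intro allI impI)
      fix i j assume "i < dim_row U" "j < i"
      moreover have "kblock m t j * m \<le> j" by (rule bl)
      ultimately show "U $$ (i,j) = 0" by (auto simp: U_def)
    qed
    moreover have "U \<in> carrier_mat n n" by (simp add: U_def)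
    moreover have "diag_mat U = replicate n 1" by (auto simp: diag_mat_def U_def intro: nth_equalityI)
    ultimately show ?thesis by (simp add: det_upper_triangular)
  qed
  moreover have "det (kry n m t c A v * U) = det (kry n m t c A v) * det U" by (intro det_mult) (auto simp: U_def)
  ultimately have "det (kry n m t c A' v) = det (kry n m t c A v)" by simp
  then show "kdet n m t c (point n m (A - v * e + (mtr (v * e) / of_nat n) \<cdot>\<^sub>m 1\<^sub>m n) v) = kdet n m t c (point n m A v)"
    using A v A' by (simp add: kdet_def A'_def[symmetric] k_def[symmetric] carrier_matD)
qed

subsection \<open>The slice\<close>

lemma sum_lessThan_split:
  fixes f :: "nat \<Rightarrow> 'a::comm_monoid_add"
  shows "(\<Sum>l<m + k. f l) = (\<Sum>l<m. f l) + (\<Sum>l<k. f (m + l))"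
  by (induction k) (auto simp: add.assoc)

definition emb :: "nat \<Rightarrow> nat \<Rightarrow> complex mat" where
  "emb N m = mat N m (\<lambda>(i,k). if i = k then 1 else 0)"

lemma emb_carrier [simp]: "emb N m \<in> carrier_mat N m" "dim_row (emb N m) = N" "dim_col (emb N m) = m"
  by (auto simp: emb_def)

lemma mult_emb:
  assumes "G \<in> carrier_mat N' N" "m \<le> N"
  shows "G * emb N m = mat N' m (\<lambda>(i,k). G $$ (i,k))"
proof (rule eq_matI)
  fix i k assume "i < dim_row (mat N' m (\<lambda>(i,k). G $$ (i,k)))" "k < dim_col (mat N' m (\<lambda>(i,k). G $$ (i,k)))"
  then have ik: "i < N'" "k < m" by auto
  have "(G * emb N m) $$ (i,k) = (\<Sum>l<N. G $$ (i,l) * emb N m $$ (l,k))"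
    using mat_mult_entry[OF assms(1) emb_carrier(1) ik] .
  also have "\<dots> = (\<Sum>l<N. if l = k then G $$ (i,k) else 0)"
    using ik by (intro sum.cong) (auto simp: emb_def)
  finally show "(G * emb N m) $$ (i,k) = mat N' m (\<lambda>(i,k). G $$ (i,k)) $$ (i,k)" using ik assms by simp
qed (use assms in auto)

lemma emb_mult_entry:
  assumes "h \<in> carrier_mat m k" "i < N" "j < k"
  shows "(emb N m * h) $$ (i,j) = (if i < m then h $$ (i,j) else 0)"
proof -
  have "(emb N m * h) $$ (i,j) = (\<Sum>l<m. emb N m $$ (i,l) * h $$ (l,j))"
    by (rule mat_mult_entry[OF emb_carrier(1) assms(1,2,3)])
  also have "\<dots> = (\<Sum>l<m. if l = i then h $$ (i,j) else 0)"
    using assms by (intro sum.cong) (auto simp: emb_def)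
  finally show ?thesis by simp
qed

text \<open>Shape of A once v has become the first m basis vectors and exp(V) has cleared the top m
  rows. The lower blocks (A, v) form a pair of the same kind in dimension k, which makes the
  reduction recursive.\<close>

definition lift_mat :: "nat \<Rightarrow> nat \<Rightarrow> complex mat \<Rightarrow> complex mat \<Rightarrow> complex mat" where
  "lift_mat m k v A = four_block_mat (0\<^sub>m m m) (0\<^sub>m m k) v A"

lemma lift_mat_carrier [simp]:
  "A \<in> carrier_mat k k \<Longrightarrow> lift_mat m k v A \<in> carrier_mat (m + k) (m + k)"
  by (auto simp: lift_mat_def)

lemma lift_mat_entry:
  assumes "A \<in> carrier_mat k k" "v \<in> carrier_mat k m" "i < m + k" "j < m + k"
  shows "lift_mat m k v A $$ (i,j) = (if i < m then 0 else if j < m then v $$ (i - m, j) else A $$ (i - m, j - m))"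
  using assms by (auto simp: lift_mat_def)

lemma mtr_lift:
  assumes "A \<in> carrier_mat k k" "v \<in> carrier_mat k m"
  shows "mtr (lift_mat m k v A) = mtr A"
proof -
  have "mtr (lift_mat m k v A) = (\<Sum>i<m + k. lift_mat m k v A $$ (i,i))"
    using assms by (simp add: mtr_def lift_mat_def)
  also have "\<dots> = (\<Sum>i<k. A $$ (i,i))" unfolding sum_lessThan_split
    using assms by (simp add: lift_mat_entry)
  finally show ?thesis using assms by (simp add: mtr_def)
qed

lemma block_diag_mult:
  assumes "P \<in> carrier_mat m m" "P' \<in> carrier_mat m m" "g \<in> carrier_mat k k" "g' \<in> carrier_mat k k"
  shows "four_block_mat P (0\<^sub>m m k) (0\<^sub>m k m) g * four_block_mat P' (0\<^sub>m m k) (0\<^sub>m k m) g' =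
    four_block_mat (P * P') (0\<^sub>m m k) (0\<^sub>m k m) (g * (g' :: complex mat))"
  using assms by (subst mult_four_block_mat[of _ m m _ k _ k _ _ m _ k]) (auto simp: mat_algebra)

lemma block_diag_conj_lift:
  assumes P: "P \<in> carrier_mat m m" "P' \<in> carrier_mat m m" and g: "g \<in> carrier_mat k k" "g' \<in> carrier_mat k k"
    and A: "A \<in> carrier_mat k k" and v: "v \<in> carrier_mat k m"
  shows "four_block_mat P (0\<^sub>m m k) (0\<^sub>m k m) g * lift_mat m k v A * four_block_mat P' (0\<^sub>m m k) (0\<^sub>m k m) g' =
    lift_mat m k (g * v * P') (g * A * g')"
proof -
  have "four_block_mat P (0\<^sub>m m k) (0\<^sub>m k m) g * lift_mat m k v A = lift_mat m k (g * v) (g * A)"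
    unfolding lift_mat_def using P g A v
    by (subst mult_four_block_mat[of _ m m _ k _ k _ _ m _ k]) (auto simp: mat_algebra)
  moreover have "lift_mat m k (g * v) (g * A) * four_block_mat P' (0\<^sub>m m k) (0\<^sub>m k m) g' = lift_mat m k (g * v * P') (g * A * g')"
    unfolding lift_mat_def using P g A v
    by (subst mult_four_block_mat[of _ m m _ k _ k _ _ m _ k]) (auto simp: mat_algebra)
  ultimately show ?thesis by simp
qed

lemma block_diag_emb:
  assumes "P \<in> carrier_mat m m" "g \<in> carrier_mat k k"
  shows "four_block_mat P (0\<^sub>m m k) (0\<^sub>m k m) g * emb (m + k) m = mat (m + k) m (\<lambda>(i,j). if i < m then P $$ (i,j) else 0)"
  using assms by (subst mult_emb[of _ "m + k"]) (auto intro!: eq_matI)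

text \<open>For v = \<open>emb\<close> the product v e is an arbitrary matrix in the top m rows and
  zero below. The scalar c restores tracelessness of the remaining block.\<close>

lemma qconj_clear_top:
  assumes q: "qconj (m + k) m A v M (emb (m + k) m)"
    and A22: "A22 = mat k k (\<lambda>(i,j). M $$ (m + i, m + j)) + c \<cdot>\<^sub>m 1\<^sub>m k" and tr: "mtr A22 = 0"
  shows "qconj (m + k) m A v (lift_mat m k (mat k m (\<lambda>(i,j). M $$ (m + i, j))) A22) (emb (m + k) m)"
proof -
  let ?N = "m + k"
  have M: "M \<in> carrier_mat ?N ?N" using qconj_carrier[OF q] by simp
  \<comment> \<open>The diagonal entries c cancel the part of the added scalar matrix that falls
    into the top rows.\<close>
  define e where "e = mat m ?N (\<lambda>(i,j). M $$ (i,j) + (if i = j then c else 0))"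
  have e: "e \<in> carrier_mat m ?N" by (simp add: e_def)
  have c22: "A22 \<in> carrier_mat k k" "mat k m (\<lambda>(i,j). M $$ (m + i, j)) \<in> carrier_mat k m" by (auto simp: A22)
  have eq: "M - emb ?N m * e + c \<cdot>\<^sub>m 1\<^sub>m ?N = lift_mat m k (mat k m (\<lambda>(i,j). M $$ (m + i, j))) A22"
  proof (rule eq_matI)
    fix i j assume "i < dim_row (lift_mat m k (mat k m (\<lambda>(i,j). M $$ (m + i, j))) A22)"
      "j < dim_col (lift_mat m k (mat k m (\<lambda>(i,j). M $$ (m + i, j))) A22)"
    then have ij: "i < ?N" "j < ?N" using c22 by (auto simp: lift_mat_def)
    have dm: "dim_row (emb ?N m * e) = ?N" "dim_col (emb ?N m * e) = ?N" using e by auto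
    have "(M - emb ?N m * e + c \<cdot>\<^sub>m 1\<^sub>m ?N) $$ (i,j) = M $$ (i,j) - (emb ?N m * e) $$ (i,j) + c * (if i = j then 1 else 0)"
      using ij M dm by (simp del: index_mult_mat(1))
    also have "\<dots> = (if i < m then 0 else M $$ (i,j) + c * (if i = j then 1 else 0))"
      unfolding emb_mult_entry[OF e ij] using ij by (auto simp: e_def)
    also have "\<dots> = lift_mat m k (mat k m (\<lambda>(i,j). M $$ (m + i, j))) A22 $$ (i,j)"
      unfolding lift_mat_entry[OF c22 ij] using ij by (auto simp: A22)
    finally show "(M - emb ?N m * e + c \<cdot>\<^sub>m 1\<^sub>m ?N) $$ (i,j) = lift_mat m k (mat k m (\<lambda>(i,j). M $$ (m + i, j))) A22 $$ (i,j)" .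
  qed (use M e in \<open>auto simp: lift_mat_def A22\<close>)
  have "mtr (M - emb ?N m * e + c \<cdot>\<^sub>m 1\<^sub>m ?N) = 0" unfolding eq using c22 tr by (simp add: mtr_lift)
  from qconj_V[OF q e this] show ?thesis unfolding eq .
qed

text \<open>Each move of the small pair comes from moves of the large one: SL_k embeds as a diagonal
  block, and the shift by \<open>e\<close> is conjugation by the unipotent matrix with upper right
  block \<open>e\<close>, followed by clearing the top rows again.\<close>

lemma qconj_lift:
  assumes "qconj k m A v B u"
  shows "qconj (m + k) m (lift_mat m k v A) (emb (m + k) m) (lift_mat m k u B) (emb (m + k) m)"
  using assms
proof induction
  case qconj_refl
  then show ?case by (intro qconj.qconj_refl) (auto simp: mtr_lift)
next
  case (qconj_SL B u g g')
  note c = qconj_carrier[OF qconj_SL(1)]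
  let ?G = "four_block_mat (1\<^sub>m m) (0\<^sub>m m k) (0\<^sub>m k m) g" and ?G' = "four_block_mat (1\<^sub>m m) (0\<^sub>m m k) (0\<^sub>m k m) g'"
  have "?G * ?G' = 1\<^sub>m (m + k)"
    using qconj_SL(2-4) by (subst block_diag_mult) (auto simp: four_block_one_mat)
  moreover have "det ?G = 1"
    using qconj_SL(2,5) by (subst det_four_block_mat_lower_left_zero) auto
  ultimately have "qconj (m + k) m (lift_mat m k v A) (emb (m + k) m) (?G * lift_mat m k u B * ?G') (?G * emb (m + k) m)"
    using qconj_SL(2,3) by (intro qconj.qconj_SL[OF qconj_SL.IH]) auto
  moreover have "?G * lift_mat m k u B * ?G' = lift_mat m k (g * u) (g * B * g')"
    using qconj_SL(2,3) c by (subst block_diag_conj_lift) (auto simp: mat_algebra)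
  moreover have "?G * emb (m + k) m = emb (m + k) m"
    using qconj_SL(2) by (subst block_diag_emb) (auto simp: emb_def intro!: eq_matI)
  ultimately show ?case by simp
next
  case (qconj_V B u e c)
  note cc = qconj_carrier[OF qconj_V(1)]
  let ?G = "four_block_mat (1\<^sub>m m) e (0\<^sub>m k m) (1\<^sub>m k)" and ?G' = "four_block_mat (1\<^sub>m m) (- e) (0\<^sub>m k m) (1\<^sub>m k)"
  let ?M = "four_block_mat (e * u) (e * u * (- e) + e * B) u (B - u * e)"
  have "?G * ?G' = four_block_mat (1\<^sub>m m) (0\<^sub>m m k) (0\<^sub>m k m) (1\<^sub>m k)"
  proof -
    have "- 0\<^sub>m k k + 1\<^sub>m k = (1\<^sub>m k :: complex mat)" by (intro eq_matI) auto
    then show ?thesis using qconj_V(2)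
      by (subst mult_four_block_mat[of _ m m _ k _ k _ _ m _ k]) (auto simp: mat_algebra)
  qed
  then have 1: "?G * ?G' = 1\<^sub>m (m + k)" by (simp add: four_block_one_mat)
  have 2: "det ?G = 1" using qconj_V(2) by (subst det_four_block_mat_lower_left_zero) auto
  have GG: "?G \<in> carrier_mat (m + k) (m + k)" "?G' \<in> carrier_mat (m + k) (m + k)" by auto
  have q: "qconj (m + k) m (lift_mat m k v A) (emb (m + k) m) (?G * lift_mat m k u B * ?G') (?G * emb (m + k) m)"
    by (rule qconj.qconj_SL[OF qconj_V.IH GG 1 2])
  have "?G * lift_mat m k u B = four_block_mat (e * u) (e * B) u B"
    unfolding lift_mat_def using qconj_V(2) cc
    by (subst mult_four_block_mat[of _ m m _ k _ k _ _ m _ k]) (auto simp: mat_algebra)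
  moreover have "four_block_mat (e * u) (e * B) u B * ?G' = ?M"
    using qconj_V(2) cc
    by (subst mult_four_block_mat[of _ m m _ k _ k _ _ m _ k])
      (auto simp: mat_algebra add_uminus_minus_mat[symmetric] intro!: arg_cong[where f = "four_block_mat _ _ _"] eq_matI)
  ultimately have 3: "?G * lift_mat m k u B * ?G' = ?M" by simp
  have 4: "?G * emb (m + k) m = emb (m + k) m"
    using qconj_V(2) by (subst mult_emb[of _ "m + k"]) (auto simp: emb_def intro!: eq_matI)
  have 5: "mat k m (\<lambda>(i,j). ?M $$ (m + i, j)) = u" "mat k k (\<lambda>(i,j). ?M $$ (m + i, m + j)) = B - u * e"
    using qconj_V(2) cc by (auto intro!: eq_matI)
  show ?case
    using qconj_clear_top[OF q[unfolded 3 4], of "B - u * e + c \<cdot>\<^sub>m 1\<^sub>m k" c] qconj_V(3) unfolding 5 by simp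
qed

fun slice_col :: "nat \<Rightarrow> nat \<Rightarrow> nat \<Rightarrow> complex mat \<Rightarrow> complex mat" where
  "slice_col m r 0 w = w"
| "slice_col m r (Suc t) w = emb (m + (t * m + r)) m"

text \<open>The base pair (B, w) lifted t times. The matrix B is kept as a parameter so that moves
  of the base pair can be carried along by \<open>slice_qconj\<close>; the slice proper has B =
  0.\<close>

fun slice_lin :: "nat \<Rightarrow> nat \<Rightarrow> nat \<Rightarrow> complex mat \<Rightarrow> complex mat \<Rightarrow> complex mat" where
  "slice_lin m r 0 B w = B"
| "slice_lin m r (Suc t) B w = lift_mat m (t * m + r) (slice_col m r t w) (slice_lin m r t B w)"

definition slice :: "nat \<Rightarrow> nat \<Rightarrow> nat \<Rightarrow> complex mat \<Rightarrow> idx \<Rightarrow> complex" where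
  "slice m r t w = point (t * m + r) m (slice_lin m r t (0\<^sub>m r r) w) (slice_col m r t w)"

lemma slice_carrier [simp]:
  "w \<in> carrier_mat r m \<Longrightarrow> slice_col m r t w \<in> carrier_mat (t * m + r) m"
  "B \<in> carrier_mat r r \<Longrightarrow> w \<in> carrier_mat r m \<Longrightarrow> slice_lin m r t B w \<in> carrier_mat (t * m + r) (t * m + r)"
proof -
  show "w \<in> carrier_mat r m \<Longrightarrow> slice_col m r t w \<in> carrier_mat (t * m + r) m" by (cases t) (auto simp: add.assoc)
  show "B \<in> carrier_mat r r \<Longrightarrow> w \<in> carrier_mat r m \<Longrightarrow> slice_lin m r t B w \<in> carrier_mat (t * m + r) (t * m + r)"
  proof (induction t)
    case (Suc t)
    have "m + (t * m + r) = Suc t * m + r" by simp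
    then show ?case using lift_mat_carrier[OF Suc.IH[OF Suc.prems]] by (metis slice_lin.simps(2))
  qed simp
qed

lemma slice_qconj:
  assumes "qconj r m B w B' w'"
  shows "qconj (t * m + r) m (slice_lin m r t B w) (slice_col m r t w) (slice_lin m r t B' w') (slice_col m r t w')"
proof (induction t)
  case 0
  show ?case using assms by simp
next
  case (Suc t)
  have e: "Suc t * m + r = m + (t * m + r)" by simp
  show ?case unfolding e slice_lin.simps slice_col.simps by (rule qconj_lift[OF Suc.IH])
qed

lemma slice_in_qspace:
  assumes "w \<in> carrier_mat r m"
  shows "slice m r t w \<in> qspace (t * m + r) m"
proof -
  have "qconj r m (0\<^sub>m r r) w (0\<^sub>m r r) w" using assms by (intro qconj_refl) (auto simp: mtr_def)
  from qconj_carrier[OF slice_qconj[OF this]] show ?thesis unfolding slice_def by (intro point_in_qspace) auto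
qed

text \<open>SL_r acts on the base pair (0, w), fixing the zero matrix; lifting makes it the residual
  symmetry of the slice.\<close>

lemma slice_SL_invariant:
  assumes "w \<in> carrier_mat r m" "g \<in> carrier_mat r r" "g' \<in> carrier_mat r r" "g * g' = 1\<^sub>m r" "det g = 1"
    "F \<in> inv_alg (t * m + r) m" "r > 0"
  shows "F (slice m r t (g * w)) = F (slice m r t w)"
proof -
  have "qconj r m (0\<^sub>m r r) w (0\<^sub>m r r) w" using assms by (intro qconj_refl) (auto simp: mtr_def)
  from qconj_SL[OF this assms(2-5)] have "qconj r m (0\<^sub>m r r) w (0\<^sub>m r r) (g * w)"
    using assms by (simp add: mat_algebra)
  from qconj_invariants(1)[OF slice_qconj[OF this] _ assms(6)] show ?thesis
    using assms(7) by (simp add: slice_def)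
qed

text \<open>The lifted matrix pushes the first m basis vectors into the lower block; from there on
  the powers are those of the small pair, one step behind.\<close>

lemma kpow_lift:
  assumes A: "A \<in> carrier_mat k k" and v: "v \<in> carrier_mat k m"
  shows "kpow (lift_mat m k v A) (emb (m + k) m) (Suc j) = mat (m + k) m (\<lambda>(i,l). if i < m then 0 else kpow A v j $$ (i - m, l))"
proof (induction j)
  case 0
  show ?case using A v
    by (simp, subst mult_emb[of _ "m + k"]) (auto simp: lift_mat_entry intro!: eq_matI)
next
  case (Suc j)
  let ?X = "mat (m + k) m (\<lambda>(i,l). if i < m then 0 else kpow A v j $$ (i - m, l))"
  have kc: "kpow A v j \<in> carrier_mat k m" using A v by simp
  have L: "lift_mat m k v A \<in> carrier_mat (m + k) (m + k)" using A by simp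
  have "lift_mat m k v A * ?X = mat (m + k) m (\<lambda>(i,l). if i < m then 0 else kpow A v (Suc j) $$ (i - m, l))"
  proof (rule eq_matI)
    fix i l assume "i < dim_row (mat (m + k) m (\<lambda>(i,l). if i < m then 0 else kpow A v (Suc j) $$ (i - m, l)))"
      "l < dim_col (mat (m + k) m (\<lambda>(i,l). if i < m then 0 else kpow A v (Suc j) $$ (i - m, l)))"
    then have il: "i < m + k" "l < m" by auto
    have "(lift_mat m k v A * ?X) $$ (i,l) = (\<Sum>b<m + k. lift_mat m k v A $$ (i,b) * ?X $$ (b,l))"
      by (rule mat_mult_entry[OF L _ il]) simp
    also have "\<dots> = (\<Sum>b<k. lift_mat m k v A $$ (i, m + b) * kpow A v j $$ (b,l))"
      unfolding sum_lessThan_split using il by simp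
    also have "\<dots> = (if i < m then 0 else kpow A v (Suc j) $$ (i - m, l))"
    proof (cases "i < m")
      case False
      then have "i - m < k" using il by simp
      from mat_mult_entry[OF A kc this il(2)] show ?thesis using False il A v by (simp add: lift_mat_entry)
    qed (use il A v in \<open>simp add: lift_mat_entry\<close>)
    finally show "(lift_mat m k v A * ?X) $$ (i,l) = mat (m + k) m (\<lambda>(i,l). if i < m then 0 else kpow A v (Suc j) $$ (i - m, l)) $$ (i,l)"
      using il by simp
  qed (use A v in \<open>auto simp: lift_mat_def\<close>)
  then show ?case using Suc.IH by simp
qed

lemma kry_lift:
  assumes A: "A \<in> carrier_mat k k" and v: "v \<in> carrier_mat k m" and m: "m > 0" and k: "k = t * m + r"
    and c: "\<And>l. l < r \<Longrightarrow> c l < m"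
  shows "kry (m + k) m (Suc t) c (lift_mat m k v A) (emb (m + k) m) =
    four_block_mat (1\<^sub>m m) (0\<^sub>m m k) (0\<^sub>m k m) (kry k m t c A v)" (is "?L = ?R")
proof (rule eq_matI)
  fix i j assume "i < dim_row ?R" "j < dim_col ?R"
  then have ij: "i < m + k" "j < m + k" by auto
  show "?L $$ (i,j) = ?R $$ (i,j)"
  proof (cases "j < m")
    case True
    then have "j < Suc t * m" by simp
    then have "kblock m (Suc t) j = 0" "kindex m (Suc t) c j = j" using True by (auto simp: kblock_def kindex_def)
    then show ?thesis using ij True by (simp add: kry_def emb_def)
  next
    case False
    define j' where "j' = j - m"
    have j: "j = m + j'" "j' < k" using False ij by (auto simp: j'_def)
    have kb: "kblock m (Suc t) (m + j') = Suc (kblock m t j')" "kindex m (Suc t) c (m + j') = kindex m t c j'"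
      using m by (auto simp: kblock_def kindex_def)
    have "kindex m t c j' < m" using kindex_less[of k t m r j' c] k c j by simp
    then show ?thesis unfolding kry_def using ij j
      by (simp add: kb kpow_lift[OF A v] del: kpow.simps)
  qed
qed (auto simp: kry_def)

lemma kdet_lift:
  assumes A: "A \<in> carrier_mat k k" and v: "v \<in> carrier_mat k m" and m: "m > 0" and k: "k = t * m + r"
    and c: "\<And>l. l < r \<Longrightarrow> c l < m"
  shows "det (kry (m + k) m (Suc t) c (lift_mat m k v A) (emb (m + k) m)) = det (kry k m t c A v)"
proof -
  have e: "kry (m + k) m (Suc t) c (lift_mat m k v A) (emb (m + k) m) =
    four_block_mat (1\<^sub>m m) (0\<^sub>m m k) (0\<^sub>m k m) (kry k m t c A v)"
    by (rule kry_lift[OF A v m k c])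
  show ?thesis unfolding e
    by (subst det_four_block_mat_lower_left_zero[of _ m _ k]) auto
qed

lemma kdet_slice:
  assumes w: "w \<in> carrier_mat r m" and m: "m > 0" and c: "\<And>l. l < r \<Longrightarrow> c l < m"
  shows "kdet (t * m + r) m t c (slice m r t w) = det (mat r r (\<lambda>(i,j). w $$ (i, c j)))"
proof -
  have z: "0\<^sub>m r r \<in> carrier_mat r r" by simp
  have "det (kry (t * m + r) m t c (slice_lin m r t (0\<^sub>m r r) w) (slice_col m r t w)) = det (mat r r (\<lambda>(i,j). w $$ (i, c j)))"
  proof (induction t)
    case 0
    show ?case by (simp add: kry_def kblock_def kindex_def)
  next
    case (Suc t)
    have e: "Suc t * m + r = m + (t * m + r)" by simp
    show ?case unfolding e slice_lin.simps slice_col.simps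
      using kdet_lift[OF slice_carrier(2)[OF z w] slice_carrier(1)[OF w] m refl c] Suc.IH by simp
  qed
  then show ?thesis unfolding kdet_def slice_def
    using slice_carrier(2)[OF z w, of t] slice_carrier(1)[OF w, of t] by (simp add: carrier_matD)
qed

lemma inverse_of_det_nonzero:
  assumes "K \<in> carrier_mat n n" "det K \<noteq> (0 :: complex)"
  obtains K' where "K' \<in> carrier_mat n n" "K * K' = 1\<^sub>m n" "K' * K = 1\<^sub>m n" "det K' = inverse (det K)"
proof -
  have "K \<in> Units (ring_mat TYPE(complex) n ())" by (rule det_non_zero_imp_unit[OF assms])
  then obtain K' where K': "K' \<in> carrier_mat n n" "K * K' = 1\<^sub>m n" "K' * K = 1\<^sub>m n"
    unfolding Units_def ring_mat_def by auto
  have "det K * det K' = 1" using det_mult[OF assms(1) K'(1)] K'(2) by simp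
  then have "det K' = inverse (det K)" using assms(2) by (simp add: field_simps)
  with K' that show ?thesis by blast
qed

text \<open>The inverse of the Krylov matrix carries v to the first m basis vectors; after clearing
  the top rows the lower pair has the same Krylov determinant, so the reduction continues. For t = 0
  the first r columns of v are invertible, and exp(V) removes A altogether.\<close>

lemma generic_point_on_slice:
  assumes r: "0 < r" "r \<le> m" and A: "A \<in> carrier_mat (t * m + r) (t * m + r)"
    and v: "v \<in> carrier_mat (t * m + r) m" and tr: "mtr A = 0"
    and det: "det (kry (t * m + r) m t (\<lambda>l. l) A v) \<noteq> 0"
  shows "\<exists>w \<in> carrier_mat r m. qconj (t * m + r) m A v (slice_lin m r t (0\<^sub>m r r) w) (slice_col m r t w)"
  using A v tr det
proof (induction t arbitrary: A v)
  case 0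
  let ?K = "kry r m 0 (\<lambda>l. l) A v"
  have K: "?K \<in> carrier_mat r r" "det ?K \<noteq> 0" using 0(4) unfolding mult_0 add_0 by (simp_all only: kry_carrier simp_thms)
  obtain K' where K': "K' \<in> carrier_mat r r" "?K * K' = 1\<^sub>m r" using inverse_of_det_nonzero[OF K] by blast
  have A: "A \<in> carrier_mat r r" and v: "v \<in> carrier_mat r m" using 0 by auto
  \<comment> \<open>A solution of v e = A: invert the first r columns of v and give the other m - r
    columns coefficient zero.\<close>
  define e where "e = mat m r (\<lambda>(i,j). if i < r then (K' * A) $$ (i,j) else 0)"
  have e: "e \<in> carrier_mat m r" by (simp add: e_def)
  have KA: "K' * A \<in> carrier_mat r r" using K' A by auto
  have ve: "v * e = A"
  proof (rule eq_matI)
    fix i j assume "i < dim_row A" "j < dim_col A"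
    then have ij: "i < r" "j < r" using A by auto
    have "(v * e) $$ (i,j) = (\<Sum>l<m. v $$ (i,l) * e $$ (l,j))" by (rule mat_mult_entry[OF v e ij])
    also have "\<dots> = (\<Sum>l<r. v $$ (i,l) * (K' * A) $$ (l,j))"
      using r ij by (intro sum.mono_neutral_cong_right) (auto simp: e_def)
    also have "\<dots> = (\<Sum>l<r. ?K $$ (i,l) * (K' * A) $$ (l,j))"
      using ij by (intro sum.cong) (auto simp: kry_def kblock_def kindex_def)
    also have "\<dots> = (?K * (K' * A)) $$ (i,j)" by (rule mat_mult_entry[OF K(1) KA ij, symmetric])
    also have "?K * (K' * A) = A" using A K' by (intro mat_inverse_cancel[OF K'(2)]) auto
    finally show "(v * e) $$ (i,j) = A $$ (i,j)" .
  qed (use A v e in auto)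
  have z: "A - v * e + 0 \<cdot>\<^sub>m 1\<^sub>m r = 0\<^sub>m r r" unfolding ve using A by (intro eq_matI) auto
  have "qconj r m A v (A - v * e + 0 \<cdot>\<^sub>m 1\<^sub>m r) v"
  proof (rule qconj_V[OF qconj_refl e])
    show "mtr (A - v * e + 0 \<cdot>\<^sub>m 1\<^sub>m r) = 0" unfolding z by (simp add: mtr_def)
  qed (use A v 0 in auto)
  then show ?case unfolding z using v by (intro bexI[of _ v]) auto
next
  case (Suc t)
  define k where "k = t * m + r"
  have k: "k > 0" "k = t * m + r" "Suc t * m + r = m + k" using r by (auto simp: k_def)
  have m: "m > 0" using r by simp
  let ?N = "m + k"
  have A: "A \<in> carrier_mat ?N ?N" and v: "v \<in> carrier_mat ?N m" and det: "det (kry ?N m (Suc t) (\<lambda>l. l) A v) \<noteq> 0"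
    using Suc.prems unfolding k(3) by auto
  let ?K = "kry ?N m (Suc t) (\<lambda>l. l) A v"
  obtain K' where K': "K' \<in> carrier_mat ?N ?N" "?K * K' = 1\<^sub>m ?N" "K' * ?K = 1\<^sub>m ?N" "det K' = inverse (det ?K)"
    using inverse_of_det_nonzero[OF kry_carrier(1) det] by blast
  have Kemb: "?K * emb ?N m = v"
  proof -
    have "kblock m (Suc t) j = 0" "kindex m (Suc t) (\<lambda>l. l) j = j" if "j < m" for j
      using that by (auto simp: kblock_def kindex_def)
    then show ?thesis using v by (subst mult_emb[of _ ?N]) (auto simp: kry_def intro!: eq_matI)
  qed
  have "K' * (?K * emb ?N m) = emb ?N m" using K' by (intro mat_inverse_cancel[OF K'(3)]) auto
  then have K'v: "K' * v = emb ?N m" by (simp only: Kemb)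
  define d where "d = det ?K"
  \<comment> \<open>Corrects the determinant of K' to 1 by rescaling the last coordinate. As k > 0,
    this coordinate lies beyond the first m, so \<open>emb\<close> stays fixed.\<close>
  define E where "E x = mat ?N ?N (\<lambda>(i,j). if i = j then (if i = ?N - 1 then x else 1) else 0)" for x :: complex
  have Ec: "E x \<in> carrier_mat ?N ?N" for x by (simp add: E_def)
  have EE: "E d * E (inverse d) = 1\<^sub>m ?N"
  proof (rule eq_matI)
    fix i j assume "i < dim_row (1\<^sub>m ?N :: complex mat)" "j < dim_col (1\<^sub>m ?N :: complex mat)"
    then have ij: "i < ?N" "j < ?N" by auto
    have "(E d * E (inverse d)) $$ (i,j) = (\<Sum>l<?N. E d $$ (i,l) * E (inverse d) $$ (l,j))"
      by (rule mat_mult_entry[OF Ec Ec ij])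
    also have "\<dots> = (\<Sum>l<?N. if l = i then E d $$ (i,i) * E (inverse d) $$ (i,j) else 0)"
      using ij by (intro sum.cong) (auto simp: E_def)
    also have "\<dots> = (1\<^sub>m ?N) $$ (i,j)" using ij det by (auto simp: E_def d_def)
    finally show "(E d * E (inverse d)) $$ (i,j) = (1\<^sub>m ?N) $$ (i,j)" .
  qed (auto simp: E_def)
  have detE: "det (E d) = d"
  proof -
    have "det (E d) = prod_list (diag_mat (E d))"
      by (rule det_upper_triangular[OF _ Ec]) (auto simp: upper_triangular_def E_def)
    also have "\<dots> = (\<Prod>i = 0..<?N. E d $$ (i,i))" by (simp add: diag_mat_def E_def prod.distinct_set_conv_list[symmetric] atLeast0LessThan[symmetric])
    also have "\<dots> = (\<Prod>i = 0..<?N. if i = ?N - 1 then d else 1)" by (intro prod.cong) (auto simp: E_def)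
    also have "\<dots> = d" using k by (subst prod.delta) auto
    finally show ?thesis .
  qed
  define g where "g = E d * K'"
  define g' where "g' = ?K * E (inverse d)"
  have g: "g \<in> carrier_mat ?N ?N" "g' \<in> carrier_mat ?N ?N"
    unfolding g_def g'_def by (rule mult_carrier_mat[OF Ec K'(1)], rule mult_carrier_mat[OF kry_carrier(1) Ec])
  have gg: "g * g' = 1\<^sub>m ?N"
  proof -
    have "K' * (?K * E (inverse d)) = E (inverse d)" using K' Ec[of "inverse d"] by (intro mat_inverse_cancel[OF K'(3)]) auto
    moreover have "g * g' = E d * (K' * (?K * E (inverse d)))"
      unfolding g_def g'_def using Ec[of d] K' by (intro mat_assoc) auto
    ultimately show ?thesis using EE by simp
  qed
  have dg: "det g = 1" unfolding g_def using det_mult[OF Ec K'(1), of d] detE K'(4) det by (simp add: d_def)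
  have gv: "g * v = emb ?N m"
  proof -
    have "g * v = E d * (K' * v)" unfolding g_def using Ec[of d] K' v by (intro mat_assoc) auto
    also have "\<dots> = emb ?N m" unfolding K'v using k(1)
      by (subst mult_emb[OF Ec]) (auto simp: emb_def E_def intro!: eq_matI)
    finally show ?thesis .
  qed
  have q1: "qconj ?N m A v (g * A * g') (emb ?N m)"
    using qconj_SL[OF qconj_refl[OF A v Suc.prems(3)] g gg dg] unfolding gv .
  define M where "M = g * A * g'"
  define A21 where "A21 = mat k m (\<lambda>(i,j). M $$ (m + i, j))"
  define B where "B = mat k k (\<lambda>(i,j). M $$ (m + i, m + j))"
  define c where "c = - mtr B / of_nat k"
  define A22 where "A22 = B + c \<cdot>\<^sub>m 1\<^sub>m k"
  have tr22: "mtr A22 = 0" using k(1) unfolding A22_def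
    by (subst mtr_linear) (auto simp: mtr_linear mtr_one c_def B_def)
  have c22: "A22 \<in> carrier_mat k k" "A21 \<in> carrier_mat k m" by (auto simp: A22_def B_def A21_def)
  have q2: "qconj ?N m A v (lift_mat m k A21 A22) (emb ?N m)"
    unfolding A21_def by (rule qconj_clear_top[OF q1[folded M_def] A22_def[unfolded B_def] tr22])
  \<comment> \<open>Invariance of the Krylov determinant passes its nonvanishing on to the smaller
    pair, as the induction hypothesis demands.\<close>
  have "kdet ?N m (Suc t) (\<lambda>l. l) (point ?N m A v) = kdet ?N m (Suc t) (\<lambda>l. l) (point ?N m (lift_mat m k A21 A22) (emb ?N m))"
  proof (rule qconj_invariants(1)[OF q2])
    show "kdet ?N m (Suc t) (\<lambda>l. l) \<in> inv_alg ?N m"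
      using r by (intro kdet_invariant[where r = r]) (auto simp: k)
  qed (use k in simp)
  then have "det ?K = det (kry ?N m (Suc t) (\<lambda>l. l) (lift_mat m k A21 A22) (emb ?N m))"
    using A v lift_mat_carrier[OF c22(1), of m A21] by (simp add: kdet_def carrier_matD)
  also have "\<dots> = det (kry k m t (\<lambda>l. l) A22 A21)" using r by (intro kdet_lift[OF c22 m k(2)]) auto
  finally have "det (kry k m t (\<lambda>l. l) A22 A21) \<noteq> 0" using det by simp
  then obtain w where w: "w \<in> carrier_mat r m"
    "qconj k m A22 A21 (slice_lin m r t (0\<^sub>m r r) w) (slice_col m r t w)"
    using Suc.IH[of A22 A21] c22 tr22 unfolding k_def by blast
  from qconj_trans[OF qconj_lift[OF w(2)] q2] show ?case
    using w(1) unfolding k(3) by (intro bexI[of _ w]) (auto simp: k_def)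
qed

text \<open>Right multiplication of w by \<open>h\<close> is the action of GL_m on the copies,
  corrected at every level of the slice by a change of basis.\<close>

lemma slice_right_action:
  assumes w: "w \<in> carrier_mat r m" and h: "h \<in> carrier_mat m m" "h' \<in> carrier_mat m m" "h * h' = 1\<^sub>m m"
  shows "stab_dim (t * m + r) m (slice m r t (w * h)) = stab_dim (t * m + r) m (slice m r t w)"
proof -
  have h'h: "h' * h = 1\<^sub>m m" using mat_mult_left_right_inverse[OF h] .
  have z: "0\<^sub>m r r \<in> carrier_mat r r" by simp
  have wh: "w * h \<in> carrier_mat r m" using w h by simp
  have "\<exists>g g'. g \<in> carrier_mat (t * m + r) (t * m + r) \<and> g' \<in> carrier_mat (t * m + r) (t * m + r) \<and>
    g * g' = 1\<^sub>m (t * m + r) \<and> g * slice_lin m r t (0\<^sub>m r r) w * g' = slice_lin m r t (0\<^sub>m r r) (w * h) \<and>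
    g * slice_col m r t w * h = slice_col m r t (w * h)"
  proof (induction t)
    case 0
    show ?case using w h by (intro exI[of _ "1\<^sub>m r"]) (auto simp: mat_algebra)
  next
    case (Suc t)
    define k where "k = t * m + r"
    have e: "Suc t * m + r = m + k" by (simp add: k_def)
    obtain g g' where g: "g \<in> carrier_mat k k" "g' \<in> carrier_mat k k" "g * g' = 1\<^sub>m k"
      "g * slice_lin m r t (0\<^sub>m r r) w * g' = slice_lin m r t (0\<^sub>m r r) (w * h)"
      "g * slice_col m r t w * h = slice_col m r t (w * h)" using Suc.IH unfolding k_def by blast
    \<comment> \<open>The inverse of \<open>h\<close> acts on the first m basis vectors, so that
      mixing the copies by \<open>h\<close> afterwards restores \<open>emb\<close>.\<close>
    let ?G = "four_block_mat h' (0\<^sub>m m k) (0\<^sub>m k m) g" and ?G' = "four_block_mat h (0\<^sub>m m k) (0\<^sub>m k m) g'"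
    have 1: "?G * ?G' = 1\<^sub>m (m + k)" using g h h'h by (subst block_diag_mult) (auto simp: four_block_one_mat)
    have 2: "?G * lift_mat m k (slice_col m r t w) (slice_lin m r t (0\<^sub>m r r) w) * ?G' =
      lift_mat m k (slice_col m r t (w * h)) (slice_lin m r t (0\<^sub>m r r) (w * h))"
      unfolding g(4,5)[symmetric]
      using slice_carrier(1)[OF w, of t] slice_carrier(2)[OF z w, of t] g h unfolding k_def[symmetric]
      by (intro block_diag_conj_lift) auto
    have 3: "?G * emb (m + k) m * h = emb (m + k) m"
    proof (rule eq_matI)
      let ?P = "mat (m + k) m (\<lambda>(i,j). if i < m then h' $$ (i,j) else 0)"
      have P: "?G * emb (m + k) m = ?P" using g h by (intro block_diag_emb) auto
      fix i j assume "i < dim_row (emb (m + k) m)" "j < dim_col (emb (m + k) m)"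
      then have ij: "i < m + k" "j < m" by auto
      have "(?P * h) $$ (i,j) = (\<Sum>l<m. ?P $$ (i,l) * h $$ (l,j))" by (rule mat_mult_entry[OF _ h(1) ij]) simp
      also have "\<dots> = (if i < m then (h' * h) $$ (i,j) else 0)"
        using ij mat_mult_entry[OF h(2,1), of i j] by simp
      also have "\<dots> = emb (m + k) m $$ (i,j)" unfolding h'h using ij by (simp add: emb_def)
      finally show "(?G * emb (m + k) m * h) $$ (i,j) = emb (m + k) m $$ (i,j)" unfolding P .
    qed (use g h in auto)
    show ?case unfolding e slice_lin.simps slice_col.simps k_def[symmetric]
      using 1 2 3 g h by (intro exI[of _ ?G] exI[of _ ?G']) auto
  qed
  then obtain g g' where g: "g \<in> carrier_mat (t * m + r) (t * m + r)" "g' \<in> carrier_mat (t * m + r) (t * m + r)"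
    "g * g' = 1\<^sub>m (t * m + r)" "g * slice_lin m r t (0\<^sub>m r r) w * g' = slice_lin m r t (0\<^sub>m r r) (w * h)"
    "g * slice_col m r t w * h = slice_col m r t (w * h)" by blast
  show ?thesis unfolding slice_def g(4,5)[symmetric]
    by (rule stab_dim_conj[OF slice_carrier(2)[OF z w] slice_carrier(1)[OF w] g(1-3) h])
qed

text \<open>Passes from coordinate functions, to which \<open>poly_fun\<close> applies, to
  matrices.\<close>

definition wmat :: "nat \<Rightarrow> nat \<Rightarrow> (nat \<times> nat \<Rightarrow> complex) \<Rightarrow> complex mat" where
  "wmat r m x = mat r m x"

lemma wmat_carrier [simp]: "wmat r m x \<in> carrier_mat r m"
  by (simp add: wmat_def)

lemma wmat_surj: "w \<in> carrier_mat r m \<Longrightarrow> wmat r m (($$) w) = w"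
  by (auto simp: wmat_def intro!: eq_matI)

lemma slice_poly_fun: "(\<lambda>x. slice m r t (wmat r m x) c) \<in> poly_fun UNIV"
proof -
  have col: "(\<lambda>x. slice_col m r t (wmat r m x) $$ (i,k)) \<in> poly_fun UNIV" if "i < t * m + r" "k < m" for i k t
    using that by (cases t) (auto simp: wmat_def emb_def intro!: poly_fun_intros)
  have lin: "(\<lambda>x. slice_lin m r t (0\<^sub>m r r) (wmat r m x) $$ (i,j)) \<in> poly_fun UNIV"
    if "i < t * m + r" "j < t * m + r" for i j t
    using that
  proof (induction t arbitrary: i j)
    case 0
    then show ?case by (auto intro!: poly_fun_intros)
  next
    case (Suc t)
    define k where "k = t * m + r"
    have z: "0\<^sub>m r r \<in> carrier_mat r r" by simp
    have ij: "i < m + k" "j < m + k" using Suc.prems by (auto simp: k_def)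
    have eq: "slice_lin m r (Suc t) (0\<^sub>m r r) (wmat r m x) $$ (i,j) = (if i < m then 0 else if j < m
        then slice_col m r t (wmat r m x) $$ (i - m, j) else slice_lin m r t (0\<^sub>m r r) (wmat r m x) $$ (i - m, j - m))" for x
      unfolding slice_lin.simps
      using lift_mat_entry[OF slice_carrier(2)[OF z wmat_carrier[of r m x], of t] slice_carrier(1)[OF wmat_carrier[of r m x], of t], of i j] ij
      by (simp add: k_def)
    have "i - m < t * m + r" if "\<not> i < m" using that ij by (simp add: k_def) 
    moreover have "j - m < t * m + r" if "\<not> j < m" using that ij by (simp add: k_def)
    ultimately show ?case unfolding eq
      by (cases "i < m"; cases "j < m") (auto intro!: pf_const col Suc.IH)
  qed
  show ?thesis
  proof (cases "in_range (t * m + r) m c")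
    case True
    then show ?thesis unfolding slice_def point_def
      by (cases c) (auto simp: in_range_def intro!: col lin)
  next
    case False
    then show ?thesis unfolding slice_def point_def by (simp add: pf_const)
  qed
qed

lemma slice_compose_poly_fun: "F \<in> poly_fun I \<Longrightarrow> (\<lambda>x. F (slice m r t (wmat r m x))) \<in> poly_fun UNIV"
  by (rule poly_fun_compose[where g = "\<lambda>x. slice m r t (wmat r m x)"]) (auto intro: slice_poly_fun)

subsection \<open>Invariants are determined on the slice\<close>

definition minor :: "nat \<Rightarrow> (nat \<Rightarrow> nat) \<Rightarrow> complex mat \<Rightarrow> complex" where
  "minor r c w = det (mat r r (\<lambda>(i,j). w $$ (i, c j)))"

lemma minor_mult:
  assumes g: "g \<in> carrier_mat r r" and w: "w \<in> carrier_mat r m" and c: "\<And>l. l < r \<Longrightarrow> c l < m"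
  shows "minor r c (g * w) = det g * minor r c w"
proof -
  let ?w = "mat r r (\<lambda>(i,j). w $$ (i, c j))"
  have "mat r r (\<lambda>(i,j). (g * w) $$ (i, c j)) = g * ?w"
  proof (rule eq_matI)
    fix i j assume "i < dim_row (g * ?w)" "j < dim_col (g * ?w)"
    then have ij: "i < r" "j < r" using g by auto
    have "(g * ?w) $$ (i,j) = (\<Sum>l<r. g $$ (i,l) * ?w $$ (l,j))" by (rule mat_mult_entry[OF g _ ij]) simp
    also have "\<dots> = (g * w) $$ (i, c j)" using ij mat_mult_entry[OF g w ij(1) c[OF ij(2)]] by simp
    finally show "mat r r (\<lambda>(i,j). (g * w) $$ (i, c j)) $$ (i,j) = (g * ?w) $$ (i,j)" using ij by simp
  qed (use g in auto)
  then show ?thesis unfolding minor_def using det_mult[OF g, of ?w] by simp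
qed

lemma minor_poly_fun:
  assumes "\<And>l. l < r \<Longrightarrow> c l < m"
  shows "(\<lambda>x. minor r c (wmat r m x)) \<in> poly_fun UNIV"
  unfolding minor_def wmat_def using assms by (intro det_poly_fun) (auto intro: poly_fun_intros)

lemma minor_emb: "r \<le> m \<Longrightarrow> minor r (\<lambda>l. l) (emb r m) = 1"
proof -
  assume "r \<le> m"
  then have "mat r r (\<lambda>(i,j). emb r m $$ (i,j)) = 1\<^sub>m r" by (auto simp: emb_def intro!: eq_matI)
  then show ?thesis by (simp add: minor_def)
qed

lemma generic_slice_point:
  assumes r: "0 < r" "r \<le> m" and \<gamma>: "\<gamma> \<in> qspace (t * m + r) m" and nz: "kdet (t * m + r) m t (\<lambda>l. l) \<gamma> \<noteq> 0"
  obtains w where "w \<in> carrier_mat r m" "\<And>F. F \<in> inv_alg (t * m + r) m \<Longrightarrow> F \<gamma> = F (slice m r t w)"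
    "stab_dim (t * m + r) m \<gamma> = stab_dim (t * m + r) m (slice m r t w)"
proof -
  obtain A v where A: "A \<in> carrier_mat (t * m + r) (t * m + r)" "v \<in> carrier_mat (t * m + r) m" "mtr A = 0"
    "\<gamma> = point (t * m + r) m A v" using qdual_cases[OF \<gamma>] by blast
  have "det (kry (t * m + r) m t (\<lambda>l. l) A v) \<noteq> 0" using nz A by (simp add: kdet_def)
  then obtain w where w: "w \<in> carrier_mat r m"
    "qconj (t * m + r) m A v (slice_lin m r t (0\<^sub>m r r) w) (slice_col m r t w)"
    using generic_point_on_slice[OF r A(1-3)] by blast
  show ?thesis
    using that[OF w(1)] qconj_invariants[OF w(2)] r(1) A(4) unfolding slice_def by simp
qed

lemma kdet_nonzero_somewhere:
  assumes r: "0 < r" "r \<le> m"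
  shows "\<exists>\<gamma>\<in>qspace (t * m + r) m. kdet (t * m + r) m t (\<lambda>l. l) \<gamma> \<noteq> 0"
  using kdet_slice[OF emb_carrier(1)[of r m], of "\<lambda>l. l" t] r minor_emb[OF r(2)] slice_in_qspace[OF emb_carrier(1)[of r m], of t]
  by (intro bexI[of _ "slice m r t (emb r m)"]) (auto simp: minor_def)

text \<open>The orbits through the slice contain every point with nonzero Krylov determinant, hence
  a dense set; restriction to the slice is therefore injective on invariants.\<close>

lemma inv_alg_ext:
  assumes r: "0 < r" "r \<le> m" and F: "F \<in> inv_alg (t * m + r) m" and G: "G \<in> inv_alg (t * m + r) m"
    and eq: "\<And>w. w \<in> carrier_mat r m \<Longrightarrow> F (slice m r t w) = G (slice m r t w)"
    and \<gamma>: "\<gamma> \<in> qspace (t * m + r) m"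
  shows "F \<gamma> = G \<gamma>"
proof -
  obtain \<gamma>0 where g0: "\<gamma>0 \<in> qspace (t * m + r) m" "kdet (t * m + r) m t (\<lambda>l. l) \<gamma>0 \<noteq> 0"
    using kdet_nonzero_somewhere[OF r] by blast
  have kp: "kdet (t * m + r) m t (\<lambda>l. l) \<in> poly_fun UNIV" using r by (intro kdet_poly_fun[where r = r]) auto
  show ?thesis
  proof (rule poly_fun_dense_eq[OF line_closed_qspace kp inv_algD(1)[OF F] inv_algD(1)[OF G] g0 _ \<gamma>])
    fix z assume z: "z \<in> qspace (t * m + r) m" "kdet (t * m + r) m t (\<lambda>l. l) z \<noteq> 0"
    show "F z = G z"
    proof (rule generic_slice_point[OF r z])
      fix w assume w: "w \<in> carrier_mat r m" and e: "\<And>F. F \<in> inv_alg (t * m + r) m \<Longrightarrow> F z = F (slice m r t w)"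
      show "F z = G z" using e[OF F] e[OF G] eq[OF w] by simp
    qed
  qed
qed

lemma inv_alg_compose:
  assumes P: "P \<in> poly_fun {..<k::nat}" and Fs: "\<And>i. i < k \<Longrightarrow> Fs i \<in> inv_alg n m"
  shows "(\<lambda>\<gamma>. P (\<lambda>i. Fs i \<gamma>)) \<in> inv_alg n m"
proof -
  have "(\<lambda>\<gamma>. P (\<lambda>i. Fs i \<gamma>)) \<in> poly_fun UNIV"
    by (rule poly_fun_compose[OF P]) (use Fs in \<open>auto simp: inv_alg_def\<close>)
  have c: "P (\<lambda>i. Fs i x) = P (\<lambda>i. Fs i y)" if "\<And>i. i < k \<Longrightarrow> Fs i x = Fs i y" for x y
    by (rule poly_fun_cong[OF P]) (use that in auto)
  show ?thesis unfolding inv_alg_def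
  proof (intro CollectI conjI ballI allI impI)
    show "(\<lambda>\<gamma>. P (\<lambda>i. Fs i \<gamma>)) \<in> poly_fun UNIV" by fact
    show "P (\<lambda>i. Fs i (act_SL n m g h \<gamma>)) = P (\<lambda>i. Fs i \<gamma>)" if "\<gamma> \<in> qspace n m" "is_SL n g h" for \<gamma> g h
      by (rule c) (use Fs that in \<open>auto simp: inv_alg_def\<close>)
    show "P (\<lambda>i. Fs i (act_V n m \<eta> \<gamma>)) = P (\<lambda>i. Fs i \<gamma>)" if "\<gamma> \<in> qspace n m" for \<gamma> \<eta>
      by (rule c) (use Fs that in \<open>auto simp: inv_alg_def\<close>)
  qed
qed

definition SL_invariant :: "nat \<Rightarrow> nat \<Rightarrow> (complex mat \<Rightarrow> complex) \<Rightarrow> bool" where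
  "SL_invariant r m \<Phi> \<longleftrightarrow> (\<lambda>x. \<Phi> (wmat r m x)) \<in> poly_fun UNIV \<and>
     (\<forall>w\<in>carrier_mat r m. \<forall>g\<in>carrier_mat r r. \<forall>g'\<in>carrier_mat r r. g * g' = 1\<^sub>m r \<longrightarrow> det g = 1 \<longrightarrow> \<Phi> (g * w) = \<Phi> w)"

lemma slice_restriction_SL_invariant:
  assumes "F \<in> inv_alg (t * m + r) m" "r > 0"
  shows "SL_invariant r m (\<lambda>w. F (slice m r t w))"
  unfolding SL_invariant_def
  using slice_compose_poly_fun[OF inv_algD(1)[OF assms(1)]] slice_SL_invariant[OF _ _ _ _ _ assms] by blast

text \<open>Restriction to the slice is injective on invariants and each minor has a Krylov
  determinant above it, so a free system of minors generating the SL_r-invariants lifts to a free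
  system of generators.\<close>

lemma polynomial_ring_criterion:
  fixes k :: nat and c :: "nat \<Rightarrow> nat \<Rightarrow> nat"
  assumes r: "0 < r" "r \<le> m" and c: "\<And>i l. i < k \<Longrightarrow> l < r \<Longrightarrow> c i l < m"
    and ind: "\<And>P. P \<in> poly_fun {..<k} \<Longrightarrow> (\<And>w. w \<in> carrier_mat r m \<Longrightarrow> P (\<lambda>i. minor r (c i) w) = 0) \<Longrightarrow> \<forall>y. P y = 0"
    and gen: "\<And>\<Phi>. SL_invariant r m \<Phi> \<Longrightarrow> \<exists>P\<in>poly_fun {..<k}. \<forall>w\<in>carrier_mat r m. \<Phi> w = P (\<lambda>i. minor r (c i) w)"
  shows "inv_polynomial_ring (t * m + r) m"
proof -
  let ?n = "t * m + r"
  define Fs where "Fs i = kdet ?n m t (c i)" for i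
  have m: "m > 0" using r by simp
  have Fs: "Fs i \<in> inv_alg ?n m" if "i < k" for i
    unfolding Fs_def using that c m by (intro kdet_invariant[where r = r]) auto
  have Fw: "Fs i (slice m r t w) = minor r (c i) w" if "i < k" "w \<in> carrier_mat r m" for i w
    unfolding Fs_def minor_def using kdet_slice[OF that(2) m c[OF that(1)]] by simp
  have PF: "P (\<lambda>i. Fs i (slice m r t w)) = P (\<lambda>i. minor r (c i) w)" if "P \<in> poly_fun {..<k}" "w \<in> carrier_mat r m" for P w
    by (rule poly_fun_cong[OF that(1)]) (use Fw that(2) in auto)
  show ?thesis unfolding inv_polynomial_ring_def
  proof (intro exI[of _ k] exI[of _ Fs] conjI ballI allI impI)
    fix P y assume P: "P \<in> poly_fun {..<k}" and z: "\<forall>\<gamma>\<in>qspace ?n m. P (\<lambda>i. Fs i \<gamma>) = 0"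
    have "P (\<lambda>i. minor r (c i) w) = 0" if "w \<in> carrier_mat r m" for w
      using z slice_in_qspace[OF that, of t] PF[OF P that] by auto
    then show "P y = 0" using ind[OF P] by blast
  next
    fix F assume F: "F \<in> inv_alg ?n m"
    obtain P where P: "P \<in> poly_fun {..<k}" "\<And>w. w \<in> carrier_mat r m \<Longrightarrow> F (slice m r t w) = P (\<lambda>i. minor r (c i) w)"
      using gen[OF slice_restriction_SL_invariant[OF F r(1)]] by blast
    show "\<exists>P\<in>poly_fun {..<k}. \<forall>\<gamma>\<in>qspace ?n m. F \<gamma> = P (\<lambda>i. Fs i \<gamma>)"
    proof (intro bexI[OF _ P(1)] ballI)
      fix \<gamma> assume g: "\<gamma> \<in> qspace ?n m"
      show "F \<gamma> = P (\<lambda>i. Fs i \<gamma>)"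
        by (rule inv_alg_ext[OF r F inv_alg_compose[OF P(1) Fs] _ g]) (use P(2) PF[OF P(1)] in simp_all)
    qed
  qed (use Fs in auto)
qed

subsection \<open>The three polynomial cases\<close>

text \<open>SL_1 is trivial, so every polynomial in the single row w is invariant, and the 1 by 1
  minors are its coordinates.\<close>

lemma polynomial_ring_remainder_1:
  assumes "0 < m"
  shows "inv_polynomial_ring (t * m + 1) m"
proof (rule polynomial_ring_criterion[where k = m and c = "\<lambda>i l. i"])
  have minor: "minor 1 (\<lambda>l. i) w = w $$ (0,i)" for i w
    unfolding minor_def by (subst det_single) auto
  define W where "W y = wmat 1 m (\<lambda>(a,k). if k < m then y k else 0)" for y :: "nat \<Rightarrow> complex"
  have W: "W y \<in> carrier_mat 1 m" "\<And>i. i < m \<Longrightarrow> W y $$ (0,i) = y i" for y by (auto simp: W_def wmat_def)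
  show "\<forall>y. P y = 0" if P: "P \<in> poly_fun {..<m}" and z: "\<And>w. w \<in> carrier_mat 1 m \<Longrightarrow> P (\<lambda>i. minor 1 (\<lambda>l. i) w) = 0" for P
  proof
    fix y
    have "P y = P (\<lambda>i. minor 1 (\<lambda>l. i) (W y))" by (rule poly_fun_cong[OF P]) (auto simp: minor minor[unfolded One_nat_def] W)
    then show "P y = 0" using z[OF W(1)] by simp
  qed
  show "\<exists>P\<in>poly_fun {..<m}. \<forall>w\<in>carrier_mat 1 m. \<Phi> w = P (\<lambda>i. minor 1 (\<lambda>l. i) w)" if \<Phi>: "SL_invariant 1 m \<Phi>" for \<Phi> :: "complex mat \<Rightarrow> complex"
  proof (intro bexI[of _ "\<lambda>y. \<Phi> (W y)"] ballI)
    fix w :: "complex mat" assume w: "w \<in> carrier_mat 1 m"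
    have "W (\<lambda>i. minor 1 (\<lambda>l. i) w) = w" using w by (auto simp: minor minor[unfolded One_nat_def] W_def wmat_def intro!: eq_matI)
    then show "\<Phi> w = \<Phi> (W (\<lambda>i. minor 1 (\<lambda>l. i) w))" by simp
  next
    have "(\<lambda>x. \<Phi> (wmat 1 m x)) \<in> poly_fun UNIV" using \<Phi> by (simp add: SL_invariant_def)
    then show "(\<lambda>y. \<Phi> (W y)) \<in> poly_fun {..<m}" unfolding W_def
    proof (rule poly_fun_compose[of _ _ "\<lambda>y (a,k). if k < m then y k else 0"])
      fix ij :: "nat \<times> nat"
      show "(\<lambda>y. case ij of (a,k) \<Rightarrow> if k < m then y k else 0) \<in> poly_fun {..<m}"
        by (cases ij; cases "snd ij < m") (auto intro: pf_const pf_var)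
    qed
  qed
qed (use assms in auto)

text \<open>A representative of the matrices of determinant d modulo SL_r, depending polynomially on
  d.\<close>

definition first_diag :: "nat \<Rightarrow> complex \<Rightarrow> complex mat" where
  "first_diag r d = mat r r (\<lambda>(i,j). if i = j then (if i = 0 then d else 1) else 0)"

lemma first_diag_carrier [simp]: "first_diag r d \<in> carrier_mat r r" "dim_row (first_diag r d) = r" "dim_col (first_diag r d) = r"
  by (auto simp: first_diag_def)

lemma first_diag_mult_entry:
  assumes "w \<in> carrier_mat r m" "i < r" "j < m"
  shows "(first_diag r d * w) $$ (i,j) = (if i = 0 then d else 1) * w $$ (i,j)"
proof -
  have "(first_diag r d * w) $$ (i,j) = (\<Sum>l<r. first_diag r d $$ (i,l) * w $$ (l,j))"
    by (rule mat_mult_entry[OF first_diag_carrier(1) assms])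
  also have "\<dots> = (\<Sum>l<r. if l = i then (if i = 0 then d else 1) * w $$ (i,j) else 0)"
    using assms by (intro sum.cong) (auto simp: first_diag_def)
  finally show ?thesis using assms by simp
qed

lemma first_diag_mult: "first_diag r a * first_diag r b = first_diag r (a * b)"
proof (rule eq_matI)
  fix i j assume "i < dim_row (first_diag r (a * b))" "j < dim_col (first_diag r (a * b))"
  then have "i < r" "j < r" by auto
  then show "(first_diag r a * first_diag r b) $$ (i,j) = first_diag r (a * b) $$ (i,j)"
    using first_diag_mult_entry[OF first_diag_carrier(1), of i r j a b] by (simp add: first_diag_def del: index_mult_mat(1))
qed auto

lemma first_diag_one: "first_diag r 1 = 1\<^sub>m r"
  by (auto simp: first_diag_def intro!: eq_matI)

lemma det_first_diag: "r > 0 \<Longrightarrow> det (first_diag r d) = d"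
proof -
  assume r: "r > 0"
  have "det (first_diag r d) = prod_list (diag_mat (first_diag r d))"
    by (rule det_upper_triangular[of _ r]) (auto simp: upper_triangular_def first_diag_def)
  also have "\<dots> = (\<Prod>i = 0..<r. first_diag r d $$ (i,i))"
    by (simp add: diag_mat_def prod.distinct_set_conv_list[symmetric] atLeast0LessThan[symmetric])
  also have "\<dots> = (\<Prod>i = 0..<r. if i = 0 then d else 1)" by (intro prod.cong) (auto simp: first_diag_def)
  also have "\<dots> = d" using r by (subst prod.delta) auto
  finally show ?thesis .
qed

lemma normalize_by_SL:
  assumes \<Phi>: "SL_invariant r m \<Phi>" and r: "r > 0" and M: "M \<in> carrier_mat r r" "det M = d" "d \<noteq> 0" and w: "w \<in> carrier_mat r m"
  shows "\<Phi> (M * w) = \<Phi> (first_diag r d * w)"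
proof -
  obtain M' where M': "M' \<in> carrier_mat r r" "M * M' = 1\<^sub>m r" "M' * M = 1\<^sub>m r"
    using inverse_of_det_nonzero[OF M(1)] M by blast
  let ?g = "M * first_diag r (inverse d)" and ?g' = "first_diag r d * M'"
  have fd: "first_diag r (inverse d) * first_diag r d = 1\<^sub>m r" using M by (simp add: first_diag_mult first_diag_one)
  have "?g * ?g' = M * (first_diag r (inverse d) * (first_diag r d * M'))" using M M' by (simp add: mat_algebra)
  also have "\<dots> = M * M'" using M' by (simp add: mat_inverse_cancel[OF fd])
  finally have 1: "?g * ?g' = 1\<^sub>m r" using M' by simp
  have 2: "det ?g = 1" using det_mult[OF M(1) first_diag_carrier(1)] M r by (simp add: det_first_diag)
  have "?g * (first_diag r d * w) = M * (first_diag r (inverse d) * (first_diag r d * w))" using M w by (simp add: mat_algebra)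
  also have "\<dots> = M * w" using w by (simp add: mat_inverse_cancel[OF fd])
  finally have 3: "?g * (first_diag r d * w) = M * w" .
  have "first_diag r d * w \<in> carrier_mat r m" "?g \<in> carrier_mat r r" "?g' \<in> carrier_mat r r" using M M' w by auto
  then show ?thesis using \<Phi> 1 2 3 unfolding SL_invariant_def by metis
qed

text \<open>An invertible square w is SL_m-equivalent to \<open>first_diag m (det w)\<close>, so an
  invariant is a polynomial in the determinant, first on a dense set and then everywhere.\<close>

lemma polynomial_ring_remainder_0:
  assumes m: "0 < m"
  shows "inv_polynomial_ring (t * m + m) m"
proof (rule polynomial_ring_criterion[where k = 1 and c = "\<lambda>i l. l"])
  have minor: "minor m (\<lambda>l. l) w = det w" if "w \<in> carrier_mat m m" for w
  proof -
    have "mat m m (\<lambda>(i,j). w $$ (i,j)) = w" using that by (auto intro!: eq_matI)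
    then show ?thesis by (simp add: minor_def)
  qed
  show "\<forall>y. P y = 0" if P: "P \<in> poly_fun {..<1::nat}" and z: "\<And>w. w \<in> carrier_mat m m \<Longrightarrow> P (\<lambda>i. minor m (\<lambda>l. l) w) = 0" for P
  proof
    fix y :: "nat \<Rightarrow> complex"
    have "P y = P (\<lambda>i. minor m (\<lambda>l. l) (first_diag m (y 0)))"
      by (rule poly_fun_cong[OF P]) (auto simp: minor det_first_diag m)
    then show "P y = 0" using z[OF first_diag_carrier(1)] by simp
  qed
  show "\<exists>P\<in>poly_fun {..<1::nat}. \<forall>w\<in>carrier_mat m m. \<Phi> w = P (\<lambda>i. minor m (\<lambda>l. l) w)" if \<Phi>: "SL_invariant m m \<Phi>" for \<Phi>
  proof -
    have poly: "(\<lambda>x. \<Phi> (wmat m m x)) \<in> poly_fun UNIV" using \<Phi> by (simp add: SL_invariant_def)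
    have fd: "first_diag m d = wmat m m (\<lambda>(i,j). if i = j then (if i = 0 then d else 1) else 0)" for d
      by (simp add: first_diag_def wmat_def)
    have P: "(\<lambda>y. \<Phi> (first_diag m (y 0))) \<in> poly_fun {..<1::nat}"
      unfolding fd
    proof (rule poly_fun_compose[OF poly, of "\<lambda>y (i,j). if i = j then (if i = 0 then y 0 else 1) else 0"])
      fix ij :: "nat \<times> nat"
      show "(\<lambda>y. case ij of (i,j) \<Rightarrow> if i = j then (if i = 0 then y 0 else 1) else 0) \<in> poly_fun {..<1::nat}"
        by (cases ij; cases "fst ij = snd ij"; cases "fst ij = 0") (auto intro: pf_const pf_var)
    qed
    \<comment> \<open>The same polynomial over a one-element index type, ready for substituting the
      determinant.\<close>
    have P1: "(\<lambda>d. \<Phi> (first_diag m (d ()))) \<in> poly_fun UNIV"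
      unfolding fd
    proof (rule poly_fun_compose[OF poly, of "\<lambda>y (i,j). if i = j then (if i = 0 then y () else 1) else 0"])
      fix ij :: "nat \<times> nat"
      show "(\<lambda>y. case ij of (i,j) \<Rightarrow> if i = j then (if i = 0 then y () else 1) else 0) \<in> poly_fun UNIV"
        by (cases ij; cases "fst ij = snd ij"; cases "fst ij = 0") (auto intro: pf_const pf_var)
    qed
    have detp: "(\<lambda>x. det (wmat m m x)) \<in> poly_fun UNIV"
      using minor_poly_fun[of m "\<lambda>l. l" m] by (simp add: minor)
    have Pd: "(\<lambda>x. \<Phi> (first_diag m (det (wmat m m x)))) \<in> poly_fun UNIV"
      using poly_fun_compose[OF P1, of "\<lambda>x _. det (wmat m m x)" UNIV] detp by simp
    have all: "\<Phi> (wmat m m y) = \<Phi> (first_diag m (det (wmat m m y)))" for y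
    proof (rule poly_fun_dense_eq[OF line_closed_UNIV detp poly Pd])
      show "det (wmat m m (($$) (1\<^sub>m m))) \<noteq> 0" by (simp add: wmat_surj)
      fix z assume nz: "det (wmat m m z) \<noteq> 0"
      have "\<Phi> (wmat m m z * 1\<^sub>m m) = \<Phi> (first_diag m (det (wmat m m z)) * 1\<^sub>m m)"
        by (rule normalize_by_SL[OF \<Phi> m wmat_carrier refl nz]) simp
      then show "\<Phi> (wmat m m z) = \<Phi> (first_diag m (det (wmat m m z)))"
        by (simp add: mat_one_right wmat_def)
    qed auto
    have "\<Phi> w = \<Phi> (first_diag m (minor m (\<lambda>l. l) w))" if "w \<in> carrier_mat m m" for w
      using all[of "($$) w"] unfolding wmat_surj[OF that] minor[OF that] .
    then show ?thesis by (intro bexI[OF _ P] ballI)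
  qed
qed (use m in auto)

text \<open>Repeat row i of w as a last row and expand the vanishing determinant along it;
  \<open>insert_index j\<close> enumerates the columns other than j.\<close>

lemma minor_orthogonality:
  assumes w: "w \<in> carrier_mat r (Suc r)" and i: "i < r"
  shows "(\<Sum>j<Suc r. w $$ (i,j) * ((-1)^j * minor r (insert_index j) w)) = 0"
proof -
  define M where "M = mat (Suc r) (Suc r) (\<lambda>(a,b). if a < r then w $$ (a,b) else w $$ (i,b))"
  have M: "M \<in> carrier_mat (Suc r) (Suc r)" by (simp add: M_def)
  have "det M = 0"
    by (rule det_identical_rows[OF M, of i r]) (use i in \<open>auto simp: M_def row_def intro!: eq_vecI\<close>)
  moreover have "det M = (\<Sum>j<Suc r. M $$ (r,j) * cofactor M r j)"
    by (rule laplace_expansion_row[OF M]) simp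
  moreover have "M $$ (r,j) * cofactor M r j = (-1)^r * (w $$ (i,j) * ((-1)^j * minor r (insert_index j) w))" if j: "j < Suc r" for j
  proof -
    have "mat_delete M r j = mat r r (\<lambda>(a,b). w $$ (a, insert_index j b))"
    proof (rule eq_matI)
      fix a b assume "a < dim_row (mat r r (\<lambda>(a,b). w $$ (a, insert_index j b)))" "b < dim_col (mat r r (\<lambda>(a,b). w $$ (a, insert_index j b)))"
      then have ab: "a < r" "b < r" by auto
      then show "mat_delete M r j $$ (a,b) = mat r r (\<lambda>(a,b). w $$ (a, insert_index j b)) $$ (a,b)"
        using M j by (auto simp: mat_delete_def M_def insert_index_def)
    qed (use M in \<open>auto simp: mat_delete_def\<close>)
    then show ?thesis using j by (simp add: cofactor_def minor_def M_def power_add)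
  qed
  then have "(\<Sum>j<Suc r. M $$ (r,j) * cofactor M r j) = (\<Sum>j<Suc r. (-1)^r * (w $$ (i,j) * ((-1)^j * minor r (insert_index j) w)))"
    by (intro sum.cong) (simp_all only: lessThan_iff)
  ultimately have "0 = (-1)^r * (\<Sum>j<Suc r. w $$ (i,j) * ((-1)^j * minor r (insert_index j) w))"
    by (simp only: sum_distrib_left)
  then have "(-1::complex)^r = 0 \<or> (\<Sum>j<Suc r. w $$ (i,j) * ((-1)^j * minor r (insert_index j) w)) = 0"
    by (intro mult_eq_0_iff[THEN iffD1]) (rule sym)
  then show ?thesis by (rule disjE) simp_all
qed

lemma insert_index_less: "l < r \<Longrightarrow> insert_index j l < Suc r"
  by (auto simp: insert_index_def)

text \<open>Take the identity in columns 1, ..., r, which makes the minor omitting column 0 equal to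
  1. Orthogonality then shows which column 0 gives the ratios y (i + 1) / y 0, and
  \<open>first_diag\<close> scales all minors by y 0.\<close>

lemma minors_surjective:
  fixes y :: "nat \<Rightarrow> complex"
  assumes r: "r > 0" and y: "y 0 \<noteq> 0"
  shows "\<exists>w\<in>carrier_mat r (Suc r). \<forall>i<Suc r. minor r (insert_index i) w = y i"
proof -
  define w where "w = mat r (Suc r) (\<lambda>(i,j). if j = 0 then - ((-1)^Suc i * y (Suc i) / y 0) else if j = Suc i then 1 else 0)"
  have w: "w \<in> carrier_mat r (Suc r)" by (simp add: w_def)
  have "mat r r (\<lambda>(i,j). w $$ (i, insert_index 0 j)) = 1\<^sub>m r" by (auto simp: w_def insert_index_def intro!: eq_matI)
  then have p0: "minor r (insert_index 0) w = 1" by (simp add: minor_def)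
  have p: "minor r (insert_index (Suc i)) w = y (Suc i) / y 0" if i: "i < r" for i
  proof -
    have "(\<Sum>j<Suc r. w $$ (i,j) * ((-1)^j * minor r (insert_index j) w)) =
      (\<Sum>j\<in>{0, Suc i}. w $$ (i,j) * ((-1)^j * minor r (insert_index j) w))"
      using i by (intro sum.mono_neutral_right) (auto simp: w_def)
    also have "\<dots> = - ((-1)^Suc i * y (Suc i) / y 0) + (-1)^Suc i * minor r (insert_index (Suc i)) w"
    proof -
      have "w $$ (i,0) = - ((-1)^Suc i * y (Suc i) / y 0)" "w $$ (i,Suc i) = 1" using i by (simp_all add: w_def)
      then show ?thesis by (simp add: p0)
    qed
    finally have "(-1)^Suc i * minor r (insert_index (Suc i)) w = (-1)^Suc i * (y (Suc i) / y 0)"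
      using minor_orthogonality[OF w i] by (simp add: algebra_simps)
    then show ?thesis by (simp only: mult_cancel_left power_eq_0_iff) simp
  qed
  show ?thesis
  proof (intro bexI[of _ "first_diag r (y 0) * w"] allI impI)
    fix i assume i: "i < Suc r"
    have "minor r (insert_index i) (first_diag r (y 0) * w) = y 0 * minor r (insert_index i) w"
      using minor_mult[OF first_diag_carrier(1) w, of "insert_index i" "y 0"] insert_index_less r by (simp add: det_first_diag)
    also have "\<dots> = y i" using i y p p0 by (cases i) auto
    finally show "minor r (insert_index i) (first_diag r (y 0) * w) = y i" .
  qed (use w in auto)
qed

text \<open>Substituting fractions with a common denominator gives a polynomial over a power of that
  denominator; products and sums of such expressions are again of this form.\<close>

lemma poly_fun_clear_denominators:
  assumes "f \<in> poly_fun I" and a: "\<And>i. i \<in> I \<Longrightarrow> a i \<in> poly_fun J" and b: "b \<in> poly_fun J"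
  shows "\<exists>N. \<exists>G\<in>poly_fun J. \<forall>y. b y \<noteq> 0 \<longrightarrow> f (\<lambda>i. a i y / b y) * b y ^ N = G y"
  using assms(1)
proof induction
  case (pf_const c)
  show ?case by (intro exI[of _ 0] bexI[of _ "\<lambda>_. c"]) (auto intro: poly_fun.pf_const)
next
  case (pf_var i)
  then show ?case using a by (intro exI[of _ 1] bexI[of _ "a i"]) auto
next
  case (pf_add f g)
  then obtain N M F G where F: "F \<in> poly_fun J" "\<And>y. b y \<noteq> 0 \<Longrightarrow> f (\<lambda>i. a i y / b y) * b y ^ N = F y"
    and G: "G \<in> poly_fun J" "\<And>y. b y \<noteq> 0 \<Longrightarrow> g (\<lambda>i. a i y / b y) * b y ^ M = G y" by blast
  show ?case
  proof (intro exI[of _ "N + M"] bexI[of _ "\<lambda>y. F y * b y ^ M + G y * b y ^ N"] allI impI)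
    fix y assume "b y \<noteq> 0"
    then show "(f (\<lambda>i. a i y / b y) + g (\<lambda>i. a i y / b y)) * b y ^ (N + M) = F y * b y ^ M + G y * b y ^ N"
      unfolding F(2)[symmetric, OF \<open>b y \<noteq> 0\<close>] G(2)[symmetric, OF \<open>b y \<noteq> 0\<close>] by (simp add: algebra_simps power_add)
  qed (intro poly_fun_intros F G b)
next
  case (pf_mult f g)
  then obtain N M F G where F: "F \<in> poly_fun J" "\<And>y. b y \<noteq> 0 \<Longrightarrow> f (\<lambda>i. a i y / b y) * b y ^ N = F y"
    and G: "G \<in> poly_fun J" "\<And>y. b y \<noteq> 0 \<Longrightarrow> g (\<lambda>i. a i y / b y) * b y ^ M = G y" by blast
  show ?case
  proof (intro exI[of _ "N + M"] bexI[of _ "\<lambda>y. F y * G y"] allI impI)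
    fix y assume "b y \<noteq> 0"
    then show "f (\<lambda>i. a i y / b y) * g (\<lambda>i. a i y / b y) * b y ^ (N + M) = F y * G y"
      unfolding F(2)[symmetric, OF \<open>b y \<noteq> 0\<close>] G(2)[symmetric, OF \<open>b y \<noteq> 0\<close>] by (simp add: algebra_simps power_add)
  qed (intro poly_fun_intros F G)
qed

lemma poly_fun_divide_coordinate:
  assumes "f \<in> poly_fun I" "i \<in> I"
  shows "\<exists>g\<in>poly_fun I. \<forall>y. f y = f (y(i := 0)) + y i * g y"
  using assms(1)
proof induction
  case (pf_const c)
  show ?case by (intro bexI[of _ "\<lambda>_. 0"]) (auto intro: poly_fun.pf_const)
next
  case (pf_var j)
  show ?case
    by (intro bexI[of _ "\<lambda>_. if i = j then 1 else 0"]) (auto intro: poly_fun.pf_const)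
next
  case (pf_add f g)
  then obtain F G where F: "F \<in> poly_fun I" "\<And>y. f y = f (y(i := 0)) + y i * F y" and
    G: "G \<in> poly_fun I" "\<And>y. g y = g (y(i := 0)) + y i * G y" by blast
  have "f y + g y = f (y(i := 0)) + g (y(i := 0)) + y i * (F y + G y)" for y
    using F(2)[of y] G(2)[of y] by (simp add: algebra_simps)
  then show ?case by (intro bexI[of _ "\<lambda>y. F y + G y"] allI) (assumption, intro poly_fun_intros F G)
next
  case (pf_mult f g)
  then obtain F G where F: "F \<in> poly_fun I" "\<And>y. f y = f (y(i := 0)) + y i * F y" and
    G: "G \<in> poly_fun I" "\<And>y. g y = g (y(i := 0)) + y i * G y" by blast
  have "(\<lambda>y. f (y(i := 0))) \<in> poly_fun I"
    by (rule poly_fun_compose[OF pf_mult(1), of "\<lambda>y. y(i := 0)"]) (auto intro: poly_fun_intros)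
  moreover have "f y * g y = f (y(i := 0)) * g (y(i := 0)) + y i * (F y * g y + f (y(i := 0)) * G y)" for y
  proof -
    have "f y * g y = f (y(i := 0)) * g y + y i * F y * g y" using F(2)[of y] by (simp add: algebra_simps)
    also have "f (y(i := 0)) * g y = f (y(i := 0)) * (g (y(i := 0)) + y i * G y)" using G(2)[of y] by simp
    finally show ?thesis by (simp add: algebra_simps)
  qed
  ultimately show ?case
    by (intro bexI[of _ "\<lambda>y. F y * g y + f (y(i := 0)) * G y"] allI) (assumption, intro poly_fun_intros F(1) G(1) pf_mult(2))
qed

text \<open>Where the leading minor is nonzero, Cramer's rule writes a normal form of w in terms of
  the minors, so an invariant is a polynomial in the minors over a power of the leading one. The
  numerator vanishes when that coordinate is set to zero, and the denominator cancels one factor at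
  a time.\<close>

lemma polynomial_ring_remainder_minus_1:
  assumes r: "0 < r"
  shows "inv_polynomial_ring (t * Suc r + r) (Suc r)"
proof (rule polynomial_ring_criterion[where k = "Suc r" and c = insert_index])
  let ?p = "\<lambda>w i. minor r (insert_index i) w"
  show "\<forall>y. P y = 0" if P: "P \<in> poly_fun {..<Suc r}" and z: "\<And>w. w \<in> carrier_mat r (Suc r) \<Longrightarrow> P (?p w) = 0" for P
  proof
    fix y :: "nat \<Rightarrow> complex"
    have v: "(\<lambda>y. y 0) \<in> poly_fun {..<Suc r}" by (intro pf_var) simp
    show "P y = 0"
    proof (rule poly_fun_dense[OF line_closed_UNIV v P, of "\<lambda>_. 1"])
      fix u :: "nat \<Rightarrow> complex" assume "u 0 \<noteq> 0"
      then obtain w where w: "w \<in> carrier_mat r (Suc r)" "\<forall>i<Suc r. ?p w i = u i" using minors_surjective[of r u] r by blast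
      have "P u = P (?p w)" by (rule poly_fun_cong[OF P]) (use w in auto)
      then show "P u = 0" using z[OF w(1)] by simp
    qed auto
  qed
  show "\<exists>P\<in>poly_fun {..<Suc r}. \<forall>w\<in>carrier_mat r (Suc r). \<Phi> w = P (?p w)" if \<Phi>: "SL_invariant r (Suc r) \<Phi>" for \<Phi>
  proof -
    have poly: "(\<lambda>x. \<Phi> (wmat r (Suc r) x)) \<in> poly_fun UNIV" using \<Phi> by (simp add: SL_invariant_def)
    have mp: "(\<lambda>x. ?p (wmat r (Suc r) x) i) \<in> poly_fun UNIV" for i
      by (rule minor_poly_fun) (rule insert_index_less)
    have last: "minor r (insert_index r) w = minor r (\<lambda>l. l) w" for w
      unfolding minor_def by (rule arg_cong[where f = det]) (auto simp: insert_index_def intro!: eq_matI)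
    have nz0: "?p (wmat r (Suc r) (($$) (emb r (Suc r)))) r \<noteq> 0"
      using minor_emb[of r "Suc r"] by (simp add: wmat_surj last)
    have Pp: "(\<lambda>x. P (?p (wmat r (Suc r) x))) \<in> poly_fun UNIV" if "P \<in> poly_fun {..<Suc r}" for P
      by (rule poly_fun_compose[OF that]) (rule mp)
    have ext: "\<Phi> w * ?p w r ^ N = G (?p w)" if "G \<in> poly_fun {..<Suc r}"
      and "\<And>w. w \<in> carrier_mat r (Suc r) \<Longrightarrow> ?p w r \<noteq> 0 \<Longrightarrow> \<Phi> w * ?p w r ^ N = G (?p w)" and w: "w \<in> carrier_mat r (Suc r)" for G N w
    proof -
      have "(\<lambda>x. \<Phi> (wmat r (Suc r) x) * ?p (wmat r (Suc r) x) r ^ N) (($$) w) = (\<lambda>x. G (?p (wmat r (Suc r) x))) (($$) w)"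
        by (rule poly_fun_dense_eq[OF line_closed_UNIV mp[of r] _ Pp[OF that(1)] UNIV_I nz0])
          (use that(2) in \<open>auto intro!: poly_fun_intros poly mp\<close>)
      then show ?thesis using wmat_surj[OF w] by simp
    qed
    \<comment> \<open>The normal form: \<open>first_diag r d\<close> times the identity matrix
      extended by the column u.\<close>
    define \<sigma> where "\<sigma> d u = wmat r (Suc r) (\<lambda>(i,j). if j < r then (if i = j then (if i = 0 then d else 1) else 0) else (if i = 0 then d else 1) * u i)"
      for d :: complex and u :: "nat \<Rightarrow> complex"
    have norm: "\<Phi> w = \<Phi> (\<sigma> (?p w r) (\<lambda>i. - ((-1)^i * ?p w i) / ((-1)^r * ?p w r)))"
      if w: "w \<in> carrier_mat r (Suc r)" and nz: "?p w r \<noteq> 0" for w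
    proof -
      let ?u = "\<lambda>i. - ((-1)^i * ?p w i) / ((-1)^r * ?p w r)"
      define M where "M = mat r r (\<lambda>(i,j). w $$ (i,j))"
      have M: "M \<in> carrier_mat r r" "det M = ?p w r" unfolding last by (simp_all add: M_def minor_def)
      define z where "z = mat r (Suc r) (\<lambda>(i,j). if j < r then (if i = j then 1 else 0) else ?u i)"
      have z: "z \<in> carrier_mat r (Suc r)" by (simp add: z_def)
      have "M * z = w"
      proof (rule eq_matI)
        fix i j assume "i < dim_row w" "j < dim_col w"
        then have ij: "i < r" "j < Suc r" using w by auto
        have e: "(M * z) $$ (i,j) = (\<Sum>l<r. w $$ (i,l) * z $$ (l,j))"
          using mat_mult_entry[OF M(1) z ij] ij by (simp add: M_def)
        show "(M * z) $$ (i,j) = w $$ (i,j)"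
        proof (cases "j < r")
          case True
          have "(\<Sum>l<r. w $$ (i,l) * z $$ (l,j)) = (\<Sum>l<r. if l = j then w $$ (i,j) else 0)"
            using True by (intro sum.cong) (auto simp: z_def)
          then show ?thesis using e True by simp
        next
          case False
          then have j: "j = r" using ij by simp
          have "(\<Sum>l<r. w $$ (i,l) * ((-1)^l * ?p w l)) + w $$ (i,r) * ((-1)^r * ?p w r) = 0"
            using minor_orthogonality[OF w ij(1)] by simp
          then have s: "(\<Sum>l<r. w $$ (i,l) * ((-1)^l * ?p w l)) = - w $$ (i,r) * ((-1)^r * ?p w r)"
            by (simp add: eq_neg_iff_add_eq_0)
          have "(\<Sum>l<r. w $$ (i,l) * z $$ (l,j)) = (\<Sum>l<r. - (w $$ (i,l) * ((-1)^l * ?p w l)) / ((-1)^r * ?p w r))"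
            using j by (intro sum.cong) (auto simp: z_def)
          also have "\<dots> = - (\<Sum>l<r. w $$ (i,l) * ((-1)^l * ?p w l)) / ((-1)^r * ?p w r)"
            by (simp only: sum_divide_distrib[symmetric] sum_negf)
          also have "\<dots> = w $$ (i,r)" unfolding s using nz by simp
          finally show ?thesis using e j by simp
        qed
      qed (use M z w in auto)
      then have "\<Phi> w = \<Phi> (first_diag r (?p w r) * z)"
        using normalize_by_SL[OF \<Phi> r M nz z] by simp
      also have "first_diag r (?p w r) * z = \<sigma> (?p w r) ?u"
      proof (rule eq_matI)
        fix i j assume "i < dim_row (\<sigma> (?p w r) ?u)" "j < dim_col (\<sigma> (?p w r) ?u)"
        then have ij: "i < r" "j < Suc r" by (auto simp: \<sigma>_def wmat_def)
        show "(first_diag r (?p w r) * z) $$ (i,j) = \<sigma> (?p w r) ?u $$ (i,j)"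
          unfolding first_diag_mult_entry[OF z ij] using ij by (auto simp: \<sigma>_def wmat_def z_def)
      qed (auto simp: \<sigma>_def wmat_def z_def)
      finally show ?thesis .
    qed
    \<comment> \<open>\<open>b\<close> is the common denominator of the normal form and
      \<open>a\<close> collects the numerators; positions outside the matrix get 0 so that only
      variables below \<open>Suc r\<close> occur.\<close>
    define b where "b y = (-1)^r * y r" for y :: "nat \<Rightarrow> complex"
    define a where "a ij y = (case ij of (i,j) \<Rightarrow>
        if j < r then (if i = j then (if i = 0 then y r else 1) else 0) * b y
        else if i < r then (if i = 0 then y r else 1) * (- ((-1)^i * y i)) else 0)" for ij :: "nat \<times> nat" and y :: "nat \<Rightarrow> complex"
    have bp: "b \<in> poly_fun {..<Suc r}" unfolding b_def by (intro poly_fun_intros) simp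
    have ap: "a ij \<in> poly_fun {..<Suc r}" for ij
    proof (cases ij)
      case (Pair i j)
      show ?thesis
      proof (cases "i < r")
        case True
        then show ?thesis unfolding a_def Pair prod.case by (intro poly_fun_intros bp) auto
      next
        case False
        then have "a ij = (\<lambda>y. if j < r then (if i = j then (if i = 0 then y r else 1) else 0) * b y else 0)"
          by (auto simp: a_def Pair fun_eq_iff)
        moreover have "\<dots> \<in> poly_fun {..<Suc r}" by (intro poly_fun_intros bp) auto
        ultimately show ?thesis by simp
      qed
    qed
    obtain N G where G: "G \<in> poly_fun {..<Suc r}"
      "\<And>y. b y \<noteq> 0 \<Longrightarrow> \<Phi> (wmat r (Suc r) (\<lambda>ij. a ij y / b y)) * b y ^ N = G y"
      using poly_fun_clear_denominators[OF poly, of a "{..<Suc r}" b] ap bp by blast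
    have G1: "\<Phi> w * ?p w r ^ N = (-1)^(r*N) * G (?p w)" if w: "w \<in> carrier_mat r (Suc r)" and nz: "?p w r \<noteq> 0" for w
    proof -
      have bnz: "b (?p w) \<noteq> 0" using nz by (simp add: b_def)
      have "wmat r (Suc r) (\<lambda>ij. a ij (?p w) / b (?p w)) = \<sigma> (?p w r) (\<lambda>i. - ((-1)^i * ?p w i) / ((-1)^r * ?p w r))"
        unfolding \<sigma>_def wmat_def using bnz by (intro eq_matI) (auto simp: a_def b_def)
      then have "\<Phi> w * b (?p w) ^ N = G (?p w)" using G(2)[OF bnz] norm[OF w nz] by simp
      then have "(-1)^(r*N) * (\<Phi> w * ((-1)^(r*N) * ?p w r ^ N)) = (-1)^(r*N) * G (?p w)"
        by (simp add: b_def power_mult_distrib power_mult)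
      moreover have "(-1)^(r*N) * (-1)^(r*N) = (1::complex)" by (simp flip: power_mult_distrib)
      moreover have "e * (\<Phi> w * (e * q)) = e * e * (\<Phi> w * q)" for e q by (simp only: mult_ac)
      ultimately show ?thesis by (simp only: mult_1)
    qed
    have reduce: "\<exists>P\<in>poly_fun {..<Suc r}. \<forall>w\<in>carrier_mat r (Suc r). \<Phi> w = P (?p w)"
      if "G \<in> poly_fun {..<Suc r}" "\<And>w. w \<in> carrier_mat r (Suc r) \<Longrightarrow> \<Phi> w * ?p w r ^ N = G (?p w)" for N G
      using that
    proof (induction N arbitrary: G)
      case 0
      then show ?case by (intro bexI[of _ G]) auto
    next
      case (Suc N)
      let ?H = "\<lambda>y. G (y(r := 0))"
      have H: "?H \<in> poly_fun {..<Suc r}"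
        by (rule poly_fun_compose[OF Suc.prems(1), of "\<lambda>y. y(r := 0)"]) (auto intro: poly_fun_intros)
      have v: "(\<lambda>y. y 0) \<in> poly_fun {..<Suc r}" by (intro pf_var) simp
      \<comment> \<open>Minors with last coordinate 0 are still attained by matrices: the pivot in
        \<open>minors_surjective\<close> is coordinate 0, which differs from r since r > 0.\<close>
      have zero: "?H y = 0" for y
      proof (rule poly_fun_dense[OF line_closed_UNIV v H, of "\<lambda>_. 1"])
        fix u :: "nat \<Rightarrow> complex" assume "u 0 \<noteq> 0"
        then have "(u(r := 0)) 0 \<noteq> 0" using r by simp
        then obtain w where w: "w \<in> carrier_mat r (Suc r)" "\<forall>i<Suc r. ?p w i = (u(r := 0)) i"
          using minors_surjective[of r "u(r := 0)"] r by blast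
        have "G (u(r := 0)) = G (?p w)" by (rule poly_fun_cong[OF Suc.prems(1)]) (use w in auto)
        also have "\<dots> = \<Phi> w * ?p w r ^ Suc N" using Suc.prems(2)[OF w(1)] by simp
        also have "\<dots> = 0" using w(2) by simp
        finally show "G (u(r := 0)) = 0" .
      qed auto
      obtain G' where G': "G' \<in> poly_fun {..<Suc r}" "\<And>y. G y = y r * G' y"
        using poly_fun_divide_coordinate[OF Suc.prems(1), of r] unfolding zero add_0 by blast
      show ?case
      proof (rule Suc.IH[OF G'(1)], rule ext[OF G'(1)])
        fix w assume w: "w \<in> carrier_mat r (Suc r)" "?p w r \<noteq> 0"
        have "?p w r * (\<Phi> w * ?p w r ^ N) = ?p w r * G' (?p w)"
          using Suc.prems(2)[OF w(1)] G'(2) by (simp add: mult_ac)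
        then show "\<Phi> w * ?p w r ^ N = G' (?p w)" using w(2) by simp
      qed
    qed
    have G'p: "(\<lambda>y. (-1)^(r*N) * G y) \<in> poly_fun {..<Suc r}" by (intro poly_fun_intros G(1))
    show ?thesis by (rule reduce[OF G'p ext[OF G'p G1]])
  qed
qed (use r insert_index_less in auto)

subsection \<open>The non-polynomial case\<close>

lemma det_2: "det (mat 2 2 f) = f (0,0) * f (1,1) - f (0,1) * (f (1,0) :: complex)"
proof -
  let ?V = "mat 2 2 f"
  have d: "det (mat_delete ?V i 0) = f (1 - i, 1)" if "i < 2" for i
  proof -
    have "mat_delete ?V i 0 = mat 1 1 (\<lambda>_. f (1 - i, 1))" using that by (auto simp: mat_delete_def)
    then show ?thesis by (simp add: det_single)
  qed
  have "det ?V = (\<Sum>i<2. ?V $$ (i,0) * cofactor ?V i 0)" by (rule laplace_expansion_column) auto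
  also have "\<dots> = ?V $$ (0,0) * cofactor ?V 0 0 + ?V $$ (1,0) * cofactor ?V 1 0" by (simp add: numeral_2_eq_2)
  finally show ?thesis by (simp add: cofactor_def d algebra_simps)
qed

text \<open>With columns 0, ..., s - 1 fixed and a, b among s, ..., s + 3, the six minors behave
  like the coordinates of the Grassmannian of planes in 4-space.\<close>

definition last_two :: "nat \<Rightarrow> nat \<Rightarrow> nat \<Rightarrow> nat \<Rightarrow> nat" where
  "last_two s a b l = (if l < s then l else if l = s then a else b)"

lemma last_two_less: "s \<le> m \<Longrightarrow> a < m \<Longrightarrow> b < m \<Longrightarrow> last_two s a b l < m"
  by (auto simp: last_two_def)

lemma minor_last_two_normalized:
  assumes w: "w \<in> carrier_mat (s + 2) m" and m: "s \<le> m" "a < m" "b < m"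
    and std: "\<And>i j. i < s + 2 \<Longrightarrow> j < s \<Longrightarrow> w $$ (i,j) = (if i = j then 1 else 0)"
  shows "minor (s + 2) (last_two s a b) w = w $$ (s,a) * w $$ (s+1,b) - w $$ (s,b) * w $$ (s+1,a)"
proof -
  let ?V = "mat 2 2 (\<lambda>(i,j). w $$ (s + i, last_two s a b (s + j)))"
  let ?U = "mat s 2 (\<lambda>(i,j). w $$ (i, last_two s a b (s + j)))"
  have "mat (s + 2) (s + 2) (\<lambda>(i,j). w $$ (i, last_two s a b j)) = four_block_mat (1\<^sub>m s) ?U (0\<^sub>m 2 s) ?V"
    by (rule eq_matI) (auto simp: std last_two_def)
  then have "minor (s + 2) (last_two s a b) w = det (four_block_mat (1\<^sub>m s) ?U (0\<^sub>m 2 s) ?V)" by (simp add: minor_def)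
  also have "\<dots> = det ?V" by (subst det_four_block_mat_lower_left_zero[of _ s _ 2]) auto
  finally show ?thesis by (simp add: det_2 last_two_def)
qed

text \<open>Where the leading minor is nonzero, w = M u with the leading block of u equal to the
  identity. The six minors are then det M times 2 by 2 minors of two rows, for which the relation is
  an identity; density does the rest.\<close>

lemma plucker_relation:
  assumes m: "s + 4 \<le> m" and w: "w \<in> carrier_mat (s + 2) m"
  defines "p \<equiv> \<lambda>a b. minor (s + 2) (last_two s a b)"
  shows "p s (s+1) w * p (s+2) (s+3) w - p s (s+2) w * p (s+1) (s+3) w + p s (s+3) w * p (s+1) (s+2) w = 0"
proof -
  let ?r = "s + 2"
  define Q where "Q w = p s (s+1) w * p (s+2) (s+3) w - p s (s+2) w * p (s+1) (s+3) w + p s (s+3) w * p (s+1) (s+2) w" for w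
  have pp: "(\<lambda>x. p a b (wmat ?r m x)) \<in> poly_fun UNIV" if "a < m" "b < m" for a b
    unfolding p_def using that m by (intro minor_poly_fun last_two_less) auto
  have Qp: "(\<lambda>x. Q (wmat ?r m x)) \<in> poly_fun UNIV"
    unfolding Q_def using m by (intro poly_fun_intros pp) auto
  have id: "p s (s+1) w = minor ?r (\<lambda>l. l) w" for w
  proof -
    have "last_two s s (s + 1) j = j" if "j < ?r" for j using that by (auto simp: last_two_def)
    then show ?thesis unfolding p_def minor_def by (intro arg_cong[where f = det] eq_matI) auto
  qed
  have "Q (wmat ?r m y) = 0" for y
  proof (rule poly_fun_dense[OF line_closed_UNIV pp[of s "s+1"] Qp])
    show "p s (s+1) (wmat ?r m (($$) (emb ?r m))) \<noteq> 0" unfolding id wmat_surj[OF emb_carrier(1)] using minor_emb[of ?r m] m by simp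
    fix z assume nz: "p s (s+1) (wmat ?r m z) \<noteq> 0"
    let ?w = "wmat ?r m z"
    define M where "M = mat ?r ?r (\<lambda>(i,j). ?w $$ (i,j))"
    have M: "M \<in> carrier_mat ?r ?r" "det M \<noteq> 0" using nz unfolding id by (auto simp: M_def minor_def)
    obtain M' where M': "M' \<in> carrier_mat ?r ?r" "M * M' = 1\<^sub>m ?r" "M' * M = 1\<^sub>m ?r"
      using inverse_of_det_nonzero[OF M] by blast
    define u where "u = M' * ?w"
    have u: "u \<in> carrier_mat ?r m" unfolding u_def by (rule mult_carrier_mat[OF M'(1) wmat_carrier])
    have wu: "?w = M * u" unfolding u_def using M M' by (intro mat_inverse_cancel[OF M'(2), symmetric]) (auto simp: wmat_def)
    have std: "u $$ (i,j) = (if i = j then 1 else 0)" if "i < ?r" "j < s" for i j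
    proof -
      have "u $$ (i,j) = (\<Sum>l<?r. M' $$ (i,l) * ?w $$ (l,j))"
        unfolding u_def using that m by (intro mat_mult_entry[OF M'(1) wmat_carrier]) auto
      also have "\<dots> = (\<Sum>l<?r. M' $$ (i,l) * M $$ (l,j))" using that by (intro sum.cong) (auto simp: M_def)
      also have "\<dots> = (M' * M) $$ (i,j)" using that by (intro mat_mult_entry[OF M'(1) M(1), symmetric]) auto
      finally show ?thesis unfolding M'(3) using that by simp
    qed
    have val: "p a b ?w = det M * (u $$ (s,a) * u $$ (s+1,b) - u $$ (s,b) * u $$ (s+1,a))" if "a < m" "b < m" for a b
      unfolding wu p_def using minor_mult[OF M(1) u, of "last_two s a b"] minor_last_two_normalized[OF u _ that std] last_two_less[of s m a b] m that by simp
    have b: "s < m" "s + 1 < m" "s + 2 < m" "s + 3 < m" using m by auto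
    show "Q ?w = 0"
      unfolding Q_def val[OF b(1,2)] val[OF b(3,4)] val[OF b(1,3)] val[OF b(2,4)] val[OF b(1,4)] val[OF b(2,3)]
      by (simp add: algebra_simps)
  qed (use m in auto)
  then have "Q (wmat ?r m (($$) w)) = 0" .
  then show ?thesis unfolding wmat_surj[OF w] Q_def .
qed

lemma inv_alg_closed:
  "F \<in> inv_alg n m \<Longrightarrow> G \<in> inv_alg n m \<Longrightarrow> (\<lambda>\<gamma>. F \<gamma> + G \<gamma>) \<in> inv_alg n m"
  "F \<in> inv_alg n m \<Longrightarrow> G \<in> inv_alg n m \<Longrightarrow> (\<lambda>\<gamma>. F \<gamma> - G \<gamma>) \<in> inv_alg n m"
  "F \<in> inv_alg n m \<Longrightarrow> G \<in> inv_alg n m \<Longrightarrow> (\<lambda>\<gamma>. F \<gamma> * G \<gamma>) \<in> inv_alg n m"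
  "(\<lambda>\<gamma>. c) \<in> inv_alg n m"
  by (auto simp: inv_alg_def intro: poly_fun_intros)

text \<open>Scaling by an \<open>r\<close>-th root of unity lies in \<open>SL\<^sub>r\<close>, so an \<open>SL\<^sub>r\<close>-invariant has no terms of
  degree strictly between \<open>0\<close> and \<open>r\<close>.\<close>

lemma SL_invariant_along_ray:
  assumes \<Phi>: "SL_invariant r m \<Phi>" and r: "r > 0" and w: "w \<in> carrier_mat r m"
  shows "\<exists>G u. (\<forall>s. \<Phi> (s \<cdot>\<^sub>m w) = poly G s) \<and> monom 1 (Suc r) dvd G - [:\<Phi> (0\<^sub>m r m):] - monom u r"
proof -
  have sw: "s \<cdot>\<^sub>m w = wmat r m (\<lambda>i. poly [:0, w $$ i:] s)" for s
    using w by (auto simp: wmat_def intro!: eq_matI)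
  have "(\<lambda>x. \<Phi> (wmat r m x)) \<in> poly_fun UNIV" using \<Phi> by (simp add: SL_invariant_def)
  from poly_fun_curve[OF this, of "\<lambda>i. [:0, w $$ i:]"] obtain G where G: "\<And>s. \<Phi> (s \<cdot>\<^sub>m w) = poly G s"
    unfolding sw by blast
  define \<zeta> where "\<zeta> = cis (2 * pi / real r)"
  have zp: "\<zeta> ^ j = cis (2 * pi * real j / real r)" for j by (simp add: \<zeta>_def DeMoivre mult_ac)
  have z1: "\<zeta> ^ r = 1" using r by (simp add: zp)
  have zne: "\<zeta> ^ j \<noteq> 1" if "0 < j" "j < r" for j
  proof
    assume "\<zeta> ^ j = 1"
    then have "cis (2 * pi * real j / real r) = cis (2 * pi * real 0 / real r)" by (simp add: zp)
    moreover have "inj_on (\<lambda>k. cis (2 * pi * real k / real r)) {..<r}"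
      using bij_betw_roots_unity[OF r] by (rule bij_betw_imp_inj_on)
    ultimately have "j = 0" using that r inj_onD[of "\<lambda>k. cis (2 * pi * real k / real r)" "{..<r}" j 0] by simp
    then show False using that by simp
  qed
  have z0: "\<zeta> \<noteq> 0" using z1 r by (auto simp: power_0_left)
  have inv: "poly G (\<zeta> * s) = poly G s" for s
  proof -
    let ?g = "\<zeta> \<cdot>\<^sub>m 1\<^sub>m r" and ?g' = "inverse \<zeta> \<cdot>\<^sub>m 1\<^sub>m r"
    have "?g * ?g' = 1\<^sub>m r" using z0 by (simp add: mat_algebra) (auto intro!: eq_matI)
    moreover have "det ?g = 1" using z1 by simp
    moreover have "s \<cdot>\<^sub>m w \<in> carrier_mat r m" "?g \<in> carrier_mat r r" "?g' \<in> carrier_mat r r" using w by auto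
    ultimately have "\<Phi> (?g * (s \<cdot>\<^sub>m w)) = \<Phi> (s \<cdot>\<^sub>m w)" using \<Phi> unfolding SL_invariant_def by blast
    moreover have "?g * (s \<cdot>\<^sub>m w) = (\<zeta> * s) \<cdot>\<^sub>m w" using w by (simp add: mat_algebra) (auto intro!: eq_matI)
    ultimately show ?thesis by (simp add: G)
  qed
  have "poly (pcompose G [:0, \<zeta>:]) = poly G" using inv by (auto simp: poly_pcompose mult.commute)
  then have "pcompose G [:0, \<zeta>:] = G" by (simp only: poly_eq_poly_eq_iff)
  then have co: "coeff G j = \<zeta> ^ j * coeff G j" for j by (metis coeff_pcompose_linear)
  then have zero: "coeff G j = 0" if "0 < j" "j < r" for j using zne[OF that] co[of j] by auto
  have G0: "coeff G 0 = \<Phi> (0\<^sub>m r m)"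
  proof -
    have "0 \<cdot>\<^sub>m w = 0\<^sub>m r m" using w by (auto intro!: eq_matI)
    then show ?thesis using G[of 0] by (simp add: poly_0_coeff_0)
  qed
  have "monom 1 (Suc r) dvd G - [:\<Phi> (0\<^sub>m r m):] - monom (coeff G r) r"
    unfolding monom_1_dvd_iff'
  proof (intro allI impI)
    fix j assume "j < Suc r"
    then consider "j = 0" | "0 < j" "j < r" | "j = r" by linarith
    then show "coeff (G - [:\<Phi> (0\<^sub>m r m):] - monom (coeff G r) r) j = 0"
      using G0 zero r by cases (auto simp: coeff_pCons split: nat.splits)
  qed
  then show ?thesis using G by blast
qed

text \<open>Free generators would turn the Pluecker relation into an identity in independent
  variables, so that its quadratic part holds for all directions u. But the linear parts are
  additive in u, while the minor vectors of matrices are not closed under addition: a sum of two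
  decomposable vectors leaves the cone and violates the relation.\<close>

lemma not_polynomial_ring:
  assumes m: "s + 4 \<le> m"
  shows "\<not> inv_polynomial_ring (t * m + (s + 2)) m"
proof
  let ?r = "s + 2" and ?n = "t * m + (s + 2)"
  have r: "0 < ?r" "?r \<le> m" "m > 0" using m by auto
  assume "inv_polynomial_ring ?n m"
  then obtain k :: nat and Fs where Fs: "\<And>i. i < k \<Longrightarrow> Fs i \<in> inv_alg ?n m"
    and ind: "\<And>P y. P \<in> poly_fun {..<k} \<Longrightarrow> (\<forall>\<gamma>\<in>qspace ?n m. P (\<lambda>i. Fs i \<gamma>) = 0) \<Longrightarrow> P y = 0"
    and gen: "\<And>F. F \<in> inv_alg ?n m \<Longrightarrow> \<exists>P\<in>poly_fun {..<k}. \<forall>\<gamma>\<in>qspace ?n m. F \<gamma> = P (\<lambda>i. Fs i \<gamma>)"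
    unfolding inv_polynomial_ring_def by blast
  define F where "F a b = kdet ?n m t (last_two s a b)" for a b
  define ok where "ok a b \<longleftrightarrow> a < m \<and> b < m" for a b
  have okm: "a \<in> {s, s+1, s+2, s+3} \<Longrightarrow> b \<in> {s, s+1, s+2, s+3} \<Longrightarrow> ok a b" for a b using m by (auto simp: ok_def)
  have FI: "F a b \<in> inv_alg ?n m" if "ok a b" for a b
    unfolding F_def using that m r(3) by (intro kdet_invariant[where r = ?r] last_two_less) (auto simp: ok_def)
  have Fw: "F a b (slice m ?r t w) = minor ?r (last_two s a b) w" if "ok a b" "w \<in> carrier_mat ?r m" for a b w
    unfolding F_def minor_def using that m r(3) by (intro kdet_slice last_two_less) (auto simp: ok_def)
  define P where "P a b = (SOME P. P \<in> poly_fun {..<k} \<and> (\<forall>\<gamma>\<in>qspace ?n m. F a b \<gamma> = P (\<lambda>i. Fs i \<gamma>)))" for a b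
  have P: "P a b \<in> poly_fun {..<k}" "\<And>\<gamma>. \<gamma> \<in> qspace ?n m \<Longrightarrow> F a b \<gamma> = P a b (\<lambda>i. Fs i \<gamma>)" if "ok a b" for a b
  proof -
    have "\<exists>P. P \<in> poly_fun {..<k} \<and> (\<forall>\<gamma>\<in>qspace ?n m. F a b \<gamma> = P (\<lambda>i. Fs i \<gamma>))" using gen[OF FI[OF that]] by blast
    from someI_ex[OF this] show "P a b \<in> poly_fun {..<k}" "\<And>\<gamma>. \<gamma> \<in> qspace ?n m \<Longrightarrow> F a b \<gamma> = P a b (\<lambda>i. Fs i \<gamma>)"
      unfolding P_def[symmetric] by auto
  qed
  define R where "R y = P s (s+1) y * P (s+2) (s+3) y - P s (s+2) y * P (s+1) (s+3) y + P s (s+3) y * P (s+1) (s+2) y" for y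
  have Rp: "R \<in> poly_fun {..<k}" unfolding R_def by (intro poly_fun_intros P(1) okm) auto
  have R0: "R y = 0" for y
  proof (rule ind[OF Rp], rule ballI)
    fix \<gamma> assume g: "\<gamma> \<in> qspace ?n m"
    let ?H = "\<lambda>\<gamma>. F s (s+1) \<gamma> * F (s+2) (s+3) \<gamma> - F s (s+2) \<gamma> * F (s+1) (s+3) \<gamma> + F s (s+3) \<gamma> * F (s+1) (s+2) \<gamma>"
    have "?H \<gamma> = 0"
    proof (rule inv_alg_ext[OF r(1,2) _ inv_alg_closed(4) _ g])
      show "?H \<in> inv_alg ?n m" by (intro inv_alg_closed FI okm) auto
      fix w :: "complex mat" assume w: "w \<in> carrier_mat ?r m"
      show "?H (slice m ?r t w) = 0"
      proof -
        have o: "ok s (s+1)" "ok (s+2) (s+3)" "ok s (s+2)" "ok (s+1) (s+3)" "ok s (s+3)" "ok (s+1) (s+2)"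
          using m by (auto simp: ok_def)
        show ?thesis unfolding Fw[OF o(1) w] Fw[OF o(2) w] Fw[OF o(3) w] Fw[OF o(4) w] Fw[OF o(5) w] Fw[OF o(6) w]
          by (rule plucker_relation[OF m w])
      qed
    qed
    moreover have o: "ok s (s+1)" "ok (s+2) (s+3)" "ok s (s+2)" "ok (s+1) (s+3)" "ok s (s+3)" "ok (s+1) (s+2)"
      using m by (auto simp: ok_def)
    ultimately show "R (\<lambda>i. Fs i \<gamma>) = 0"
      unfolding R_def P(2)[OF o(1) g] P(2)[OF o(2) g] P(2)[OF o(3) g] P(2)[OF o(4) g] P(2)[OF o(5) g] P(2)[OF o(6) g] by simp
  qed
  \<comment> \<open>The values of the generators at w = 0, the vertex of the cone, where all minors
    vanish. Everything is expanded around this point.\<close>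
  define a where "a i = Fs i (slice m ?r t (0\<^sub>m ?r m))" for i
  have Pa: "P x y a = 0" if "ok x y" for x y
  proof -
    have "P x y a = F x y (slice m ?r t (0\<^sub>m ?r m))" unfolding a_def using P(2)[OF that slice_in_qspace] by simp
    also have "\<dots> = minor ?r (last_two s x y) (0\<^sub>m ?r m)" by (rule Fw[OF that]) simp
    also have "\<dots> = 0"
    proof -
      have "mat ?r ?r (\<lambda>(i,j). 0\<^sub>m ?r m $$ (i, last_two s x y j)) = (0\<^sub>m ?r ?r :: complex mat)"
        using that m last_two_less[of s m x y] by (intro eq_matI) (auto simp: ok_def)
      then show ?thesis by (simp add: minor_def)
    qed
    finally show ?thesis .
  qed
  define spec where "spec x y L \<longleftrightarrow> (\<forall>u v. L (\<lambda>i. u i + v i) = L u + L v) \<and>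
    (\<forall>q\<ge>1. \<forall>g u. (\<forall>i\<in>{..<k}. monom 1 (Suc q) dvd g i - [:a i:] - monom (u i) q) \<longrightarrow>
      (\<exists>p. (\<forall>s'. P x y (\<lambda>i. poly (g i) s') = poly p s') \<and>
           monom 1 (Suc q) dvd p - [:P x y a:] - monom (L u) q))" for x y and L :: "(nat \<Rightarrow> complex) \<Rightarrow> complex"
  define L where "L x y = (SOME L. spec x y L)" for x y
  have spec: "spec x y (L x y)" if "ok x y" for x y
  proof -
    have "\<exists>L. spec x y L" unfolding spec_def by (rule poly_fun_first_order[OF P(1)[OF that]])
    then show ?thesis unfolding L_def by (rule someI_ex)
  qed
  have Ladd: "L x y (\<lambda>i. u i + v i) = L x y u + L x y v" if "ok x y" for x y u v
    using spec[OF that] unfolding spec_def by blast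
  have L: "\<exists>p. (\<forall>s'. P x y (\<lambda>i. poly (g i) s') = poly p s') \<and> monom 1 (Suc q) dvd p - monom (L x y u) q"
    if "ok x y" "q \<ge> 1" "\<And>i. i < k \<Longrightarrow> monom 1 (Suc q) dvd g i - [:a i:] - monom (u i) q" for x y q g u
  proof -
    have "\<exists>p. (\<forall>s'. P x y (\<lambda>i. poly (g i) s') = poly p s') \<and> monom 1 (Suc q) dvd p - [:P x y a:] - monom (L x y u) q"
      using spec[OF that(1)] that(2,3) unfolding spec_def by blast
    then show ?thesis unfolding Pa[OF that(1)] by simp
  qed
  \<comment> \<open>Along the ray s w the generators are a + s^r u modulo s^(r+1), while a minor is
    exactly s^r times its value at w. The first-order expansion with exponent r therefore yields the
    minors as values of the linear parts at u.\<close>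
  have ray: "\<exists>u. \<forall>x y. ok x y \<longrightarrow> L x y u = minor ?r (last_two s x y) w" if w: "w \<in> carrier_mat ?r m" for w
  proof -
    have "\<forall>i\<in>{..<k}. \<exists>Gu. (\<forall>s'. Fs i (slice m ?r t (s' \<cdot>\<^sub>m w)) = poly (fst Gu) s') \<and> monom 1 (Suc ?r) dvd fst Gu - [:a i:] - monom (snd Gu) ?r"
      using SL_invariant_along_ray[OF slice_restriction_SL_invariant[OF Fs r(1)] r(1) w] unfolding a_def by simp
    from bchoice[OF this] obtain Gu where Gu0: "\<forall>i\<in>{..<k}. (\<forall>s'. Fs i (slice m ?r t (s' \<cdot>\<^sub>m w)) = poly (fst (Gu i)) s') \<and>
        monom 1 (Suc ?r) dvd fst (Gu i) - [:a i:] - monom (snd (Gu i)) ?r" by (elim exE)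
    have Gu: "(\<forall>s'. Fs i (slice m ?r t (s' \<cdot>\<^sub>m w)) = poly (fst (Gu i)) s') \<and>
        monom 1 (Suc ?r) dvd fst (Gu i) - [:a i:] - monom (snd (Gu i)) ?r" if "i < k" for i
      using bspec[OF Gu0, of i] that by (simp only: lessThan_iff simp_thms)
    show ?thesis
    proof (intro exI[of _ "\<lambda>i. snd (Gu i)"] allI impI)
      fix x y assume xy: "ok x y"
      obtain p where p: "\<And>s'. P x y (\<lambda>i. poly (fst (Gu i)) s') = poly p s'"
        "monom 1 (Suc ?r) dvd p - monom (L x y (\<lambda>i. snd (Gu i))) ?r"
        using L[OF xy, of ?r "\<lambda>i. fst (Gu i)" "\<lambda>i. snd (Gu i)"] Gu by auto
      have "poly p s' = poly (monom (minor ?r (last_two s x y) w) ?r) s'" for s'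
      proof -
        have sw: "s' \<cdot>\<^sub>m w \<in> carrier_mat ?r m" using w by simp
        have "poly p s' = P x y (\<lambda>i. Fs i (slice m ?r t (s' \<cdot>\<^sub>m w)))"
          unfolding p(1)[symmetric] by (rule poly_fun_cong[OF P(1)[OF xy]]) (use Gu in auto)
        also have "\<dots> = minor ?r (last_two s x y) (s' \<cdot>\<^sub>m w)"
          using P(2)[OF xy slice_in_qspace[OF sw]] Fw[OF xy sw] by simp
        also have "\<dots> = minor ?r (last_two s x y) ((s' \<cdot>\<^sub>m 1\<^sub>m ?r) * w)" using w by (simp add: mat_algebra)
        also have "\<dots> = s' ^ ?r * minor ?r (last_two s x y) w"
          using xy m by (subst minor_mult[OF _ w last_two_less]) (auto simp: ok_def)
        finally show ?thesis by (simp add: poly_monom mult.commute)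
      qed
      then have pe: "p = monom (minor ?r (last_two s x y) w) ?r" by (simp add: poly_eq_poly_eq_iff[symmetric] fun_eq_iff)
      have "coeff (p - monom (L x y (\<lambda>i. snd (Gu i))) ?r) ?r = 0" using p(2) unfolding monom_1_dvd_iff' by simp
      then show "L x y (\<lambda>i. snd (Gu i)) = minor ?r (last_two s x y) w" unfolding pe by simp
    qed
  qed
  \<comment> \<open>Has the decomposable minor vector: the first s basis vectors wedged with those
    numbered c and d.\<close>
  define W where "W c d = mat ?r m (\<lambda>(i,j). if i < s \<and> j = i \<or> i = s \<and> j = c \<or> i = s + 1 \<and> j = d then 1 else (0::complex))" for c d
  have W: "W c d \<in> carrier_mat ?r m" for c d by (simp add: W_def)
  have Wm: "minor ?r (last_two s x y) (W c d) = (if x = c \<and> y = d then 1 else 0)"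
    if "x < y" "c < d" "s \<le> c" "s \<le> x" "y < m" "d < m" for x y c d
    using that m by (subst minor_last_two_normalized[OF W]) (auto simp: W_def)
  obtain u1 where u1: "\<And>x y. ok x y \<Longrightarrow> L x y u1 = minor ?r (last_two s x y) (W s (s+1))" using ray[OF W] by blast
  obtain u2 where u2: "\<And>x y. ok x y \<Longrightarrow> L x y u2 = minor ?r (last_two s x y) (W (s+2) (s+3))" using ray[OF W] by blast
  \<comment> \<open>Corresponds to the sum of the decomposables with labels (s, s+1) and (s+2, s+3),
    which is not decomposable.\<close>
  define u where "u i = u1 i + u2 i" for i
  have Lu: "L x y u = (if x = s \<and> y = s + 1 \<or> x = s + 2 \<and> y = s + 3 then 1 else 0)"
    if "x < y" "s \<le> x" "y \<le> s + 3" for x y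
  proof -
    have o: "ok x y" using that m by (auto simp: ok_def)
    have "L x y u = L x y u1 + L x y u2" using Ladd[OF o, of u1 u2] by (simp add: u_def[abs_def])
    moreover have "minor ?r (last_two s x y) (W s (s+1)) = (if x = s \<and> y = s + 1 then 1 else 0)"
      by (rule Wm) (use that m in auto)
    moreover have "minor ?r (last_two s x y) (W (s+2) (s+3)) = (if x = s + 2 \<and> y = s + 3 then 1 else 0)"
      by (rule Wm) (use that m in auto)
    ultimately show ?thesis unfolding u1[OF o] u2[OF o] by auto
  qed
  \<comment> \<open>Now the honest line a + s u in generator space, with exponent 1: the coefficient
    of s^2 in the relation is the same quadric evaluated at the linear parts.\<close>
  define lp where "lp x y p \<longleftrightarrow> (\<forall>s'. P x y (\<lambda>i. poly [:a i, u i:] s') = poly p s') \<and> coeff p 0 = 0 \<and> coeff p 1 = L x y u" for x y p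
  have ex: "\<exists>p. lp x y p" if xy: "ok x y" for x y
  proof -
    have z: "[:a i, u i:] - [:a i:] - monom (u i) 1 = 0" for i by (simp add: monom_altdef)
    obtain p where p: "\<forall>s'. P x y (\<lambda>i. poly [:a i, u i:] s') = poly p s'" "monom 1 (Suc 1) dvd p - monom (L x y u) 1"
    proof -
      have "monom 1 (Suc 1) dvd [:a i, u i:] - [:a i:] - monom (u i) 1" for i unfolding z by (rule dvd_0_right)
      from L[OF xy le_refl this] show thesis using that by blast
    qed
    have "coeff (p - monom (L x y u) 1) 0 = 0" "coeff (p - monom (L x y u) 1) 1 = 0"
      using p(2) unfolding monom_1_dvd_iff' by auto
    then show ?thesis using p(1) by (intro exI[of _ p]) (auto simp: lp_def)
  qed
  define p where "p x y = (SOME p. lp x y p)" for x y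
  have "lp x y (p x y)" if "ok x y" for x y
    unfolding p_def by (rule someI_ex[OF ex[OF that]])
  then have pr: "P x y (\<lambda>i. poly [:a i, u i:] s') = poly (p x y) s'" "coeff (p x y) 0 = 0" "coeff (p x y) 1 = L x y u" if "ok x y" for x y s'
    using that unfolding lp_def by blast+
  have o: "ok s (s+1)" "ok (s+2) (s+3)" "ok s (s+2)" "ok (s+1) (s+3)" "ok s (s+3)" "ok (s+1) (s+2)"
    using m by (auto simp: ok_def)
  let ?q = "p s (s+1) * p (s+2) (s+3) - p s (s+2) * p (s+1) (s+3) + p s (s+3) * p (s+1) (s+2)"
  have "poly ?q s' = 0" for s'
    using R0[of "\<lambda>i. poly [:a i, u i:] s'"]
    unfolding R_def pr(1)[OF o(1)] pr(1)[OF o(2)] pr(1)[OF o(3)] pr(1)[OF o(4)] pr(1)[OF o(5)] pr(1)[OF o(6)]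
    by (simp only: poly_add poly_diff poly_mult)
  then have "?q = 0" using poly_all_0_iff_0 by blast
  then have "coeff ?q 2 = 0" by simp
  moreover have c2: "coeff (f * g) 2 = coeff f 1 * coeff g 1" if "coeff f 0 = 0" "coeff g 0 = 0" for f g :: "complex poly"
    using that by (simp add: coeff_mult numeral_2_eq_2 One_nat_def)
  ultimately have "L s (s+1) u * L (s+2) (s+3) u - L s (s+2) u * L (s+1) (s+3) u + L s (s+3) u * L (s+1) (s+2) u = 0"
    unfolding coeff_add coeff_diff c2[OF pr(2)[OF o(1)] pr(2)[OF o(2)]] c2[OF pr(2)[OF o(3)] pr(2)[OF o(4)]]
      c2[OF pr(2)[OF o(5)] pr(2)[OF o(6)]] pr(3)[OF o(1)] pr(3)[OF o(2)] pr(3)[OF o(3)] pr(3)[OF o(4)] pr(3)[OF o(5)] pr(3)[OF o(6)] by (elim asm_rl)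
  moreover have "L s (s+1) u = 1" "L (s+2) (s+3) u = 1" "L s (s+2) u = 0" "L s (s+3) u = 0"
    by (simp_all add: Lu)
  ultimately show False by simp
qed

subsection \<open>Generation of \<open>SL\<^sub>n\<close> by transvections\<close>

inductive row_reach :: "nat \<Rightarrow> complex mat \<Rightarrow> complex mat \<Rightarrow> bool" for n g where
  row_reach_refl: "row_reach n g g"
| row_reach_step: "row_reach n g h \<Longrightarrow> i < n \<Longrightarrow> j < n \<Longrightarrow> i \<noteq> j \<Longrightarrow> row_reach n g (addrow a i j h)"

lemma row_reach_trans: "row_reach n h h' \<Longrightarrow> row_reach n g h \<Longrightarrow> row_reach n g h'"
  by (induction rule: row_reach.induct) (auto intro: row_reach.intros)

lemma row_reach_carrier_det:
  assumes "row_reach n g h" "g \<in> carrier_mat n n"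
  shows "h \<in> carrier_mat n n \<and> det h = det g"
  using assms by induction (auto simp: det_addrow)

definition std_cols :: "nat \<Rightarrow> nat \<Rightarrow> complex mat \<Rightarrow> bool" where
  "std_cols n k h \<longleftrightarrow> (\<forall>i<n. \<forall>j<k. h $$ (i,j) = (if i = j then 1 else 0))"

lemma addrow_entry:
  "h \<in> carrier_mat n n \<Longrightarrow> p < n \<Longrightarrow> q < n \<Longrightarrow>
    addrow a i j h $$ (p,q) = (if i = p then a * h $$ (j,q) + h $$ (p,q) else h $$ (p,q :: nat) :: complex)"
  by (auto)

lemma std_cols_addrow:
  assumes "h \<in> carrier_mat n n" "std_cols n k h" "k \<le> j" "j < n" "k \<le> n"
  shows "std_cols n k (addrow a i j h)"
  unfolding std_cols_def
proof (intro allI impI)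
  fix p q assume pq: "p < n" "q < k"
  then show "addrow a i j h $$ (p,q) = (if p = q then 1 else 0)"
    using assms by (subst addrow_entry[of _ n]) (auto simp: std_cols_def)
qed

lemma clear_column:
  assumes h: "h \<in> carrier_mat n n" "std_cols n k h" "k < n" "h $$ (k,k) = 1"
  shows "\<exists>h'. row_reach n h h' \<and> std_cols n (Suc k) h'"
proof -
  have "\<exists>h'. row_reach n h h' \<and> h' \<in> carrier_mat n n \<and> std_cols n k h' \<and> h' $$ (k,k) = 1 \<and> (\<forall>i<p. i \<noteq> k \<longrightarrow> h' $$ (i,k) = 0)"
    if "p \<le> n" for p using that
  proof (induction p)
    case 0
    show ?case using h by (intro exI[of _ h]) (auto intro: row_reach_refl)
  next
    case (Suc p)
    then obtain h' where h': "row_reach n h h'" "h' \<in> carrier_mat n n" "std_cols n k h'" "h' $$ (k,k) = 1"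
      "\<And>i. i < p \<Longrightarrow> i \<noteq> k \<Longrightarrow> h' $$ (i,k) = 0" by auto
    show ?case
    proof (cases "p = k")
      case True
      then show ?thesis using h' by (intro exI[of _ h']) (auto simp: less_Suc_eq)
    next
      case False
      let ?h = "addrow (- h' $$ (p,k)) p k h'"
      have p: "p < n" using Suc.prems by simp
      have "row_reach n h ?h" using h' p False h by (intro row_reach_step) auto
      moreover have "std_cols n k ?h" using h' h by (intro std_cols_addrow) auto
      moreover have "?h $$ (k,k) = 1" using h' h False by (subst addrow_entry[of _ n]) auto
      moreover have "?h $$ (i,k) = 0" if "i < Suc p" "i \<noteq> k" for i
        using that h' h p by (subst addrow_entry[of _ n]) (auto simp: less_Suc_eq)
      ultimately show ?thesis using h' by (intro exI[of _ ?h]) auto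
    qed
  qed
  from this[of n] obtain h' where h': "row_reach n h h'" "std_cols n k h'" "h' $$ (k,k) = 1"
    "\<And>i. i < n \<Longrightarrow> i \<noteq> k \<Longrightarrow> h' $$ (i,k) = 0" by auto
  then have "std_cols n (Suc k) h'" by (auto simp: std_cols_def less_Suc_eq)
  then show ?thesis using h'(1) by blast
qed

text \<open>A nonzero entry below position k in column k lets a row operation set the pivot to 1. If
  there is none, invertibility forces a nonzero pivot, and adding row k to row k + 1 creates such an
  entry; this takes one more row, hence \<open>Suc k < n\<close>.\<close>

lemma make_pivot_one:
  assumes h: "h \<in> carrier_mat n n" "std_cols n k h" "Suc k < n" "det h \<noteq> 0"
  shows "\<exists>h'. row_reach n h h' \<and> h' \<in> carrier_mat n n \<and> std_cols n k h' \<and> h' $$ (k,k) = 1"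
proof -
  have below: "\<exists>h'. row_reach n h h' \<and> h' \<in> carrier_mat n n \<and> std_cols n k h' \<and> h' $$ (k,k) = 1"
    if g: "row_reach n h g" "g \<in> carrier_mat n n" "std_cols n k g" and i: "k < i" "i < n" "g $$ (i,k) \<noteq> 0" for g i
  proof -
    let ?h = "addrow ((1 - g $$ (k,k)) / g $$ (i,k)) k i g"
    have "row_reach n h ?h" using g i h by (intro row_reach_step) auto
    moreover have "std_cols n k ?h" using g i h by (intro std_cols_addrow) auto
    moreover have "?h $$ (k,k) = 1" using g i h by (subst addrow_entry[of _ n]) auto
    ultimately show ?thesis using g by (intro exI[of _ ?h]) auto
  qed
  show ?thesis
  proof (cases "\<exists>i. k < i \<and> i < n \<and> h $$ (i,k) \<noteq> 0")
    case True
    then show ?thesis using below[OF row_reach_refl h(1,2)] by blast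
  next
    case False
    have "h $$ (k,k) \<noteq> 0"
    proof
      assume z: "h $$ (k,k) = 0"
      \<comment> \<open>Kernel vector expressing that column k would be a combination of the
        standard columns before it.\<close>
      define x where "x = vec n (\<lambda>j. if j = k then 1 else if j < k then - h $$ (j,k) else 0)"
      have x: "x \<in> carrier_vec n" "x \<noteq> 0\<^sub>v n"
      proof -
        have "x $ k = 1" "(0\<^sub>v n :: complex vec) $ k = 0" using h by (auto simp: x_def)
        then show "x \<noteq> 0\<^sub>v n" by auto
      qed (simp add: x_def)
      have "h *\<^sub>v x = 0\<^sub>v n"
      proof (rule eq_vecI)
        fix i assume "i < dim_vec (0\<^sub>v n :: complex vec)"
        then have i: "i < n" by simp
        have "(h *\<^sub>v x) $ i = (\<Sum>j<n. h $$ (i,j) * x $ j)"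
          using h i by (simp add: scalar_prod_def lessThan_atLeast0 x_def)
        also have "\<dots> = (\<Sum>j<n. (if j = k then h $$ (i,k) else 0) + (if j = i \<and> i < k then - h $$ (i,k) else 0))"
        proof (rule sum.cong[OF refl])
          fix j assume "j \<in> {..<n}"
          then show "h $$ (i,j) * x $ j = (if j = k then h $$ (i,k) else 0) + (if j = i \<and> i < k then - h $$ (i,k) else 0)"
            using h(2) i by (auto simp: x_def std_cols_def)
        qed
        also have "\<dots> = h $$ (i,k) + (if i < k then - h $$ (i,k) else 0)"
          using h i by (cases "i < k") (auto simp: sum.distrib)
        also have "\<dots> = 0" using z False i by (cases i k rule: linorder_cases) auto
        finally show "(h *\<^sub>v x) $ i = 0\<^sub>v n $ i" using i by simp
      qed (use h in auto)
      then show False using h x det_0_iff_vec_prod_zero[OF h(1)] by blast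
    qed
    moreover let ?g = "addrow 1 (Suc k) k h"
    have "row_reach n h ?g" using h by (intro row_reach_step row_reach_refl) auto
    moreover have "std_cols n k ?g" using h by (intro std_cols_addrow) auto
    moreover have "?g $$ (Suc k,k) = h $$ (k,k)" using h False by (subst addrow_entry[of _ n]) auto
    ultimately show ?thesis using below[of ?g "Suc k"] h by auto
  qed
qed

lemma SL_row_reach_one:
  assumes g: "g \<in> carrier_mat n n" "det g = 1"
  shows "row_reach n g (1\<^sub>m n)"
proof -
  have "\<exists>h. row_reach n g h \<and> std_cols n k h" if "k \<le> n" for k using that
  proof (induction k)
    case 0
    show ?case by (intro exI[of _ g]) (auto simp: std_cols_def intro: row_reach_refl)
  next
    case (Suc k)
    then obtain h where h: "row_reach n g h" "std_cols n k h" by auto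
    have hc: "h \<in> carrier_mat n n" "det h = 1" using row_reach_carrier_det[OF h(1) g(1)] g(2) by auto
    have "\<exists>h'. row_reach n h h' \<and> h' \<in> carrier_mat n n \<and> std_cols n k h' \<and> h' $$ (k,k) = 1"
    proof (cases "Suc k < n")
      case True
      then show ?thesis using make_pivot_one[OF hc(1) h(2)] hc(2) by simp
    next
      case False
      then have n: "n = Suc k" using Suc.prems by simp
      \<comment> \<open>No row is left below the last pivot, but here the matrix is triangular with
        all other diagonal entries 1, so determinant 1 gives the pivot.\<close>
      have "upper_triangular h" using h(2) hc(1) n unfolding upper_triangular_def std_cols_def by auto
      then have "1 = prod_list (diag_mat h)" using det_upper_triangular hc by metis
      also have "\<dots> = (\<Prod>i = 0..<n. h $$ (i,i))"
        using hc(1) by (simp add: diag_mat_def prod.distinct_set_conv_list[symmetric] atLeast0LessThan[symmetric])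
      also have "\<dots> = (\<Prod>i = 0..<n. if i = k then h $$ (k,k) else 1)"
        using h(2) n by (intro prod.cong) (auto simp: std_cols_def less_Suc_eq)
      also have "\<dots> = h $$ (k,k)" using n by (subst prod.delta) auto
      finally show ?thesis using h hc by (intro exI[of _ h]) (auto intro: row_reach_refl)
    qed
    then obtain h' where h': "row_reach n h h'" "h' \<in> carrier_mat n n" "std_cols n k h'" "h' $$ (k,k) = 1" by blast
    obtain h'' where "row_reach n h' h''" "std_cols n (Suc k) h''"
      using clear_column[OF h'(2,3) _ h'(4)] Suc.prems by auto
    then show ?case using row_reach_trans h(1) h'(1) by blast
  qed
  from this[of n] obtain h where h: "row_reach n g h" "std_cols n n h" by auto
  have "h = 1\<^sub>m n" using h(2) row_reach_carrier_det[OF h(1) g(1)] by (intro eq_matI) (auto simp: std_cols_def)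
  then show ?thesis using h(1) by simp
qed

text \<open>Row reduction to the identity read backwards; the inverse of a transvection is a
  transvection.\<close>

lemma SL_transvection_induct:
  fixes g :: "complex mat"
  assumes g: "g \<in> carrier_mat n n" "det g = 1" and one: "P (1\<^sub>m n)"
    and step: "\<And>g a i j. g \<in> carrier_mat n n \<Longrightarrow> det g = 1 \<Longrightarrow> P g \<Longrightarrow> i < n \<Longrightarrow> j < n \<Longrightarrow> i \<noteq> j \<Longrightarrow> P (addrow_mat n a i j * g)"
  shows "P g"
proof -
  have "P g" if "row_reach n g h" "P h" for h using that
  proof induction
    case (row_reach_step h i j a)
    note c = row_reach_carrier_det[OF row_reach_step(1) g(1)]
    have e: "addrow a i j h = addrow_mat n a i j * h" using addrow_mat[of h n n j a i] c row_reach_step by simp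
    have inv: "addrow_mat n (- a) i j * addrow_mat n a i j = 1\<^sub>m n"
      using addrow_mat_inv[of i n j "- a"] row_reach_step by simp
    have c1: "addrow a i j h \<in> carrier_mat n n" "det (addrow a i j h) = 1"
      using c g row_reach_step by (auto simp: det_addrow)
    have "P (addrow_mat n (- a) i j * addrow a i j h)" using step[OF c1 row_reach_step.prems, of i j "- a"] row_reach_step by simp
    moreover have "addrow_mat n (- a) i j * addrow a i j h = h"
      unfolding e using c by (intro mat_inverse_cancel[OF inv]) auto
    ultimately show ?case using row_reach_step.IH by simp
  qed
  then show ?thesis using SL_row_reach_one[OF g] one by blast
qed

subsection \<open>Common divisors of the Pfaffians are invariant\<close>

text \<open>The orbit of a unipotent group 1 + s N with inverse 1 - s N: A moves to A + s (N A - A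
  N) - s^2 N A N and v to v + s N v.\<close>

lemma point_quadratic_curve:
  assumes "A \<in> carrier_mat n n" "X \<in> carrier_mat n n" "Z \<in> carrier_mat n n" "v \<in> carrier_mat n m" "U \<in> carrier_mat n m"
  shows "(\<lambda>c. poly (if in_range n m c then (case c of
           Mat x y \<Rightarrow> [:A $$ (x,y), X $$ (x,y), - Z $$ (x,y):]
         | Vec k x \<Rightarrow> [:v $$ (x,k), U $$ (x,k):]) else 0) s) =
    point n m (A + s \<cdot>\<^sub>m X + (- (s * s)) \<cdot>\<^sub>m Z) (v + s \<cdot>\<^sub>m U)"
proof
  fix c
  show "poly (if in_range n m c then (case c of
           Mat x y \<Rightarrow> [:A $$ (x,y), X $$ (x,y), - Z $$ (x,y):]
         | Vec k x \<Rightarrow> [:v $$ (x,k), U $$ (x,k):]) else 0) s =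
    point n m (A + s \<cdot>\<^sub>m X + (- (s * s)) \<cdot>\<^sub>m Z) (v + s \<cdot>\<^sub>m U) c"
    using assms by (cases c) (auto simp: point_def in_range_def algebra_simps)
qed

text \<open>A common divisor does not vanish at regular points, hence is constant along any polynomial
  curve of regular points; orbits of unipotent one-parameter groups are such curves.\<close>

lemma common_divisor_invariant:
  assumes n: "n > 0" and f: "f \<in> poly_fun UNIV"
    and dvd: "\<forall>J. J \<subseteq> {..<length (qbasis n m)} \<and> card J = qdim n m - qind n m \<longrightarrow> pdvd n m f (principal_pfaffian n m J)"
  shows "f \<in> inv_alg n m"
proof -
  obtain \<gamma>0 where g0: "\<gamma>0 \<in> qspace n m" "stab_dim n m \<gamma>0 = qind n m" using qind_attained by blast
  obtain J where J: "J \<subseteq> {..<length (qbasis n m)}" "card J = qdim n m - qind n m" "principal_pfaffian n m J \<gamma>0 \<noteq> 0"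
    using principal_pfaffian_nonzero_exists[of n m \<gamma>0] g0(2) by auto
  have reg: "stab_dim n m \<gamma> = qind n m" if "\<gamma> \<in> qspace n m" "principal_pfaffian n m J \<gamma> \<noteq> 0" for \<gamma>
    using principal_pfaffian_zero_at_singular[OF J(1,2), of \<gamma>] that qind_le_stab_dim[OF that(1)] by linarith
  \<comment> \<open>Invariance under a polynomial map is checked at regular points; those with
    nonzero Pfaffian at the fixed J are already dense.\<close>
  have extend: "f (T \<gamma>) = f \<gamma>"
    if T: "\<And>c. (\<lambda>\<gamma>. T \<gamma> c) \<in> poly_fun UNIV"
      and eq: "\<And>\<gamma>. \<gamma> \<in> qspace n m \<Longrightarrow> stab_dim n m \<gamma> = qind n m \<Longrightarrow> f (T \<gamma>) = f \<gamma>" and \<gamma>: "\<gamma> \<in> qspace n m" for T \<gamma>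
    by (rule poly_fun_dense_eq[OF line_closed_qspace principal_pfaffian_poly_fun poly_fun_compose[OF f T] f g0(1) J(3) _ \<gamma>])
      (use reg eq in auto)
  have curve: "f (\<lambda>c. poly (p c) 1) = f (\<lambda>c. poly (p c) 0)"
    if "\<And>s. (\<lambda>c. poly (p c) s) \<in> qspace n m" "\<And>s. stab_dim n m (\<lambda>c. poly (p c) s) = qind n m" for p
    by (rule nonvanishing_poly_fun_curve_constant[OF f]) (rule common_divisor_nonzero_at_regular[OF dvd that])
  have regroup: "A + (s \<cdot>\<^sub>m X + (- s \<cdot>\<^sub>m Y + - s \<cdot>\<^sub>m (s \<cdot>\<^sub>m Z))) = A + s \<cdot>\<^sub>m (X - Y) + (- (s * s)) \<cdot>\<^sub>m Z"
    if "A \<in> carrier_mat n n" "X \<in> carrier_mat n n" "Y \<in> carrier_mat n n" "Z \<in> carrier_mat n n"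
    for A X Y Z :: "complex mat" and s
    using that by (intro eq_matI) (auto simp: algebra_simps)
  have transvection: "f (point n m (addrow_mat n a i j * A * addrow_mat n (- a) i j) (addrow_mat n a i j * v)) = f (point n m A v)"
    if A: "A \<in> carrier_mat n n" and v: "v \<in> carrier_mat n m" and tr: "mtr A = 0" and ij: "i < n" "j < n" "i \<noteq> j" for A v a i j
  proof -
    define N where "N = mat n n (\<lambda>(p,q). if p = i \<and> q = j then a else 0)"
    have N: "N \<in> carrier_mat n n" by (simp add: N_def)
    have E: "addrow_mat n (s * a) i j = 1\<^sub>m n + s \<cdot>\<^sub>m N" for s
      using ij by (auto simp: addrow_mat_def N_def intro!: eq_matI)
    have inv: "addrow_mat n (s * a) i j * addrow_mat n (- (s * a)) i j = 1\<^sub>m n" for s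
      using addrow_mat_inv[of i n j "s * a"] ij by simp
    have det: "det (addrow_mat n (s * a) i j) = 1" for s using det_addrow_mat[of i j n "s * a"] ij by simp
    define B where "B s = addrow_mat n (s * a) i j * A * addrow_mat n (- (s * a)) i j" for s
    define u where "u s = addrow_mat n (s * a) i j * v" for s
    have q: "qconj n m A v (B s) (u s)" for s
      unfolding B_def u_def by (rule qconj_SL[OF qconj_refl[OF A v tr] _ _ inv det]) auto
    let ?g = "\<lambda>\<gamma>. act_SL n m (\<lambda>p q. addrow_mat n a i j $$ (p,q)) (\<lambda>p q. addrow_mat n (- a) i j $$ (p,q)) \<gamma>"
    have mid: "mat n n (($$) (addrow_mat n b i j)) = addrow_mat n b i j" for b by (auto intro!: eq_matI)
    have gp: "?g (point n m A v) = point n m (addrow_mat n a i j * A * addrow_mat n (- a) i j) (addrow_mat n a i j * v)"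
      if "A \<in> carrier_mat n n" "v \<in> carrier_mat n m" for A v
      using that by (simp add: act_SL_point mid)
    have "f (?g (point n m A v)) = f (point n m A v)"
    proof (rule extend)
      show "(\<lambda>\<gamma>. ?g \<gamma> c) \<in> poly_fun UNIV" for c
        unfolding act_SL_def by (cases c) (auto intro!: poly_fun_intros)
      show "point n m A v \<in> qspace n m" by (rule point_in_qspace[OF A tr])
      fix \<gamma> assume \<gamma>: "\<gamma> \<in> qspace n m" "stab_dim n m \<gamma> = qind n m"
      obtain A v where A: "A \<in> carrier_mat n n" "v \<in> carrier_mat n m" "mtr A = 0" "\<gamma> = point n m A v"
        using qdual_cases[OF \<gamma>(1)] by blast
      define p where "p c = (if in_range n m c then (case c of
           Mat x y \<Rightarrow> [:A $$ (x,y), (N * A - A * N) $$ (x,y), - (N * A * N) $$ (x,y):]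
         | Vec k x \<Rightarrow> [:v $$ (x,k), (N * v) $$ (x,k):]) else 0)" for c
      have curve_eq: "(\<lambda>c. poly (p c) s) = point n m (addrow_mat n (s * a) i j * A * addrow_mat n (- (s * a)) i j) (addrow_mat n (s * a) i j * v)" for s
      proof -
        have Em: "addrow_mat n (- (s * a)) i j = 1\<^sub>m n + (- s) \<cdot>\<^sub>m N" using E[of "- s"] by simp
        have 1: "addrow_mat n (s * a) i j * A * addrow_mat n (- (s * a)) i j = A + s \<cdot>\<^sub>m (N * A - A * N) + (- (s * s)) \<cdot>\<^sub>m (N * A * N)"
        proof -
          have c: "N * A \<in> carrier_mat n n" "A * N \<in> carrier_mat n n" "N * (A * N) \<in> carrier_mat n n" using A N by auto
          have "addrow_mat n (s * a) i j * A * addrow_mat n (- (s * a)) i j = (1\<^sub>m n + s \<cdot>\<^sub>m N) * A * (1\<^sub>m n + (- s) \<cdot>\<^sub>m N)"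
            unfolding Em E by simp
          also have "\<dots> = A + (s \<cdot>\<^sub>m (N * A) + (- s \<cdot>\<^sub>m (A * N) + - s \<cdot>\<^sub>m (s \<cdot>\<^sub>m (N * (A * N)))))"
            using A N by (simp add: mat_algebra mat_smult_add)
          also have "\<dots> = A + s \<cdot>\<^sub>m (N * A - A * N) + (- (s * s)) \<cdot>\<^sub>m (N * (A * N))"
            by (rule regroup[OF A(1) c])
          finally show ?thesis using A N by (simp add: mat_algebra)
        qed
        have 2: "addrow_mat n (s * a) i j * v = v + s \<cdot>\<^sub>m (N * v)" unfolding E using A N by (simp add: mat_algebra)
        have c: "N * A \<in> carrier_mat n n" "A * N \<in> carrier_mat n n" "N * A * N \<in> carrier_mat n n" "N * v \<in> carrier_mat n m" using A N by auto
        have cd: "N * A - A * N \<in> carrier_mat n n" by (rule minus_carrier_mat[OF c(2)])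
        show ?thesis unfolding 1 2 p_def by (rule point_quadratic_curve[OF A(1) cd c(3) A(2) c(4)])
      qed
      have q: "qconj n m A v (addrow_mat n (s * a) i j * A * addrow_mat n (- (s * a)) i j) (addrow_mat n (s * a) i j * v)" for s
        by (rule qconj_SL[OF qconj_refl[OF A(1-3)] _ _ inv det]) auto
      have "f (\<lambda>c. poly (p c) 1) = f (\<lambda>c. poly (p c) 0)"
      proof (rule curve)
        show "(\<lambda>c. poly (p c) s) \<in> qspace n m" for s unfolding curve_eq using qconj_carrier[OF q] by (intro point_in_qspace) auto
        show "stab_dim n m (\<lambda>c. poly (p c) s) = qind n m" for s
          unfolding curve_eq using qconj_invariants(2)[OF q n] \<gamma>(2) A(4) by simp
      qed
      moreover have "(\<lambda>c. poly (p c) 0) = \<gamma>"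
      proof
        fix c show "poly (p c) 0 = \<gamma> c" unfolding A(4) p_def point_def by (cases c) auto
      qed
      ultimately show "f (?g \<gamma>) = f \<gamma>" unfolding curve_eq A(4) gp[OF A(1,2)] by simp
    qed
    then show ?thesis unfolding gp[OF A v] .
  qed
  show ?thesis
  proof (rule inv_algI[OF f])
    fix A v g g' :: "complex mat"
    assume A: "A \<in> carrier_mat n n" "v \<in> carrier_mat n m" "mtr A = 0"
      and g: "g \<in> carrier_mat n n" "g' \<in> carrier_mat n n" "g * g' = 1\<^sub>m n" "det g = 1"
    \<comment> \<open>The inverse is quantified inside the predicate because it changes with every
      transvection multiplied on.\<close>
    define Q where "Q g \<longleftrightarrow> (\<forall>g'. g' \<in> carrier_mat n n \<longrightarrow> g * g' = 1\<^sub>m n \<longrightarrow> f (point n m (g * A * g') (g * v)) = f (point n m A v))" for g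
    have "Q g"
    proof (rule SL_transvection_induct[OF g(1,4)])
      show "Q (1\<^sub>m n)" using A by (auto simp: Q_def mat_algebra)
      fix h a i j assume h: "h \<in> carrier_mat n n" "det h = 1" "Q h" and ij: "i < n" "j < n" "i \<noteq> j"
      show "Q (addrow_mat n a i j * h)" unfolding Q_def
      proof (intro allI impI)
        fix k assume k: "k \<in> carrier_mat n n" "addrow_mat n a i j * h * k = 1\<^sub>m n"
        let ?E = "addrow_mat n a i j" and ?E' = "addrow_mat n (- a) i j"
        have EE: "?E * ?E' = 1\<^sub>m n" using addrow_mat_inv[of i n j a] ij by simp
        have E'E: "?E' * ?E = 1\<^sub>m n" using addrow_mat_inv[of i n j "- a"] ij by simp
        have c: "?E \<in> carrier_mat n n" "?E' \<in> carrier_mat n n" by auto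
        have "?E' * (?E * (h * k)) = h * k" using h k by (intro mat_inverse_cancel[OF E'E]) auto
        moreover have "?E * (h * k) = 1\<^sub>m n" using k h by (simp add: mat_algebra)
        ultimately have hk: "h * k = ?E'" using c by (simp add: mat_algebra)
        have hkE: "h * (k * ?E) = 1\<^sub>m n"
        proof -
          have "h * (k * ?E) = h * k * ?E" using h k by (intro mat_assoc[symmetric]) auto
          then show ?thesis unfolding hk E'E .
        qed
        have kE: "k * ?E \<in> carrier_mat n n" using k c by auto
        have hv: "h * A * (k * ?E) \<in> carrier_mat n n" "h * v \<in> carrier_mat n m" using h A kE by auto
        have "f (point n m (?E * (h * A * (k * ?E)) * ?E') (?E * (h * v))) = f (point n m (h * A * (k * ?E)) (h * v))"
          using mtr_conj[OF A(1) h(1) kE hkE] A(3) by (intro transvection[OF hv _ ij]) simp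
        also have "\<dots> = f (point n m A v)" using h(3) kE hkE by (auto simp: Q_def)
        also have "?E * (h * A * (k * ?E)) * ?E' = ?E * h * A * k"
        proof -
          have "k * (?E * ?E') = k" unfolding EE using k by (simp add: mat_algebra)
          then show ?thesis using h A k c by (simp add: mat_algebra)
        qed
        also have "?E * (h * v) = ?E * h * v" using h A c by (simp add: mat_algebra)
        finally show "f (point n m (?E * h * A * k) (?E * h * v)) = f (point n m A v)" .
      qed
    qed
    then show "f (point n m (g * A * g') (g * v)) = f (point n m A v)" using g by (auto simp: Q_def)
  next
    fix A v e :: "complex mat"
    assume A: "A \<in> carrier_mat n n" "v \<in> carrier_mat n m" "mtr A = 0" and e: "e \<in> carrier_mat m n"
    let ?T = "act_V n m (\<lambda>k j. e $$ (k,j))"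
    have mid: "mat m n (($$) e) = e" using e by (auto intro!: eq_matI)
    have Tp: "?T (point n m A v) = point n m (A - v * e + (mtr (v * e) / of_nat n) \<cdot>\<^sub>m 1\<^sub>m n) v"
      if "A \<in> carrier_mat n n" "v \<in> carrier_mat n m" for A v using that by (simp add: act_V_point mid)
    have "f (?T (point n m A v)) = f (point n m A v)"
    proof (rule extend)
      show "(\<lambda>\<gamma>. ?T \<gamma> c) \<in> poly_fun UNIV" for c
        unfolding act_V_def by (cases c) (auto intro!: poly_fun_intros)
      show "point n m A v \<in> qspace n m" by (rule point_in_qspace[OF A(1,3)])
      fix \<gamma> assume \<gamma>: "\<gamma> \<in> qspace n m" "stab_dim n m \<gamma> = qind n m"
      obtain A v where A: "A \<in> carrier_mat n n" "v \<in> carrier_mat n m" "mtr A = 0" "\<gamma> = point n m A v"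
        using qdual_cases[OF \<gamma>(1)] by blast
      define k where "k = mtr (v * e) / of_nat n"
      define p where "p c = (if in_range n m c then (case c of
           Mat x y \<Rightarrow> [:A $$ (x,y), (k \<cdot>\<^sub>m 1\<^sub>m n - v * e) $$ (x,y), - 0\<^sub>m n n $$ (x,y):]
         | Vec k x \<Rightarrow> [:v $$ (x,k), 0\<^sub>m n m $$ (x,k):]) else 0)" for c
      have ve: "v * e \<in> carrier_mat n n" using A e by auto
      have curve_eq: "(\<lambda>c. poly (p c) s) = point n m (A - v * (s \<cdot>\<^sub>m e) + (s * k) \<cdot>\<^sub>m 1\<^sub>m n) v" for s
      proof -
        have 1: "v * (s \<cdot>\<^sub>m e) = s \<cdot>\<^sub>m (v * e)" using A e by (simp add: mat_algebra)
        have 2: "A + s \<cdot>\<^sub>m (k \<cdot>\<^sub>m 1\<^sub>m n - Y) + (- (s * s)) \<cdot>\<^sub>m 0\<^sub>m n n = A - s \<cdot>\<^sub>m Y + (s * k) \<cdot>\<^sub>m 1\<^sub>m n"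
          if "Y \<in> carrier_mat n n" for Y using A(1) that by (intro eq_matI) (auto simp: algebra_simps)
        have 3: "v + s \<cdot>\<^sub>m 0\<^sub>m n m = v" using A(2) by (intro eq_matI) auto
        have cd: "k \<cdot>\<^sub>m 1\<^sub>m n - v * e \<in> carrier_mat n n" by (rule minus_carrier_mat[OF ve])
        show ?thesis unfolding 1 2[OF ve, symmetric] p_def
          by (subst point_quadratic_curve[OF A(1) cd zero_carrier_mat A(2) zero_carrier_mat]) (simp only: 3)
      qed
      have q: "qconj n m A v (A - v * (s \<cdot>\<^sub>m e) + (s * k) \<cdot>\<^sub>m 1\<^sub>m n) v" for s
      proof (rule qconj_V[OF qconj_refl[OF A(1-3)]])
        show "s \<cdot>\<^sub>m e \<in> carrier_mat m n" using e by simp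
        have "v * (s \<cdot>\<^sub>m e) = s \<cdot>\<^sub>m (v * e)" using A e by (simp add: mat_algebra)
        then show "mtr (A - v * (s \<cdot>\<^sub>m e) + (s * k) \<cdot>\<^sub>m 1\<^sub>m n) = 0"
          using A e n by (simp add: mtr_linear mtr_one k_def)
      qed
      have "f (\<lambda>c. poly (p c) 1) = f (\<lambda>c. poly (p c) 0)"
      proof (rule curve)
        show "(\<lambda>c. poly (p c) s) \<in> qspace n m" for s unfolding curve_eq using qconj_carrier[OF q] by (intro point_in_qspace) auto
        show "stab_dim n m (\<lambda>c. poly (p c) s) = qind n m" for s
          unfolding curve_eq using qconj_invariants(2)[OF q n] \<gamma>(2) A(4) by simp
      qed
      moreover have "(\<lambda>c. poly (p c) 0) = \<gamma>"
      proof
        fix c show "poly (p c) 0 = \<gamma> c" unfolding A(4) p_def point_def by (cases c) auto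
      qed
      moreover have "A - v * (1 \<cdot>\<^sub>m e) + (1 * k) \<cdot>\<^sub>m 1\<^sub>m n = A - v * e + k \<cdot>\<^sub>m 1\<^sub>m n"
        using A e by (simp add: mat_algebra) (auto intro!: eq_matI)
      ultimately show "f (?T \<gamma>) = f \<gamma>" unfolding curve_eq A(4) Tp[OF A(1,2)] k_def[symmetric] by simp
    qed
    then show "f (point n m (A - v * e + (mtr (v * e) / of_nat n) \<cdot>\<^sub>m 1\<^sub>m n) v) = f (point n m A v)" unfolding Tp[OF A(1,2)] .
  qed
qed

subsection \<open>Triviality of the fundamental semi-invariant\<close>

text \<open>All w with nonzero leading minor form one orbit under right multiplication by GL_m, so
  their slice points share one stabiliser dimension; since regular points are dense, one of them is
  regular.\<close>

lemma slice_regular: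
  assumes r: "0 < r" "r \<le> m" and w: "w \<in> carrier_mat r m" and nz: "minor r (\<lambda>l. l) w \<noteq> 0"
  shows "stab_dim (t * m + r) m (slice m r t w) = qind (t * m + r) m"
proof -
  let ?n = "t * m + r"
  have base: "stab_dim ?n m (slice m r t w) = stab_dim ?n m (slice m r t (emb r m))"
    if w: "w \<in> carrier_mat r m" and nz: "minor r (\<lambda>l. l) w \<noteq> 0" for w
  proof -
    \<comment> \<open>Completes w to an invertible m by m matrix, so that w is
      \<open>emb r m * h\<close>.\<close>
    define h where "h = mat m m (\<lambda>(i,j). if i < r then w $$ (i,j) else if i = j then 1 else 0)"
    have h: "h \<in> carrier_mat m m" by (simp add: h_def)
    let ?w1 = "mat r r (\<lambda>(i,j). w $$ (i,j))" and ?w2 = "mat r (m - r) (\<lambda>(i,j). w $$ (i, r + j))"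
    have "h = four_block_mat ?w1 ?w2 (0\<^sub>m (m - r) r) (1\<^sub>m (m - r))"
      using r by (intro eq_matI) (auto simp: h_def)
    then have "det h = det ?w1"
      by (simp only:) (subst det_four_block_mat_lower_left_zero[of _ r _ "m - r"], auto)
    then have "det h \<noteq> 0" using nz by (simp add: minor_def)
    then obtain h' where h': "h' \<in> carrier_mat m m" "h * h' = 1\<^sub>m m" using inverse_of_det_nonzero[OF h] by blast
    have "emb r m * h = w"
    proof (rule eq_matI)
      fix i j assume "i < dim_row w" "j < dim_col w"
      then have ij: "i < r" "j < m" using w by auto
      then show "(emb r m * h) $$ (i,j) = w $$ (i,j)" using r emb_mult_entry[OF h, of i r j] by (simp add: h_def)
    qed (use w h in auto)
    then show ?thesis using slice_right_action[OF emb_carrier(1)[of r m] h h', of t] by simp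
  qed
  have kp: "kdet ?n m t (\<lambda>l. l) \<in> poly_fun UNIV" using r by (intro kdet_poly_fun[where r = r]) auto
  obtain \<gamma>0 where g0: "\<gamma>0 \<in> qspace ?n m" "kdet ?n m t (\<lambda>l. l) \<gamma>0 \<noteq> 0" using kdet_nonzero_somewhere[OF r] by blast
  obtain \<gamma> where g: "\<gamma> \<in> qspace ?n m" "kdet ?n m t (\<lambda>l. l) \<gamma> \<noteq> 0" "stab_dim ?n m \<gamma> = qind ?n m"
    using generic_regular_point[OF kp g0] by blast
  show ?thesis
  proof (rule generic_slice_point[OF r g(1,2)])
    fix u assume u: "u \<in> carrier_mat r m" and inv: "\<And>F. F \<in> inv_alg ?n m \<Longrightarrow> F \<gamma> = F (slice m r t u)"
      and sd: "stab_dim ?n m \<gamma> = stab_dim ?n m (slice m r t u)"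
    have "kdet ?n m t (\<lambda>l. l) \<in> inv_alg ?n m" using r by (intro kdet_invariant[where r = r]) auto
    from inv[OF this] have "kdet ?n m t (\<lambda>l. l) (slice m r t u) \<noteq> 0" using g(2) by simp
    then have "minor r (\<lambda>l. l) u \<noteq> 0" using kdet_slice[OF u, of "\<lambda>l. l" t] r by (simp add: minor_def)
    then show ?thesis using base[OF u] base[OF w nz] sd g(3) by simp
  qed
qed

lemma fund_semi_inv_trivialI:
  assumes "n > 0"
    and "\<And>f. f \<in> inv_alg n m \<Longrightarrow> (\<And>\<gamma>. \<gamma> \<in> qspace n m \<Longrightarrow> stab_dim n m \<gamma> = qind n m \<Longrightarrow> f \<gamma> \<noteq> 0) \<Longrightarrow>
      \<exists>c. \<forall>\<gamma>\<in>qspace n m. f \<gamma> = c"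
  shows "fund_semi_inv_trivial n m"
  unfolding fund_semi_inv_trivial_def
proof (intro ballI impI)
  fix f assume f: "f \<in> poly_fun UNIV"
    and dvd: "\<forall>J. J \<subseteq> {..<length (qbasis n m)} \<and> card J = qdim n m - qind n m \<longrightarrow> pdvd n m f (principal_pfaffian n m J)"
  have nz: "f \<gamma> \<noteq> 0" if "\<gamma> \<in> qspace n m" "stab_dim n m \<gamma> = qind n m" for \<gamma>
    by (rule common_divisor_nonzero_at_regular[OF dvd that])
  obtain c where c: "\<forall>\<gamma>\<in>qspace n m. f \<gamma> = c"
    using assms(2)[OF common_divisor_invariant[OF assms(1) f dvd] nz] by blast
  moreover have "c \<noteq> 0" using nz c qind_attained[of n m] by metis
  ultimately show "\<exists>c. c \<noteq> 0 \<and> (\<forall>\<gamma>\<in>qspace n m. f \<gamma> = c)" by blast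
qed

text \<open>Since r < m, any chosen column can be exchanged with one outside the leading minor.
  Moving it along a line then keeps that minor, hence regularity, so f has no zero on the line and
  is constant there.\<close>

lemma fund_semi_inv_trivial_lt:
  assumes r: "0 < r" "r < m"
  shows "fund_semi_inv_trivial (t * m + r) m"
proof (rule fund_semi_inv_trivialI)
  let ?n = "t * m + r"
  show "0 < ?n" using r by simp
  fix f assume f: "f \<in> inv_alg ?n m" and nz: "\<And>\<gamma>. \<gamma> \<in> qspace ?n m \<Longrightarrow> stab_dim ?n m \<gamma> = qind ?n m \<Longrightarrow> f \<gamma> \<noteq> 0"
  define \<phi> where "\<phi> x = f (slice m r t (wmat r m x))" for x
  have phi: "\<phi> \<in> poly_fun UNIV" unfolding \<phi>_def by (rule slice_compose_poly_fun[OF inv_algD(1)[OF f]])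
  have cong: "\<phi> x = \<phi> y" if "\<And>i j. i < r \<Longrightarrow> j < m \<Longrightarrow> x (i,j) = y (i,j)" for x y
  proof -
    have "wmat r m x = wmat r m y" using that by (auto simp: wmat_def intro!: eq_matI)
    then show ?thesis by (simp add: \<phi>_def)
  qed
  \<comment> \<open>Exchanging two columns is right multiplication by a permutation matrix and
    preserves the stabiliser dimension.\<close>
  have nonzero: "\<phi> (\<lambda>(i,j). x (i, transpose a b j)) \<noteq> 0" if x: "minor r (\<lambda>l. l) (wmat r m x) \<noteq> 0" and ab: "a < m" "b < m" for x a b
  proof -
    define h where "h = mat m m (\<lambda>(i,j). if i = transpose a b j then 1 else (0::complex))"
    have h: "h \<in> carrier_mat m m" by (simp add: h_def)
    have tr: "transpose a b j < m" if "j < m" for j using that ab by (auto simp: transpose_def)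
    have mult: "(M * h) $$ (i,j) = M $$ (i, transpose a b j)" if "M \<in> carrier_mat k m" "i < k" "j < m" for M k i j
    proof -
      have "(M * h) $$ (i,j) = (\<Sum>l<m. M $$ (i,l) * h $$ (l,j))" by (rule mat_mult_entry[OF that(1) h that(2,3)])
      also have "\<dots> = (\<Sum>l<m. if l = transpose a b j then M $$ (i, transpose a b j) else 0)"
        using that by (intro sum.cong) (auto simp: h_def)
      finally show ?thesis using tr[OF that(3)] by simp
    qed
    have hh: "h * h = 1\<^sub>m m"
      using mult[OF h] tr by (intro eq_matI) (auto simp: h_def simp del: index_mult_mat(1))
    have "wmat r m (\<lambda>(i,j). x (i, transpose a b j)) = wmat r m x * h"
    proof (rule eq_matI)
      fix i j assume "i < dim_row (wmat r m x * h)" "j < dim_col (wmat r m x * h)"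
      then have ij: "i < r" "j < m" by (auto simp: wmat_def h_def)
      show "wmat r m (\<lambda>(i,j). x (i, transpose a b j)) $$ (i,j) = (wmat r m x * h) $$ (i,j)"
        unfolding mult[OF wmat_carrier ij] using ij tr by (simp add: wmat_def)
    qed (auto simp: wmat_def h_def)
    then have "stab_dim ?n m (slice m r t (wmat r m (\<lambda>(i,j). x (i, transpose a b j)))) = qind ?n m"
      using slice_right_action[OF wmat_carrier h h hh] slice_regular[OF r(1) _ wmat_carrier x] r by simp
    then show ?thesis unfolding \<phi>_def by (intro nz slice_in_qspace) auto
  qed
  have indep: "\<phi> x = \<phi> y" if "k < m" and eq: "\<And>i j. j \<noteq> k \<Longrightarrow> x (i,j) = y (i,j)" for k x y
  proof -
    \<comment> \<open>A column outside the first r: k itself if k >= r, and r otherwise.\<close>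
    define b where "b = max k r"
    define a where "a = k"
    have ab: "a < m" "b < m" "b \<ge> r" using that r by (auto simp: a_def b_def)
    define \<tau> where "\<tau> = (\<lambda>(i::nat,j). (i, transpose a b j))"
    define \<psi> where "\<psi> x = \<phi> (x \<circ> \<tau>)" for x
    have psi: "\<psi> \<in> poly_fun UNIV" unfolding \<psi>_def
      by (rule poly_fun_compose[OF phi]) (auto simp: \<tau>_def split: prod.splits intro: pf_var)
    define \<delta> where "\<delta> = (\<lambda>p. (y \<circ> \<tau>) p - (x \<circ> \<tau>) p)"
    have tb: "transpose a b j = k \<longleftrightarrow> j = b" for j by (auto simp: a_def transpose_def)
    have \<delta>0: "\<delta> (i,j) = 0" if "j \<noteq> b" for i j
      using eq[of "transpose a b j" i] tb[of j] that by (simp add: \<delta>_def \<tau>_def)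
    have mp: "(\<lambda>x. minor r (\<lambda>l. l) (wmat r m x)) \<in> poly_fun UNIV" using r by (intro minor_poly_fun) auto
    have sp: "(\<lambda>z. \<psi> (\<lambda>p. z p + \<delta> p)) \<in> poly_fun UNIV"
      by (rule poly_fun_compose[OF psi]) (intro pf_add pf_var pf_const UNIV_I)
    have e0: "minor r (\<lambda>l. l) (wmat r m (($$) (emb r m))) \<noteq> 0" using minor_emb[of r m] r by (simp add: wmat_surj)
    have shift: "\<psi> (\<lambda>p. z p + \<delta> p) = \<psi> z" for z
    proof (rule poly_fun_dense_eq[OF line_closed_UNIV mp sp psi UNIV_I e0 _ UNIV_I])
      fix z assume znz: "minor r (\<lambda>l. l) (wmat r m z) \<noteq> 0"
      have "minor r (\<lambda>l. l) (wmat r m (\<lambda>p. z p + s * \<delta> p)) = minor r (\<lambda>l. l) (wmat r m z)" for s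
        unfolding minor_def using ab r \<delta>0 by (intro arg_cong[where f = det] eq_matI) (auto simp: wmat_def)
      then have "\<psi> (\<lambda>p. z p + s * \<delta> p) \<noteq> 0" for s
        using nonzero[OF _ ab(1,2), of "\<lambda>p. z p + s * \<delta> p"] znz
        by (simp add: \<psi>_def \<tau>_def comp_def case_prod_beta')
      then have "\<psi> (\<lambda>p. poly [:z p, \<delta> p:] 1) = \<psi> (\<lambda>p. poly [:z p, \<delta> p:] 0)"
        by (intro nonvanishing_poly_fun_curve_constant[OF psi]) simp
      then show "\<psi> (\<lambda>p. z p + \<delta> p) = \<psi> z" by simp
    qed
    have \<tau>2: "u \<circ> \<tau> \<circ> \<tau> = u" for u :: "nat \<times> nat \<Rightarrow> complex" by (auto simp: \<tau>_def fun_eq_iff)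
    have "\<phi> y = \<psi> (y \<circ> \<tau>)" by (simp add: \<psi>_def \<tau>2)
    also have "y \<circ> \<tau> = (\<lambda>p. (x \<circ> \<tau>) p + \<delta> p)" by (auto simp: \<delta>_def fun_eq_iff)
    also have "\<psi> \<dots> = \<psi> (x \<circ> \<tau>)" by (rule shift)
    also have "\<dots> = \<phi> x" by (simp add: \<psi>_def \<tau>2)
    finally show ?thesis by simp
  qed
  have cols: "\<phi> x = \<phi> (\<lambda>(i,j). if j < K then 0 else x (i,j))" if "K \<le> m" for x K
    using that
  proof (induction K)
    case (Suc K)
    have "\<phi> (\<lambda>(i,j). if j < K then 0 else x (i,j)) = \<phi> (\<lambda>(i,j). if j < Suc K then 0 else x (i,j))"
      using Suc.prems by (intro indep[of K]) auto
    then show ?case using Suc by simp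
  qed simp
  have const: "\<phi> x = \<phi> (\<lambda>_. 0)" for x
    using cols[of m x] cong[of "\<lambda>(i,j). if j < m then 0 else x (i,j)" "\<lambda>_. 0"] by simp
  have "f \<gamma> = \<phi> (\<lambda>_. 0)" if g: "\<gamma> \<in> qspace ?n m" for \<gamma>
  proof (rule inv_alg_ext[OF r(1) _ f inv_alg_closed(4) _ g])
    fix w :: "complex mat" assume w: "w \<in> carrier_mat r m"
    show "f (slice m r t w) = \<phi> (\<lambda>_. 0)" using const[of "($$) w"] unfolding \<phi>_def wmat_surj[OF w] .
  qed (use r in simp)
  then show "\<exists>c. \<forall>\<gamma>\<in>qspace ?n m. f \<gamma> = c" by blast
qed

lemma stab_dim_le_1:
  assumes "\<And>x. x \<in> qstab n m \<gamma> \<Longrightarrow> x c = 0 \<Longrightarrow> x = (\<lambda>_. 0)"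
  shows "stab_dim n m \<gamma> \<le> 1"
proof (cases "\<exists>x0\<in>qstab n m \<gamma>. x0 c \<noteq> 0")
  case True
  then obtain x0 where x0: "x0 \<in> qstab n m \<gamma>" "x0 c \<noteq> 0" by blast
  have "qstab n m \<gamma> \<subseteq> cs.span {x0}"
  proof
    fix x assume x: "x \<in> qstab n m \<gamma>"
    have "x - cscale (x c / x0 c) x0 \<in> qstab n m \<gamma>"
      using qstab_subspace x x0(1) by (intro cs.subspace_diff cs.subspace_scale) auto
    then have z: "x - cscale (x c / x0 c) x0 = (\<lambda>_. 0)" using x0(2) by (intro assms) (auto simp: cscale_def)
    have "x = cscale (x c / x0 c) x0"
    proof
      fix d show "x d = cscale (x c / x0 c) x0 d" using fun_cong[OF z, of d] by simp
    qed
    moreover have "cscale (x c / x0 c) x0 \<in> cs.span {x0}" by (intro cs.span_scale cs.span_base) simp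
    ultimately show "x \<in> cs.span {x0}" by simp
  qed
  from cs.dim_le_card[OF this] show ?thesis by (simp add: stab_dim_def)
next
  case False
  then have "qstab n m \<gamma> \<subseteq> cs.span {}" using assms by (auto simp: zero_fun_def)
  from cs.dim_le_card[OF this] show ?thesis by (simp add: stab_dim_def)
qed

text \<open>Subtracting the mean makes the trace zero and keeps the differences
  \<open>a i - a j\<close>, on which the commutator depends.\<close>

definition diag_traceless :: "nat \<Rightarrow> (nat \<Rightarrow> complex) \<Rightarrow> complex mat" where
  "diag_traceless n a = mat n n (\<lambda>(i,j). if i = j then a i - (\<Sum>l<n. a l) / of_nat n else 0)"

lemma diag_traceless_carrier [simp]: "diag_traceless n a \<in> carrier_mat n n"
  by (simp add: diag_traceless_def)

lemma mtr_diag_traceless: "n > 0 \<Longrightarrow> mtr (diag_traceless n a) = 0"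
  by (simp add: mtr_def diag_traceless_def sum_subtractf)

lemma diag_mult_entry:
  assumes "X \<in> carrier_mat n k" "i < n" "j < k"
  shows "(diag_traceless n a * X) $$ (i,j) = (a i - (\<Sum>l<n. a l) / of_nat n) * X $$ (i,j)"
proof -
  have "(diag_traceless n a * X) $$ (i,j) = (\<Sum>l<n. diag_traceless n a $$ (i,l) * X $$ (l,j))"
    by (rule mat_mult_entry[OF diag_traceless_carrier assms])
  also have "\<dots> = (\<Sum>l<n. if l = i then (a i - (\<Sum>l<n. a l) / of_nat n) * X $$ (i,j) else 0)"
    using assms by (intro sum.cong) (auto simp: diag_traceless_def)
  finally show ?thesis using assms by simp
qed

lemma mult_diag_entry:
  assumes "X \<in> carrier_mat k n" "i < k" "j < n"
  shows "(X * diag_traceless n a) $$ (i,j) = X $$ (i,j) * (a j - (\<Sum>l<n. a l) / of_nat n)"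
proof -
  have "(X * diag_traceless n a) $$ (i,j) = (\<Sum>l<n. X $$ (i,l) * diag_traceless n a $$ (l,j))"
    by (rule mat_mult_entry[OF assms(1) diag_traceless_carrier assms(2,3)])
  also have "\<dots> = (\<Sum>l<n. if l = j then X $$ (i,j) * (a j - (\<Sum>l<n. a l) / of_nat n) else 0)"
    using assms by (intro sum.cong) (auto simp: diag_traceless_def)
  finally show ?thesis using assms by simp
qed

lemma qstab_diag_entries:
  assumes x: "x \<in> qstab n m (point n m (diag_traceless n a) v)" and v: "v \<in> carrier_mat n m"
  obtains c where "\<And>i j. i < n \<Longrightarrow> j < n \<Longrightarrow>
      (a i - a j) * x (Mat i j) + (\<Sum>k<m. v $$ (i,k) * x (Vec k j)) = (if i = j then c else 0)"
    "\<And>i k. i < n \<Longrightarrow> k < m \<Longrightarrow> (\<Sum>j<n. x (Mat i j) * v $$ (j,k)) = 0"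
    "(\<Sum>i<n. x (Mat i i)) = 0" "\<And>d. \<not> in_range n m d \<Longrightarrow> x d = 0"
proof -
  let ?X = "lin_part n x" and ?R = "row_part n m x" and ?A = "diag_traceless n a"
  obtain c where x': "x \<in> qspace n m" "?X * v = 0\<^sub>m n m" "?A * ?X - ?X * ?A + v * ?R = c \<cdot>\<^sub>m 1\<^sub>m n"
    using x v by (auto simp: qstab_iff moment_def carrier_matD[OF diag_traceless_carrier])
  have X: "?X \<in> carrier_mat n n" and R: "?R \<in> carrier_mat m n" by auto
  have e: "?X $$ (i,j) = x (Mat i j)" if "i < n" "j < n" for i j using that by (simp add: lin_part_def)
  have e': "?R $$ (k,j) = x (Vec k j)" if "k < m" "j < n" for k j using that by (simp add: row_part_def)
  show ?thesis
  proof (rule that)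
    fix i j assume ij: "i < n" "j < n"
    have d: "dim_row (?A * ?X) = n" "dim_col (?A * ?X) = n" "dim_row (?X * ?A) = n" "dim_col (?X * ?A) = n"
      "dim_row (v * ?R) = n" "dim_col (v * ?R) = n" using v by (auto simp: diag_traceless_def)
    have "(c \<cdot>\<^sub>m 1\<^sub>m n) $$ (i,j) = (?A * ?X) $$ (i,j) - (?X * ?A) $$ (i,j) + (v * ?R) $$ (i,j)"
      unfolding x'(3)[symmetric] using ij d by (simp del: index_mult_mat(1))
    also have "(?A * ?X) $$ (i,j) = (a i - (\<Sum>l<n. a l) / of_nat n) * x (Mat i j)"
      using diag_mult_entry[OF X ij] e[OF ij] by simp
    also have "(?X * ?A) $$ (i,j) = x (Mat i j) * (a j - (\<Sum>l<n. a l) / of_nat n)"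
      using mult_diag_entry[OF X ij] e[OF ij] by simp
    also have "(v * ?R) $$ (i,j) = (\<Sum>k<m. v $$ (i,k) * x (Vec k j))"
      using mat_mult_entry[OF v R ij] e' ij by simp
    finally show "(a i - a j) * x (Mat i j) + (\<Sum>k<m. v $$ (i,k) * x (Vec k j)) = (if i = j then c else 0)"
      using ij by (cases "i = j") (simp_all add: algebra_simps)
  next
    fix i k assume ik: "i < n" "k < m"
    have "(?X * v) $$ (i,k) = 0" unfolding x'(2) using ik by simp
    then show "(\<Sum>j<n. x (Mat i j) * v $$ (j,k)) = 0" using mat_mult_entry[OF X v ik] e ik by simp
  qed (use x'(1) in \<open>auto simp: qspace_def\<close>)
qed

lemma kpow_diag:
  assumes v: "v \<in> carrier_mat n m" and "i < n" "k < m"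
  shows "kpow (diag_traceless n a) v j $$ (i,k) = (a i - (\<Sum>l<n. a l) / of_nat n) ^ j * v $$ (i,k)"
  using assms(2,3)
proof (induction j)
  case (Suc j)
  have "kpow (diag_traceless n a) v j \<in> carrier_mat n m" using v by simp
  from diag_mult_entry[OF this Suc.prems] show ?case using Suc by simp
qed simp

lemma fund_semi_inv_trivial_one_copy:
  assumes n: "n \<ge> 2"
  shows "fund_semi_inv_trivial n 1"
proof (rule fund_semi_inv_trivialI)
  define t where "t = n - 1"
  have nt: "t * 1 + 1 = n" "n > 0" using n by (auto simp: t_def)
  show "0 < n" using n by simp
  fix f assume f: "f \<in> inv_alg n 1" and nz: "\<And>\<gamma>. \<gamma> \<in> qspace n 1 \<Longrightarrow> stab_dim n 1 \<gamma> = qind n 1 \<Longrightarrow> f \<gamma> \<noteq> 0"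
  define W where "W y = wmat 1 1 (\<lambda>_. y)" for y :: complex
  have W: "W y \<in> carrier_mat 1 1" for y by (simp add: W_def)
  have minorW: "minor 1 (\<lambda>l. l) (W y) = y" for y
    unfolding minor_def by (subst det_single) (auto simp: W_def wmat_def)
  have Wsurj: "W (minor 1 (\<lambda>l. l) w) = w" if "w \<in> carrier_mat 1 1" for w
    using that unfolding minor_def by (subst det_single) (auto simp: W_def wmat_def intro!: eq_matI)
  let ?D = "kdet n 1 t (\<lambda>l. l)"
  have DI: "?D \<in> inv_alg n 1" using nt by (intro kdet_invariant[where r = 1]) auto
  have Dw: "?D (slice 1 1 t w) = minor 1 (\<lambda>l. l) w" if "w \<in> carrier_mat 1 1" for w
    using kdet_slice[OF that, of "\<lambda>l. l" t] nt by (simp add: minor_def)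
  have fp: "(\<lambda>x. f (slice 1 1 t (wmat 1 1 x))) \<in> poly_fun UNIV" by (rule slice_compose_poly_fun[OF inv_algD(1)[OF f]])
  \<comment> \<open>The slice is a line for m = 1, and its parameter is the Krylov determinant; so f
    is p of that determinant.\<close>
  obtain p where p: "\<And>y. f (slice 1 1 t (W y)) = poly p y"
    using poly_fun_curve[OF fp, of "\<lambda>_. [:0,1:]"] by (auto simp: W_def)
  have DP: "(\<lambda>\<gamma>. poly p (?D \<gamma>)) \<in> inv_alg n 1"
    using DI poly_fun_compose_poly[of ?D UNIV p] by (auto simp: inv_alg_def)
  have fD: "f \<gamma> = poly p (?D \<gamma>)" if g: "\<gamma> \<in> qspace n 1" for \<gamma>
  proof (rule inv_alg_ext[where t = t and r = 1 and m = 1, unfolded nt(1), OF _ _ f DP _ g])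
    fix w :: "complex mat" assume w: "w \<in> carrier_mat 1 1"
    show "f (slice 1 1 t w) = poly p (?D (slice 1 1 t w))"
      unfolding Dw[OF w] p[symmetric] Wsurj[OF w] ..
  qed auto
  have "poly p y \<noteq> 0" for y
  proof (cases "y = 0")
    case False
    have "stab_dim n 1 (slice 1 1 t (W y)) = qind n 1"
      using slice_regular[of 1 1 "W y" t] W False minorW[of y] nt(1) by simp
    moreover have "slice 1 1 t (W y) \<in> qspace n 1" using slice_in_qspace[OF W, of t y] nt(1) by simp
    ultimately show ?thesis using nz p by metis
  next
    case True
    \<comment> \<open>The eigenvalues of A are distinct and v has nonzero components on all
      eigenlines but one. The zero last row kills the Krylov determinant, yet the point stays
      regular.\<close>
    define v where "v = mat n 1 (\<lambda>(i,k). if i < n - 1 then 1 else (0::complex))"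
    have v: "v \<in> carrier_mat n 1" by (simp add: v_def)
    define \<gamma> where "\<gamma> = point n 1 (diag_traceless n of_nat) v"
    have \<gamma>: "\<gamma> \<in> qspace n 1" unfolding \<gamma>_def using nt by (intro point_in_qspace) (auto simp: mtr_diag_traceless)
    have le: "stab_dim n 1 \<gamma> \<le> 1"
    proof (rule stab_dim_le_1[where c = "Vec 0 (n - 1)"])
      fix x assume x: "x \<in> qstab n 1 \<gamma>" and x0: "x (Vec 0 (n - 1)) = 0"
      obtain c where e: "\<And>i j. i < n \<Longrightarrow> j < n \<Longrightarrow>
          (of_nat i - of_nat j) * x (Mat i j) + (\<Sum>k<1. v $$ (i,k) * x (Vec k j)) = (if i = j then c else 0)"
        "\<And>i k. i < n \<Longrightarrow> k < 1 \<Longrightarrow> (\<Sum>j<n. x (Mat i j) * v $$ (j,k)) = 0"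
        "(\<Sum>i<n. x (Mat i i)) = 0" "\<And>d. \<not> in_range n 1 d \<Longrightarrow> x d = 0"
        by (rule qstab_diag_entries[OF x[unfolded \<gamma>_def] v]) (rule that)
      have c: "c = 0" using e(1)[of "n - 1" "n - 1"] nt by (simp add: v_def)
      have xi: "x (Vec 0 j) = 0" if "j < n" for j
        using e(1)[of j j] that x0 c by (cases "j = n - 1") (auto simp: v_def split: if_splits)
      have off: "x (Mat i j) = 0" if "i < n" "j < n" "i \<noteq> j" for i j
        using e(1)[of i j] that xi by simp
      have diag: "x (Mat i i) = 0" if "i < n - 1" for i
      proof -
        have "(\<Sum>j<n. x (Mat i j) * v $$ (j,0)) = (\<Sum>j\<in>{i}. x (Mat i j) * v $$ (j,0))"
          using that off by (intro sum.mono_neutral_right) auto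
        then show ?thesis using e(2)[of i 0] that by (simp add: v_def)
      qed
      have "(\<Sum>i<n. x (Mat i i)) = (\<Sum>i\<in>{n - 1}. x (Mat i i))"
      proof (rule sum.mono_neutral_right)
        show "\<forall>i\<in>{..<n} - {n - 1}. x (Mat i i) = 0"
        proof
          fix i assume "i \<in> {..<n} - {n - 1}"
          then have "i < n - 1" by auto
          then show "x (Mat i i) = 0" by (rule diag)
        qed
      qed (use nt in auto)
      then have last: "x (Mat (n - 1) (n - 1)) = 0" using e(3) by simp
      show "x = (\<lambda>_. 0)"
      proof
        fix d
        show "x d = 0"
        proof (cases "in_range n 1 d")
          case True
          then show ?thesis
          proof (cases d)
            case (Mat i j)
            then have ij: "i < n" "j < n" using True by (auto simp: in_range_def)
            then consider "i \<noteq> j" | "i = j" "i < n - 1" | "i = j" "i = n - 1" by linarith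
            then show ?thesis using Mat off[OF ij] diag[of i] last by cases simp_all
          next
            case (Vec k i)
            then show ?thesis using True xi by (auto simp: in_range_def)
          qed
        qed (use e(4) in blast)
      qed
    qed
    obtain \<gamma>0 where g0: "\<gamma>0 \<in> qspace n 1" "stab_dim n 1 \<gamma>0 = qind n 1" using qind_attained by blast
    obtain k where k: "qdim n 1 = 2 * k + stab_dim n 1 \<gamma>" using qdim_stab_dim_parity by blast
    obtain l where l: "qdim n 1 = 2 * l + qind n 1" using qdim_stab_dim_parity[of n 1 \<gamma>0] unfolding g0(2) by blast
    \<comment> \<open>Stabiliser dimensions all have the parity of dim q. One that is at most 1 is
      therefore equal to the minimum.\<close>
    have reg: "stab_dim n 1 \<gamma> = qind n 1" using k l le qind_le_stab_dim[OF \<gamma>] by presburger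
    have "?D \<gamma> = 0"
    proof -
      let ?K = "kry n 1 t (\<lambda>l. l) (diag_traceless n of_nat) v"
      have K: "?K $$ (n - 1, j) = 0" if "j < n" for j
        using that nt kindex_less[of n t 1 1 j "\<lambda>l. l"] kpow_diag[OF v, of "n - 1" "kindex 1 t (\<lambda>l. l) j"] by (simp add: kry_def v_def)
      have "det ?K = (\<Sum>j<n. ?K $$ (n - 1, j) * cofactor ?K (n - 1) j)"
        using nt by (intro laplace_expansion_row) auto
      then have "det ?K = 0" using K by simp
      then show ?thesis by (simp add: kdet_def \<gamma>_def carrier_matD[OF diag_traceless_carrier] carrier_matD[OF v])
    qed
    then show ?thesis using fD[OF \<gamma>] nz[OF \<gamma> reg] True by simp
  qed
  then have "poly p y = poly p 0" for y using nonvanishing_poly_constant by blast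
  then show "\<exists>c. \<forall>\<gamma>\<in>qspace n 1. f \<gamma> = c" using fD by metis
qed

subsection \<open>Singular points when \<open>m\<close> divides \<open>n\<close>\<close>

text \<open>Test point: t + 1 distinct eigenvalues, each with an m-dimensional eigenspace on which v
  restricts to the identity. The stabiliser then has X = 0, and its row part is determined by the
  scalar c alone.\<close>

lemma qind_le_1:
  assumes m: "m > 0"
  shows "qind (t * m + m) m \<le> 1"
proof -
  define n where "n = t * m + m"
  have n: "n > 0" using m by (simp add: n_def)
  define v where "v = mat n m (\<lambda>(i,k). if i mod m = k then 1 else (0::complex))"
  have v: "v \<in> carrier_mat n m" by (simp add: v_def)
  define a where "a i = (of_nat (i div m) :: complex)" for i
  define \<gamma> where "\<gamma> = point n m (diag_traceless n a) v"
  have \<gamma>: "\<gamma> \<in> qspace n m" unfolding \<gamma>_def using n by (intro point_in_qspace) (auto simp: mtr_diag_traceless)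
  have "stab_dim n m \<gamma> \<le> 1"
  proof (rule stab_dim_le_1[where c = "Vec 0 0"])
    fix x assume x: "x \<in> qstab n m \<gamma>" and x0: "x (Vec 0 0) = 0"
    obtain c where e: "\<And>i j. i < n \<Longrightarrow> j < n \<Longrightarrow>
        (a i - a j) * x (Mat i j) + (\<Sum>k<m. v $$ (i,k) * x (Vec k j)) = (if i = j then c else 0)"
      "\<And>i k. i < n \<Longrightarrow> k < m \<Longrightarrow> (\<Sum>j<n. x (Mat i j) * v $$ (j,k)) = 0"
      "(\<Sum>i<n. x (Mat i i)) = 0" "\<And>d. \<not> in_range n m d \<Longrightarrow> x d = 0"
      by (rule qstab_diag_entries[OF x[unfolded \<gamma>_def] v]) (rule that)
    have vs: "(\<Sum>k<m. v $$ (i,k) * x (Vec k j)) = x (Vec (i mod m) j)" if "i < n" for i j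
    proof -
      have "(\<Sum>k<m. v $$ (i,k) * x (Vec k j)) = (\<Sum>k<m. if k = i mod m then x (Vec (i mod m) j) else 0)"
        using that by (intro sum.cong) (auto simp: v_def)
      then show ?thesis using m by simp
    qed
    have idx: "j div m * m + k < n" "(j div m * m + k) div m = j div m" "(j div m * m + k) mod m = k" if "j < n" "k < m" for j k
    proof -
      have "j div m < Suc t" using that m by (simp add: n_def less_mult_imp_div_less)
      then have "j div m * m \<le> t * m" by (intro mult_le_mono1) simp
      then show "j div m * m + k < n" using that(2) unfolding n_def by linarith
      show "(j div m * m + k) div m = j div m" "(j div m * m + k) mod m = k"
        using that m div_mult_self3[of m "j div m" k] mod_mult_self3[of "j div m" m k] by simp_all
    qed
    \<comment> \<open>Index \<open>?i\<close> lies in the same eigenspace as j, so the commutator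
      term drops out of the stabiliser equation.\<close>
    have xk: "x (Vec k j) = (if k = j mod m then c else 0)" if "j < n" "k < m" for j k
    proof -
      let ?i = "j div m * m + k"
      have "?i = j \<longleftrightarrow> k = j mod m" using div_mult_mod_eq[of j m] by linarith
      then show ?thesis using e(1)[OF idx(1)[OF that] that(1)] vs[OF idx(1)[OF that], of j] idx(2,3)[OF that] by (simp add: a_def)
    qed
    have c: "c = 0" using xk[of 0 0] x0 n m by simp
    have xk0: "x (Vec k j) = 0" if "j < n" "k < m" for j k using xk[OF that] c by simp
    have off: "x (Mat i j) = 0" if "i < n" "j < n" "i div m \<noteq> j div m" for i j
    proof -
      have "i \<noteq> j" using that by auto
      then have "(a i - a j) * x (Mat i j) = 0"
        using e(1)[OF that(1,2)] vs[OF that(1), of j] xk0[OF that(2), of "i mod m"] m by simp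
      moreover have "a i - a j \<noteq> 0" using that(3) by (simp add: a_def)
      ultimately show ?thesis by simp
    qed
    have same: "x (Mat i j) = 0" if "i < n" "j < n" "i div m = j div m" for i j
    proof -
      have jm: "j mod m < m" using m by simp
      have "(\<Sum>j'<n. x (Mat i j') * v $$ (j', j mod m)) = (\<Sum>j'\<in>{j}. x (Mat i j') * v $$ (j', j mod m))"
      proof (rule sum.mono_neutral_right)
        show "\<forall>j'\<in>{..<n} - {j}. x (Mat i j') * v $$ (j', j mod m) = 0"
        proof
          fix j' assume j': "j' \<in> {..<n} - {j}"
          show "x (Mat i j') * v $$ (j', j mod m) = 0"
          proof (cases "j' div m = j div m")
            case True
            then have "j' mod m \<noteq> j mod m" using j' by (metis DiffD2 div_mult_mod_eq singletonI)
            then show ?thesis using j' jm by (simp add: v_def)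
          next
            case False
            then show ?thesis using off[OF that(1), of j'] j' that(3) by simp
          qed
        qed
      qed (use that in auto)
      then show ?thesis using e(2)[OF that(1) jm] that jm by (simp add: v_def)
    qed
    show "x = (\<lambda>_. 0)"
    proof
      fix d show "x d = 0"
      proof (cases "in_range n m d")
        case True
        then show ?thesis using off same xk0 by (cases d) (auto simp: in_range_def)
      qed (rule e(4))
    qed
  qed
  then show ?thesis using qind_le_stab_dim[OF \<gamma>] unfolding n_def by linarith
qed

lemma sum_lessThan_blocks:
  fixes f :: "nat \<Rightarrow> complex"
  shows "(\<Sum>s<J * m. f s) = (\<Sum>j<J. \<Sum>k<m. f (j * m + k))"
proof (induction J)
  case (Suc J)
  have "(\<Sum>s<Suc J * m. f s) = (\<Sum>s<J * m + m. f s)" by (simp add: add.commute)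
  also have "\<dots> = (\<Sum>s<J * m. f s) + (\<Sum>k<m. f (J * m + k))" by (rule sum_lessThan_split)
  finally show ?case using Suc.IH by simp
qed simp

text \<open>The row vector y A^p, the left-hand counterpart of \<open>kpow\<close>.\<close>

fun ypow :: "nat \<Rightarrow> complex mat \<Rightarrow> (nat \<Rightarrow> complex) \<Rightarrow> nat \<Rightarrow> nat \<Rightarrow> complex" where
  "ypow n A y 0 q = y q"
| "ypow n A y (Suc p) q = (\<Sum>a<n. ypow n A y p a * A $$ (a,q))"

lemma ypow_linear: "ypow n A (\<lambda>q. y q - k * z q) p q = ypow n A y p q - k * ypow n A z p q"
proof (induction p arbitrary: q)
  case (Suc p)
  show ?case by (simp only: ypow.simps Suc left_diff_distrib sum_subtractf sum_distrib_left mult.assoc)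
qed simp

lemma ypow_kpow:
  assumes A: "A \<in> carrier_mat n n" and v: "v \<in> carrier_mat n m" and k: "k < m"
  shows "(\<Sum>q<n. ypow n A y p q * kpow A v j $$ (q,k)) = (\<Sum>b<n. y b * kpow A v (p + j) $$ (b,k))"
proof (induction p arbitrary: j)
  case (Suc p)
  have kc: "kpow A v j \<in> carrier_mat n m" using A v by simp
  have "(\<Sum>q<n. ypow n A y (Suc p) q * kpow A v j $$ (q,k)) = (\<Sum>q<n. \<Sum>a<n. ypow n A y p a * (A $$ (a,q) * kpow A v j $$ (q,k)))"
    by (simp add: sum_distrib_right mult.assoc)
  also have "\<dots> = (\<Sum>a<n. ypow n A y p a * (\<Sum>q<n. A $$ (a,q) * kpow A v j $$ (q,k)))"
    by (subst sum.swap) (simp add: sum_distrib_left)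
  also have "\<dots> = (\<Sum>a<n. ypow n A y p a * kpow A v (Suc j) $$ (a,k))"
    using mat_mult_entry[OF A kc _ k] by (intro sum.cong) auto
  finally show ?case using Suc.IH[of "Suc j"] by simp
qed simp

text \<open>The stabiliser element attached to a relation \<open>\<Sum>\<^sub>j A\<^sup>j v u\<^sub>j = 0\<close> and a row vector \<open>y\<close>:
  \<open>X = \<Sum>\<^sub>j \<Sum>\<^sub>i\<^sub><\<^sub>j A\<^sup>i v u\<^sub>j y A\<^sup>j\<^sup>-\<^sup>1\<^sup>-\<^sup>i\<close>, so that \<open>[A, X]\<close> telescopes.\<close>

definition relation_stab :: "nat \<Rightarrow> nat \<Rightarrow> complex mat \<Rightarrow> complex mat \<Rightarrow> nat \<Rightarrow> (nat \<Rightarrow> complex) \<Rightarrow> (nat \<Rightarrow> complex) \<Rightarrow> idx \<Rightarrow> complex" where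
  "relation_stab n m A v J u y c = (if in_range n m c then (case c of
     Mat a q \<Rightarrow> (\<Sum>j<Suc J. \<Sum>i<j. (\<Sum>k<m. kpow A v i $$ (a,k) * u (j * m + k)) * ypow n A y (j - 1 - i) q)
   | Vec k q \<Rightarrow> (\<Sum>j<Suc J. u (j * m + k) * ypow n A y j q)) else 0)"

lemma relation_stab_linear:
  "relation_stab n m A v J u (\<lambda>q. y q - k * z q) = relation_stab n m A v J u y - cscale k (relation_stab n m A v J u z)"
proof
  fix c
  have lin: "w * (a - k * b) = w * a - k * (w * b)" for w a b :: complex by (simp add: algebra_simps)
  show "relation_stab n m A v J u (\<lambda>q. y q - k * z q) c = (relation_stab n m A v J u y - cscale k (relation_stab n m A v J u z)) c"
    by (cases c) (simp_all add: relation_stab_def cscale_def ypow_linear lin sum_subtractf sum_distrib_left[symmetric] del: sum.lessThan_Suc)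
qed

text \<open>[A, X] telescopes to the sum of A^j v u_j y, which the relation makes zero, minus the
  sum of v u_j y A^j, which the row part compensates. Both X v and the trace of X contain factors y
  A^p v with p < t, by \<open>J \<le> t\<close>, and these vanish.\<close>

lemma relation_stab_in_qstab:
  assumes A: "A \<in> carrier_mat n n" and v: "v \<in> carrier_mat n m" and J: "J \<le> t"
    and rel: "\<And>a. a < n \<Longrightarrow> (\<Sum>j<Suc J. \<Sum>k<m. kpow A v j $$ (a,k) * u (j * m + k)) = 0"
    and ann: "\<And>p k. p < t \<Longrightarrow> k < m \<Longrightarrow> (\<Sum>b<n. y b * kpow A v p $$ (b,k)) = 0"
  shows "relation_stab n m A v J u y \<in> qstab n m (point n m A v)"
proof -
  define x where "x = relation_stab n m A v J u y"
  define W where "W i j a = (\<Sum>k<m. kpow A v i $$ (a,k) * u (j * m + k))" for i j a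
  define Y where "Y = ypow n A y"
  have xM: "x (Mat a q) = (\<Sum>j<Suc J. \<Sum>i<j. W i j a * Y (j - 1 - i) q)" if "a < n" "q < n" for a q
    using that by (simp add: x_def relation_stab_def in_range_def W_def Y_def)
  have xV: "x (Vec k q) = (\<Sum>j<Suc J. u (j * m + k) * Y j q)" if "k < m" "q < n" for k q
    using that by (simp add: x_def relation_stab_def in_range_def Y_def)
  have AW: "(\<Sum>b<n. A $$ (a,b) * W i j b) = W (Suc i) j a" if "a < n" for a i j
  proof -
    have kc: "kpow A v i \<in> carrier_mat n m" using A v by simp
    have "(\<Sum>b<n. A $$ (a,b) * W i j b) = (\<Sum>k<m. (\<Sum>b<n. A $$ (a,b) * kpow A v i $$ (b,k)) * u (j * m + k))"
      unfolding W_def sum_distrib_left sum_distrib_right by (subst sum.swap) (simp add: mult_ac)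
    also have "\<dots> = W (Suc i) j a" unfolding W_def
      using mat_mult_entry[OF A kc that] by (intro sum.cong) auto
    finally show ?thesis .
  qed
  have YW: "(\<Sum>b<n. Y p b * W i j b) = 0" if "p + i < t" for p i j
  proof -
    have "(\<Sum>b<n. Y p b * W i j b) = (\<Sum>k<m. (\<Sum>b<n. Y p b * kpow A v i $$ (b,k)) * u (j * m + k))"
      unfolding W_def sum_distrib_left sum_distrib_right by (subst sum.swap) (simp add: mult_ac)
    also have "\<dots> = 0"
      unfolding Y_def using ypow_kpow[OF A v] ann[OF that] by (intro sum.neutral) simp
    finally show ?thesis .
  qed
  have qs: "x \<in> qspace n m"
  proof -
    have "(\<Sum>a<n. x (Mat a a)) = (\<Sum>a<n. \<Sum>j<Suc J. \<Sum>i<j. Y (j - 1 - i) a * W i j a)"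
      using xM by (intro sum.cong) (auto simp: mult.commute)
    also have "\<dots> = (\<Sum>j<Suc J. \<Sum>a<n. \<Sum>i<j. Y (j - 1 - i) a * W i j a)" by (rule sum.swap)
    also have "\<dots> = (\<Sum>j<Suc J. \<Sum>i<j. \<Sum>a<n. Y (j - 1 - i) a * W i j a)" by (intro sum.cong refl sum.swap)
    also have "\<dots> = 0"
    proof (rule sum.neutral, rule ballI, rule sum.neutral, rule ballI)
      fix j i assume "j \<in> {..<Suc J}" "i \<in> {..<j}"
      then have "j - 1 - i + i < t" using J by auto
      then show "(\<Sum>a<n. Y (j - 1 - i) a * W i j a) = 0" by (rule YW)
    qed
    finally show ?thesis by (auto simp: qspace_def x_def relation_stab_def)
  qed
  have Xv: "lin_part n x * v = 0\<^sub>m n m"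
  proof (rule eq_matI)
    fix a k assume "a < dim_row (0\<^sub>m n m :: complex mat)" "k < dim_col (0\<^sub>m n m :: complex mat)"
    then have ak: "a < n" "k < m" by auto
    have "(lin_part n x * v) $$ (a,k) = (\<Sum>q<n. lin_part n x $$ (a,q) * v $$ (q,k))"
      by (rule mat_mult_entry[OF part_carrier(1) v ak])
    also have "\<dots> = (\<Sum>q<n. \<Sum>j<Suc J. \<Sum>i<j. W i j a * (Y (j - 1 - i) q * kpow A v 0 $$ (q,k)))"
      using ak xM by (intro sum.cong) (auto simp: lin_part_def sum_distrib_right mult.assoc simp del: sum.lessThan_Suc)
    also have "\<dots> = (\<Sum>j<Suc J. \<Sum>q<n. \<Sum>i<j. W i j a * (Y (j - 1 - i) q * kpow A v 0 $$ (q,k)))" by (rule sum.swap)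
    also have "\<dots> = (\<Sum>j<Suc J. \<Sum>i<j. \<Sum>q<n. W i j a * (Y (j - 1 - i) q * kpow A v 0 $$ (q,k)))" by (intro sum.cong refl sum.swap)
    also have "\<dots> = 0"
    proof (rule sum.neutral, rule ballI, rule sum.neutral, rule ballI)
      fix j i assume "j \<in> {..<Suc J}" "i \<in> {..<j}"
      then have p: "j - 1 - i < t" using J by auto
      have "(\<Sum>q<n. W i j a * (Y (j - 1 - i) q * kpow A v 0 $$ (q,k))) = W i j a * (\<Sum>q<n. Y (j - 1 - i) q * kpow A v 0 $$ (q,k))"
        by (simp only: sum_distrib_left)
      also have "\<dots> = 0" unfolding Y_def ypow_kpow[OF A v ak(2)] using ann[OF p ak(2)] by simp
      finally show "(\<Sum>q<n. W i j a * (Y (j - 1 - i) q * kpow A v 0 $$ (q,k))) = 0" .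
    qed
    finally show "(lin_part n x * v) $$ (a,k) = 0\<^sub>m n m $$ (a,k)" using ak by simp
  qed (use v in auto)
  have "moment n m (point n m A v) x = 0 \<cdot>\<^sub>m 1\<^sub>m n"
  proof (rule eq_matI)
    fix a q assume "a < dim_row (0 \<cdot>\<^sub>m 1\<^sub>m n :: complex mat)" "q < dim_col (0 \<cdot>\<^sub>m 1\<^sub>m n :: complex mat)"
    then have aq: "a < n" "q < n" by auto
    let ?X = "lin_part n x" and ?R = "row_part n m x"
    have "(A * ?X) $$ (a,q) = (\<Sum>b<n. A $$ (a,b) * ?X $$ (b,q))" by (rule mat_mult_entry[OF A part_carrier(1) aq])
    also have "\<dots> = (\<Sum>b<n. \<Sum>j<Suc J. \<Sum>i<j. (A $$ (a,b) * W i j b) * Y (j - 1 - i) q)"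
      using aq xM by (intro sum.cong) (auto simp: lin_part_def sum_distrib_left mult_ac simp del: sum.lessThan_Suc)
    also have "\<dots> = (\<Sum>j<Suc J. \<Sum>b<n. \<Sum>i<j. (A $$ (a,b) * W i j b) * Y (j - 1 - i) q)" by (rule sum.swap)
    also have "\<dots> = (\<Sum>j<Suc J. \<Sum>i<j. \<Sum>b<n. (A $$ (a,b) * W i j b) * Y (j - 1 - i) q)" by (intro sum.cong refl sum.swap)
    also have "\<dots> = (\<Sum>j<Suc J. \<Sum>i<j. W (Suc i) j a * Y (j - Suc i) q)"
      using AW[OF aq(1)] by (intro sum.cong refl) (simp add: sum_distrib_right[symmetric])
    finally have 1: "(A * ?X) $$ (a,q) = (\<Sum>j<Suc J. \<Sum>i<j. W (Suc i) j a * Y (j - Suc i) q)" .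
    have "(?X * A) $$ (a,q) = (\<Sum>b<n. ?X $$ (a,b) * A $$ (b,q))" by (rule mat_mult_entry[OF part_carrier(1) A aq])
    also have "\<dots> = (\<Sum>b<n. \<Sum>j<Suc J. \<Sum>i<j. W i j a * (Y (j - 1 - i) b * A $$ (b,q)))"
      using aq xM by (intro sum.cong) (auto simp: lin_part_def sum_distrib_right mult.assoc simp del: sum.lessThan_Suc)
    also have "\<dots> = (\<Sum>j<Suc J. \<Sum>b<n. \<Sum>i<j. W i j a * (Y (j - 1 - i) b * A $$ (b,q)))" by (rule sum.swap)
    also have "\<dots> = (\<Sum>j<Suc J. \<Sum>i<j. \<Sum>b<n. W i j a * (Y (j - 1 - i) b * A $$ (b,q)))" by (intro sum.cong refl sum.swap)
    also have "\<dots> = (\<Sum>j<Suc J. \<Sum>i<j. W i j a * Y (j - i) q)"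
    proof (rule sum.cong[OF refl], rule sum.cong[OF refl])
      fix j i :: nat assume "i \<in> {..<j}"
      then have "j - i = Suc (j - 1 - i)" by auto
      then show "(\<Sum>b<n. W i j a * (Y (j - 1 - i) b * A $$ (b,q))) = W i j a * Y (j - i) q"
        by (simp add: Y_def sum_distrib_left)
    qed
    finally have 2: "(?X * A) $$ (a,q) = (\<Sum>j<Suc J. \<Sum>i<j. W i j a * Y (j - i) q)" .
    have 3: "(v * ?R) $$ (a,q) = (\<Sum>j<Suc J. W 0 j a * Y j q)"
    proof -
      have "(v * ?R) $$ (a,q) = (\<Sum>k<m. v $$ (a,k) * ?R $$ (k,q))" by (rule mat_mult_entry[OF v part_carrier(2) aq])
      also have "\<dots> = (\<Sum>k<m. \<Sum>j<Suc J. v $$ (a,k) * u (j * m + k) * Y j q)"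
        using aq xV by (intro sum.cong) (auto simp: row_part_def sum_distrib_left mult_ac simp del: sum.lessThan_Suc)
      also have "\<dots> = (\<Sum>j<Suc J. W 0 j a * Y j q)"
        unfolding W_def by (subst sum.swap) (simp add: sum_distrib_right)
      finally show ?thesis .
    qed
    have "(\<Sum>i<j. W (Suc i) j a * Y (j - Suc i) q) - (\<Sum>i<j. W i j a * Y (j - i) q) = W j j a * Y 0 q - W 0 j a * Y j q" for j
      using sum_lessThan_telescope[of "\<lambda>i. W i j a * Y (j - i) q" j] by (simp add: sum_subtractf)
    then have "(\<Sum>j<Suc J. \<Sum>i<j. W (Suc i) j a * Y (j - Suc i) q) - (\<Sum>j<Suc J. \<Sum>i<j. W i j a * Y (j - i) q) =
        (\<Sum>j<Suc J. W j j a * Y 0 q) - (\<Sum>j<Suc J. W 0 j a * Y j q)"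
      by (simp only: sum_subtractf[symmetric])
    moreover have "(\<Sum>j<Suc J. W j j a * Y 0 q) = 0"
    proof -
      have "(\<Sum>j<Suc J. W j j a * Y 0 q) = (\<Sum>j<Suc J. W j j a) * Y 0 q" by (simp only: sum_distrib_right)
      then show ?thesis using rel[OF aq(1)] by (simp only: W_def mult_zero_left)
    qed
    ultimately have "(A * ?X) $$ (a,q) - (?X * A) $$ (a,q) + (v * ?R) $$ (a,q) = 0" unfolding 1 2 3 by simp
    moreover have "moment n m (point n m A v) x $$ (a,q) = (A * ?X) $$ (a,q) - (?X * A) $$ (a,q) + (v * ?R) $$ (a,q)"
    proof -
      have d: "dim_row (A * ?X) = n" "dim_col (A * ?X) = n" "dim_row (?X * A) = n" "dim_col (?X * A) = n"
        "dim_row (v * ?R) = n" "dim_col (v * ?R) = n" using A v by auto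
      show ?thesis unfolding moment_def using A v aq d by (simp del: index_mult_mat(1))
    qed
    ultimately show "moment n m (point n m A v) x $$ (a,q) = (0 \<cdot>\<^sub>m 1\<^sub>m n) $$ (a,q)" using aq by simp
  qed auto
  then have "x \<in> qstab n m (point n m A v)" unfolding qstab_iff using qs Xv v by auto
  then show ?thesis by (simp add: x_def)
qed

lemma kry_full:
  assumes m: "m > 0" and ij: "a < t * m + m" "j < t * m + m"
  shows "kry (t * m + m) m t (\<lambda>l. l) A v $$ (a,j) = kpow A v (j div m) $$ (a, j mod m)"
proof (cases "j < t * m")
  case True
  then show ?thesis using ij by (simp add: kry_def kblock_def kindex_def)
next
  case False
  define l where "l = j - t * m"
  have j: "j = t * m + l" "l < m" using False ij by (auto simp: l_def)
  have "j div m = t" "j mod m = l" using j m div_mult_self3[of m t l] mod_mult_self3[of t m l] by simp_all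
  then show ?thesis using ij j by (simp add: kry_def kblock_def kindex_def)
qed

lemma det_zero_kernel:
  assumes "M \<in> carrier_mat n n" "det M = (0::complex)"
  obtains u where "\<And>i. i < n \<Longrightarrow> (\<Sum>j<n. M $$ (i,j) * u j) = 0" "\<exists>j<n. u j \<noteq> 0"
proof -
  obtain w where w: "w \<in> carrier_vec n" "w \<noteq> 0\<^sub>v n" "M *\<^sub>v w = 0\<^sub>v n"
    using det_0_iff_vec_prod_zero[OF assms(1)] assms(2) by blast
  have "(\<Sum>j<n. M $$ (i,j) * w $ j) = 0" if "i < n" for i
  proof -
    have "(M *\<^sub>v w) $ i = 0" using w(3) that by simp
    then show ?thesis using assms(1) w(1) that by (simp add: scalar_prod_def lessThan_atLeast0)
  qed
  moreover have "\<exists>j<n. w $ j \<noteq> 0"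
  proof (rule ccontr)
    assume "\<not> ?thesis"
    then have "w = 0\<^sub>v n" using w(1) by (intro eq_vecI) auto
    then show False using w(2) by simp
  qed
  ultimately show ?thesis by (rule that)
qed

text \<open>A vanishing Krylov determinant provides a relation between the columns. The row vectors
  y annihilating A^p v for p < t form a space of dimension at least m >= 2, and for a shortest
  relation the stabiliser element depends injectively on y.\<close>

lemma stab_dim_ge_2:
  assumes m: "m \<ge> 2" and \<gamma>: "\<gamma> \<in> qspace (t * m + m) m" and zero: "kdet (t * m + m) m t (\<lambda>l. l) \<gamma> = 0"
  shows "2 \<le> stab_dim (t * m + m) m \<gamma>"
proof -
  define n where "n = t * m + m"
  obtain A v where A: "A \<in> carrier_mat n n" and v: "v \<in> carrier_mat n m" and \<gamma>': "\<gamma> = point n m A v"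
    using qdual_cases[OF \<gamma>] unfolding n_def by blast
  define kc where "kc s a = kpow A v (s div m) $$ (a, s mod m)" for s a
  let ?K = "kry n m t (\<lambda>l. l) A v"
  have "det ?K = 0" using zero A v unfolding \<gamma>' n_def[symmetric] by (simp add: kdet_def)
  then obtain u0 where u0: "\<And>a. a < n \<Longrightarrow> (\<Sum>j<n. ?K $$ (a,j) * u0 j) = 0" "\<exists>j<n. u0 j \<noteq> 0"
    using det_zero_kernel[OF kry_carrier(1)] by blast
  define Rel where "Rel J u \<longleftrightarrow> (\<forall>a<n. (\<Sum>s<Suc J * m. kc s a * u s) = 0) \<and> (\<exists>s<Suc J * m. u s \<noteq> 0)" for J and u :: "nat \<Rightarrow> complex"
  have "Rel t u0"
  proof -
    have nn: "Suc t * m = n" by (simp add: n_def)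
    have "(\<Sum>s<n. kc s a * u0 s) = 0" if "a < n" for a
      using u0(1)[OF that] kry_full[of m a t _ A v] m that by (simp add: kc_def n_def)
    then show ?thesis unfolding Rel_def nn using u0(2) by blast
  qed
  then have ex: "\<exists>J. \<exists>u. Rel J u" by blast
  \<comment> \<open>A relation of minimal block length: the columns of the blocks below J are
    independent, and some coefficient in block J is nonzero.\<close>
  define J where "J = (LEAST J. \<exists>u. Rel J u)"
  obtain u where u: "Rel J u" using LeastI_ex[OF ex] unfolding J_def by blast
  have Jt: "J \<le> t" unfolding J_def using \<open>Rel t u0\<close> by (intro Least_le) blast
  have small: "\<not> Rel J' c" if "J' < J" for J' c using not_less_Least[OF that[unfolded J_def]] by blast
  have indep: "c s = 0" if c: "\<And>a. a < n \<Longrightarrow> (\<Sum>s<J * m. kc s a * c s) = 0" and s: "s < J * m" for c s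
  proof (rule ccontr)
    assume "c s \<noteq> 0"
    obtain J' where J': "J = Suc J'" using s by (cases J) auto
    have "Rel J' c" unfolding Rel_def using c s \<open>c s \<noteq> 0\<close> unfolding J' by blast
    then show False using small[of J' c] J' by simp
  qed
  have top: "\<exists>k<m. u (J * m + k) \<noteq> 0"
  proof (rule ccontr)
    assume "\<not> ?thesis"
    then have z: "\<And>k. k < m \<Longrightarrow> u (J * m + k) = 0" by blast
    have nn: "Suc J * m = J * m + m" by simp
    have sum: "(\<Sum>s<Suc J * m. kc s a * u s) = (\<Sum>s<J * m. kc s a * u s)" for a
      unfolding nn sum_lessThan_split using z by simp
    obtain s where s: "s < Suc J * m" "u s \<noteq> 0" using u unfolding Rel_def by blast
    have "s < J * m"
    proof (rule ccontr)
      assume "\<not> s < J * m"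
      then have "s = J * m + (s - J * m)" "s - J * m < m" using s(1) by auto
      then show False using z s(2) by metis
    qed
    moreover have "u s = 0" if "s < J * m" using indep[of u s] u that unfolding Rel_def sum by blast
    ultimately show False using s(2) by simp
  qed
  have div: "(j * m + k) div m = j" "(j * m + k) mod m = k" if "k < m" for j k
    using that m div_mult_self3[of m j k] mod_mult_self3[of j m k] by simp_all
  have rel: "(\<Sum>j<Suc J. \<Sum>k<m. kpow A v j $$ (a,k) * u (j * m + k)) = 0" if "a < n" for a
  proof -
    have "(\<Sum>j<Suc J. \<Sum>k<m. kc (j * m + k) a * u (j * m + k)) = 0"
      using u that unfolding Rel_def sum_lessThan_blocks by blast
    then show ?thesis using div by (simp add: kc_def del: sum.lessThan_Suc)
  qed
  define Ann where "Ann y \<longleftrightarrow> (\<forall>p<t. \<forall>k<m. (\<Sum>b<n. y b * kpow A v p $$ (b,k)) = 0)" for y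
  have exists_ann: "\<exists>y. Ann y \<and> y b = 0 \<and> (\<exists>q<n. y q \<noteq> 0)" if b: "b < n" for b
  proof -
    \<comment> \<open>The t m annihilation conditions and y b = 0 make t m + 1 equations; as m >= 2
      this is fewer than n, and the remaining rows of M are zero. The choice of b later separates
      two solutions.\<close>
    define M where "M = mat n n (\<lambda>(i,j). if i < t * m then kc i j else if i = t * m then (if j = b then 1 else 0) else 0)"
    have M: "M \<in> carrier_mat n n" by (simp add: M_def)
    have last: "n - 1 < n" "\<not> n - 1 < t * m" "n - 1 \<noteq> t * m" using m by (auto simp: n_def)
    have "det M = (\<Sum>j<n. M $$ (n - 1, j) * cofactor M (n - 1) j)" by (rule laplace_expansion_row[OF M last(1)])
    also have "\<dots> = 0" using last by (intro sum.neutral) (auto simp: M_def)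
    finally obtain y where y: "\<And>i. i < n \<Longrightarrow> (\<Sum>j<n. M $$ (i,j) * y j) = 0" "\<exists>j<n. y j \<noteq> 0"
      using det_zero_kernel[OF M] by blast
    have "Ann y" unfolding Ann_def
    proof (intro allI impI)
      fix p k assume pk: "p < t" "k < m"
      then have "p * m + k < t * m" using mult_le_mono1[of "Suc p" t m] by simp
      moreover then have "p * m + k < n" by (simp add: n_def)
      ultimately show "(\<Sum>b<n. y b * kpow A v p $$ (b,k)) = 0"
        using y(1)[of "p * m + k"] div[OF pk(2), of p] by (simp add: M_def kc_def mult.commute)
    qed
    moreover have "y b = 0"
    proof -
      have "(\<Sum>j<n. M $$ (t * m, j) * y j) = (\<Sum>j<n. if j = b then y b else 0)"
        using m by (intro sum.cong) (auto simp: M_def n_def)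
      then show ?thesis using y(1)[of "t * m"] b m by (simp add: n_def)
    qed
    ultimately show ?thesis using y(2) by blast
  qed
  let ?x = "relation_stab n m A v J u"
  have mem: "?x y \<in> qstab n m \<gamma>" if "Ann y" for y
    unfolding \<gamma>' using that unfolding Ann_def by (intro relation_stab_in_qstab[OF A v Jt rel]) auto
  have inj: "y q = 0" if y0: "?x y = 0" and q: "q < n" for y q
  proof -
    have M0: "?x y (Mat a q) = 0" and V0: "?x y (Vec k q) = 0" for a k using y0 by simp_all
    obtain k0 where k0: "k0 < m" "u (J * m + k0) \<noteq> 0" using top by blast
    show ?thesis
    proof (cases J)
      case 0
      then have "u k0 * y q = 0" using V0[of k0] k0 q by (simp add: relation_stab_def in_range_def)
      then show ?thesis using k0 0 by simp
    next
      case (Suc J')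
      \<comment> \<open>Coefficient of column k of A^i v in column q of X. In block J - 1 only the
        term j = J contributes, and it is the top coefficient of the relation times y q.\<close>
      define C where "C i k = (\<Sum>j\<in>{i<..J}. u (j * m + k) * ypow n A y (j - 1 - i) q)" for i k
      have "(\<Sum>s<J * m. kc s a * C (s div m) (s mod m)) = 0" if a: "a < n" for a
      proof -
        have "(\<Sum>s<J * m. kc s a * C (s div m) (s mod m)) = (\<Sum>i<J. \<Sum>k<m. kpow A v i $$ (a,k) * C i k)"
          unfolding sum_lessThan_blocks using div by (simp add: kc_def)
        also have "\<dots> = (\<Sum>i<J. \<Sum>j\<in>{i<..J}. (\<Sum>k<m. kpow A v i $$ (a,k) * u (j * m + k)) * ypow n A y (j - 1 - i) q)"
          unfolding C_def sum_distrib_left sum_distrib_right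
          by (rule sum.cong[OF refl], subst sum.swap, simp add: mult.assoc)
        also have "\<dots> = (\<Sum>i<J. \<Sum>j | j \<in> {..<Suc J} \<and> i < j. (\<Sum>k<m. kpow A v i $$ (a,k) * u (j * m + k)) * ypow n A y (j - 1 - i) q)"
          by (intro sum.cong) auto
        also have "\<dots> = (\<Sum>j<Suc J. \<Sum>i | i \<in> {..<J} \<and> i < j. (\<Sum>k<m. kpow A v i $$ (a,k) * u (j * m + k)) * ypow n A y (j - 1 - i) q)"
          by (rule sum.swap_restrict) auto
        also have "\<dots> = (\<Sum>j<Suc J. \<Sum>i<j. (\<Sum>k<m. kpow A v i $$ (a,k) * u (j * m + k)) * ypow n A y (j - 1 - i) q)"
          by (intro sum.cong) auto
        also have "\<dots> = ?x y (Mat a q)" using a q by (simp add: relation_stab_def in_range_def del: sum.lessThan_Suc)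
        finally show ?thesis using M0 by simp
      qed
      note all0 = indep[OF this]
      have "J' * m + k0 < J * m" using k0 Suc by simp
      from all0[OF _ this] have "C J' k0 = 0" using div[OF k0(1), of J'] by simp
      moreover have "{J'<..J} = {J}" using Suc by auto
      ultimately have "u (J * m + k0) * y q = 0" using Suc by (simp add: C_def)
      then show ?thesis using k0 by simp
    qed
  qed
  have npos: "0 < n" using m by (simp add: n_def)
  obtain y1 where y1: "Ann y1" "\<exists>q<n. y1 q \<noteq> 0" using exists_ann[OF npos] by blast
  then obtain b where b: "b < n" "y1 b \<noteq> 0" by blast
  obtain y2 where y2: "Ann y2" "y2 b = 0" "\<exists>q<n. y2 q \<noteq> 0" using exists_ann[OF b(1)] by blast
  have x2: "?x y2 \<noteq> 0" using inj y2(3) by blast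
  have notin: "?x y1 \<notin> cs.span {?x y2}"
  proof
    assume "?x y1 \<in> cs.span {?x y2}"
    then obtain k where "?x y1 = cscale k (?x y2)" by (auto simp: cs.span_singleton)
    then have "?x (\<lambda>q. y1 q - k * y2 q) = 0" unfolding relation_stab_linear by simp
    from inj[OF this b(1)] show False using b(2) y2(2) by simp
  qed
  have "cs.independent {?x y1, ?x y2}"
    using x2 notin cs.span_base[of "?x y1" "{?x y2}"] by (auto simp: cs.independent_insert)
  moreover have "?x y1 \<noteq> ?x y2" using notin cs.span_base[of "?x y1" "{?x y2}"] by auto
  moreover obtain D where D: "D \<subseteq> qstab n m \<gamma>" "cs.independent D" "qstab n m \<gamma> \<subseteq> cs.span D" "card D = cs.dim (qstab n m \<gamma>)"
    using cs.basis_exists by blast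
  moreover have "finite D"
    using cs.independent_span_bound[OF _ D(2), of "set (qbasis n m)"] D(1) qstab_subset_qspace[of n m \<gamma>] by auto
  moreover have "{?x y1, ?x y2} \<subseteq> cs.span D" using mem[OF y1(1)] mem[OF y2(1)] D(3) by auto
  ultimately have "card {?x y1, ?x y2} \<le> card D" using cs.independent_span_bound by blast
  then show ?thesis using \<open>?x y1 \<noteq> ?x y2\<close> D(4) by (simp add: stab_dim_def n_def)
qed

subsection \<open>Divisibility by a square-free homogeneous polynomial\<close>

text \<open>A polynomial in s over the polynomial functions of \<gamma>, given pointwise; a degree
  bound uniform in \<gamma> is carried separately.\<close>

definition coeff_family :: "(('i \<Rightarrow> complex) \<Rightarrow> complex poly) \<Rightarrow> bool" where
  "coeff_family P \<longleftrightarrow> (\<forall>i. (\<lambda>\<gamma>. coeff (P \<gamma>) i) \<in> poly_fun UNIV)"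

lemma coeff_family_add: "coeff_family P \<Longrightarrow> coeff_family Q \<Longrightarrow> coeff_family (\<lambda>\<gamma>. P \<gamma> + Q \<gamma>)"
  by (auto simp: coeff_family_def intro: poly_fun_intros)

lemma coeff_family_mult: "coeff_family P \<Longrightarrow> coeff_family Q \<Longrightarrow> coeff_family (\<lambda>\<gamma>. P \<gamma> * Q \<gamma>)"
  by (auto simp: coeff_family_def coeff_mult intro!: poly_fun_intros)

lemma coeff_family_monom: "f \<in> poly_fun UNIV \<Longrightarrow> coeff_family (\<lambda>\<gamma>. monom (f \<gamma>) k)"
  by (auto simp: coeff_family_def intro!: poly_fun_intros)

text \<open>Refines \<open>poly_fun_line\<close> by recording how the restricted polynomial depends
  on the base point.\<close>

lemma poly_fun_line_family:
  assumes "F \<in> poly_fun UNIV"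
  shows "\<exists>P k. coeff_family P \<and> (\<forall>\<gamma>. \<forall>i\<ge>k. coeff (P \<gamma>) i = 0) \<and>
    (\<forall>\<gamma> s. F (\<lambda>i. \<gamma> i + s * \<delta> i) = poly (P \<gamma>) s)"
  using assms
proof induction
  case (pf_const c)
  show ?case
    by (intro exI[of _ "\<lambda>_. [:c:]"] exI[of _ 1])
      (auto simp: coeff_family_def coeff_pCons split: nat.splits intro: poly_fun.pf_const)
next
  case (pf_var j)
  have "coeff_family (\<lambda>\<gamma>. [:\<gamma> j, \<delta> j:])" unfolding coeff_family_def
  proof
    fix i
    show "(\<lambda>\<gamma>. coeff [:\<gamma> j, \<delta> j:] i) \<in> poly_fun UNIV"
      by (cases i; cases "i - 1") (auto intro: poly_fun_intros)
  qed
  moreover have "coeff [:\<gamma> j, \<delta> j:] i = 0" if "i \<ge> 2" for \<gamma> :: "'a \<Rightarrow> complex" and i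
    using that by (auto simp: coeff_pCons split: nat.splits)
  ultimately show ?case by (intro exI[of _ "\<lambda>\<gamma>. [:\<gamma> j, \<delta> j:]"] exI[of _ 2]) auto
next
  case (pf_add f g)
  obtain P k where P: "coeff_family P" "\<forall>\<gamma>. \<forall>i\<ge>k. coeff (P \<gamma>) i = 0" "\<forall>\<gamma> s. f (\<lambda>i. \<gamma> i + s * \<delta> i) = poly (P \<gamma>) s"
    using pf_add.IH(1) by (elim exE conjE) (rule that)
  obtain Q l where Q: "coeff_family Q" "\<forall>\<gamma>. \<forall>i\<ge>l. coeff (Q \<gamma>) i = 0" "\<forall>\<gamma> s. g (\<lambda>i. \<gamma> i + s * \<delta> i) = poly (Q \<gamma>) s"
    using pf_add.IH(2) by (elim exE conjE) (rule that)
  show ?case using P Q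
    by (intro exI[of _ "\<lambda>\<gamma>. P \<gamma> + Q \<gamma>"] exI[of _ "max k l"]) (auto intro: coeff_family_add)
next
  case (pf_mult f g)
  obtain P k where P: "coeff_family P" "\<forall>\<gamma>. \<forall>i\<ge>k. coeff (P \<gamma>) i = 0" "\<forall>\<gamma> s. f (\<lambda>i. \<gamma> i + s * \<delta> i) = poly (P \<gamma>) s"
    using pf_mult.IH(1) by (elim exE conjE) (rule that)
  obtain Q l where Q: "coeff_family Q" "\<forall>\<gamma>. \<forall>i\<ge>l. coeff (Q \<gamma>) i = 0" "\<forall>\<gamma> s. g (\<lambda>i. \<gamma> i + s * \<delta> i) = poly (Q \<gamma>) s"
    using pf_mult.IH(2) by (elim exE conjE) (rule that)
  have "coeff (P \<gamma> * Q \<gamma>) i = 0" if "i \<ge> k + l" for \<gamma> i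
    unfolding coeff_mult
  proof (intro sum.neutral ballI)
    fix j assume "j \<in> {..i}"
    then have "j \<ge> k \<or> i - j \<ge> l" using that by auto
    then show "coeff (P \<gamma>) j * coeff (Q \<gamma>) (i - j) = 0" using P(2) Q(2) by auto
  qed
  then show ?case using P Q
    by (intro exI[of _ "\<lambda>\<gamma>. P \<gamma> * Q \<gamma>"] exI[of _ "k + l"]) (auto intro: coeff_family_mult)
qed

text \<open>Along a line through \<open>\<delta>\<close> a form \<open>D\<close> of degree \<open>d\<close> has the constant leading coefficient \<open>D \<delta>\<close>,
  because \<open>D (\<gamma> + s \<delta>) = s\<^sup>d D (\<delta> + \<gamma> / s)\<close>.\<close>

lemma homogeneous_line_coeff:
  assumes D: "D \<in> poly_fun UNIV" and hom: "\<And>c \<gamma>. D (\<lambda>i. c * \<gamma> i) = c ^ d * D \<gamma>"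
    and p: "\<And>s. D (\<lambda>i. \<gamma> i + s * \<delta> i) = poly p s"
  shows "coeff p d = D \<delta>" "i > d \<Longrightarrow> coeff p i = 0"
proof -
  obtain q where q: "\<And>s. D (\<lambda>i. \<delta> i + s * \<gamma> i) = poly q s"
    using poly_fun_line[OF D, of \<delta> \<gamma>] by blast
  define N where "N = degree q"
  have eq: "s ^ N * poly p s = s ^ d * poly (reflect_poly q) s" if "s \<noteq> 0" for s
  proof -
    have "poly p s = D (\<lambda>i. \<gamma> i + s * \<delta> i)" by (simp only: p)
    also have "(\<lambda>i. \<gamma> i + s * \<delta> i) = (\<lambda>i. s * (\<delta> i + inverse s * \<gamma> i))"
    proof
      fix i
      show "\<gamma> i + s * \<delta> i = s * (\<delta> i + inverse s * \<gamma> i)"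
        unfolding distrib_left mult.assoc[symmetric] right_inverse[OF that] by simp
    qed
    also have "D \<dots> = s ^ d * D (\<lambda>i. \<delta> i + inverse s * \<gamma> i)" by (rule hom)
    also have "\<dots> = s ^ d * poly q (inverse s)" by (simp only: q)
    finally show ?thesis using poly_reflect_poly_nz[OF that, of q] by (simp add: N_def)
  qed
  have "monom 1 (Suc N) * p = monom 1 (Suc d) * reflect_poly q"
  proof (rule poly_ext)
    fix s :: complex
    show "poly (monom 1 (Suc N) * p) s = poly (monom 1 (Suc d) * reflect_poly q) s"
      using eq[of s] by (cases "s = 0") (auto simp: poly_monom)
  qed
  then have "coeff (monom 1 (Suc N) * p) (Suc N + j) = coeff (monom 1 (Suc d) * reflect_poly q) (Suc N + j)" for j
    by simp
  then have *: "coeff p j = (if N + j < d then 0 else coeff (reflect_poly q) (N + j - d))" for j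
    by (simp add: coeff_monom_mult)
  have "poly q 0 = D \<delta>" using q[of 0] by simp
  then show "coeff p d = D \<delta>" using *[of d] by (simp add: coeff_reflect_poly N_def poly_0_coeff_0)
  show "coeff p i = 0" if "i > d" using *[of i] that by (simp add: coeff_reflect_poly N_def)
qed

text \<open>Long division by a polynomial with constant leading coefficient \<kappa>: only \<kappa>
  is ever divided by, so quotient and remainder keep coefficients polynomial in \<gamma>.\<close>

lemma coeff_family_division:
  assumes D: "coeff_family D" and lead: "\<And>\<gamma>. coeff (D \<gamma>) d = \<kappa>" "\<kappa> \<noteq> 0" and above: "\<And>\<gamma> i. i > d \<Longrightarrow> coeff (D \<gamma>) i = 0"
    and P: "coeff_family P" and bound: "\<And>\<gamma> i. i \<ge> k \<Longrightarrow> coeff (P \<gamma>) i = 0"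
  shows "\<exists>Q R. coeff_family Q \<and> coeff_family R \<and> (\<forall>\<gamma>. P \<gamma> = D \<gamma> * Q \<gamma> + R \<gamma>) \<and> (\<forall>\<gamma>. \<forall>i\<ge>d. coeff (R \<gamma>) i = 0)"
  using P bound
proof (induction k arbitrary: P)
  case 0
  then have "P \<gamma> = 0" for \<gamma> by (simp add: poly_eq_iff)
  then show ?case
    by (intro exI[of _ "\<lambda>_. 0"]) (auto simp: coeff_family_def intro: pf_const)
next
  case (Suc k)
  show ?case
  proof (cases "k < d")
    case True
    then show ?thesis using Suc.prems
      by (intro exI[of _ "\<lambda>_. 0"] exI[of _ P]) (auto simp: coeff_family_def intro: pf_const)
  next
    case False
    define M where "M \<gamma> = monom (coeff (P \<gamma>) k / \<kappa>) (k - d)" for \<gamma>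
    have M: "coeff_family M" unfolding M_def using Suc.prems(1)
      by (intro coeff_family_monom poly_fun_div) (auto simp: coeff_family_def)
    define P' where "P' \<gamma> = P \<gamma> + monom (-1) 0 * (M \<gamma> * D \<gamma>)" for \<gamma>
    have P': "coeff_family P'" unfolding P'_def
      by (intro coeff_family_add coeff_family_mult coeff_family_monom Suc.prems(1) D M pf_const)
    have eq: "P' \<gamma> = P \<gamma> - M \<gamma> * D \<gamma>" for \<gamma> by (simp add: P'_def monom_0)
    have bound': "coeff (P' \<gamma>) i = 0" if "i \<ge> k" for \<gamma> i
    proof (cases "i = k")
      case True
      then show ?thesis using False lead by (simp add: eq M_def coeff_monom_mult)
    next
      case neq: False
      then have "i - (k - d) > d" "i \<ge> Suc k" using that False by auto
      then show ?thesis using Suc.prems(2)[of i \<gamma>] above[of "i - (k - d)" \<gamma>] by (simp add: eq M_def coeff_monom_mult)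
    qed
    have "\<exists>Q R. coeff_family Q \<and> coeff_family R \<and> (\<forall>\<gamma>. P' \<gamma> = D \<gamma> * Q \<gamma> + R \<gamma>) \<and> (\<forall>\<gamma>. \<forall>i\<ge>d. coeff (R \<gamma>) i = 0)"
      by (rule Suc.IH[OF P']) (rule bound')
    then obtain Q R where QR: "coeff_family Q" "coeff_family R"
      "\<forall>\<gamma>. P' \<gamma> = D \<gamma> * Q \<gamma> + R \<gamma>" "\<forall>\<gamma>. \<forall>i\<ge>d. coeff (R \<gamma>) i = 0"
      by (elim exE conjE) (rule that)
    have "P \<gamma> = D \<gamma> * (M \<gamma> + Q \<gamma>) + R \<gamma>" for \<gamma>
    proof -
      have "P \<gamma> = P' \<gamma> + M \<gamma> * D \<gamma>" by (simp add: eq)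
      then show ?thesis using QR(3) by (simp add: algebra_simps)
    qed
    then show ?thesis using QR(2,4) coeff_family_add[OF M QR(1)]
      by (intro exI[of _ "\<lambda>\<gamma>. M \<gamma> + Q \<gamma>"] exI[of _ R]) auto
  qed
qed

text \<open>Nonzero discriminant means no root shared with the derivative. The count of distinct
  roots is the form that an explicit list of zeros on a line can supply.\<close>

lemma resultant_pderiv_nonzero_iff:
  fixes p :: "complex poly"
  assumes "degree p > 0"
  shows "resultant p (pderiv p) \<noteq> 0 \<longleftrightarrow> card {s. poly p s = 0} \<ge> degree p"
proof -
  have p: "p \<noteq> 0" using assms by auto
  have gcd: "resultant p (pderiv p) \<noteq> 0 \<longleftrightarrow> (\<forall>a. \<not> (poly p a = 0 \<and> poly (pderiv p) a = 0))"
  proof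
    assume nz: "resultant p (pderiv p) \<noteq> 0"
    show "\<forall>a. \<not> (poly p a = 0 \<and> poly (pderiv p) a = 0)"
    proof (intro allI notI)
      fix a assume "poly p a = 0 \<and> poly (pderiv p) a = 0"
      then have "[:-a, 1:] dvd gcd p (pderiv p)" by (simp add: poly_eq_0_iff_dvd)
      then have "degree [:-a, 1:] \<le> degree (gcd p (pderiv p))" using p by (intro dvd_imp_degree_le) auto
      then show False using nz by (simp add: resultant_0_gcd)
    qed
  next
    assume *: "\<forall>a. \<not> (poly p a = 0 \<and> poly (pderiv p) a = 0)"
    show "resultant p (pderiv p) \<noteq> 0"
    proof
      assume "resultant p (pderiv p) = 0"
      then have "degree (gcd p (pderiv p)) \<noteq> 0" by (simp add: resultant_0_gcd)
      then obtain a where "poly (gcd p (pderiv p)) a = 0"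
        using fundamental_theorem_of_algebra[of "gcd p (pderiv p)"] by (auto simp: constant_degree)
      then have "[:-a, 1:] dvd gcd p (pderiv p)" by (simp add: poly_eq_0_iff_dvd)
      then have "poly p a = 0" "poly (pderiv p) a = 0" by (simp_all add: poly_eq_0_iff_dvd)
      then show False using * by blast
    qed
  qed
  show ?thesis unfolding gcd
  proof
    assume "\<forall>a. \<not> (poly p a = 0 \<and> poly (pderiv p) a = 0)"
    then have "rsquarefree p" by (simp add: rsquarefree_roots)
    from complex_poly_decompose_rsquarefree[OF this]
    have "degree p = degree (smult (lead_coeff p) (\<Prod>z | poly p z = 0. [:- z, 1:]))" by simp
    also have "\<dots> \<le> degree (\<Prod>z | poly p z = 0. [:- z, 1:])" by (rule degree_smult_le)
    also have "\<dots> \<le> (\<Sum>z | poly p z = 0. degree [:- z, 1:])"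
      by (rule order_trans[OF degree_prod_sum_le]) (use poly_roots_finite[OF p] in auto)
    finally show "card {s. poly p s = 0} \<ge> degree p" by simp
  next
    assume card: "card {s. poly p s = 0} \<ge> degree p"
    show "\<forall>a. \<not> (poly p a = 0 \<and> poly (pderiv p) a = 0)"
    proof (intro allI notI)
      fix a assume a: "poly p a = 0 \<and> poly (pderiv p) a = 0"
      then obtain g where g: "p = [:-a, 1:] * g" using poly_eq_0_iff_dvd by (metis dvdE)
      have "poly (pderiv ([:-a, 1:] * g)) a = 0" using a unfolding g by blast
      then have ga: "poly g a = 0" unfolding pderiv_mult poly_add poly_mult by (simp add: pderiv_pCons)
      have g0: "g \<noteq> 0" using p g by auto
      have "{s. poly p s = 0} \<subseteq> {s. poly g s = 0}" using ga unfolding g by auto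
      then have "card {s. poly p s = 0} \<le> card {s. poly g s = 0}"
        by (rule card_mono[OF poly_roots_finite[OF g0]])
      also have "\<dots> \<le> degree g" by (rule card_poly_roots_bound[OF g0])
      also have "\<dots> < degree p" unfolding g using g0 by (subst degree_mult_eq) auto
      finally show False using card by simp
    qed
  qed
qed

text \<open>If \<open>D\<close> restricted to one line has \<open>d\<close> distinct roots, then the same holds on the dense set
  where the discriminant does not vanish; there the remainder of \<open>F\<close> modulo \<open>D\<close> has too many roots.\<close>

lemma vanishing_imp_divisible:
  assumes D: "D \<in> poly_fun UNIV" and F: "F \<in> poly_fun UNIV" and S: "line_closed S"
    and shift: "\<And>\<gamma> s. \<gamma> \<in> S \<Longrightarrow> (\<lambda>i. \<gamma> i + s * \<delta> i) \<in> S"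
    and hom: "\<And>c \<gamma>. D (\<lambda>i. c * \<gamma> i) = c ^ d * D \<gamma>" and d: "d > 0" and \<delta>: "D \<delta> \<noteq> 0"
    and \<gamma>0: "\<gamma>0 \<in> S" and Z: "card Z \<ge> d" "\<And>s. s \<in> Z \<Longrightarrow> D (\<lambda>i. \<gamma>0 i + s * \<delta> i) = 0"
    and van: "\<And>\<gamma>. \<gamma> \<in> S \<Longrightarrow> D \<gamma> = 0 \<Longrightarrow> F \<gamma> = 0"
  shows "\<exists>h\<in>poly_fun UNIV. \<forall>\<gamma>\<in>S. F \<gamma> = D \<gamma> * h \<gamma>"
proof -
  obtain P k where P: "coeff_family P" "\<forall>\<gamma>. \<forall>i\<ge>k. coeff (P \<gamma>) i = 0" "\<forall>\<gamma> s. F (\<lambda>i. \<gamma> i + s * \<delta> i) = poly (P \<gamma>) s"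
    using poly_fun_line_family[OF F, where \<delta> = \<delta>] by (elim exE conjE) (rule that)
  obtain E l where E: "coeff_family E" "\<forall>\<gamma>. \<forall>i\<ge>l. coeff (E \<gamma>) i = 0" "\<forall>\<gamma> s. D (\<lambda>i. \<gamma> i + s * \<delta> i) = poly (E \<gamma>) s"
    using poly_fun_line_family[OF D, where \<delta> = \<delta>] by (elim exE conjE) (rule that)
  have lead: "coeff (E \<gamma>) d = D \<delta>" and above: "i > d \<Longrightarrow> coeff (E \<gamma>) i = 0" for \<gamma> i
    using homogeneous_line_coeff[OF D hom, of \<gamma> \<delta> "E \<gamma>"] E(3) by auto
  have deg: "degree (E \<gamma>) = d" for \<gamma>
    using above[of _ \<gamma>] lead[of \<gamma>] \<delta> by (intro antisym degree_le le_degree) auto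
  obtain Q R where QR: "coeff_family Q" "coeff_family R" "\<forall>\<gamma>. P \<gamma> = E \<gamma> * Q \<gamma> + R \<gamma>"
    "\<forall>\<gamma>. \<forall>i\<ge>d. coeff (R \<gamma>) i = 0"
  proof -
    have "\<exists>Q R. coeff_family Q \<and> coeff_family R \<and> (\<forall>\<gamma>. P \<gamma> = E \<gamma> * Q \<gamma> + R \<gamma>) \<and> (\<forall>\<gamma>. \<forall>i\<ge>d. coeff (R \<gamma>) i = 0)"
      by (rule coeff_family_division[OF E(1) lead \<delta> _ P(1), where k = k]) (use above P(2) in auto)
    then show ?thesis by (elim exE conjE) (rule that)
  qed
  define disc where "disc \<gamma> = resultant (E \<gamma>) (pderiv (E \<gamma>))" for \<gamma>
  have disc: "disc \<in> poly_fun UNIV"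
  proof -
    \<comment> \<open>The degree of \<open>E \<gamma>\<close> is d for every \<gamma>, so the
      Sylvester matrices have one common size and the discriminant is a polynomial function.\<close>
    have "disc = (\<lambda>\<gamma>. det (mat (d + (d - 1)) (d + (d - 1)) (\<lambda>(i,j).
        if i < d - 1 then if i \<le> j \<and> j - i \<le> d then coeff (E \<gamma>) (d + i - j) else 0
        else if i - (d - 1) \<le> j \<and> j \<le> i then coeff (pderiv (E \<gamma>)) (i - j) else 0)))"
      by (intro ext, unfold disc_def resultant_def sylvester_mat_def sylvester_mat_sub_def degree_pderiv deg, rule refl)
    also have "\<dots> \<in> poly_fun UNIV"
    proof -
      have c: "(\<lambda>\<gamma>. coeff (E \<gamma>) i) \<in> poly_fun UNIV" for i using E(1) by (simp add: coeff_family_def)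
      have "(\<lambda>\<gamma>. coeff (pderiv (E \<gamma>)) i) \<in> poly_fun UNIV" for i
        unfolding coeff_pderiv by (rule poly_fun_cmult[OF c])
      then show ?thesis by (intro det_poly_fun poly_fun_if pf_const c)
    qed
    finally show ?thesis .
  qed
  have disc_iff: "disc \<gamma> \<noteq> 0 \<longleftrightarrow> card {s. poly (E \<gamma>) s = 0} \<ge> d" for \<gamma>
    unfolding disc_def using resultant_pderiv_nonzero_iff[of "E \<gamma>"] d deg by simp
  have fin: "finite {s. poly (E \<gamma>) s = 0}" for \<gamma>
    using deg[of \<gamma>] d by (intro poly_roots_finite) auto
  have "Z \<subseteq> {s. poly (E \<gamma>0) s = 0}" using Z(2) E(3) by auto
  then have "d \<le> card {s. poly (E \<gamma>0) s = 0}" using Z(1) card_mono[OF fin] by (meson le_trans)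
  then have disc0: "disc \<gamma>0 \<noteq> 0" by (simp add: disc_iff)
  have R0: "R \<gamma> = 0" if \<gamma>: "\<gamma> \<in> S" "disc \<gamma> \<noteq> 0" for \<gamma>
  proof (rule ccontr)
    assume nz: "R \<gamma> \<noteq> 0"
    have "{s. poly (E \<gamma>) s = 0} \<subseteq> {s. poly (R \<gamma>) s = 0}"
    proof
      fix s assume "s \<in> {s. poly (E \<gamma>) s = 0}"
      then have s: "poly (E \<gamma>) s = 0" by simp
      then have "F (\<lambda>i. \<gamma> i + s * \<delta> i) = 0" using van[OF shift[OF \<gamma>(1)]] E(3) by simp
      then have "poly (E \<gamma> * Q \<gamma> + R \<gamma>) s = 0" using P(3) QR(3) by simp
      then show "s \<in> {s. poly (R \<gamma>) s = 0}" using s by simp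
    qed
    then have "card {s. poly (E \<gamma>) s = 0} \<le> card {s. poly (R \<gamma>) s = 0}"
      by (rule card_mono[OF poly_roots_finite[OF nz]])
    also have "\<dots> \<le> degree (R \<gamma>)" by (rule card_poly_roots_bound[OF nz])
    also have "\<dots> < d" using QR(4) d by (intro degree_lessI) auto
    finally show False using disc_iff \<gamma>(2) by simp
  qed
  have "F \<gamma> = D \<gamma> * coeff (Q \<gamma>) 0" if "\<gamma> \<in> S" for \<gamma>
  proof -
    have c: "(\<lambda>\<gamma>. coeff (R \<gamma>) 0) \<in> poly_fun UNIV" using QR(2) by (simp add: coeff_family_def)
    have "coeff (R \<gamma>) 0 = 0"
      by (rule poly_fun_dense[OF S disc c \<gamma>0 disc0 _ that]) (simp add: R0)
    moreover have "F \<gamma> = poly (P \<gamma>) 0" "D \<gamma> = poly (E \<gamma>) 0"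
      using P(3)[rule_format, of \<gamma> 0] E(3)[rule_format, of \<gamma> 0] by simp_all
    ultimately show ?thesis using QR(3) by (simp add: poly_0_coeff_0 coeff_mult)
  qed
  then show ?thesis using QR(1)
    by (intro bexI[of _ "\<lambda>\<gamma>. coeff (Q \<gamma>) 0"]) (auto simp: coeff_family_def)
qed

subsection \<open>The Krylov determinant divides every Pfaffian when \<open>m\<close> divides \<open>n\<close>\<close>

lemma kdet_full:
  assumes "m > 0" "n = t * m + m"
  shows "kdet n m t (\<lambda>l. l) \<gamma> =
    det (mat n n (\<lambda>(i,j). kpow (lin_part n \<gamma>) (col_part n m \<gamma>) (j div m) $$ (i, j mod m)))"
proof -
  have "kry n m t (\<lambda>l. l) (lin_part n \<gamma>) (col_part n m \<gamma>) =
      mat n n (\<lambda>(i,j). kpow (lin_part n \<gamma>) (col_part n m \<gamma>) (j div m) $$ (i, j mod m))"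
    using kry_full[OF assms(1)] assms(2) by (intro eq_matI) auto
  then show ?thesis by (simp add: kdet_def)
qed

lemma det_scale_cols:
  fixes g :: "nat \<Rightarrow> nat \<Rightarrow> complex"
  shows "det (mat n n (\<lambda>(i,j). f j * g i j)) = (\<Prod>j<n. f j) * det (mat n n (\<lambda>(i,j). g i j))"
proof -
  have "(\<Prod>i<n. f (p i) * g i (p i)) = (\<Prod>j<n. f j) * (\<Prod>i<n. g i (p i))" if "p permutes {..<n}" for p
    using prod.permute[OF that, of f] by (simp add: prod.distrib comp_def)
  then show ?thesis
    unfolding detn_eq_det[symmetric] detn_def sum_distrib_left by (intro sum.cong) auto
qed

lemma kpow_scale:
  assumes "i < n" "k < m"
  shows "kpow (lin_part n (\<lambda>d. c * \<gamma> d)) (col_part n m (\<lambda>d. c * \<gamma> d)) p $$ (i,k) =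
    c ^ Suc p * kpow (lin_part n \<gamma>) (col_part n m \<gamma>) p $$ (i,k)"
  using assms
proof (induction p arbitrary: i)
  case 0
  then show ?case by (simp add: col_part_def)
next
  case (Suc p)
  have rec: "kpow (lin_part n \<beta>) (col_part n m \<beta>) (Suc p) $$ (i,k) =
      (\<Sum>l<n. \<beta> (Mat i l) * kpow (lin_part n \<beta>) (col_part n m \<beta>) p $$ (l,k))" for \<beta>
  proof -
    have c: "kpow (lin_part n \<beta>) (col_part n m \<beta>) p \<in> carrier_mat n m" by simp
    show ?thesis unfolding kpow.simps mat_mult_entry[OF part_carrier(1) c Suc.prems]
      using Suc.prems by (intro sum.cong) (auto simp: lin_part_def)
  qed
  have "(\<Sum>l<n. c * \<gamma> (Mat i l) * kpow (lin_part n (\<lambda>d. c * \<gamma> d)) (col_part n m (\<lambda>d. c * \<gamma> d)) p $$ (l,k)) =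
      (\<Sum>l<n. c ^ Suc (Suc p) * (\<gamma> (Mat i l) * kpow (lin_part n \<gamma>) (col_part n m \<gamma>) p $$ (l,k)))"
    using Suc.IH[OF _ Suc.prems(2)] by (intro sum.cong) (auto simp: mult_ac)
  then show ?case unfolding rec sum_distrib_left .
qed

text \<open>Column j is a column of A^(j div m) v and thus has degree j div m + 1 in the
  point.\<close>

lemma kdet_homogeneous:
  assumes "m > 0" "n = t * m + m"
  shows "kdet n m t (\<lambda>l. l) (\<lambda>d. c * \<gamma> d) = c ^ (\<Sum>j<n. Suc (j div m)) * kdet n m t (\<lambda>l. l) \<gamma>"
proof -
  have "mat n n (\<lambda>(i,j). kpow (lin_part n (\<lambda>d. c * \<gamma> d)) (col_part n m (\<lambda>d. c * \<gamma> d)) (j div m) $$ (i, j mod m)) =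
      mat n n (\<lambda>(i,j). c ^ Suc (j div m) * kpow (lin_part n \<gamma>) (col_part n m \<gamma>) (j div m) $$ (i, j mod m))"
    using assms(1) by (intro eq_matI) (auto simp: kpow_scale simp del: power_Suc)
  then show ?thesis
    unfolding kdet_full[OF assms] using det_scale_cols[of n "\<lambda>j. c ^ Suc (j div m)"] by (simp only: power_sum)
qed

text \<open>Copy k lives on the coordinates congruent to k modulo m. For n = (t + 1) m the Krylov
  determinant thereby becomes, up to sign, the product of the weights \<open>w\<close> and of m
  Vandermonde determinants of size t + 1.\<close>

definition diag_point :: "nat \<Rightarrow> nat \<Rightarrow> (nat \<Rightarrow> complex) \<Rightarrow> (nat \<Rightarrow> complex) \<Rightarrow> idx \<Rightarrow> complex" where
  "diag_point n m a w = point n m (diag_traceless n a) (mat n m (\<lambda>(i,k). if i mod m = k then w i else 0))"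

lemma diag_point_in_qspace: "n > 0 \<Longrightarrow> diag_point n m a w \<in> qspace n m"
  unfolding diag_point_def by (intro point_in_qspace) (auto simp: mtr_diag_traceless)

lemma diag_point_line:
  "(\<lambda>c. diag_point n m a w c + s * diag_point n m b z c) = diag_point n m (\<lambda>i. a i + s * b i) (\<lambda>i. w i + s * z i)"
proof
  fix c
  show "diag_point n m a w c + s * diag_point n m b z c = diag_point n m (\<lambda>i. a i + s * b i) (\<lambda>i. w i + s * z i) c"
    by (cases c) (auto simp: diag_point_def point_def in_range_def diag_traceless_def sum.distrib
        sum_distrib_left[symmetric] add_divide_distrib right_diff_distrib)
qed

lemma kdet_diag_point:
  assumes "m > 0" "n = t * m + m"
  shows "kdet n m t (\<lambda>l. l) (diag_point n m a w) =
    det (mat n n (\<lambda>(i,j). (a i - (\<Sum>l<n. a l) / of_nat n) ^ (j div m) * (if i mod m = j mod m then w i else 0)))"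
proof -
  let ?v = "mat n m (\<lambda>(i,k). if i mod m = k then w i else 0)"
  have v: "?v \<in> carrier_mat n m" by simp
  have parts: "lin_part n (diag_point n m a w) = diag_traceless n a" "col_part n m (diag_point n m a w) = ?v"
    unfolding diag_point_def by (simp_all add: carrier_matD[OF diag_traceless_carrier])
  have "mat n n (\<lambda>(i,j). kpow (diag_traceless n a) ?v (j div m) $$ (i, j mod m)) =
      mat n n (\<lambda>(i,j). (a i - (\<Sum>l<n. a l) / of_nat n) ^ (j div m) * (if i mod m = j mod m then w i else 0))"
    using assms(1) kpow_diag[OF v, of _ _ a] by (intro eq_matI) auto
  then show ?thesis unfolding kdet_full[OF assms] parts by simp
qed

lemma left_kernel_det_zero:
  fixes M :: "complex mat"
  assumes M: "M \<in> carrier_mat n n" and y: "\<And>j. j < n \<Longrightarrow> (\<Sum>i<n. y i * M $$ (i,j)) = 0" and b: "b < n" "y b \<noteq> 0"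
  shows "det M = 0"
proof -
  have T: "transpose_mat M \<in> carrier_mat n n" using M by simp
  have "transpose_mat M *\<^sub>v vec n y = 0\<^sub>v n"
  proof (rule eq_vecI)
    fix j assume "j < dim_vec (0\<^sub>v n :: complex vec)"
    then have j: "j < n" by simp
    then have "(transpose_mat M *\<^sub>v vec n y) $ j = (\<Sum>i<n. M $$ (i,j) * y i)"
      using M by (simp add: scalar_prod_def lessThan_atLeast0)
    then show "(transpose_mat M *\<^sub>v vec n y) $ j = 0\<^sub>v n $ j" using y[OF j] j by (simp add: mult.commute)
  qed (use M in auto)
  moreover have "vec n y \<noteq> 0\<^sub>v n"
  proof
    assume "vec n y = 0\<^sub>v n"
    then have "vec n y $ b = 0\<^sub>v n $ b" by simp
    then show False using b by simp
  qed
  ultimately have "det (transpose_mat M) = 0"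
    unfolding det_0_iff_vec_prod_zero[OF T] by (intro exI[of _ "vec n y"]) auto
  then show ?thesis using det_transpose[OF M] by simp
qed

lemma kdet_diag_point_zero:
  assumes mn: "m > 0" "n = t * m + m" and ij: "i < n" "j < n" "i mod m = j mod m"
    and zero: "if i = j then w i = 0 else a i = a j \<and> w i \<noteq> 0"
  shows "kdet n m t (\<lambda>l. l) (diag_point n m a w) = 0"
proof -
  let ?g = "\<lambda>i c. (a i - (\<Sum>l<n. a l) / of_nat n) ^ (c div m) * (if i mod m = c mod m then w i else 0)"
  \<comment> \<open>Left kernel vector: row i is zero if its weight is zero, and rows i and j with
    equal eigenvalue are proportional to their weights.\<close>
  define y where "y l = (if i = j then (if l = i then 1 else 0) else if l = i then w j else if l = j then - w i else 0)" for l
  have "(\<Sum>l<n. y l * mat n n (\<lambda>(i,c). ?g i c) $$ (l,c)) = 0" if c: "c < n" for c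
  proof -
    have "(\<Sum>l<n. y l * mat n n (\<lambda>(i,c). ?g i c) $$ (l,c)) = (\<Sum>l<n. y l * ?g l c)"
      using c by (intro sum.cong) auto
    also have "\<dots> = (\<Sum>l\<in>{i,j}. y l * ?g l c)"
      using ij by (intro sum.mono_neutral_right) (auto simp: y_def)
    also have "\<dots> = 0"
    proof (cases "i = j")
      case True
      then have s: "{i,j} = {i}" and w: "w i = 0" using zero by auto
      show ?thesis unfolding s using w by simp
    next
      case False
      then show ?thesis using zero ij(3) by (simp add: y_def)
    qed
    finally show ?thesis .
  qed
  moreover have "\<exists>b<n. y b \<noteq> 0" using zero ij by (cases "i = j") (auto simp: y_def)
  ultimately show ?thesis unfolding kdet_diag_point[OF mn]
    using left_kernel_det_zero[of "mat n n (\<lambda>(i,c). ?g i c)" n y] by auto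
qed

lemma kdet_diag_point_nonzero:
  assumes mn: "m > 0" "n = t * m + m" and inj: "inj_on a {..<n}"
  shows "kdet n m t (\<lambda>l. l) (diag_point n m a (\<lambda>_. 1)) \<noteq> 0"
proof
  define b where "b i = a i - (\<Sum>l<n. a l) / of_nat n" for i
  define M where "M = mat n n (\<lambda>(i,j). b i ^ (j div m) * (if i mod m = j mod m then 1 else 0))"
  have M: "M \<in> carrier_mat n n" by (simp add: M_def)
  assume "kdet n m t (\<lambda>l. l) (diag_point n m a (\<lambda>_. 1)) = 0"
  then have "det M = 0" unfolding kdet_diag_point[OF mn] M_def b_def .
  then obtain u where u: "\<And>i. i < n \<Longrightarrow> (\<Sum>j<n. M $$ (i,j) * u j) = 0" "\<exists>j<n. u j \<noteq> 0"
    using det_zero_kernel[OF M] by blast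
  have div: "(p * m + k) div m = p" "(p * m + k) mod m = k" if "k < m" for p k
    using that mn div_mult_self3[of m p k] mod_mult_self3[of p m k] by simp_all
  have lt: "p * m + k < n" if "p < Suc t" "k < m" for p k
  proof -
    have "p * m \<le> t * m" using that by (intro mult_le_mono1) simp
    then show ?thesis using that(2) mn(2) by linarith
  qed
  \<comment> \<open>A kernel vector splits into m polynomials of degree at most t, one per residue
    class; each vanishes at the t + 1 distinct eigenvalues of its class.\<close>
  define q where "q k = (\<Sum>p<Suc t. monom (u (p * m + k)) p)" for k
  have root: "poly (q k) (b (p * m + k)) = 0" if pk: "p < Suc t" "k < m" for p k
  proof -
    let ?i = "p * m + k"
    have nn: "n = Suc t * m" using mn by simp
    have "0 = (\<Sum>j<n. (b ?i ^ (j div m) * (if ?i mod m = j mod m then 1 else 0)) * u j)"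
      using u(1)[OF lt[OF pk]] lt[OF pk] by (simp add: M_def)
    also have "\<dots> = (\<Sum>p'<Suc t. \<Sum>k'<m. (b ?i ^ ((p' * m + k') div m) * (if ?i mod m = (p' * m + k') mod m then 1 else 0)) * u (p' * m + k'))"
      unfolding nn by (rule sum_lessThan_blocks)
    also have "\<dots> = (\<Sum>p'<Suc t. \<Sum>k'<m. if k' = k then b ?i ^ p' * u (p' * m + k) else 0)"
      using div pk by (intro sum.cong refl) auto
    also have "\<dots> = poly (q k) (b ?i)" using pk(2)
      by (simp add: q_def poly_sum poly_monom mult.commute del: sum.lessThan_Suc)
    finally show ?thesis by simp
  qed
  have q0: "q k = 0" if k: "k < m" for k
  proof (rule ccontr)
    assume nz: "q k \<noteq> 0"
    have "inj_on (\<lambda>p. b (p * m + k)) {..<Suc t}"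
    proof (rule inj_onI)
      fix p p' assume pp: "p \<in> {..<Suc t}" "p' \<in> {..<Suc t}" "b (p * m + k) = b (p' * m + k)"
      then have "p * m + k = p' * m + k" using lt[of p k] lt[of p' k] k
        by (intro inj_onD[OF inj]) (auto simp: b_def)
      then show "p = p'" using mn by simp
    qed
    then have "Suc t = card ((\<lambda>p. b (p * m + k)) ` {..<Suc t})" by (simp add: card_image)
    also have "\<dots> \<le> card {s. poly (q k) s = 0}"
      using root[OF _ k] by (intro card_mono poly_roots_finite[OF nz]) auto
    also have "\<dots> \<le> degree (q k)" by (rule card_poly_roots_bound[OF nz])
    also have "\<dots> \<le> t" unfolding q_def by (rule degree_sum_le) (auto intro: order_trans[OF degree_monom_le])
    finally show False by simp
  qed
  have "u (p * m + k) = 0" if "p < Suc t" "k < m" for p k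
  proof -
    have "coeff (q k) p = (\<Sum>p'<Suc t. if p' = p then u (p * m + k) else 0)"
      unfolding q_def coeff_sum by (intro sum.cong) auto
    then show ?thesis using q0[OF that(2)] that(1) by (simp del: sum.lessThan_Suc)
  qed
  moreover have "j = j div m * m + j mod m" "j div m < Suc t" "j mod m < m" if "j < n" for j
    using that mn by (auto simp: less_mult_imp_div_less)
  ultimately show False using u(2) by metis
qed

text \<open>Uniqueness of binary expansions; it keeps the zeros contributed by different linear
  factors apart.\<close>

lemma two_power_sum_inj:
  fixes i j i' j' :: nat
  assumes "i \<le> j" "i' \<le> j'" "(2::nat) ^ i + 2 ^ j = 2 ^ i' + 2 ^ j'"
  shows "i = i' \<and> j = j'"
proof -
  have less: "(2::nat) ^ i + 2 ^ j < 2 ^ i' + 2 ^ j'" if "i \<le> j" "j < j'" for i j i' j' :: nat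
  proof -
    have "(2::nat) ^ i + 2 ^ j \<le> 2 ^ Suc j" using that power_increasing[of i j "2::nat"] by simp
    also have "\<dots> \<le> 2 ^ j'" using that by (intro power_increasing) auto
    also have "\<dots> < 2 ^ i' + 2 ^ j'" by simp
    finally show ?thesis .
  qed
  have "j = j'" using less[of i j j' i'] less[of i' j' j i] assms by linarith
  then show ?thesis using assms(3) by simp
qed

text \<open>Along the line below the determinant vanishes exactly at the points \<open>- (2\<^sup>i + 2\<^sup>j)\<close> with
  \<open>i \<le> j < n\<close> congruent modulo \<open>m\<close>: \<open>4\<^sup>j - 4\<^sup>i + s (2\<^sup>j - 2\<^sup>i)\<close> and \<open>2\<^sup>i\<^sup>+\<^sup>1 + s\<close> are its linear factors.\<close>

lemma kdet_divides_pfaffian: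
  assumes m: "m \<ge> 2" and n: "n = t * m + m" and J: "J \<subseteq> {..<length (qbasis n m)}" "card J = qdim n m - qind n m"
  shows "pdvd n m (kdet n m t (\<lambda>l. l)) (principal_pfaffian n m J)"
proof -
  have mn: "m > 0" "n = t * m + m" using m n by auto
  have npos: "n > 0" using mn by simp
  \<comment> \<open>Eigenvalues 4^i moving with speed 2^i make those numbered i and j meet at s =
    -(2^i + 2^j), because 4^j - 4^i = (2^j - 2^i)(2^j + 2^i). The weights 2^(i+1) + s continue this
    formula to i = j.\<close>
  define \<gamma>0 where "\<gamma>0 = diag_point n m (\<lambda>i. 4 ^ i) (\<lambda>i. 2 ^ Suc i)"
  define \<delta> where "\<delta> = diag_point n m (\<lambda>i. 2 ^ i) (\<lambda>_. 1)"
  have q: "\<gamma>0 \<in> qspace n m" "\<delta> \<in> qspace n m"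
    unfolding \<gamma>0_def \<delta>_def by (rule diag_point_in_qspace[OF npos])+
  have inj2: "inj_on (\<lambda>i. 2 ^ i :: complex) {..<n}"
  proof (rule inj_onI)
    fix i j assume "(2::complex) ^ i = 2 ^ j"
    then have "of_nat (2 ^ i) = (of_nat (2 ^ j) :: complex)" by simp
    then have "(2::nat) ^ i = 2 ^ j" by (simp only: of_nat_eq_iff)
    then show "i = j" by simp
  qed
  define d where "d = (\<Sum>j<n. Suc (j div m))"
  \<comment> \<open>The pair (j, p) encodes the factor for i = p m + j mod m, that is, i <= j
    congruent modulo m; there are j div m + 1 of them for each j, in total the degree d.\<close>
  define X where "X = (SIGMA j:{..<n}. {..j div m})"
  define z where "z = (\<lambda>(j,p). - (of_nat (2 ^ (p * m + j mod m) + 2 ^ j) :: complex))"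
  have le: "p * m + j mod m \<le> j" if "p \<le> j div m" for p j
    using mult_le_mono1[OF that, of m] div_mult_mod_eq[of j m] by linarith
  have injz: "inj_on z X"
  proof (rule inj_onI)
    fix x y assume x: "x \<in> X" and y: "y \<in> X" and eq: "z x = z y"
    obtain j p j' p' where xy: "x = (j,p)" "y = (j',p')" by (cases x, cases y)
    have "2 ^ (p * m + j mod m) + 2 ^ j = (2 ^ (p' * m + j' mod m) + 2 ^ j' :: nat)"
      using eq unfolding xy z_def by (simp only: prod.case neg_equal_iff_equal of_nat_eq_iff)
    then have "p * m + j mod m = p' * m + j' mod m \<and> j = j'"
      using x y unfolding xy X_def by (intro two_power_sum_inj) (auto intro: le)
    then have "p * m = p' * m" "j = j'" by auto
    then show "x = y" using mn(1) by (simp add: xy)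
  qed
  have cardZ: "card (z ` X) = d" 
    unfolding card_image[OF injz] by (simp add: X_def d_def)
  have zeros: "kdet n m t (\<lambda>l. l) (\<lambda>i. \<gamma>0 i + s * \<delta> i) = 0" if sZ: "s \<in> z ` X" for s
  proof -
    obtain j p where jp: "j < n" "p \<le> j div m" "s = z (j,p)" using sZ unfolding X_def by auto
    define i where "i = p * m + j mod m"
    have i: "i \<le> j" "i mod m = j mod m" using le[OF jp(2)] by (simp_all add: i_def)
    have s: "s = - (2 ^ i + 2 ^ j)" using jp(3) by (simp add: z_def i_def)
    \<comment> \<open>For distinct i and j the weight at i must also survive, so that the kernel
      vector in \<open>kdet_diag_point_zero\<close> is nonzero: it equals 2^i - 2^j.\<close>
    have "if i = j then 2 ^ Suc i + s * 1 = 0 else 4 ^ i + s * 2 ^ i = 4 ^ j + s * 2 ^ j \<and> 2 ^ Suc i + s * 1 \<noteq> 0"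
    proof (cases "i = j")
      case False
      have four: "(4::complex) ^ k = 2 ^ k * 2 ^ k" for k by (simp flip: power_mult_distrib)
      have "(2::complex) ^ i \<noteq> 2 ^ j" using inj_onD[OF inj2, of i j] False i(1) jp(1) by auto
      then show ?thesis using False by (simp add: s four algebra_simps)
    qed (simp add: s)
    then show ?thesis unfolding \<gamma>0_def \<delta>_def diag_point_line
      by (intro kdet_diag_point_zero[OF mn _ jp(1) i(2)]) (use i jp in auto)
  qed
  have sing: "principal_pfaffian n m J \<gamma> = 0" if "\<gamma> \<in> qspace n m" "kdet n m t (\<lambda>l. l) \<gamma> = 0" for \<gamma>
  proof (rule principal_pfaffian_zero_at_singular[OF J])
    have "2 \<le> stab_dim n m \<gamma>" using stab_dim_ge_2[OF m, of \<gamma> t] that by (simp add: n)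
    moreover have "qind n m \<le> 1" using qind_le_1[OF mn(1), of t] by (simp add: n)
    ultimately show "qind n m < stab_dim n m \<gamma>" by linarith
  qed
  have "\<exists>h\<in>poly_fun UNIV. \<forall>\<gamma>\<in>qspace n m. principal_pfaffian n m J \<gamma> = kdet n m t (\<lambda>l. l) \<gamma> * h \<gamma>"
  proof (rule vanishing_imp_divisible[where d = d and \<delta> = \<delta> and ?\<gamma>0.0 = \<gamma>0 and Z = "z ` X"])
    show "kdet n m t (\<lambda>l. l) \<in> poly_fun UNIV" using n by (rule kdet_poly_fun) auto
    show "principal_pfaffian n m J \<in> poly_fun UNIV" by (rule principal_pfaffian_poly_fun)
    show "line_closed (qspace n m)" by (rule line_closed_qspace)
    show "(\<lambda>i. \<gamma> i + s * \<delta> i) \<in> qspace n m" if "\<gamma> \<in> qspace n m" for \<gamma> s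
      using that q(2) by (auto simp: qspace_def sum.distrib sum_distrib_left[symmetric])
    show "kdet n m t (\<lambda>l. l) (\<lambda>i. c * \<gamma> i) = c ^ d * kdet n m t (\<lambda>l. l) \<gamma>" for c \<gamma>
      unfolding d_def by (rule kdet_homogeneous[OF mn])
    show "0 < d" unfolding d_def using npos by (intro sum_pos) auto
    show "kdet n m t (\<lambda>l. l) \<delta> \<noteq> 0" unfolding \<delta>_def by (rule kdet_diag_point_nonzero[OF mn inj2])
    show "d \<le> card (z ` X)" by (simp add: cardZ)
  qed (use q(1) zeros sing in auto)
  then show ?thesis by (simp add: pdvd_def)
qed

lemma not_fund_semi_inv_trivial:
  assumes m: "m \<ge> 2"
  shows "\<not> fund_semi_inv_trivial (t * m + m) m"
proof
  define n where "n = t * m + m"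
  have mn: "m > 0" "n = t * m + m" using m by (auto simp: n_def)
  assume "fund_semi_inv_trivial (t * m + m) m"
  moreover have "kdet n m t (\<lambda>l. l) \<in> poly_fun UNIV" using mn(2) by (rule kdet_poly_fun) auto
  ultimately obtain c where c: "c \<noteq> 0" "\<forall>\<gamma>\<in>qspace n m. kdet n m t (\<lambda>l. l) \<gamma> = c"
    using kdet_divides_pfaffian[OF m mn(2)] unfolding fund_semi_inv_trivial_def n_def[symmetric] by blast
  have "0 < (\<Sum>j<n. Suc (j div m))" using mn by (intro sum_pos) auto
  note zero = zero_power[OF this, where 'a = complex]
  \<comment> \<open>Positive degree forces a zero at the origin, so the common divisor found is not
    a nonzero constant.\<close>
  have "kdet n m t (\<lambda>l. l) (\<lambda>_. 0) = 0"
    using kdet_homogeneous[OF mn, of 0 "\<lambda>_. 0", unfolded zero] by simp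
  then show False using c zero_in_qspace[of n m] by auto
qed

theorem theorem4p3:
  fixes n m :: nat
  assumes "n \<ge> 2" and "m \<ge> 1"
  shows "(inv_polynomial_ring n m \<longleftrightarrow>
            (m \<le> n + 1 \<and> (m dvd (n - 1) \<or> m dvd n \<or> m dvd (n + 1))))
       \<and> ((m \<le> n + 1 \<and> (m dvd (n - 1) \<or> m dvd n \<or> m dvd (n + 1))) \<longrightarrow>
            (fund_semi_inv_trivial n m \<longleftrightarrow> (m dvd (n - 1) \<or> m dvd (n + 1))))"
proof -
  \<comment> \<open>Dividing n - 1 rather than n puts the remainder r in 1, ..., m.\<close>
  define t where "t = (n - 1) div m"
  define r where "r = Suc ((n - 1) mod m)"
  have rm: "0 < r" "r \<le> m" using assms by (auto simp: r_def Suc_le_eq)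
  have n1: "n - 1 = t * m + (r - 1)" by (simp add: t_def r_def)
  then have n: "n = t * m + r" using assms rm by linarith
  have dvd: "m dvd t * m + k \<longleftrightarrow> m dvd k" for k by (rule dvd_add_right_iff) simp
  have d1: "m dvd n - 1 \<longleftrightarrow> r = 1"
    unfolding n1 dvd using rm by (auto dest: dvd_imp_le)
  have d2: "m dvd n \<longleftrightarrow> r = m"
    unfolding n dvd using rm by (auto dest: dvd_imp_le)
  \<comment> \<open>As r + 1 is at most m + 1, it is a multiple of m only if it equals m, or if r =
    m and m divides 1.\<close>
  have d3: "m dvd n + 1 \<longleftrightarrow> r + 1 = m \<or> m = 1"
  proof -
    have "m dvd n + 1 \<longleftrightarrow> m dvd r + 1" using dvd[of "r + 1"] by (simp add: n)
    also have "\<dots> \<longleftrightarrow> r + 1 = m \<or> m = 1"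
    proof
      assume a: "m dvd r + 1"
      then have "m \<le> r + 1" by (rule dvd_imp_le) simp
      moreover have "m = 1" if "r = m" using a dvd_add_right_iff[of m m 1] that by simp
      ultimately show "r + 1 = m \<or> m = 1" using rm by linarith
    qed auto
    finally show ?thesis .
  qed
  have cond: "(m \<le> n + 1 \<and> (m dvd (n - 1) \<or> m dvd n \<or> m dvd (n + 1))) \<longleftrightarrow> r = 1 \<or> r = m \<or> r + 1 = m"
  proof -
    have le1: "m \<le> n + 1" if "r = 1"
      using dvd_imp_le[of m "n - 1"] d1 that assms by simp
    have "m \<le> n + 1" if "r = m \<or> r + 1 = m" using that n by auto
    then show ?thesis using d1 d2 d3 le1 rm by auto
  qed
  have poly: "inv_polynomial_ring n m \<longleftrightarrow> r = 1 \<or> r = m \<or> r + 1 = m"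
  proof
    assume p: "inv_polynomial_ring n m"
    show "r = 1 \<or> r = m \<or> r + 1 = m"
    proof (rule ccontr)
      assume "\<not> ?thesis"
      then have "r - 2 + 4 \<le> m" "r = (r - 2) + 2" using rm by auto
      then show False using not_polynomial_ring[of "r - 2" m t] p n by metis
    qed
  next
    assume "r = 1 \<or> r = m \<or> r + 1 = m"
    then consider "r = 1" | "r = m" | "m = Suc r" by auto
    then show "inv_polynomial_ring n m"
    proof cases
      case 1
      then show ?thesis using polynomial_ring_remainder_1[of m t] assms by (simp add: n)
    next
      case 2
      then show ?thesis using polynomial_ring_remainder_0[of m t] assms by (simp add: n)
    next
      case 3
      then show ?thesis using polynomial_ring_remainder_minus_1[of r t] rm by (simp add: n)
    qed
  qed
  have semi: "fund_semi_inv_trivial n m \<longleftrightarrow> (m dvd (n - 1) \<or> m dvd (n + 1))" if "r = 1 \<or> r = m \<or> r + 1 = m"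
  proof -
    \<comment> \<open>The case m = 1 is split off: there r = m, but 1 divides n - 1 and the answer
      is positive, unlike for r = m >= 2.\<close>
    consider "r < m" | "m = 1" | "r = m" "m \<ge> 2" using rm by linarith
    then show ?thesis
    proof cases
      case 1
      then show ?thesis using fund_semi_inv_trivial_lt[OF rm(1) 1, of t] that d1 d3 by (auto simp: n)
    next
      case 2
      then show ?thesis using fund_semi_inv_trivial_one_copy[OF assms(1)] by simp
    next
      case 3
      then show ?thesis using not_fund_semi_inv_trivial[OF 3(2), of t] d1 d3 by (auto simp: n)
    qed
  qed
  show ?thesis unfolding cond using poly semi by blast
qed

end
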